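(* Let $k\in\mathbb{Z}_{>0}$, let $\chi(q,z_1,z_2)=(\chi_{i,l})_{0\le i\le l\le k}$ be the unique solution of the difference equation $\chi(q,z_1,z_2)=M(q,z_1,z_2)\,\chi(q,z_1,qz_2)$ with initial condition $\chi_{i,l}(q,z_1,0)=\delta_{i,0}\delta_{l,0}$, and let $A,B,C,D,E$ be the extremal operators, $L=(C+D)D(B+D+E)$, and $v_\infty$ the vector, all defined in the context. Then $$\chi(q,z_1,z_2)=\sum_{n,m,s=0}^{\infty}\Bigl(D^nA^mBL^sv_\infty+D^nCA^mBL^sv_\infty+D^nE^{m+1}L^sv_\infty+D^nCA^mD(B+D+E)L^sv_\infty+D^nA^{m+1}D(B+D+E)L^sv_\infty\Bigr),$$ and all terms on the right-hand side are defined.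
   Context: Notation: $(x)_n=\prod_{j=0}^{n-1}(1-q^jx)$, $(x)_\infty=\prod_{j\ge0}(1-q^jx)$ (so $(q)_n=\prod_{j=1}^n(1-q^j)$). The matrix. Fix $k\in\mathbb{Z}_{>0}$. The matrix $M(q,z_1,z_2)=(M_{i,l}^{i',l'})$, with rows indexed by $(i,l)$, $0\le i\le l\le k$, and columns by $(i',l')$, $0\le i'\le l'\le k$, is given by $M_{i,l}^{i',l'}=(qz_1z_2)^{l'-i'}z_2^i$ if $l-i\le i'\le l'\le k-i$; $M_{i,l}^{i',l'}=(qz_1z_2)^{l'-l+i}z_2^i$ if $i'<l-i\le l'\le k-i$; and $M_{i,l}^{i',l'}=0$ otherwise. The components of $\chi$ are formal power series in $q,z_2$ whose coefficients are formal Laurent series in $z_1^{-1}$ (finitely many positive powers of $z_1$ in each coefficient), i.e. elements of $R=\mathbb{C}((z_1^{-1}))[[q,z_2]]$; in this space the difference equation with the given initial condition has a unique solution. Simple vectors. For monomials $P,Q,R$ of the form $q^\alpha z_1^\beta z_2^\gamma$ with $\alpha,\beta,\gamma\in\mathbb{Z}_{\ge0}$, $[P,Q,R]$ denotes the $(k+1)(k+2)/2$-dimensional vector with $(i,l)$-component $[P,Q,R]_{i,l}=P^{k-l}Q^{l-i}R^i$ ($0\le i\le l\le k$). A simple vector is an expression $f[P,Q,R]$ with scalar part $f\in R$; one identifies $f[aP,aQ,aR]=fa^k[P,Q,R]$ for a monomial $a$. Let $(Sg)(q,z_1,z_2)=g(q,z_1,qz_2)$. Extremal operators. On simple vectors: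 $$A(f[P,Q,R])=S\left(\frac{f[P,Q,q^{-1}z_2P]}{(1-z_1z_2Q/P)(1-R/Q)}\right),$$ $$B(f[P,Q,R])=S\left(\frac{f(1-Q/P)[P,R,q^{-1}z_2P]}{(1-z_1z_2Q/P)(1-Q/R)(1-R/P)}\right),$$ $$C(f[P,Q,R])=S\left(\frac{f[z_1z_2Q,Q,q^{-1}z_2P]}{(1-(z_1z_2)^{-1}P/Q)(1-R/Q)}\right),$$ $$D(f[P,Q,R])=S\left(\frac{(1-(z_1z_2)^{-1})f[z_1z_2Q,R,q^{-1}z_2P]}{(1-(z_1z_2)^{-1}P/Q)(1-(z_1z_2)^{-1}R/Q)(1-Q/R)}\right),$$ $$E(f[P,Q,R])=S\left(\frac{f[R,R,q^{-1}z_2P]}{(1-z_1z_2Q/R)(1-P/R)}\right),$$ extended by linearity, i.e. termwise to (formal, finite or convergent infinite) sums of simple vectors such as $v_\infty$. For a monomial $X=q^\alpha z_1^\beta z_2^\gamma$ with $\alpha,\gamma\in\mathbb{Z}_{\ge0}$, $\beta\in\mathbb{Z}$ and either $\alpha+\gamma>0$, or $\alpha=\gamma=0$ and $\beta<0$, the expression $1/(1-X^{\pm1})$ means its expansion in non-negative powers of $X$. An operator $G\in\{A,B,C,D,E\}$ is said to be defined on $f[P,Q,R]$ when all denominators appearing in the formula for $G(f[P,Q,R])$ are of this form $1-X^{\pm1}$; otherwise $G(f[P,Q,R])$ is not defined. Products of operators denote composition (the rightmost acts first). The vector $v_\infty$. $v_\infty=\sum_{n=1}^\infty f_nv_n$,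 where $$v_n=[1,q^nz_2,z_2],\qquad f_n=\frac{(-1)^{n-1}q^{n(n-1)/2}(1-q^{2n}z_1z_2^2)}{(q)_\infty(q^{n+1}z_1z_2^2)_\infty(q)_{n-1}(1-q^nz_2)}.$$ *)

theory Defs
  imports "HOL-Computational_Algebra.Formal_Laurent_Series"
begin

section \<open>The ring of scalars\<close>

text \<open>
  All series live in the iterated Laurent series field \<open>C((z\<^sub>1\<^sup>-\<^sup>1))((q))((z\<^sub>2))\<close>: the innermost
  \<^const>\<open>fls_X\<close> is \<open>z\<^sub>1\<^sup>-\<^sup>1\<close>, the middle one \<open>q\<close>, the outermost one \<open>z\<^sub>2\<close>.
  It contains \<open>R = C((z\<^sub>1\<^sup>-\<^sup>1))[[q, z\<^sub>2]]\<close> as the subring \<open>ring_R\<close> below.  The larger field is used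
  only so that the factors with negative exponents that occur in the extremal operators, such as
  \<open>1 - (z\<^sub>1 z\<^sub>2)\<^sup>-\<^sup>1\<close>, can be written down.
\<close>

type_synonym lseries = "complex fls fls fls"

definition qq :: lseries where "qq = fls_const fls_X"
definition zz1 :: lseries where "zz1 = fls_const (fls_const fls_X_inv)"
definition zz2 :: lseries where "zz2 = fls_X"

definition qz_coeff :: "lseries \<Rightarrow> int \<Rightarrow> int \<Rightarrow> complex fls" where
  "qz_coeff f a c = fls_nth (fls_nth f c) a" \<comment> \<open>coefficient of \<open>q\<^sup>a z\<^sub>2\<^sup>c\<close>, a Laurent series in \<open>z\<^sub>1\<^sup>-\<^sup>1\<close>\<close>

definition ring_R :: "lseries set" where
  "ring_R = {f. \<forall>a c. a < 0 \<or> c < 0 \<longrightarrow> qz_coeff f a c = 0}"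

definition shift_S :: "lseries \<Rightarrow> lseries" where
  "shift_S g = fls_compose_fps g (fps_const fls_X * fps_X)" \<comment> \<open>\<open>z\<^sub>2\<close> is replaced by \<open>q z\<^sub>2\<close>\<close>

text \<open>
  Limits and (unordered) infinite sums in \<open>R\<close> are those of formal power series in \<open>q, z\<^sub>2\<close>: every
  coefficient of \<open>q\<^sup>a z\<^sub>2\<^sup>c\<close> is eventually constant, respectively receives only finitely many
  nonzero contributions.
\<close>

definition formal_limit :: "(nat \<Rightarrow> lseries) \<Rightarrow> lseries \<Rightarrow> bool" where
  "formal_limit X L \<longleftrightarrow> (\<forall>n. X n \<in> ring_R) \<and> L \<in> ring_R \<and>
     (\<forall>a c. \<forall>\<^sub>F n in sequentially. qz_coeff (X n) a c = qz_coeff L a c)"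

definition formal_sum :: "('i \<Rightarrow> lseries) \<Rightarrow> 'i set \<Rightarrow> lseries \<Rightarrow> bool" where
  "formal_sum f I s \<longleftrightarrow> (\<forall>j\<in>I. f j \<in> ring_R) \<and> s \<in> ring_R \<and>
     (\<forall>a c. finite {j\<in>I. qz_coeff (f j) a c \<noteq> 0} \<and>
            (\<Sum>j | j \<in> I \<and> qz_coeff (f j) a c \<noteq> 0. qz_coeff (f j) a c) = qz_coeff s a c)"

definition qpoch :: "lseries \<Rightarrow> nat \<Rightarrow> lseries" where
  "qpoch x n = (\<Prod>j<n. 1 - qq ^ j * x)"

definition qpoch_inf :: "lseries \<Rightarrow> lseries" where
  "qpoch_inf x = (THE L. formal_limit (qpoch x) L)"


section \<open>The difference equation\<close>

definition index_set :: "nat \<Rightarrow> (nat \<times> nat) set" where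
  "index_set k = {(i, l). i \<le> l \<and> l \<le> k}"

definition matrix_M :: "nat \<Rightarrow> nat \<Rightarrow> nat \<Rightarrow> nat \<Rightarrow> nat \<Rightarrow> lseries" where
  \<comment> \<open>the entry in row \<open>(i, l)\<close> and column \<open>(i', l')\<close>\<close>
  "matrix_M k i l i' l' =
     (if l - i \<le> i' \<and> i' \<le> l' \<and> l' \<le> k - i then (qq * zz1 * zz2) ^ (l' - i') * zz2 ^ i
      else if i' < l - i \<and> l - i \<le> l' \<and> l' \<le> k - i then (qq * zz1 * zz2) ^ (l' - (l - i)) * zz2 ^ i
      else 0)"

definition chi_solution :: "nat \<Rightarrow> (nat \<Rightarrow> nat \<Rightarrow> lseries) \<Rightarrow> bool" where
  \<comment> \<open>the last clause only pins down the values at irrelevant indices\<close>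
  "chi_solution k \<chi> \<longleftrightarrow>
     (\<forall>(i, l)\<in>index_set k. \<chi> i l \<in> ring_R) \<and>
     (\<forall>(i, l)\<in>index_set k.
        \<chi> i l = (\<Sum>(i', l')\<in>index_set k. matrix_M k i l i' l' * shift_S (\<chi> i' l'))) \<and>
     (\<forall>(i, l)\<in>index_set k. fls_nth (\<chi> i l) 0 = (if i = 0 \<and> l = 0 then 1 else 0)) \<and>
     (\<forall>i l. (i, l) \<notin> index_set k \<longrightarrow> \<chi> i l = 0)"

definition chi :: "nat \<Rightarrow> nat \<Rightarrow> nat \<Rightarrow> lseries" where
  "chi k = (THE \<chi>. chi_solution k \<chi>)"


section \<open>Simple vectors\<close>

text \<open>
  Simple vectors are kept as expressions.  The identification \<open>f[aP,aQ,aR] = f a\<^sup>k [P,Q,R]\<close> is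
  respected by \<open>svec_component\<close> below (and by the operators, which involve only ratios of \<open>P, Q, R\<close>
  and are homogeneous in them), so no quotient is formed.
\<close>

datatype svec = SVec lseries lseries lseries lseries \<comment> \<open>\<open>SVec f P Q R\<close> is \<open>f[P,Q,R]\<close>\<close>

fun svec_component :: "nat \<Rightarrow> svec \<Rightarrow> nat \<Rightarrow> nat \<Rightarrow> lseries" where
  "svec_component k (SVec f P Q R) i l = f * (P ^ (k - l) * Q ^ (l - i) * R ^ i)"

definition is_monomial :: "lseries \<Rightarrow> bool" where
  "is_monomial P \<longleftrightarrow> (\<exists>\<alpha> \<beta> \<gamma> :: nat. P = qq ^ \<alpha> * zz1 ^ \<beta> * zz2 ^ \<gamma>)"

fun is_simple :: "svec \<Rightarrow> bool" where
  "is_simple (SVec f P Q R) \<longleftrightarrow> f \<in> ring_R \<and> is_monomial P \<and> is_monomial Q \<and> is_monomial R"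


section \<open>Extremal operators\<close>

definition expandable :: "lseries \<Rightarrow> bool" where
  "expandable X \<longleftrightarrow> (\<exists>(\<alpha>::nat) (\<beta>::int) (\<gamma>::nat).
     X = qq ^ \<alpha> * (zz1 powi \<beta>) * zz2 ^ \<gamma> \<and> (\<alpha> + \<gamma> > 0 \<or> \<alpha> = 0 \<and> \<gamma> = 0 \<and> \<beta> < 0))"

definition good_denominator :: "lseries \<Rightarrow> bool" where
  "good_denominator d \<longleftrightarrow> (\<exists>X. expandable X \<and> (d = 1 - X \<or> d = 1 - inverse X))"

text \<open>
  For expandable \<open>X\<close> the expansion of \<open>1 / (1 - X)\<close> in non-negative powers of \<open>X\<close> is the inverse
  of \<open>1 - X\<close> in the field \<open>lseries\<close>, and that of \<open>1 / (1 - X\<^sup>-\<^sup>1)\<close> is \<open>- X / (1 - X)\<close>, so the field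
  division \<open>/\<close> has the intended meaning; see \<open>inverse_expansion\<close> and \<open>inverse_expansion_inverse\<close>.
\<close>

lemma zz1_powi: "zz1 powi b = fls_const (fls_const (fls_X_intpow (-b)))"
proof -
  have *: "fls_const (fls_const x) ^ n = fls_const (fls_const (x ^ n))" for x :: "complex fls" and n
    by (induction n) (simp_all flip: fls_const_mult_const)
  have pos: "zz1 ^ n = fls_const (fls_const (fls_X_intpow (- int n)))" for n
    unfolding zz1_def * by (simp add: fls_X_inv_power_conv_shift_1)
  show ?thesis
  proof (cases "b \<ge> 0")
    case True
    then show ?thesis using pos[of "nat b"] by (simp add: power_int_def)
  next
    case False
    have "inverse (zz1 ^ nat (-b)) = fls_const (fls_const (fls_X_intpow (-b)))"
    proof (rule inverse_unique)
      have "fls_X_intpow (- int (nat (-b))) * fls_X_intpow (-b) = (1 :: complex fls)"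
        using False unfolding fls_X_intpow_times_fls_X_intpow by simp
      then show "zz1 ^ nat (-b) * fls_const (fls_const (fls_X_intpow (-b))) = 1"
        unfolding pos fls_const_mult_const by simp
    qed
    then show ?thesis using False by (simp add: power_int_def power_inverse)
  qed
qed

lemma qz_coeff_monomial_times:
  "qz_coeff (qq ^ \<alpha> * (zz1 powi \<beta>) * zz2 ^ \<gamma> * f) a c =
     fls_X_intpow (-\<beta>) * qz_coeff f (a - int \<alpha>) (c - int \<gamma>)"
proof -
  have q: "qq ^ \<alpha> = fls_const (fls_X ^ \<alpha>)"
    unfolding qq_def by (induction \<alpha>) (simp_all flip: fls_const_mult_const)
  have "qq ^ \<alpha> * (zz1 powi \<beta>) * zz2 ^ \<gamma> * f =
      fls_const (fls_X ^ \<alpha> * fls_const (fls_X_intpow (-\<beta>))) * (zz2 ^ \<gamma> * f)"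
    unfolding q zz1_powi by (simp flip: fls_const_mult_const add: mult_ac)
  then show ?thesis
    unfolding qz_coeff_def zz2_def
    by (simp add: fls_X_power_times_conv_shift mult.assoc fls_shifted_times_simps)
qed

text \<open>The coefficient of \<open>q\<^sup>a z\<^sub>1\<^sup>b z\<^sub>2\<^sup>c\<close> in \<open>1 / (1 - X)\<close> is that of every long enough geometric sum.\<close>

lemma inverse_expansion:
  assumes "expandable X"
  shows "\<forall>\<^sub>F N in sequentially.
    fls_nth (qz_coeff (inverse (1 - X)) a c) (-b) = fls_nth (qz_coeff (\<Sum>n<N. X ^ n) a c) (-b)"
proof -
  obtain \<alpha> \<beta> \<gamma> where X: "X = qq ^ \<alpha> * (zz1 powi \<beta>) * zz2 ^ \<gamma>"
    and pos: "\<alpha> + \<gamma> > 0 \<or> \<alpha> = 0 \<and> \<gamma> = 0 \<and> \<beta> < 0"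
    using assms unfolding expandable_def by blast
  define g where "g = inverse (1 - X)"
  have pw: "X ^ N = qq ^ (N * \<alpha>) * (zz1 powi (int N * \<beta>)) * zz2 ^ (N * \<gamma>)" for N
  proof -
    have "(zz1 powi \<beta>) ^ N = zz1 powi (int N * \<beta>)"
      by (metis mult.commute power_int_mult power_int_of_nat)
    then show ?thesis
      unfolding X power_mult_distrib by (simp flip: power_mult add: mult.commute)
  qed
  have rest: "fls_nth (qz_coeff (X ^ N * g) a c) (-b) =
      fls_nth (qz_coeff g (a - int N * int \<alpha>) (c - int N * int \<gamma>)) (-b + int N * \<beta>)" for N
    unfolding pw qz_coeff_monomial_times by (simp add: fls_shifted_times_simps)
  have "\<exists>N0. \<forall>N\<ge>N0. fls_nth (qz_coeff (X ^ N * g) a c) (-b) = 0"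
  proof -
    consider "\<gamma> > 0" | "\<gamma> = 0" "\<alpha> > 0" | "\<gamma> = 0" "\<alpha> = 0" "\<beta> < 0" using pos by auto
    then show ?thesis
    proof cases
      case 1
      have "c - int N * int \<gamma> < fls_subdegree g" if "N \<ge> nat (c - fls_subdegree g + 1)" for N
      proof -
        have "int N * 1 \<le> int N * int \<gamma>" using 1 by (intro mult_left_mono) auto
        then show ?thesis using that by linarith
      qed
      then show ?thesis
        unfolding rest unfolding qz_coeff_def by (metis fls_eq0_below_subdegree fls_zero_nth)
    next
      case 2
      let ?h = "fls_nth g c"
      have "a - int N * int \<alpha> < fls_subdegree ?h" if "N \<ge> nat (a - fls_subdegree ?h + 1)" for N
      proof -
        have "int N * 1 \<le> int N * int \<alpha>" using 2 by (intro mult_left_mono) auto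
        then show ?thesis using that by linarith
      qed
      then have "\<forall>N\<ge>nat (a - fls_subdegree ?h + 1). fls_nth ?h (a - int N * int \<alpha>) = 0"
        by (meson fls_eq0_below_subdegree)
      then show ?thesis
        unfolding rest unfolding qz_coeff_def using 2
        by (intro exI[of _ "nat (a - fls_subdegree ?h + 1)"]) simp
    next
      case 3
      let ?h = "qz_coeff g a c"
      have "- b + int N * \<beta> < fls_subdegree ?h" if "N \<ge> nat (- b - fls_subdegree ?h + 1)" for N
      proof -
        have "int N * \<beta> \<le> int N * (-1)" using 3 by (intro mult_left_mono) auto
        then show ?thesis using that by linarith
      qed
      then have "\<forall>N\<ge>nat (- b - fls_subdegree ?h + 1). fls_nth ?h (- b + int N * \<beta>) = 0"
        by (meson fls_eq0_below_subdegree)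
      then show ?thesis
        unfolding rest using 3
        by (intro exI[of _ "nat (- b - fls_subdegree ?h + 1)"]) simp
    qed
  qed
  then obtain N0 where N0: "\<And>N. N \<ge> N0 \<Longrightarrow> fls_nth (qz_coeff (X ^ N * g) a c) (-b) = 0"
    by blast
  have "X \<noteq> 1"
  proof
    assume "X = 1"
    then have g0: "qz_coeff 1 0 0 = fls_X_intpow (-\<beta>) * qz_coeff 1 (- int \<alpha>) (- int \<gamma>)"
      using qz_coeff_monomial_times[of \<alpha> \<beta> \<gamma> 1 0 0] X by simp
    show False
    proof (cases "\<alpha> = 0 \<and> \<gamma> = 0")
      case True
      then have "fls_X_intpow (-\<beta>) = (1 :: complex fls)" using g0 by (simp add: qz_coeff_def)
      then have "-\<beta> = 0" using fls_subdegree_fls_X_intpow[where ?i = "-\<beta>" and ?'a = complex] by simp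
      then show False using True pos by simp
    next
      case False
      then show False using g0 by (auto simp: qz_coeff_def split: if_splits)
    qed
  qed
  then have geo: "g = (\<Sum>n<N. X ^ n) + X ^ N * g" for N
    unfolding g_def by (simp add: geometric_sum field_simps)
  have "fls_nth (qz_coeff g a c) (-b) = fls_nth (qz_coeff (\<Sum>n<N. X ^ n) a c) (-b)"
    if "N \<ge> N0" for N
  proof -
    have "qz_coeff g a c = qz_coeff (\<Sum>n<N. X ^ n) a c + qz_coeff (X ^ N * g) a c"
      by (subst geo[of N]) (simp add: qz_coeff_def)
    then show ?thesis using N0[OF that] by simp
  qed
  then show ?thesis unfolding g_def eventually_sequentially by blast
qed

lemma inverse_expansion_inverse:
  assumes "expandable X"
  shows "inverse (1 - inverse X) = - X * inverse (1 - X)"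
proof -
  have "fls_shift b 1 \<noteq> (0 :: complex fls)" for b
    using fls_X_intpow_nonzero[of "-b"] by (simp del: fls_X_intpow_nonzero)
  then have "X \<noteq> 0"
    using assms by (auto simp: expandable_def qq_def zz1_powi zz2_def simp del: fls_shift_eq0_iff)
  then have "1 - inverse X = inverse (- X) * (1 - X)"
    by (simp add: field_simps)
  then show ?thesis by simp
qed

text \<open>
  \<open>make_op num dens f P Q R\<close> is \<open>S(num f [P,Q,R] / \<Prod>dens)\<close>, or \<open>None\<close> if it is not defined.
  \<open>S\<close> acts on the scalar part as well as on the monomials.
\<close>

definition make_op ::
  "lseries \<Rightarrow> lseries list \<Rightarrow> lseries \<Rightarrow> lseries \<Rightarrow> lseries \<Rightarrow> lseries \<Rightarrow> svec option" where
  "make_op num dens f P Q R =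
     (if \<forall>d\<in>set dens. good_denominator d
      then Some (SVec (shift_S (num * f / prod_list dens)) (shift_S P) (shift_S Q) (shift_S R))
      else None)"

fun svec_A :: "svec \<Rightarrow> svec option" where
  "svec_A (SVec f P Q R) =
     make_op 1 [1 - zz1 * zz2 * Q / P, 1 - R / Q] f P Q (inverse qq * zz2 * P)"

fun svec_B :: "svec \<Rightarrow> svec option" where
  "svec_B (SVec f P Q R) =
     make_op (1 - Q / P) [1 - zz1 * zz2 * Q / P, 1 - Q / R, 1 - R / P]
       f P R (inverse qq * zz2 * P)"

fun svec_C :: "svec \<Rightarrow> svec option" where
  "svec_C (SVec f P Q R) =
     make_op 1 [1 - inverse (zz1 * zz2) * P / Q, 1 - R / Q]
       f (zz1 * zz2 * Q) Q (inverse qq * zz2 * P)"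

fun svec_D :: "svec \<Rightarrow> svec option" where
  "svec_D (SVec f P Q R) =
     make_op (1 - inverse (zz1 * zz2))
       [1 - inverse (zz1 * zz2) * P / Q, 1 - inverse (zz1 * zz2) * R / Q, 1 - Q / R]
       f (zz1 * zz2 * Q) R (inverse qq * zz2 * P)"

fun svec_E :: "svec \<Rightarrow> svec option" where
  "svec_E (SVec f P Q R) =
     make_op 1 [1 - zz1 * zz2 * Q / R, 1 - P / R] f R R (inverse qq * zz2 * P)"


section \<open>Formal sums of simple vectors\<close>

text \<open>
  \<open>V :: formal_vec\<close> stands for the infinite sum, over all \<open>n\<close>, of the finite sum of the entries of
  the list \<open>V n\<close>.  Operators act on these expressions (they are not functions of the represented
  vector); \<open>None\<close> stands for an expression which is not defined.
\<close>

type_synonym formal_vec = "nat \<Rightarrow> svec list"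

definition extend_op :: "(svec \<Rightarrow> svec option) \<Rightarrow> formal_vec option \<Rightarrow> formal_vec option" where
  "extend_op G V =
     (case V of None \<Rightarrow> None
      | Some v \<Rightarrow>
          if \<forall>n. \<forall>x\<in>set (v n). is_simple x \<and> G x \<noteq> None
          then Some (\<lambda>n. map (\<lambda>x. the (G x)) (v n)) else None)"

definition op_plus :: "(formal_vec option \<Rightarrow> formal_vec option) \<Rightarrow>
    (formal_vec option \<Rightarrow> formal_vec option) \<Rightarrow> formal_vec option \<Rightarrow> formal_vec option"
    (infixl \<open>\<oplus>\<^sub>o\<close> 54) where \<comment> \<open>binds weaker than \<open>\<circ>\<close>\<close>
  "(F \<oplus>\<^sub>o G) V =
     (case (F V, G V) of (Some v, Some w) \<Rightarrow> Some (\<lambda>n. v n @ w n) | _ \<Rightarrow> None)"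

definition opA where "opA = extend_op svec_A"
definition opB where "opB = extend_op svec_B"
definition opC where "opC = extend_op svec_C"
definition opD where "opD = extend_op svec_D"
definition opE where "opE = extend_op svec_E"

definition opL :: "formal_vec option \<Rightarrow> formal_vec option" where
  "opL = (opC \<oplus>\<^sub>o opD) \<circ> opD \<circ> (opB \<oplus>\<^sub>o opD \<oplus>\<^sub>o opE)"

definition coeff_f :: "nat \<Rightarrow> lseries" where
  "coeff_f n =
     (-1) ^ (n - 1) * qq ^ (n * (n - 1) div 2) * (1 - qq ^ (2 * n) * zz1 * zz2 ^ 2) /
     (qpoch_inf qq * qpoch_inf (qq ^ (n + 1) * zz1 * zz2 ^ 2) * qpoch qq (n - 1) *
       (1 - qq ^ n * zz2))"

definition v_inf :: "formal_vec option" where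
  "v_inf = Some (\<lambda>n. [SVec (coeff_f (Suc n)) 1 (qq ^ Suc n * zz2) zz2])"

text \<open>The component \<open>(i, l)\<close> of a formal sum, computed termwise.\<close>

definition component_sum :: "nat \<Rightarrow> formal_vec \<Rightarrow> nat \<Rightarrow> nat \<Rightarrow> lseries \<Rightarrow> bool" where
  "component_sum k v i l s \<longleftrightarrow>
     formal_sum (\<lambda>(n, j). svec_component k (v n ! j) i l) (SIGMA n:UNIV. {..<length (v n)}) s"

definition is_defined :: "nat \<Rightarrow> formal_vec option \<Rightarrow> bool" where
  "is_defined k V \<longleftrightarrow>
     (\<exists>v. V = Some v \<and> (\<forall>n. \<forall>x\<in>set (v n). is_simple x) \<and>
          (\<forall>(i, l)\<in>index_set k. \<exists>s. component_sum k v i l s))"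

definition component :: "nat \<Rightarrow> formal_vec option \<Rightarrow> nat \<Rightarrow> nat \<Rightarrow> lseries" where
  "component k V i l = (THE s. component_sum k (the V) i l s)"

end

theory Submission
  imports Defs "HOL-Library.Product_Plus"
begin

text \<open>
  On simple vectors, the matrix \<open>M S\<close> acts as \<open>A + B + C + D + E\<close>. The summands of the
  series are \<open>D\<^sup>n\<close> applied to a few families of vectors, so that \<open>D\<close> shifts the series and it
  remains to see that the images under \<open>A + C\<close> and \<open>B + E\<close> reproduce the terms with \<open>n = 0\<close>.
  Most of these images cancel in pairs of a few types, which the operators map to each other; the others
  are telescoped through \<open>L\<^sup>s\<^sup>+\<^sup>1 v\<^sub>\<infinity> = (C + D) D (B + D + E) L\<^sup>s v\<^sub>\<infinity>\<close>.

  \<open>L\<^sup>s v\<^sub>\<infinity>\<close> is an infinite sum, but after one more step infinitely many of its entries have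
  the same shape \<open>[P, Q, R]\<close> and can be merged into a single simple vector. The scalars of the merged
  vectors are values of linear functionals on \<open>L\<^sup>s v\<^sub>\<infinity>\<close>. For \<open>s = 0\<close> telescoping gives a
  \<open>q\<close>-difference relation between them, it propagates to all \<open>s\<close>, and it is what makes the merged
  vectors cancel in pairs.

  At \<open>z\<^sub>2 = 0\<close> only \<open>A\<^sup>m B v\<^sub>\<infinity> = v\<^sub>m\<^sub>+\<^sub>1\<close> survives and the initial condition is an identity of
  Euler; a solution is determined by it degree by degree in \<open>z\<^sub>2\<close>.
\<close>

subsection \<open>Monomials\<close>

text \<open>With t = z1 z2, \<open>D\<close> sends [P, Q, R] to [t Q, R, q^-1 z2 P]: up to monomials
  and \<open>S\<close> it permutes the three slots cyclically. Vectors differing only in R become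
  vectors differing only in Q, then only in P, then in R again, which is why the bookkeeping runs
  modulo 3 in the power of \<open>D\<close>. \<open>A\<close> and \<open>C\<close> see R in a single
  factor, while \<open>B\<close> and \<open>E\<close> drop Q from the slots; those are the places
  where pairs die.

  All merged scalars come from one functional with a parameter \<kappa>: \<kappa> = 1 gives the
  scalar of \<open>B\<close>, \<kappa> = R/P that of \<open>E\<close>. Pulling L out of it costs a
  constant, three \<open>S\<close> and a change of \<kappa>. The q-difference relation compares
  \<kappa> with the \<kappa>' for which S \<kappa>' = q \<kappa>; it is applied at \<kappa> = 1, at
  \<kappa> = q, and at \<kappa> = R/P, where \<kappa>' = \<kappa>.

  The obstacle is integrality: single summands of the functional may leave the ring, so their sums
  are taken in its fraction field and only the final components are shown to lie in the ring. The
  recursion in s closes at s = 0 because \<open>B\<close> maps v_inf to its first term f_1 v_1 and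
  \<open>A\<close> maps f_n v_n to f_(n+1) v_(n+1).\<close>

type_synonym expo = "int \<times> int \<times> int"

fun mon :: "expo \<Rightarrow> lseries" where
  "mon (a, b, c) = qq powi a * zz1 powi b * zz2 powi c"

declare mon.simps [simp del]

lemma nonzero_vars [simp]: "qq \<noteq> 0" "zz1 \<noteq> 0" "zz2 \<noteq> 0"
proof -
  have "fls_X_inv \<noteq> (0 :: complex fls)"
    by (rule fls_X_inv_nonzero)
  then show "zz1 \<noteq> 0" by (simp add: zz1_def)
qed (simp_all add: qq_def zz2_def)

lemma mon_nonzero [simp]: "mon e \<noteq> 0"
  by (cases e) (simp add: mon.simps)

lemma mon_0 [simp]: "mon 0 = 1"
  by (simp add: zero_prod_def mon.simps)

lemma mon_add: "mon (d + e) = mon d * mon e"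
  by (cases d; cases e) (simp add: mon.simps power_int_add)

lemma mon_uminus: "mon (- e) = inverse (mon e)"
  by (cases e) (simp add: mon.simps power_int_minus)

lemma mon_diff: "mon (d - e) = mon d / mon e"
  using mon_add[of d "- e"] by (simp add: mon_uminus field_simps)

lemma mon_power: "mon (a, b, c) ^ n = mon (int n * a, int n * b, int n * c)"
  by (simp add: mon.simps power_mult_distrib mult.commute power_int_mult)

lemma qz_coeff_mon_times:
  "qz_coeff (mon (a, b, c) * f) a' c' = fls_X_intpow (- b) * qz_coeff f (a' - a) (c' - c)"
proof -
  have q: "qq powi a = fls_const (fls_X_intpow a)"
    by (simp add: qq_def flip: fls_const_power_int)
  have w: "zz2 powi c = fls_X_intpow c"
    by (simp add: zz2_def)
  have "mon (a, b, c) * f =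
      fls_const (fls_X_intpow a * fls_const (fls_X_intpow (- b))) * (fls_X_intpow c * f)"
    unfolding mon.simps q w zz1_powi by (simp flip: fls_const_mult_const add: mult_ac)
  then show ?thesis
    unfolding qz_coeff_def by (simp add: fls_X_intpow_times_conv_shift mult.assoc fls_shifted_times_simps)
qed

lemma qz_coeff_simps [simp]:
  "qz_coeff 0 a c = 0"
  "qz_coeff (f + g) a c = qz_coeff f a c + qz_coeff g a c"
  "qz_coeff (f - g) a c = qz_coeff f a c - qz_coeff g a c"
  "qz_coeff (- f) a c = - qz_coeff f a c"
  "qz_coeff 1 a c = (if a = 0 \<and> c = 0 then 1 else 0)"
  by (simp_all add: qz_coeff_def)

lemma qz_coeff_sum: "qz_coeff (\<Sum>i\<in>A. f i) a c = (\<Sum>i\<in>A. qz_coeff (f i) a c)"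
  by (induction A rule: infinite_finite_induct) simp_all

lemma qz_coeff_eqI: "(\<And>a c. qz_coeff f a c = qz_coeff g a c) \<Longrightarrow> f = g"
  unfolding qz_coeff_def by (metis fls_eqI)

lemma qz_coeff_mon: "qz_coeff (mon (a, b, c)) a' c' = (if a' = a \<and> c' = c then fls_X_intpow (- b) else 0)"
  using qz_coeff_mon_times[of a b c 1 a' c'] by auto

lemma mon_eq_1_iff: "mon e = 1 \<longleftrightarrow> e = 0"
proof
  assume *: "mon e = 1"
  obtain a b c where e: "e = (a, b, c)" by (cases e)
  have "qz_coeff (mon e) 0 0 = (1 :: complex fls)" by (simp add: *)
  then have **: "a = 0" "c = 0" "fls_X_intpow (- b) = (1 :: complex fls)"
    by (auto simp: e qz_coeff_mon split: if_splits simp del: fls_shift_eq_iff)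
  from **(3) have "fls_subdegree (fls_X_intpow (- b) :: complex fls) = fls_subdegree (1 :: complex fls)" by (rule arg_cong)
  then have "b = 0" by simp
  with ** show "e = 0" by (simp add: e zero_prod_def)
qed simp

text \<open>Reduces an identity between monomials to linear arithmetic on exponents, which is how
  most of them are settled below.\<close>

lemma mon_eq_iff: "mon d = mon e \<longleftrightarrow> d = e"
  using mon_eq_1_iff[of "d - e"] by (simp add: mon_diff)

lemma qq_mon: "qq = mon (1, 0, 0)" and zz1_mon: "zz1 = mon (0, 1, 0)" and zz2_mon: "zz2 = mon (0, 0, 1)"
  by (simp_all add: mon.simps)

subsection \<open>The shift operator\<close>

lemma shift_S_simps [simp]:
  "shift_S 0 = 0" "shift_S 1 = 1"
  "shift_S (f + g) = shift_S f + shift_S g"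
  "shift_S (f - g) = shift_S f - shift_S g"
  "shift_S (- f) = - shift_S f"
  "shift_S (f * g) = shift_S f * shift_S g"
  "shift_S (inverse f) = inverse (shift_S f)"
  "shift_S (f / g) = shift_S f / shift_S g"
  "shift_S (f ^ n) = shift_S f ^ n"
  "shift_S (f powi m) = shift_S f powi m"
  by (simp_all add: shift_S_def fls_compose_fps_add fls_compose_fps_diff fls_compose_fps_mult
      fls_compose_fps_inverse fls_compose_fps_divide fls_compose_fps_power fls_compose_fps_powi)

lemma shift_S_sum: "shift_S (\<Sum>i\<in>A. f i) = (\<Sum>i\<in>A. shift_S (f i))"
  by (induction A rule: infinite_finite_induct) simp_all

lemma shift_S_eq_0_iff [simp]: "shift_S f = 0 \<longleftrightarrow> f = 0"
  by (simp add: shift_S_def fls_compose_fps_eq_0_iff)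

lemma shift_S_inject [simp]: "shift_S f = shift_S g \<longleftrightarrow> f = g"
  using shift_S_eq_0_iff[of "f - g"] by simp

lemma shift_S_vars [simp]: "shift_S qq = qq" "shift_S zz1 = zz1" "shift_S zz2 = qq * zz2"
  by (simp_all add: shift_S_def qq_def zz1_def zz2_def fls_times_fps_to_fls)

text \<open>The action of \<open>S\<close> on exponents: z2^c becomes q^c z2^c.\<close>

fun sg :: "expo \<Rightarrow> expo" where "sg (a, b, c) = (a + c, b, c)"

lemma sg_add: "sg (d + e) = sg d + sg e" and sg_diff: "sg (d - e) = sg d - sg e"
  and sg_uminus: "sg (- e) = - sg e" and sg_0: "sg 0 = 0"
  by (cases d; cases e; simp add: zero_prod_def)+

lemma shift_S_mon: "shift_S (mon e) = mon (sg e)"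
  by (cases e) (simp add: mon.simps power_int_mult_distrib power_int_add)

lemma qz_coeff_shift_S: "qz_coeff (shift_S f) a c = qz_coeff f (a - c) c"
  unfolding qz_coeff_def shift_S_def
  by (subst fls_nth_fls_compose_fps_linear)
    (simp_all add: mult.commute[of _ "fls_X_intpow c"] fls_X_intpow_times_conv_shift)

subsection \<open>Degree filtration\<close>

text \<open>The N-th power of the ideal (q, z2) of R. The degree in z1 is not restricted.\<close>

definition Wt :: "nat \<Rightarrow> lseries set" where
  "Wt N = {f. \<forall>a c. qz_coeff f a c \<noteq> 0 \<longrightarrow> 0 \<le> a \<and> 0 \<le> c \<and> int N \<le> a + c}"

text \<open>The part of \<open>Wt N\<close> divisible by z2. On it \<open>S\<close> gains a degree,
  because it multiplies z2^c by q^c; this gain is the source of all convergence below.\<close>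

definition Wt1 :: "nat \<Rightarrow> lseries set" where
  "Wt1 N = {f \<in> Wt N. \<forall>a. qz_coeff f a 0 = 0}"

lemma ring_R_eq_Wt: "ring_R = Wt 0"
  by (force simp: ring_R_def Wt_def)

lemma Wt_mono: "f \<in> Wt N \<Longrightarrow> M \<le> N \<Longrightarrow> f \<in> Wt M"
  by (fastforce simp: Wt_def)

lemma Wt_ring_R: "f \<in> Wt N \<Longrightarrow> f \<in> ring_R"
  by (simp add: ring_R_eq_Wt Wt_mono)

text \<open>Embeds double power series into the field, so that products have finite convolution
  coefficients and any array of coefficients defines an element of R.\<close>

definition of_fps2 :: "complex fls fps fps \<Rightarrow> lseries" where
  "of_fps2 F = fps_to_fls (Abs_fps (\<lambda>c. fps_to_fls (fps_nth F c)))"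

lemma of_fps2_mult: "of_fps2 (F * G) = of_fps2 F * of_fps2 G"
proof -
  have sum: "fps_to_fls (\<Sum>i\<in>A. h i) = (\<Sum>i\<in>A. fps_to_fls (h i))" for A :: "nat set" and h :: "nat \<Rightarrow> complex fls fps"
    by (induction A rule: infinite_finite_induct) simp_all
  show ?thesis
    unfolding of_fps2_def fls_times_fps_to_fls[symmetric] fps_to_fls_eq_iff
    by (rule fps_ext) (simp add: fps_mult_nth sum fls_times_fps_to_fls)
qed

lemma qz_coeff_of_fps2:
  "qz_coeff (of_fps2 F) a c = (if a < 0 \<or> c < 0 then 0 else fps_nth (fps_nth F (nat c)) (nat a))"
  by (simp add: qz_coeff_def of_fps2_def)

lemma ring_R_of_fps2: "f \<in> ring_R \<Longrightarrow> of_fps2 (Abs_fps (\<lambda>c. Abs_fps (\<lambda>a. qz_coeff f (int a) (int c)))) = f"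
  by (rule qz_coeff_eqI) (auto simp: qz_coeff_of_fps2 ring_R_def)

lemma of_fps2_ring_R: "of_fps2 F \<in> ring_R"
  by (simp add: ring_R_def qz_coeff_of_fps2)

lemma qz_coeff_mult:
  assumes "f \<in> ring_R" "g \<in> ring_R"
  shows "qz_coeff (f * g) a c = (if a < 0 \<or> c < 0 then 0 else
    \<Sum>j=0..nat c. \<Sum>i=0..nat a. qz_coeff f (int i) (int j) * qz_coeff g (a - int i) (c - int j))"
proof -
  define F where "F = (\<lambda>f. Abs_fps (\<lambda>c. Abs_fps (\<lambda>a. qz_coeff f (int a) (int c))))"
  have "f * g = of_fps2 (F f * F g)"
    unfolding of_fps2_mult F_def using ring_R_of_fps2 assms by simp
  then show ?thesis
    by (auto simp: qz_coeff_of_fps2 fps_mult_nth fps_sum_nth F_def of_nat_diff intro!: sum.cong)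
qed

lemma Wt_mult:
  assumes "f \<in> Wt M" "g \<in> Wt N"
  shows "f * g \<in> Wt (M + N)"
  unfolding Wt_def
proof (intro CollectI allI impI)
  fix a c assume nz: "qz_coeff (f * g) a c \<noteq> 0"
  have R: "f \<in> ring_R" "g \<in> ring_R" using assms Wt_ring_R by blast+
  have sum_nz: "\<exists>i\<in>A. h i \<noteq> 0" if "sum h A \<noteq> 0" for h :: "nat \<Rightarrow> complex fls" and A
    using that by (meson sum.neutral)
  have "\<not> (a < 0 \<or> c < 0)"
    using nz unfolding qz_coeff_mult[OF R] by (simp split: if_splits)
  with nz have "(\<Sum>j=0..nat c. \<Sum>i=0..nat a. qz_coeff f (int i) (int j) * qz_coeff g (a - int i) (c - int j)) \<noteq> 0"
    unfolding qz_coeff_mult[OF R] by simp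
  from sum_nz[OF this] obtain j where
    "(\<Sum>i=0..nat a. qz_coeff f (int i) (int j) * qz_coeff g (a - int i) (c - int j)) \<noteq> 0" by blast
  from sum_nz[OF this] obtain i where "qz_coeff f (int i) (int j) * qz_coeff g (a - int i) (c - int j) \<noteq> 0"
    by blast
  then have "qz_coeff f (int i) (int j) \<noteq> 0" "qz_coeff g (a - int i) (c - int j) \<noteq> 0" by auto
  then have "int M \<le> int i + int j" "0 \<le> a - int i \<and> 0 \<le> c - int j \<and> int N \<le> (a - int i) + (c - int j)"
    using assms unfolding Wt_def by blast+
  then show "0 \<le> a \<and> 0 \<le> c \<and> int (M + N) \<le> a + c" by simp
qed

lemma Wt1_mult:
  assumes "f \<in> Wt1 M" "g \<in> ring_R"
  shows "f * g \<in> Wt1 M"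
proof -
  have f: "f \<in> ring_R" "f \<in> Wt M" using assms(1) Wt_ring_R by (auto simp: Wt1_def)
  have "f * g \<in> Wt M" using Wt_mult[OF f(2), of g 0] assms(2) unfolding ring_R_eq_Wt by simp
  moreover have "qz_coeff f a 0 = 0" for a using assms(1) by (simp add: Wt1_def)
  then have "qz_coeff (f * g) a 0 = 0" for a
    unfolding qz_coeff_mult[OF f(1) assms(2)] by simp
  ultimately show ?thesis by (simp add: Wt1_def)
qed

lemma Wt1_mult': "f \<in> Wt1 M \<Longrightarrow> g \<in> ring_R \<Longrightarrow> g * f \<in> Wt1 M"
  using Wt1_mult by (simp only: mult.commute)

lemma Wt_add: assumes "f \<in> Wt N" "g \<in> Wt N" shows "f + g \<in> Wt N"
  unfolding Wt_def mem_Collect_eq qz_coeff_simps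
proof (intro allI impI)
  fix a c assume "qz_coeff f a c + qz_coeff g a c \<noteq> 0"
  then have "qz_coeff f a c \<noteq> 0 \<or> qz_coeff g a c \<noteq> 0" by auto
  then show "0 \<le> a \<and> 0 \<le> c \<and> int N \<le> a + c" using assms unfolding Wt_def by blast
qed

lemma Wt_uminus: "f \<in> Wt N \<Longrightarrow> - f \<in> Wt N"
  by (simp add: Wt_def)

lemma Wt_diff: "f \<in> Wt N \<Longrightarrow> g \<in> Wt N \<Longrightarrow> f - g \<in> Wt N"
  using Wt_add[of f N "- g"] Wt_uminus by simp

lemma Wt_0: "0 \<in> Wt N"
  by (simp add: Wt_def)

lemmas Wt_closed [intro] = Wt_0 Wt_add Wt_uminus Wt_diff

lemma Wt_sum: "(\<And>i. i \<in> A \<Longrightarrow> f i \<in> Wt N) \<Longrightarrow> (\<Sum>i\<in>A. f i) \<in> Wt N"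
  by (induction A rule: infinite_finite_induct) auto

lemma Wt_sum_list: "(\<And>x. x \<in> set xs \<Longrightarrow> f x \<in> Wt N) \<Longrightarrow> (\<Sum>x\<leftarrow>xs. f x) \<in> Wt N"
  by (induction xs) auto

lemma mon_Wt: "0 \<le> a \<Longrightarrow> 0 \<le> c \<Longrightarrow> int N \<le> a + c \<Longrightarrow> mon (a, b, c) \<in> Wt N"
  by (auto simp: Wt_def qz_coeff_mon split: if_splits)

lemma ring_R_1: "1 \<in> ring_R"
  by (simp add: ring_R_def)

lemma ring_R_mult: "f \<in> ring_R \<Longrightarrow> g \<in> ring_R \<Longrightarrow> f * g \<in> ring_R"
  using Wt_mult[of f 0 g 0] unfolding ring_R_eq_Wt by (simp only: add_0)

lemmas ring_R_closed [intro] =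
  Wt_closed[where N = 0, folded ring_R_eq_Wt] ring_R_1 ring_R_mult

lemma ring_R_power [intro]: "f \<in> ring_R \<Longrightarrow> f ^ n \<in> ring_R"
  by (induction n) auto

lemma Wt_mult_ring_R: "f \<in> Wt N \<Longrightarrow> g \<in> ring_R \<Longrightarrow> f * g \<in> Wt N" "f \<in> Wt N \<Longrightarrow> g \<in> ring_R \<Longrightarrow> g * f \<in> Wt N"
  using Wt_mult[of f N g 0] by (auto simp: ring_R_eq_Wt mult.commute)

lemma mon_ring_R: "0 \<le> a \<Longrightarrow> 0 \<le> c \<Longrightarrow> mon (a, b, c) \<in> ring_R"
  using mon_Wt[of a c 0] by (simp add: ring_R_eq_Wt)

lemma mon_Wt1: "0 \<le> a \<Longrightarrow> 0 < c \<Longrightarrow> int N \<le> a + c \<Longrightarrow> mon (a, b, c) \<in> Wt1 N"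
  by (auto simp: Wt1_def qz_coeff_mon mon_Wt)

lemma shift_S_Wt: assumes "f \<in> Wt N" shows "shift_S f \<in> Wt N"
  unfolding Wt_def mem_Collect_eq qz_coeff_shift_S
proof (intro allI impI)
  fix a c assume "qz_coeff f (a - c) c \<noteq> 0"
  then have "0 \<le> a - c \<and> 0 \<le> c \<and> int N \<le> (a - c) + c" using assms unfolding Wt_def by blast
  then show "0 \<le> a \<and> 0 \<le> c \<and> int N \<le> a + c" by simp
qed

lemma shift_S_ring_R: "f \<in> ring_R \<Longrightarrow> shift_S f \<in> ring_R"
  by (simp add: ring_R_eq_Wt shift_S_Wt)

lemma shift_S_Wt1:
  assumes "f \<in> Wt1 N" shows "shift_S f \<in> Wt1 (Suc N)"
  unfolding Wt1_def Wt_def mem_Collect_eq qz_coeff_shift_S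
proof (intro conjI allI impI)
  fix a c assume nz: "qz_coeff f (a - c) c \<noteq> 0"
  then have "0 \<le> a - c" "0 \<le> c" "int N \<le> (a - c) + c" "c \<noteq> 0"
    using assms unfolding Wt1_def Wt_def by blast+
  then show "0 \<le> a" "0 \<le> c" "int (Suc N) \<le> a + c" by auto
qed (use assms in \<open>auto simp: Wt1_def\<close>)

subsection \<open>Expansion of denominators\<close>

fun expo_pos :: "expo \<Rightarrow> bool" where
  "expo_pos (a, b, c) \<longleftrightarrow> 0 \<le> a \<and> 0 \<le> c \<and> (0 < a + c \<or> b < 0)"

definition gd :: "expo \<Rightarrow> bool" where
  "gd e \<longleftrightarrow> expo_pos e \<or> expo_pos (- e)"

lemma expo_pos_expandable: "expo_pos e \<Longrightarrow> expandable (mon e)"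
proof -
  assume e: "expo_pos e"
  obtain a b c where abc: "e = (a, b, c)" by (cases e)
  have "mon e = qq ^ nat a * zz1 powi b * zz2 ^ nat c"
    using e by (simp add: abc mon.simps power_int_def)
  with e show ?thesis
    unfolding expandable_def abc by (intro exI[of _ "nat a"] exI[of _ b] exI[of _ "nat c"]) auto
qed

lemma gd_good: "gd e \<Longrightarrow> good_denominator (1 - mon e)"
  unfolding gd_def good_denominator_def using expo_pos_expandable mon_uminus
  by (metis inverse_inverse_eq)

lemma expo_pos_ring_R: "expo_pos e \<Longrightarrow> mon e \<in> ring_R"
  by (cases e) (auto intro: mon_ring_R)

text \<open>Every partial geometric sum lies in R, and by \<open>inverse_expansion\<close> each
  single coefficient of the inverse agrees with that of a long enough partial sum.\<close>

lemma inverse_pos_ring_R: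
  assumes "expo_pos e" shows "inverse (1 - mon e) \<in> ring_R"
  unfolding ring_R_def mem_Collect_eq
proof (intro allI impI)
  fix a c :: int assume ac: "a < 0 \<or> c < 0"
  show "qz_coeff (inverse (1 - mon e)) a c = 0"
  proof (rule fls_eqI)
    fix b
    have "(\<Sum>n<N. mon e ^ n) \<in> Wt 0" for N
      using expo_pos_ring_R[OF assms] by (intro Wt_sum) (auto simp: ring_R_eq_Wt[symmetric])
    then have "qz_coeff (\<Sum>n<N. mon e ^ n) a c = 0" for N
      using ac unfolding ring_R_eq_Wt[symmetric] ring_R_def by blast
    with inverse_expansion[OF expo_pos_expandable[OF assms], of a c "- b"]
    show "fls_nth (qz_coeff (inverse (1 - mon e)) a c) b = fls_nth 0 b" by simp
  qed
qed

lemma gd_nonzero: assumes "gd e" shows "1 - mon e \<noteq> 0"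
proof -
  have "e \<noteq> 0" using assms by (cases e) (auto simp: gd_def zero_prod_def)
  then show ?thesis using mon_eq_1_iff[of e] by (metis eq_iff_diff_eq_0)
qed

text \<open>The monomial in front is the one that the expansion of \<open>1 / (1 - X)\<close> produces when
  \<open>X\<close> has negative exponents.\<close>

lemma inverse_neg:
  fixes u :: lseries
  assumes "u \<noteq> 0" "u \<noteq> 1"
  shows "1 / (1 - u) = - inverse u * inverse (1 - inverse u)"
proof -
  have "1 - inverse u = - ((1 - u) * inverse u)" using assms by (simp add: left_diff_distrib)
  then have "inverse (1 - inverse u) = - (inverse (1 - u) * u)" using assms by simp
  then show ?thesis using assms by (simp add: inverse_eq_divide)
qed

lemma inverse_gd_ring_R: assumes "gd e" shows "1 / (1 - mon e) \<in> ring_R"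
proof (cases "expo_pos e")
  case True then show ?thesis using inverse_pos_ring_R by (simp add: inverse_eq_divide)
next
  case False
  with assms have *: "expo_pos (- e)" by (simp add: gd_def)
  have "mon e \<noteq> 1" using gd_nonzero[OF assms] by auto
  then have eq: "1 / (1 - mon e) = - (mon (- e) * inverse (1 - mon (- e)))"
    using inverse_neg[of "mon e"] by (simp add: mon_uminus)
  show ?thesis
    unfolding eq by (intro ring_R_closed expo_pos_ring_R[OF *] inverse_pos_ring_R[OF *])
qed

subsection \<open>Operators on simple vectors\<close>

text \<open>Simple vectors whose entries \<open>P, Q, R\<close> are given by their exponents; on these the operators
  are total.\<close>

datatype mvec = MVec (scal: lseries) expo expo expo

fun to_svec :: "mvec \<Rightarrow> svec" where
  "to_svec (MVec f p q r) = SVec f (mon p) (mon q) (mon r)"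

datatype letter = LA | LB | LC | LD | LE

definition tt :: expo where "tt = (0, 1, 1)"
definition ww :: expo where "ww = (0, 0, 1)"

fun dens :: "letter \<Rightarrow> expo \<Rightarrow> expo \<Rightarrow> expo \<Rightarrow> expo list" where
  "dens LA p q r = [tt + q - p, r - q]"
| "dens LB p q r = [tt + q - p, q - r, r - p]"
| "dens LC p q r = [p - q - tt, r - q]"
| "dens LD p q r = [p - q - tt, r - q - tt, q - r]"
| "dens LE p q r = [tt + q - r, p - r]"

fun numer :: "letter \<Rightarrow> expo \<Rightarrow> expo \<Rightarrow> expo \<Rightarrow> lseries" where
  "numer LB p q r = 1 - mon (q - p)"
| "numer LD p q r = 1 - mon (- tt)"
| "numer _ p q r = 1"

definition fac :: "letter \<Rightarrow> expo \<Rightarrow> expo \<Rightarrow> expo \<Rightarrow> lseries" where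
  "fac L p q r = numer L p q r / prod_list (map (\<lambda>e. 1 - mon e) (dens L p q r))"

fun new_p :: "letter \<Rightarrow> expo \<Rightarrow> expo \<Rightarrow> expo \<Rightarrow> expo" where
  "new_p LA p q r = sg p" | "new_p LB p q r = sg p" | "new_p LC p q r = sg (tt + q)"
| "new_p LD p q r = sg (tt + q)" | "new_p LE p q r = sg r"

fun new_q :: "letter \<Rightarrow> expo \<Rightarrow> expo \<Rightarrow> expo \<Rightarrow> expo" where
  "new_q LA p q r = sg q" | "new_q LB p q r = sg r" | "new_q LC p q r = sg q"
| "new_q LD p q r = sg r" | "new_q LE p q r = sg r"

text \<open>The third slot is S(q^-1 z2 P) = z2 S(P), the two powers of q cancelling; hence
  \<open>sg p + ww\<close> for every letter.\<close>

fun ap :: "letter \<Rightarrow> mvec \<Rightarrow> mvec" where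
  "ap L (MVec f p q r) = MVec (shift_S (f * fac L p q r)) (new_p L p q r) (new_q L p q r) (sg p + ww)"

fun good :: "letter \<Rightarrow> mvec \<Rightarrow> bool" where
  "good L (MVec f p q r) \<longleftrightarrow> (\<forall>e\<in>set (dens L p q r). gd e)"

fun svec_op :: "letter \<Rightarrow> svec \<Rightarrow> svec option" where
  "svec_op LA = svec_A" | "svec_op LB = svec_B" | "svec_op LC = svec_C"
| "svec_op LD = svec_D" | "svec_op LE = svec_E"

lemma mon_tt: "mon tt = zz1 * zz2" and mon_ww: "mon ww = zz2"
  by (simp_all add: tt_def ww_def mon.simps)

lemma svec_op_good:
  assumes "good L x"
  shows "svec_op L (to_svec x) = Some (to_svec (ap L x))"
proof -
  obtain f p q r where x: "x = MVec f p q r" by (cases x)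
  have g: "e \<in> set (dens L p q r) \<Longrightarrow> good_denominator (1 - mon e)" for e
    using assms gd_good by (auto simp: x)
  have r': "shift_S (inverse qq * zz2 * mon p) = mon (sg p + ww)"
    by (simp add: mon_add mon_ww flip: shift_S_mon)
  have t: "zz1 * zz2 * mon a / mon b = mon (tt + a - b)" "zz1 * zz2 * mon a = mon (tt + a)"
    "mon (- tt) * mon a / mon b = mon (a - b - tt)" "mon a / mon b = mon (a - b)"
    "inverse (zz1 * zz2) = mon (- tt)" for a b
    by (simp_all add: mon_add mon_diff mon_uminus mon_tt field_simps)
  show ?thesis
    using g by (cases L)
      (simp_all only: x to_svec.simps svec_op.simps svec_A.simps svec_B.simps svec_C.simps
        svec_D.simps svec_E.simps make_op_def t r' ap.simps shift_S_mon,
       simp_all add: fac_def mult_ac)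
qed

fun nonneg :: "expo \<Rightarrow> bool" where
  "nonneg (a, b, c) \<longleftrightarrow> 0 \<le> a \<and> 0 \<le> b \<and> 0 \<le> c"

fun simple :: "mvec \<Rightarrow> bool" where
  "simple (MVec f p q r) \<longleftrightarrow> f \<in> ring_R \<and> nonneg p \<and> nonneg q \<and> nonneg r"

lemma nonneg_add: "nonneg d \<Longrightarrow> nonneg e \<Longrightarrow> nonneg (d + e)"
  by (cases d; cases e) simp

lemma nonneg_sg: "nonneg e \<Longrightarrow> nonneg (sg e)"
  by (cases e) simp

lemma nonneg_tt: "nonneg tt" and nonneg_ww: "nonneg ww"
  by (simp_all add: tt_def ww_def)

lemma nonneg_ring_R: "nonneg e \<Longrightarrow> mon e \<in> ring_R"
  by (cases e) (simp add: mon_ring_R)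

lemma nonneg_monomial: assumes "nonneg e" shows "is_monomial (mon e)"
proof -
  obtain a b c where e: "e = (a, b, c)" by (cases e)
  have "mon e = qq ^ nat a * zz1 ^ nat b * zz2 ^ nat c"
    using assms by (simp add: e mon.simps power_int_def)
  then show ?thesis unfolding is_monomial_def by blast
qed

lemma simple_is_simple: "simple x \<Longrightarrow> is_simple (to_svec x)"
  by (cases x) (simp add: nonneg_monomial del: nonneg.simps)

text \<open>The numerators of \<open>B\<close> and \<open>D\<close> are the products of the monomials in two of their
  denominators, which is why they never spoil integrality.\<close>

lemma two_denominators:
  assumes "gd d" "gd e"
  shows "(1 - mon (d + e)) / ((1 - mon d) * (1 - mon e)) \<in> ring_R"
proof -
  define u v where "u = 1 - mon d" and "v = 1 - mon e"
  have nz: "u \<noteq> 0" "v \<noteq> 0" using assms gd_nonzero by (simp_all add: u_def v_def)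
  have "1 - mon (d + e) = u + v - u * v" by (simp add: u_def v_def mon_add algebra_simps)
  then have "(1 - mon (d + e)) / (u * v) = 1 / u + 1 / v - 1"
    using nz by (simp add: divide_simps)
  also have "\<dots> \<in> ring_R"
    unfolding u_def v_def by (intro ring_R_closed inverse_gd_ring_R assms)
  finally show ?thesis by (simp add: u_def v_def)
qed

lemma fac_ring_R:
  assumes "\<forall>e\<in>set (dens L p q r). gd e"
  shows "fac L p q r \<in> ring_R"
proof -
  have pr: "1 / (a * b) \<in> ring_R" if "1 / a \<in> ring_R" "1 / b \<in> ring_R" for a b
    using ring_R_mult[OF that] by simp
  have pr': "c / (a * b) \<in> ring_R" if "1 / a \<in> ring_R" "c / b \<in> ring_R" for a b c
    using ring_R_mult[OF that] by simp
  show ?thesis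
  proof (cases L)
    case LB
    have "(1 - mon (q - p)) / ((1 - mon (q - r)) * (1 - mon (r - p))) \<in> ring_R"
      using two_denominators[of "q - r" "r - p"] assms by (simp add: LB)
    then show ?thesis
      using assms by (auto simp: LB fac_def intro!: pr' inverse_gd_ring_R)
  next
    case LD
    have "(1 - mon (- tt)) / ((1 - mon (r - q - tt)) * (1 - mon (q - r))) \<in> ring_R"
      using two_denominators[of "r - q - tt" "q - r"] assms by (simp add: LD)
    then show ?thesis
      using assms by (auto simp: LD fac_def intro!: pr' inverse_gd_ring_R)
  qed (use assms in \<open>auto simp: fac_def intro!: pr inverse_gd_ring_R\<close>)
qed

lemma simple_ap:
  assumes "simple x" "good L x" shows "simple (ap L x)"
proof -
  obtain f p q r where x: "x = MVec f p q r" by (cases x)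
  have "fac L p q r \<in> ring_R" using assms(2) by (intro fac_ring_R) (simp add: x)
  then show ?thesis using assms(1)
    by (cases L) (auto simp: x intro!: shift_S_ring_R nonneg_add nonneg_sg nonneg_tt nonneg_ww)
qed

fun cmp :: "nat \<Rightarrow> nat \<Rightarrow> nat \<Rightarrow> mvec \<Rightarrow> lseries" where
  "cmp k i l (MVec f p q r) = f * (mon p ^ (k - l) * mon q ^ (l - i) * mon r ^ i)"

lemma cmp_svec_component: "svec_component k (to_svec x) i l = cmp k i l x"
  by (cases x) simp

text \<open>\<open>S\<close> raises the degree of everything divisible by \<open>z\<^sub>2\<close>, so each operator raises
  the level of such vectors. The second alternative covers the vectors \<open>A\<^sup>m B v\<^sub>n\<close>, which are not
  divisible by \<open>z\<^sub>2\<close>.\<close>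

fun div_level :: "nat \<Rightarrow> mvec \<Rightarrow> bool" where
  "div_level N (MVec f p q r) \<longleftrightarrow> f * mon p \<in> Wt1 N \<and> f * mon q \<in> Wt1 N \<and> f * mon r \<in> Wt1 N"

fun v_level :: "nat \<Rightarrow> mvec \<Rightarrow> bool" where
  "v_level N (MVec f p q r) \<longleftrightarrow> f \<in> Wt N \<and> p = 0 \<and> (\<exists>i\<ge>1. q = (i, 0, 1)) \<and> r = (0, 0, 1)"

definition level :: "nat \<Rightarrow> mvec \<Rightarrow> bool" where
  "level N x \<longleftrightarrow> simple x \<and> (div_level N x \<or> v_level N x)"

text \<open>Each new slot is \<open>S\<close> of an old one, possibly times t or z2, and the new
  scalar differs from \<open>S\<close> of the old one by an element of R. The gained degree is the
  one that \<open>S\<close> gains on multiples of z2.\<close>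

lemma div_level_ap:
  assumes "simple x" "good L x" "div_level N x"
  shows "div_level (Suc N) (ap L x)"
proof -
  obtain f p q r where x: "x = MVec f p q r" by (cases x)
  define g where "g = shift_S (f * fac L p q r)"
  have ap: "ap L x = MVec g (new_p L p q r) (new_q L p q r) (sg p + ww)"
    by (simp add: x g_def del: shift_S_simps)
  have fr: "fac L p q r \<in> ring_R" using assms(2) by (intro fac_ring_R) (simp add: x)
  have *: "g * mon (sg e) \<in> Wt1 (Suc N)" if "f * mon e \<in> Wt1 N" for e
  proof -
    have "shift_S (f * mon e * fac L p q r) \<in> Wt1 (Suc N)"
      by (intro shift_S_Wt1 Wt1_mult that fr)
    then show ?thesis by (simp add: g_def shift_S_mon mult_ac)
  qed
  have t: "f * mon (tt + e) \<in> Wt1 N" if "f * mon e \<in> Wt1 N" for e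
    using Wt1_mult[OF that nonneg_ring_R[OF nonneg_tt]] by (simp add: mon_add mult_ac)
  have w: "g * mon (sg p + ww) \<in> Wt1 (Suc N)"
    using Wt1_mult[OF *[of p] nonneg_ring_R[OF nonneg_ww]] assms(3) by (simp add: x mon_add mult_ac)
  show ?thesis unfolding ap using assms(3) w by (cases L) (simp_all add: x * t)
qed

text \<open>On [1, q^i z2, z2] the operator \<open>A\<close> keeps the shape and gains from 1/(1 -
  q^-i) = -q^i/(1 - q^i), \<open>B\<close> keeps the shape with i = 1, and the other three put a
  factor z2 into every slot.\<close>

lemma v_level_ap:
  assumes "good L x" "v_level N x"
  shows "v_level (if L = LA then Suc N else N) (ap L x) \<or> div_level N (ap L x)"
proof -
  obtain f i where i: "i \<ge> 1" and f: "f \<in> Wt N" and x: "x = MVec f 0 (i, 0, 1) (0, 0, 1)"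
    using assms(2) by (cases x) auto
  define p q r :: expo where "p = 0" and "q = (i, 0, 1)" and "r = (0, 0, 1)"
  note pqr = p_def q_def r_def
  define g where "g = shift_S (f * fac L p q r)"
  have ap: "ap L x = MVec g (new_p L p q r) (new_q L p q r) (0, 0, 1)"
    by (simp add: x g_def pqr ww_def sg_0 del: shift_S_simps)
  have g: "g \<in> Wt N"
    unfolding g_def using assms(1) f by (intro shift_S_Wt Wt_mult_ring_R fac_ring_R) (simp_all add: x pqr)
  have *: "g * mon (a, b, c) \<in> Wt1 N" if "0 \<le> a" "0 < c" for a b c
  proof -
    have "g * mon (a, b, c) \<in> Wt N"
      using that by (intro Wt_mult_ring_R g mon_ring_R) auto
    moreover have "mon (a, b, c) \<in> Wt1 0" using that by (intro mon_Wt1) auto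
    then have "g * mon (a, b, c) \<in> Wt1 0" by (intro Wt1_mult' Wt_ring_R[OF g])
    ultimately show ?thesis by (simp add: Wt1_def)
  qed
  consider "L = LA" | "L = LB" | "L \<in> {LC, LD, LE}" by (cases L) auto
  then show ?thesis
  proof cases
    case 1
    have gd: "gd (i, 1, 2)" "gd (- i, 0, 0)" "gd (i, 0, 0)" using i by (auto simp: gd_def)
    have "mon (- i, 0, 0) \<noteq> 1" using gd_nonzero[OF gd(2)] by auto
    then have "1 / (1 - mon (- i, 0, 0)) = - (mon (i, 0, 0) * (1 / (1 - mon (i, 0, 0))))"
      using inverse_neg[of "mon (- i, 0, 0)"] mon_uminus[of "(- i, 0, 0)"]
      by (simp add: inverse_eq_divide)
    moreover have "mon (i, 0, 0) * (1 / (1 - mon (i, 0, 0))) \<in> Wt 1"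
      using i by (intro Wt_mult_ring_R mon_Wt inverse_gd_ring_R gd) auto
    ultimately have "1 / (1 - mon (- i, 0, 0)) \<in> Wt 1" by (simp only: Wt_uminus)
    then have "f * (1 / (1 - mon (- i, 0, 0)) * (1 / (1 - mon (i, 1, 2)))) \<in> Wt (N + 1)"
      by (intro Wt_mult[OF f] Wt_mult_ring_R inverse_gd_ring_R gd)
    moreover have "fac LA p q r = 1 / (1 - mon (- i, 0, 0)) * (1 / (1 - mon (i, 1, 2)))"
      by (simp add: fac_def tt_def pqr zero_prod_def)
    ultimately have "g \<in> Wt (Suc N)"
      unfolding g_def 1 by (metis Suc_eq_plus1 shift_S_Wt)
    then show ?thesis unfolding ap using i 1 by (simp add: pqr sg_0)
  next
    case 2
    then show ?thesis unfolding ap using g by (simp add: pqr sg_0)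
  next
    case 3
    then show ?thesis unfolding ap using i
      by (intro disjI2) (auto simp: pqr tt_def intro!: *)
  qed
qed

lemma v_level_mono: "v_level N x \<Longrightarrow> M \<le> N \<Longrightarrow> v_level M x"
  by (cases x) (auto intro: Wt_mono)

lemma Wt1_mono: "f \<in> Wt1 N \<Longrightarrow> M \<le> N \<Longrightarrow> f \<in> Wt1 M"
  by (auto simp: Wt1_def intro: Wt_mono)

lemma div_level_mono: "div_level N x \<Longrightarrow> M \<le> N \<Longrightarrow> div_level M x"
  by (cases x) (auto intro: Wt1_mono)

lemma level_ap: assumes "level N x" "good L x" shows "level N (ap L x)"
  using assms simple_ap[of x L] div_level_ap[of x L N] v_level_ap[of L x N]
    div_level_mono[of "Suc N" "ap L x" N] v_level_mono[of "Suc N" "ap L x" N]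
  unfolding level_def by (auto split: if_splits)

text \<open>A component is the scalar times a monomial of total degree k in P, Q, R; as k > 0, at
  least one of the three slots occurs and brings its divisibility along.\<close>

lemma div_level_cmp:
  assumes "simple x" "div_level N x" "0 < k" "i \<le> l" "l \<le> k"
  shows "cmp k i l x \<in> Wt1 N"
proof -
  obtain f p q r where x: "x = MVec f p q r" by (cases x)
  have R: "mon p \<in> ring_R" "mon q \<in> ring_R" "mon r \<in> ring_R"
    using assms(1) by (auto simp: x intro: nonneg_ring_R)
  consider "k - l = Suc (k - l - 1)" | "l - i = Suc (l - i - 1)" | "i = Suc (i - 1)" using assms by linarith
  then show ?thesis
  proof cases
    case 1
    have "f * mon p * (mon p ^ (k - l - 1) * mon q ^ (l - i) * mon r ^ i) \<in> Wt1 N"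
      by (rule Wt1_mult, use assms in \<open>simp add: x\<close>) (intro ring_R_mult ring_R_power R)
    then show ?thesis unfolding x cmp.simps by (subst 1) (simp add: mult_ac)
  next
    case 2
    have "f * mon q * (mon p ^ (k - l) * mon q ^ (l - i - 1) * mon r ^ i) \<in> Wt1 N"
      by (rule Wt1_mult, use assms in \<open>simp add: x\<close>) (intro ring_R_mult ring_R_power R)
    then show ?thesis unfolding x cmp.simps by (subst 2) (simp add: mult_ac)
  next
    case 3
    have "f * mon r * (mon p ^ (k - l) * mon q ^ (l - i) * mon r ^ (i - 1)) \<in> Wt1 N"
      by (rule Wt1_mult, use assms in \<open>simp add: x\<close>) (intro ring_R_mult ring_R_power R)
    then show ?thesis unfolding x cmp.simps by (subst 3) (simp add: mult_ac)
  qed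
qed

lemma level_cmp:
  assumes "level N x" "0 < k" "i \<le> l" "l \<le> k"
  shows "cmp k i l x \<in> Wt N"
proof -
  obtain f p q r where x: "x = MVec f p q r" by (cases x)
  consider "simple x" "div_level N x" | "simple x" "v_level N x" using assms(1) by (auto simp: level_def)
  then show ?thesis
  proof cases
    case 1 then show ?thesis using div_level_cmp assms by (simp add: Wt1_def)
  next
    case 2
    then have "mon p \<in> ring_R" "mon q \<in> ring_R" "mon r \<in> ring_R"
      by (auto simp: x intro: nonneg_ring_R)
    then show ?thesis using 2 unfolding x cmp.simps
      by (intro Wt_mult_ring_R ring_R_mult ring_R_power) (auto simp: level_def)
  qed
qed

subsection \<open>Definedness\<close>

text \<open>Definedness depends only on the exponents \<open>x\<close> of \<open>Q/P\<close> and \<open>y\<close> of \<open>R/P\<close>.\<close>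

definition all_gd :: "expo \<Rightarrow> expo \<Rightarrow> bool" where
  "all_gd x y \<longleftrightarrow> gd (tt + x) \<and> gd (x - y) \<and> gd y \<and> gd (tt + x - y)"

lemma gd_uminus: "gd (- e) \<longleftrightarrow> gd e"
  by (auto simp: gd_def)

lemma all_gd_good:
  assumes "all_gd (q - p) (r - p)" shows "good L (MVec f p q r)"
proof -
  have *: "gd (tt + q - p)" "gd (q - r)" "gd (r - p)" "gd (tt + q - r)"
    using assms by (simp_all add: all_gd_def algebra_simps)
  then have "gd (p - q - tt)" "gd (r - q)" "gd (p - r)" "gd (r - q - tt)"
    using gd_uminus[of "tt + q - p"] gd_uminus[of "q - r"] gd_uminus[of "r - p"] gd_uminus[of "tt + q - r"]
    by (simp_all add: algebra_simps)
  with * show ?thesis by (cases L) auto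
qed

text \<open>Nine shapes of (Q/P, R/P) in three orbits G, H, K of \<open>D\<close>, which maps 1 to
  2, 2 to 3 and 3 to 1 in each orbit. The inequalities ensure that no denominator vanishes or has
  exponents of q and z2 of both signs.\<close>

inductive fam :: "expo \<Rightarrow> expo \<Rightarrow> bool" where
  G1: "0 \<le> b \<Longrightarrow> b < a \<Longrightarrow> fam (a, 0, 1) (b, 0, 1)"
| G2: "1 \<le> a \<Longrightarrow> a < b \<Longrightarrow> fam (- a, - 1, - 1) (- b, - 1, - 1)"
| G3: "1 \<le> a \<Longrightarrow> 0 \<le> b \<Longrightarrow> fam (- a, - 1, - 1) (b, 0, 1)"
| H1: "0 \<le> a \<Longrightarrow> 1 \<le> b \<Longrightarrow> fam (a, 0, 0) (- b, 0, 0)"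
| H2: "1 \<le> b \<Longrightarrow> b < a \<Longrightarrow> fam (- a, - 1, - 1) (- b, - 1, 0)"
| H3: "1 \<le> a \<Longrightarrow> a < b \<Longrightarrow> fam (a, - 1, 0) (b, 0, 1)"
| K1: "0 \<le> a \<Longrightarrow> a < b \<Longrightarrow> fam (a, 0, 0) (b, 0, 1)"
| K2: "1 \<le> a \<Longrightarrow> 1 \<le> b \<Longrightarrow> fam (a, - 1, 0) (- b, - 1, 0)"
| K3: "1 \<le> b \<Longrightarrow> b < a \<Longrightarrow> fam (- a, - 1, - 1) (- b, 0, 0)"

lemma fam_all_gd: "fam x y \<Longrightarrow> all_gd x y"
  by (induction rule: fam.induct) (auto simp: all_gd_def tt_def gd_def zero_prod_def)

lemma fam_D: "fam x y \<Longrightarrow> fam (sg (y - x - tt)) (sg (- x - tt) + ww)"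
proof (induction rule: fam.induct)
  case (G1 b a) then show ?case using fam.G2[of "a - b + 1" "a + 2"] by (simp add: tt_def ww_def zero_prod_def)
next
  case (G2 a b) then show ?case using fam.G3[of "b - a + 1" a] by (simp add: tt_def ww_def zero_prod_def)
next
  case (G3 a b) then show ?case using fam.G1[of a "a + b + 1"] by (simp add: tt_def ww_def zero_prod_def algebra_simps)
next
  case (H1 a b) then show ?case using fam.H2[of "a + 1" "a + b + 1"] by (simp add: tt_def ww_def zero_prod_def algebra_simps)
next
  case (H2 b a) then show ?case using fam.H3[of "a - b" a] by (simp add: tt_def ww_def zero_prod_def algebra_simps)
next
  case (H3 a b) then show ?case using fam.H1[of "b - a" "a + 1"] by (simp add: tt_def ww_def zero_prod_def algebra_simps)
next
  case (K1 a b) then show ?case using fam.K2[of "b - a" "a + 1"] by (simp add: tt_def ww_def zero_prod_def algebra_simps)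
next
  case (K2 a b) then show ?case using fam.K3[of "a + 1" "a + b + 1"] by (simp add: tt_def ww_def zero_prod_def algebra_simps)
next
  case (K3 b a) then show ?case using fam.K1[of "a - b" a] by (simp add: tt_def ww_def zero_prod_def algebra_simps)
qed

text \<open>Shapes of Q/P from which \<open>A\<close> and \<open>C\<close> lead into
  \<open>fam\<close>, and which they reproduce.\<close>

definition x_ok :: "expo \<Rightarrow> bool" where
  "x_ok x \<longleftrightarrow> (\<exists>a\<ge>1. x = (a, 0, 1) \<or> x = (- a, - 1, - 1))"

definition y_ok :: "expo \<Rightarrow> bool" where
  "y_ok y \<longleftrightarrow> (\<exists>b\<ge>0. y = (b, 0, 1))"

text \<open>\<open>E\<close> sends R/P to z2 S(P/R), which swaps the two alternatives; so all powers
  of \<open>E\<close> stay defined.\<close>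

definition e_ok :: "expo \<Rightarrow> bool" where
  "e_ok y \<longleftrightarrow> y_ok y \<or> (\<exists>b\<ge>1. y = (- b, 0, 0))"

lemma fam_A: "x_ok x \<Longrightarrow> fam (sg x) ww \<and> x_ok (sg x)"
  unfolding x_ok_def ww_def
proof (elim exE conjE disjE)
  fix a :: int assume "1 \<le> a" "x = (a, 0, 1)"
  then show "fam (sg x) (0, 0, 1) \<and> (\<exists>a\<ge>1. sg x = (a, 0, 1) \<or> sg x = (- a, - 1, - 1))"
    using fam.G1[of 0 "a + 1"] by auto
next
  fix a :: int assume a: "1 \<le> a" "x = (- a, - 1, - 1)"
  then have "sg x = (- (a + 1), - 1, - 1)" by simp
  then show "fam (sg x) (0, 0, 1) \<and> (\<exists>a\<ge>1. sg x = (a, 0, 1) \<or> sg x = (- a, - 1, - 1))"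
    using fam.G3[of "a + 1" 0] a by (metis add_increasing2 le_add_same_cancel2 order_refl zero_le_one)
qed

lemma fam_C: "x_ok x \<Longrightarrow> fam (sg (- tt)) (sg (- x - tt) + ww) \<and> x_ok (sg (- tt))"
  unfolding x_ok_def ww_def tt_def
proof (elim exE conjE disjE)
  fix a :: int assume "1 \<le> a" "x = (a, 0, 1)"
  then show "fam (sg (- (0, 1, 1))) (sg (- x - (0, 1, 1)) + (0, 0, 1)) \<and>
      (\<exists>a\<ge>1. sg (- (0, 1, 1)) = (a, 0, 1) \<or> sg (- (0, 1, 1)) = (- a, - 1, - 1))"
    using fam.G2[of 1 "a + 2"] by auto
next
  fix a :: int assume "1 \<le> a" "x = (- a, - 1, - 1)"
  then show "fam (sg (- (0, 1, 1))) (sg (- x - (0, 1, 1)) + (0, 0, 1)) \<and>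
      (\<exists>a\<ge>1. sg (- (0, 1, 1)) = (a, 0, 1) \<or> sg (- (0, 1, 1)) = (- a, - 1, - 1))"
    using fam.G3[of 1 a] by (auto simp: zero_prod_def)
qed

lemma fam_B: "y_ok y \<Longrightarrow> fam (sg y) ww \<and> x_ok (sg y)"
  unfolding x_ok_def y_ok_def ww_def
proof (elim exE conjE)
  fix b :: int assume "0 \<le> b" "y = (b, 0, 1)"
  then show "fam (sg y) (0, 0, 1) \<and> (\<exists>a\<ge>1. sg y = (a, 0, 1) \<or> sg y = (- a, - 1, - 1))"
    using fam.G1[of 0 "b + 1"] by auto
qed

lemma fam_E: "e_ok y \<Longrightarrow> fam 0 (sg (- y) + ww) \<and> e_ok (sg (- y) + ww)"
  unfolding e_ok_def y_ok_def ww_def zero_prod_def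
proof (elim exE conjE disjE)
  fix b :: int assume b: "0 \<le> b" "y = (b, 0, 1)"
  then have eq: "sg (- y) + (0, 0, 1) = (- (b + 1), 0, 0)" by simp
  have "fam (0, 0, 0) (- (b + 1), 0, 0)" using b by (intro fam.H1) auto
  then show "fam (0, 0, 0) (sg (- y) + (0, 0, 1)) \<and> ((\<exists>b\<ge>0. sg (- y) + (0, 0, 1) = (b, 0, 1)) \<or>
      (\<exists>b\<ge>1. sg (- y) + (0, 0, 1) = (- b, 0, 0)))"
    unfolding eq using b by (intro conjI disjI2 exI[of _ "b + 1"]) auto
next
  fix b :: int assume "1 \<le> b" "y = (- b, 0, 0)"
  then show "fam (0, 0, 0) (sg (- y) + (0, 0, 1)) \<and> ((\<exists>b\<ge>0. sg (- y) + (0, 0, 1) = (b, 0, 1)) \<or>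
      (\<exists>b\<ge>1. sg (- y) + (0, 0, 1) = (- b, 0, 0)))"
    using fam.K1[of 0 b] by auto
qed

fun xr :: "mvec \<Rightarrow> expo" where "xr (MVec f p q r) = q - p"
fun yr :: "mvec \<Rightarrow> expo" where "yr (MVec f p q r) = r - p"

definition famv :: "mvec \<Rightarrow> bool" where "famv v \<longleftrightarrow> fam (xr v) (yr v)"

lemma ratios_ap [simp]:
  "xr (ap LA v) = sg (xr v)" "yr (ap LA v) = ww"
  "xr (ap LB v) = sg (yr v)" "yr (ap LB v) = ww"
  "xr (ap LC v) = sg (- tt)" "yr (ap LC v) = sg (- xr v - tt) + ww"
  "xr (ap LD v) = sg (yr v - xr v - tt)" "yr (ap LD v) = sg (- xr v - tt) + ww"
  "xr (ap LE v) = 0" "yr (ap LE v) = sg (- yr v) + ww"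
  by (cases v; simp add: sg_add sg_diff sg_uminus algebra_simps)+

lemma famv_good: "famv v \<Longrightarrow> good L v"
  by (cases v) (simp add: famv_def all_gd_good fam_all_gd del: good.simps)

lemma famv_ap:
  "famv v \<Longrightarrow> famv (ap LD v)" "x_ok (xr v) \<Longrightarrow> famv (ap LA v)" "x_ok (xr v) \<Longrightarrow> famv (ap LC v)"
  "y_ok (yr v) \<Longrightarrow> famv (ap LB v)" "e_ok (yr v) \<Longrightarrow> famv (ap LE v)"
  by (simp_all add: famv_def fam_A fam_B fam_C fam_D fam_E)

subsection \<open>The matrix acts as the sum of the operators\<close>

text \<open>The complete homogeneous polynomial h_m(a, b); \<open>complete_sym3\<close> gives the
  partial fractions of h_m(P, Y, R).\<close>

lemma complete_sym2:
  fixes a b :: "'a :: field"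
  assumes "a \<noteq> b"
  shows "(\<Sum>c\<le>m. a ^ (m - c) * b ^ c) = (a ^ Suc m - b ^ Suc m) / (a - b)"
proof -
  have "(\<Sum>c\<le>m. a ^ (m - c) * b ^ c) = (\<Sum>c\<le>m. b ^ c * a ^ (m - c))"
    by (simp only: mult.commute)
  also have "(b - a) * \<dots> = b ^ Suc m - a ^ Suc m"
    using diff_power_eq_sum[of b m a] by (simp add: lessThan_Suc_atMost)
  finally have "(a - b) * (\<Sum>c\<le>m. a ^ (m - c) * b ^ c) = a ^ Suc m - b ^ Suc m"
    by (simp add: algebra_simps)
  then show ?thesis using assms by (simp add: eq_divide_eq mult.commute)
qed

lemma complete_sym3:
  fixes P Y R :: "'a :: field"
  assumes "P \<noteq> Y" "P \<noteq> R" "Y \<noteq> R"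
  shows "(\<Sum>b\<le>m. Y ^ b * (\<Sum>a\<le>m - b. P ^ (m - b - a) * R ^ a)) =
    P ^ Suc (Suc m) / ((P - Y) * (P - R)) + Y ^ Suc (Suc m) / ((Y - P) * (Y - R)) + R ^ Suc (Suc m) / ((R - P) * (R - Y))"
proof -
  have "(\<Sum>b\<le>m. Y ^ b * (\<Sum>a\<le>m - b. P ^ (m - b - a) * R ^ a)) =
      (\<Sum>b\<le>m. (P * (P ^ (m - b) * Y ^ b) - R * (R ^ (m - b) * Y ^ b)) / (P - R))"
    by (intro sum.cong refl, subst complete_sym2[OF assms(2)]) (simp add: algebra_simps diff_divide_distrib)
  also have "\<dots> = (P * ((P ^ Suc m - Y ^ Suc m) / (P - Y)) - R * ((R ^ Suc m - Y ^ Suc m) / (R - Y))) / (P - R)"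
    unfolding sum_divide_distrib[symmetric] sum_subtractf sum_distrib_left[symmetric]
      complete_sym2[OF assms(1)] complete_sym2[OF assms(3)[symmetric]] ..
  also have "\<dots> = P ^ Suc (Suc m) / ((P - Y) * (P - R)) + Y ^ Suc (Suc m) / ((Y - P) * (Y - R)) + R ^ Suc (Suc m) / ((R - P) * (R - Y))"
  proof -
    define u v where "u = P ^ Suc m" and "v = R ^ Suc m"
    define y where "y = Y ^ Suc m"
    have nz: "P - Y \<noteq> 0" "P - R \<noteq> 0" "Y - P \<noteq> 0" "R - P \<noteq> 0" "Y - R \<noteq> 0" "R - Y \<noteq> 0" using assms by auto
    have "(P * ((u - y) / (P - Y)) - R * ((v - y) / (R - Y))) / (P - R) =
        P * u / ((P - Y) * (P - R)) + Y * y / ((Y - P) * (Y - R)) + R * v / ((R - P) * (R - Y))"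
      using nz by (simp add: divide_simps) (simp add: algebra_simps)
    then show ?thesis by (simp add: u_def v_def y_def)
  qed
  finally show ?thesis .
qed

text \<open>The row (i, l) is supported on a triangle d <= i' <= l' and a rectangle i' < d <= l',
  both with l' <= k - i. With Y = q z1 z2 Q the triangle contributes h_m(P, Y, R), the rectangle a
  product of two geometric sums.\<close>

lemma matrix_row_sum:
  fixes P Q R :: lseries
  assumes "i \<le> l" "l \<le> k" and d: "d = l - i" and m: "m = k - l"
  shows "(\<Sum>(i', l')\<in>index_set k. matrix_M k i l i' l' * (P ^ (k - l') * Q ^ (l' - i') * R ^ i')) =
    (zz2 * P) ^ i * (R ^ d * (\<Sum>b\<le>m. (qq * zz1 * zz2 * Q) ^ b * (\<Sum>a\<le>m - b. P ^ (m - b - a) * R ^ a)) +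
      (\<Sum>c\<le>m. P ^ (m - c) * (qq * zz1 * zz2 * Q) ^ c) * (\<Sum>j<d. Q ^ (d - j) * R ^ j))"
proof -
  define T where "T = qq * zz1 * zz2"
  define I1 where "I1 = {(i', l'). d \<le> i' \<and> i' \<le> l' \<and> l' \<le> k - i}"
  define I2 where "I2 = {(i', l'). i' < d \<and> d \<le> l' \<and> l' \<le> k - i}"
  define g1 where "g1 = (\<lambda>(i', l'). T ^ (l' - i') * zz2 ^ i * (P ^ (k - l') * Q ^ (l' - i') * R ^ i'))"
  define g2 where "g2 = (\<lambda>(i', l'). T ^ (l' - d) * zz2 ^ i * (P ^ (k - l') * Q ^ (l' - i') * R ^ i'))"
  have fin: "finite (index_set k)"
    by (rule finite_subset[of _ "{..k} \<times> {..k}"]) (auto simp: index_set_def)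
  have sub: "I1 \<subseteq> index_set k" "I2 \<subseteq> index_set k" "I1 \<inter> I2 = {}"
    by (auto simp: I1_def I2_def index_set_def)
  have "(\<Sum>(i', l')\<in>index_set k. matrix_M k i l i' l' * (P ^ (k - l') * Q ^ (l' - i') * R ^ i')) =
      (\<Sum>x\<in>index_set k. (if x \<in> I1 then g1 x else 0) + (if x \<in> I2 then g2 x else 0))"
    by (intro sum.cong) (auto simp: matrix_M_def I1_def I2_def g1_def g2_def d T_def split: if_splits)
  also have "\<dots> = sum g1 I1 + sum g2 I2"
    using sub fin by (simp add: sum.distrib sum.If_cases Int_absorb1)
  also have "sum g1 I1 = (\<Sum>(b, a)\<in>(SIGMA b:{..m}. {..m - b}).
      (zz2 * P) ^ i * (R ^ d * ((T * Q) ^ b * (P ^ (m - b - a) * R ^ a))))"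
  proof (rule sum.reindex_bij_witness[of _ "\<lambda>(b, a). (d + a, d + a + b)" "\<lambda>(i', l'). (l' - i', i' - d)"])
    fix x assume "x \<in> I1"
    then obtain i' l' where x: "x = (i', l')" and h: "d \<le> i'" "i' \<le> l'" "l' \<le> k - i" by (auto simp: I1_def)
    have e: "k - l' = i + (m - (l' - i') - (i' - d))" "i' = d + (i' - d)"
      using h assms by (auto simp: d m)
    have p: "P ^ (k - l') = P ^ i * P ^ (m - (l' - i') - (i' - d))" "R ^ i' = R ^ d * R ^ (i' - d)"
      by (subst e, simp add: power_add)+
    show "(case case x of (i', l') \<Rightarrow> (l' - i', i' - d) of (b, a) \<Rightarrow>
        (zz2 * P) ^ i * (R ^ d * ((T * Q) ^ b * (P ^ (m - b - a) * R ^ a)))) = g1 x"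
      unfolding x g1_def prod.case p by (simp add: power_mult_distrib mult_ac)
  qed (use assms in \<open>auto simp: I1_def\<close>)
  also have "\<dots> = (zz2 * P) ^ i * (R ^ d * (\<Sum>b\<le>m. (T * Q) ^ b * (\<Sum>a\<le>m - b. P ^ (m - b - a) * R ^ a)))"
    by (simp add: sum_distrib_left sum.Sigma case_prod_unfold)
  also have "sum g2 I2 = (\<Sum>(c, j)\<in>{..m} \<times> {..<d}.
      (zz2 * P) ^ i * ((P ^ (m - c) * (T * Q) ^ c) * (Q ^ (d - j) * R ^ j)))"
  proof (rule sum.reindex_bij_witness[of _ "\<lambda>(c, j). (j, d + c)" "\<lambda>(i', l'). (l' - d, i')"])
    fix x assume "x \<in> I2"
    then obtain i' l' where x: "x = (i', l')" and h: "i' < d" "d \<le> l'" "l' \<le> k - i" by (auto simp: I2_def)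
    have e: "k - l' = i + (m - (l' - d))" "l' - i' = (l' - d) + (d - i')"
      using h assms by (auto simp: d m)
    have p: "P ^ (k - l') = P ^ i * P ^ (m - (l' - d))" "Q ^ (l' - i') = Q ^ (l' - d) * Q ^ (d - i')"
      by (subst e, simp add: power_add)+
    show "(case case x of (i', l') \<Rightarrow> (l' - d, i') of (c, j) \<Rightarrow>
        (zz2 * P) ^ i * ((P ^ (m - c) * (T * Q) ^ c) * (Q ^ (d - j) * R ^ j))) = g2 x"
      unfolding x g2_def prod.case p by (simp add: power_mult_distrib mult_ac)
  qed (use assms in \<open>auto simp: I2_def\<close>)
  also have "\<dots> = (zz2 * P) ^ i * ((\<Sum>c\<le>m. P ^ (m - c) * (T * Q) ^ c) * (\<Sum>j<d. Q ^ (d - j) * R ^ j))"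
    unfolding sum_product sum.cartesian_product by (simp only: sum_distrib_left case_prod_unfold)
  finally show ?thesis by (simp add: T_def distrib_left)
qed

text \<open>The five terms are the contributions of the corner points (i', l') = (0, d), (d, d), (0,
  k - i), (d, k - i), (k - i, k - i) of triangle and rectangle. In this order they become
  \<open>A\<close>, \<open>B\<close>, \<open>C\<close>, \<open>D\<close>, \<open>E\<close>.\<close>

lemma vertex_sum:
  fixes P Q R Y :: "'a :: field"
  assumes nz: "P \<noteq> 0" "Q \<noteq> 0" "R \<noteq> 0" "Y \<noteq> 0"
    and "P \<noteq> Y" "P \<noteq> R" "Y \<noteq> R" "Q \<noteq> R"
  shows "R ^ d * (\<Sum>b\<le>m. Y ^ b * (\<Sum>a\<le>m - b. P ^ (m - b - a) * R ^ a)) +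
      (\<Sum>c\<le>m. P ^ (m - c) * Y ^ c) * (\<Sum>j<d. Q ^ (d - j) * R ^ j) =
    P ^ m * Q ^ d / ((1 - Y / P) * (1 - R / Q)) +
    (1 - Q / P) * (P ^ m * R ^ d) / ((1 - Y / P) * ((1 - Q / R) * (1 - R / P))) +
    Y ^ m * Q ^ d / ((1 - P / Y) * (1 - R / Q)) +
    (1 - Q / Y) * (Y ^ m * R ^ d) / ((1 - P / Y) * ((1 - R / Y) * (1 - Q / R))) +
    R ^ m * R ^ d / ((1 - Y / R) * (1 - P / R))"
proof -
  have d: "(\<Sum>j<d. Q ^ (d - j) * R ^ j) = Q * ((Q ^ d - R ^ d) / (Q - R))"
  proof (cases d)
    case (Suc n)
    have "(\<Sum>j<d. Q ^ (d - j) * R ^ j) = (\<Sum>j\<le>n. Q * (Q ^ (n - j) * R ^ j))"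
      unfolding Suc lessThan_Suc_atMost by (intro sum.cong) (simp_all add: Suc_diff_le)
    then show ?thesis unfolding Suc sum_distrib_left[symmetric] complete_sym2[OF \<open>Q \<noteq> R\<close>] by simp
  qed simp
  define a b c where "a = P - Y" and "b = P - R" and "c = Y - R"
  define e where "e = Q - R"
  have nz': "a \<noteq> 0" "b \<noteq> 0" "c \<noteq> 0" "e \<noteq> 0" using assms by (auto simp: a_def b_def c_def e_def)
  have r: "1 - Y / P = a / P" "1 - R / Q = e / Q" "1 - Q / R = - e / R" "1 - R / P = b / P"
    "1 - P / Y = - a / Y" "1 - R / Y = c / Y" "1 - Y / R = - c / R" "1 - P / R = - b / R"
    "Y - P = - a" "R - P = - b" "R - Y = - c" "1 - Q / P = (P - Q) / P" "1 - Q / Y = (Y - Q) / Y"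
    using nz by (simp_all add: a_def b_def c_def e_def field_simps)
  define p y s t u where "p = P ^ m" and "y = Y ^ m" and "s = R ^ m" and "t = Q ^ d" and "u = R ^ d"
  have lhs: "u * (P * (P * p) / (a * b) + Y * (Y * y) / (- a * c) + R * (R * s) / (- b * - c)) +
      ((P * p - Y * y) / a) * (Q * ((t - u) / e)) =
    p * t / (a / P * (e / Q)) + (P - Q) / P * (p * u) / (a / P * (- e / R * (b / P))) +
    y * t / (- a / Y * (e / Q)) + (Y - Q) / Y * (y * u) / (- a / Y * (c / Y * (- e / R))) +
    s * u / (- c / R * (- b / R))"
  proof -
    \<comment> \<open>Triangle and rectangle both contribute to P^m R^d, and adding them produces
      the numerator 1 - Q/P of \<open>B\<close>. The next step does the same for Y^m R^d and the
      numerator of \<open>D\<close>.\<close>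
    have 1: "p * u * P * (P / (a * b) - Q / (a * e)) = (P - Q) / P * (p * u) / (a / P * (- e / R * (b / P)))"
    proof -
      have "P * e - Q * b = R * (Q - P)" by (simp add: b_def e_def algebra_simps)
      then have "P / (a * b) - Q / (a * e) = R * (Q - P) / (a * b * e)"
        using nz' by (simp add: divide_simps)
      then show ?thesis using nz nz' by (simp add: divide_simps) (simp add: algebra_simps)
    qed
    have 2: "y * u * Y * (- (Y / (a * c)) + Q / (a * e)) = (Y - Q) / Y * (y * u) / (- a / Y * (c / Y * (- e / R)))"
    proof -
      have "- (Y * e) + Q * c = R * (Y - Q)" by (simp add: c_def e_def algebra_simps)
      then have "- (Y / (a * c)) + Q / (a * e) = R * (Y - Q) / (a * c * e)"
        using nz' by (simp add: divide_simps)
      then show ?thesis using nz nz' by (simp add: divide_simps)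
    qed
    show ?thesis unfolding 1[symmetric] 2[symmetric]
      using nz nz' by (simp add: algebra_simps diff_divide_distrib add_divide_distrib)
  qed
  show ?thesis
    unfolding d complete_sym3[OF \<open>P \<noteq> Y\<close> \<open>P \<noteq> R\<close> \<open>Y \<noteq> R\<close>] complete_sym2[OF \<open>P \<noteq> Y\<close>] r power_Suc
    using lhs by (simp only: p_def y_def s_def t_def u_def a_def b_def c_def e_def)
qed

lemma matrix_ap:
  assumes all: "\<And>L. good L x" and il: "i \<le> l" "l \<le> k"
  shows "(\<Sum>(i', l')\<in>index_set k. matrix_M k i l i' l' * shift_S (cmp k i' l' x)) =
    cmp k i l (ap LA x) + cmp k i l (ap LB x) + cmp k i l (ap LC x) + cmp k i l (ap LD x) + cmp k i l (ap LE x)"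
proof -
  obtain f p q r where x: "x = MVec f p q r" by (cases x)
  define F P Q R where "F = shift_S f" and "P = shift_S (mon p)" and "Q = shift_S (mon q)" and "R = shift_S (mon r)"
  define T where "T = qq * zz1 * zz2"
  define d m where "d = l - i" and "m = k - l"
  \<comment> \<open>\<open>S\<close> turns t = z1 z2 into q z1 z2, which is exactly the weight in
    the matrix.\<close>
  have T: "shift_S (mon tt) = T" by (simp add: mon_tt T_def mult_ac)
  have nz: "P \<noteq> 0" "Q \<noteq> 0" "R \<noteq> 0" "T * Q \<noteq> 0" by (simp_all add: P_def Q_def R_def T_def)
  have S1: "shift_S (1 - mon (tt + q - p)) = 1 - T * Q / P" "shift_S (1 - mon (r - q)) = 1 - R / Q"
    "shift_S (1 - mon (q - r)) = 1 - Q / R" "shift_S (1 - mon (r - p)) = 1 - R / P"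
    "shift_S (1 - mon (p - q - tt)) = 1 - P / (T * Q)" "shift_S (1 - mon (r - q - tt)) = 1 - R / (T * Q)"
    "shift_S (1 - mon (tt + q - r)) = 1 - T * Q / R" "shift_S (1 - mon (p - r)) = 1 - P / R"
    "shift_S (1 - mon (q - p)) = 1 - Q / P" "shift_S (1 - mon (- tt)) = 1 - Q / (T * Q)"
    by (simp_all add: mon_add mon_diff mon_uminus P_def Q_def R_def flip: T) (simp_all add: field_simps)
  have g: "gd (tt + q - p)" "gd (r - p)" "gd (tt + q - r)" "gd (q - r)"
    using all[of LB] all[of LE] by (auto simp: x)
  have "1 - T * Q / P \<noteq> 0" "1 - R / P \<noteq> 0" "1 - T * Q / R \<noteq> 0" "1 - Q / R \<noteq> 0"
    using g[THEN gd_nonzero] unfolding S1[symmetric] shift_S_eq_0_iff by auto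
  then have ne: "P \<noteq> T * Q" "P \<noteq> R" "T * Q \<noteq> R" "Q \<noteq> R"
    using nz by auto
  have c: "shift_S (cmp k i' l' x) = F * (P ^ (k - l') * Q ^ (l' - i') * R ^ i')" for i' l'
    by (simp add: x F_def P_def Q_def R_def)
  have n: "mon (sg p) = P" "mon (sg q) = Q" "mon (sg r) = R" "mon (sg (tt + q)) = T * Q" "mon (sg p + ww) = zz2 * P"
    by (simp_all add: P_def Q_def R_def mon_add mon_ww sg_add mult.commute flip: T shift_S_mon)
  have "(\<Sum>(i', l')\<in>index_set k. matrix_M k i l i' l' * shift_S (cmp k i' l' x)) =
      F * (\<Sum>(i', l')\<in>index_set k. matrix_M k i l i' l' * (P ^ (k - l') * Q ^ (l' - i') * R ^ i'))"
    by (simp add: c sum_distrib_left case_prod_unfold mult_ac)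
  also have "\<dots> = F * (zz2 * P) ^ i * (
    P ^ m * Q ^ d / ((1 - T * Q / P) * (1 - R / Q)) +
    (1 - Q / P) * (P ^ m * R ^ d) / ((1 - T * Q / P) * ((1 - Q / R) * (1 - R / P))) +
    (T * Q) ^ m * Q ^ d / ((1 - P / (T * Q)) * (1 - R / Q)) +
    (1 - Q / (T * Q)) * ((T * Q) ^ m * R ^ d) / ((1 - P / (T * Q)) * ((1 - R / (T * Q)) * (1 - Q / R))) +
    R ^ m * R ^ d / ((1 - T * Q / R) * (1 - P / R)))"
    using matrix_row_sum[OF il d_def m_def, of P Q R] vertex_sum[OF nz ne, of d m]
    by (simp only: T_def mult.assoc)
  also have "\<dots> = cmp k i l (ap LA x) + cmp k i l (ap LB x) + cmp k i l (ap LC x) + cmp k i l (ap LD x) + cmp k i l (ap LE x)"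
    unfolding x ap.simps cmp.simps new_p.simps new_q.simps n fac_def numer.simps dens.simps list.map
      prod_list.Cons prod_list.Nil shift_S_simps(6,8) mult_1_right S1
    by (simp only: d_def m_def F_def shift_S_simps(2) distrib_left times_divide_eq_right times_divide_eq_left mult_ac mult_1_left mult_1_right)
  finally show ?thesis .
qed

subsection \<open>Cancelling pairs\<close>

definition opp :: "mvec \<Rightarrow> mvec \<Rightarrow> bool" where
  "opp x y \<longleftrightarrow> (\<exists>f p q r. x = MVec f p q r \<and> y = MVec (- f) p q r)"

lemma opp_cmp: "opp x y \<Longrightarrow> cmp k i l x + cmp k i l y = 0"
  by (auto simp: opp_def)

text \<open>\<open>D\<close> maps pairs of type 3, 1, 2 to pairs of type 1, 2, 3. Pairs of type 3 are cancelled by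
  \<open>A\<close> and \<open>C\<close>, those of type 1 by \<open>B\<close> and \<open>E\<close>. \<open>C\<close> maps type 4 to type 3, and \<open>A\<close> preserves it.\<close>

fun pair1 :: "mvec \<Rightarrow> mvec \<Rightarrow> bool" where
  "pair1 (MVec f p q r) (MVec f' p' q' r') \<longleftrightarrow> p' = p \<and> r' = r \<and> tt + q + q' = p + r \<and>
     f * (1 - mon (tt + q' - r)) + f' * (1 - mon (tt + q - r)) = 0"

fun pair2 :: "mvec \<Rightarrow> mvec \<Rightarrow> bool" where
  "pair2 (MVec f p q r) (MVec f' p' q' r') \<longleftrightarrow> q' = q \<and> r' = r \<and> p + p' = q + r + (1, 1, 0) \<and>
     f * mon p' + f' * mon p = 0"

fun pair3 :: "mvec \<Rightarrow> mvec \<Rightarrow> bool" where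
  "pair3 (MVec f p q r) (MVec f' p' q' r') \<longleftrightarrow> p' = p \<and> q' = q \<and> r + r' = p + q + ww \<and>
     f * (1 - mon (r' - q)) + f' * (1 - mon (r - q)) = 0"

fun pair4 :: "mvec \<Rightarrow> mvec \<Rightarrow> bool" where
  "pair4 (MVec f p q r) (MVec f' p' q' r') \<longleftrightarrow> q' = q \<and> p + p' = q + q + (1, 1, 0) \<and>
     f * mon p' * (1 - mon (r' - q)) + f' * mon p * (1 - mon (r - q)) = 0"

lemma opp_div: "f / a + f' / b = 0 \<Longrightarrow> f' / b = - (f / a)" for f :: lseries
  by (simp add: eq_neg_iff_add_eq_0 add.commute)

text \<open>R enters \<open>A\<close> and \<open>C\<close> only through the factor 1/(1 - R/Q), and
  the new slots not at all; the type 3 relation says that f/(1 - R/Q) changes sign.\<close>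

lemma pair3_AC:
  assumes "pair3 x x'" "good L x" "good L x'" "L = LA \<or> L = LC"
  shows "opp (ap L x) (ap L x')"
proof -
  obtain f p q r f' r' where x: "x = MVec f p q r" "x' = MVec f' p q r'"
    and eq: "f * (1 - mon (r' - q)) + f' * (1 - mon (r - q)) = 0"
    using assms(1) by (cases x; cases x') auto
  have "gd (r - q)" "gd (r' - q)" using assms by (auto simp: x)
  then have nz: "1 - mon (r - q) \<noteq> 0" "1 - mon (r' - q) \<noteq> 0" using gd_nonzero by blast+
  have "f / (1 - mon (r - q)) + f' / (1 - mon (r' - q)) = 0"
    using eq nz by (simp add: divide_simps)
  then have s: "f' / (1 - mon (r' - q)) = - (f / (1 - mon (r - q)))" by (rule opp_div)
  define c where "c = (if L = LA then 1 - mon (tt + q - p) else 1 - mon (p - q - tt))"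
  have "f' * fac L p q r' = f' / (1 - mon (r' - q)) / c" "f * fac L p q r = f / (1 - mon (r - q)) / c"
    using assms(4) by (auto simp: fac_def c_def)
  then have "f' * fac L p q r' = - (f * fac L p q r)" using s by simp
  then show ?thesis using assms(4) unfolding opp_def x ap.simps by (auto simp: mult.commute simp flip: shift_S_simps)
qed

lemma mon_flip: "e = - d \<Longrightarrow> 1 - mon e = - (mon e * (1 - mon d))"
  by (simp add: mon_uminus algebra_simps)

lemma shift_S_mono: "e = sg d \<Longrightarrow> mon e = shift_S (mon d)"
  by (simp add: shift_S_mon)

lemma sg_components [simp]: "fst (sg e) = fst e + snd (snd e)" "fst (snd (sg e)) = fst (snd e)" "snd (snd (sg e)) = snd (snd e)"
  by (cases e; simp)+

lemma tt_ww_components [simp]: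
  "fst tt = 0" "fst (snd tt) = 1" "snd (snd tt) = 1" "fst ww = 0" "fst (snd ww) = 0" "snd (snd ww) = 1"
  by (simp_all add: tt_def ww_def)

lemma expo_components: "d = (e :: expo) \<longleftrightarrow> fst d = fst e \<and> fst (snd d) = fst (snd e) \<and> snd (snd d) = snd (snd e)"
  by (simp add: prod_eq_iff)

text \<open>R moves to slot Q. The two denominators of \<open>D\<close> with R, multiplied by 1 -
  tQ/R, reduce to 1/(1 - R/Q) up to a common factor (\<open>key\<close>), and R R' = z2 P Q turns
  the test factors of type 1 into \<open>S\<close> of just these 1 - tQ/R.\<close>

lemma pair3_D:
  assumes "pair3 x x'" "good LD x" "good LD x'" "good LA x" "good LA x'"
  shows "pair1 (ap LD x) (ap LD x')"
proof -
  obtain f p q r f' r' where x: "x = MVec f p q r" "x' = MVec f' p q r'"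
    and e: "r + r' = p + q + ww" and eq: "f * (1 - mon (r' - q)) + f' * (1 - mon (r - q)) = 0"
    using assms(1) by (cases x; cases x') auto
  have gd: "gd (r - q)" "gd (r' - q)" "gd (r - q - tt)" "gd (r' - q - tt)" "gd (p - q - tt)"
    using assms by (auto simp: x)
  note nz = gd[THEN gd_nonzero]
  define n c where "n = 1 - mon (- tt)" and "c = 1 - mon (p - q - tt)"
  have key: "g * fac LD p q u * (1 - mon (tt + q - u)) = g * (n * mon tt / c) / (1 - mon (u - q))"
    if u: "gd (u - q)" "gd (u - q - tt)" for g u
  proof -
    have d: "1 - mon (u - q) \<noteq> 0" "1 - mon (u - q - tt) \<noteq> 0" "c \<noteq> 0"
      using u nz gd_nonzero by (auto simp: c_def)
    have "1 - mon (q - u) = - (mon (q - u) * (1 - mon (u - q)))"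
      "1 - mon (tt + q - u) = - (mon (tt + q - u) * (1 - mon (u - q - tt)))"
      by (rule mon_flip, simp)+
    moreover have "mon (tt + q - u) = mon tt * mon (q - u)" by (simp add: mon_add mon_diff)
    ultimately show ?thesis
      unfolding fac_def using d by (simp add: n_def c_def divide_simps)
  qed
  have a: "r' - p - ww + tt = tt + q - r" "r - p - ww + tt = tt + q - r'"
    using e by (auto simp: expo_components)
  have s: "mon (tt + sg r' - (sg p + ww)) = shift_S (mon (tt + q - r))"
    "mon (tt + sg r - (sg p + ww)) = shift_S (mon (tt + q - r'))"
    using e by (intro shift_S_mono; auto simp: expo_components)+
  have "f * fac LD p q r * (1 - mon (tt + q - r)) + f' * fac LD p q r' * (1 - mon (tt + q - r')) =
      n * mon tt / c * (f / (1 - mon (r - q)) + f' / (1 - mon (r' - q)))"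
    unfolding key[OF gd(1,3)] key[OF gd(2,4)] by (simp add: distrib_left mult_ac)
  also have "f / (1 - mon (r - q)) + f' / (1 - mon (r' - q)) = 0"
    using eq nz by (simp add: divide_simps)
  finally have "shift_S (f * fac LD p q r * (1 - mon (tt + q - r)) + f' * fac LD p q r' * (1 - mon (tt + q - r'))) = 0"
    by simp
  moreover have "tt + sg r + sg r' = sg (tt + q) + (sg p + ww)"
    using e by (auto simp: expo_components)
  ultimately show ?thesis by (simp add: x s)
qed

text \<open>Q has left the slots of the images. For \<open>E\<close> it enters the scalar only
  through 1/(1 - tQ/R). For \<open>B\<close> the rest of the factor is invariant under Q <-> Q',
  since t Q Q' = P R exchanges 1 - tQ/P with 1 - R/Q'.\<close>

lemma pair1_BE:
  assumes "pair1 x x'" "good L x" "good L x'" "L = LB \<or> L = LE" "good LE x" "good LE x'"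
  shows "opp (ap L x) (ap L x')"
proof -
  obtain f p q r f' q' where x: "x = MVec f p q r" "x' = MVec f' p q' r"
    and e: "tt + q + q' = p + r" and eq: "f * (1 - mon (tt + q' - r)) + f' * (1 - mon (tt + q - r)) = 0"
    using assms(1) by (cases x; cases x') auto
  have gd: "gd (tt + q - r)" "gd (tt + q' - r)" "gd (p - r)" using assms by (auto simp: x)
  note nz = gd[THEN gd_nonzero]
  have s: "f' / (1 - mon (tt + q' - r)) = - (f / (1 - mon (tt + q - r)))"
    using eq nz by (intro opp_div) (simp add: divide_simps)
  have "f' * fac L p q' r = - (f * fac L p q r)"
  proof (cases "L = LE")
    case True
    have "f' * fac L p q' r = f' / (1 - mon (tt + q' - r)) / (1 - mon (p - r))"
      "f * fac L p q r = f / (1 - mon (tt + q - r)) / (1 - mon (p - r))" by (simp_all add: True fac_def)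
    then show ?thesis using s by simp
  next
    case False
    then have L: "L = LB" using assms(4) by simp
    have gd': "gd (tt + q - p)" "gd (tt + q' - p)" "gd (q - r)" "gd (q' - r)" "gd (r - p)"
      using assms(2,3) by (auto simp: x L)
    note nz' = gd'[THEN gd_nonzero]
    have key: "g * fac L p u r = g / (1 - mon (tt + u - r)) * (mon (r - p) / (1 - mon (r - p))) *
        ((1 - mon (u - p)) * (1 - mon (tt + u - r)) * mon (p - r) / ((1 - mon (tt + u - p)) * (1 - mon (u - r))))"
      if "gd (tt + u - r)" for g u
    proof -
      have "mon (p - r) = inverse (mon (r - p))" by (simp add: mon_diff)
      then show ?thesis using gd_nonzero[OF that] nz' by (simp add: fac_def L mult_ac)
    qed
    have a: "tt + q - p = r - q'" "tt + q' - p = r - q" "tt + q - r = p - q'" "tt + q' - r = p - q"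
      using e by (auto simp: expo_components)
    have flip: "1 - mon (r - u) = - (mon (r - u) * (1 - mon (u - r)))"
      "1 - mon (p - u) = - (mon (p - u) * (1 - mon (u - p)))" for u
      by (rule mon_flip, simp)+
    have "(1 - mon (q' - p)) * (1 - mon (tt + q' - r)) * mon (p - r) / ((1 - mon (tt + q' - p)) * (1 - mon (q' - r))) =
       (1 - mon (q - p)) * (1 - mon (tt + q - r)) * mon (p - r) / ((1 - mon (tt + q - p)) * (1 - mon (q - r)))"
      unfolding a flip using nz' by (simp add: mon_diff divide_simps)
    then show ?thesis unfolding key[OF gd(1)] key[OF gd(2)] s by simp
  qed
  then show ?thesis using assms(4) unfolding opp_def x ap.simps by (auto simp flip: shift_S_simps)
qed

text \<open>By t Q Q' = P R the denominator 1 - P/(tQ) equals 1 - Q'/R, so two of the three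
  denominators of \<open>D\<close> form a product symmetric in Q and Q'. The third one turns the
  relation of type 1 into that of type 2.\<close>

lemma pair1_D:
  assumes "pair1 x x'" "good LD x" "good LD x'" "good LE x" "good LE x'"
  shows "pair2 (ap LD x) (ap LD x')"
proof -
  obtain f p q r f' q' where x: "x = MVec f p q r" "x' = MVec f' p q' r"
    and e: "tt + q + q' = p + r" and eq: "f * (1 - mon (tt + q' - r)) + f' * (1 - mon (tt + q - r)) = 0"
    using assms(1) by (cases x; cases x') auto
  have gd: "gd (tt + q - r)" "gd (tt + q' - r)" "gd (r - q - tt)" "gd (r - q' - tt)" "gd (q - r)" "gd (q' - r)"
    using assms by (auto simp: x)
  note nz = gd[THEN gd_nonzero]
  have a: "p - q - tt = q' - r" "p - q' - tt = q - r" using e by (auto simp: expo_components)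
  define n c where "n = 1 - mon (- tt)" and "c = (1 - mon (q - r)) * (1 - mon (q' - r))"
  have key: "1 / (1 - mon (r - u - tt)) = - (mon (tt + u - r) / (1 - mon (tt + u - r)))"
    if "gd (r - u - tt)" "gd (tt + u - r)" for u
  proof -
    have "1 - mon (tt + u - r) = - (mon (tt + u - r) * (1 - mon (r - u - tt)))" by (rule mon_flip) simp
    then show ?thesis using gd_nonzero[OF that(1)] gd_nonzero[OF that(2)] by (simp add: divide_simps)
  qed
  have f1: "f * fac LD p q r = n / c * f * (1 / (1 - mon (r - q - tt)))"
    "f' * fac LD p q' r = n / c * f' * (1 / (1 - mon (r - q' - tt)))"
    by (simp_all add: fac_def n_def c_def a mult_ac)
  define K where "K = mon (tt + q + tt + q' - r)"
  have K: "mon (tt + q - r) * mon (tt + q') = K" "mon (tt + q' - r) * mon (tt + q) = K"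
    by (simp_all add: K_def mon_add mon_diff)
  have "f * fac LD p q r * mon (tt + q') = - (n / c * K) * (f / (1 - mon (tt + q - r)))"
    "f' * fac LD p q' r * mon (tt + q) = - (n / c * K) * (f' / (1 - mon (tt + q' - r)))"
    unfolding f1 key[OF gd(3,1)] key[OF gd(4,2)]
    by (subst K(1)[symmetric], simp add: mult_ac) (subst K(2)[symmetric], simp add: mult_ac)
  then have "f * fac LD p q r * mon (tt + q') + f' * fac LD p q' r * mon (tt + q) =
      - (n / c * K) * (f / (1 - mon (tt + q - r)) + f' / (1 - mon (tt + q' - r)))"
    by (simp only: distrib_left)
  also have "f / (1 - mon (tt + q - r)) + f' / (1 - mon (tt + q' - r)) = 0"
    using eq nz by (simp add: divide_simps)
  finally have "shift_S (f * fac LD p q r * mon (tt + q') + f' * fac LD p q' r * mon (tt + q)) = 0"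
    by simp
  moreover have "sg (tt + q) + sg (tt + q') = sg r + (sg p + ww) + (1, 1, 0)"
    using e by (auto simp: expo_components)
  ultimately show ?thesis by (simp add: x flip: shift_S_mon)
qed

text \<open>P occurs in one denominator of \<open>D\<close> and moves to slot R; the relation
  between P and P' makes that denominator cancel against the test factor of type 3.\<close>

lemma pair2_D:
  assumes "pair2 x x'" "good LD x" "good LD x'" "good LA (ap LD x)" "good LA (ap LD x')"
  shows "pair3 (ap LD x) (ap LD x')"
proof -
  obtain f p q r f' p' where x: "x = MVec f p q r" "x' = MVec f' p' q r"
    and e: "p + p' = q + r + (1, 1, 0)" and eq: "f * mon p' + f' * mon p = 0"
    using assms(1) by (cases x; cases x') auto
  have gd: "gd (p - q - tt)" "gd (p' - q - tt)" using assms by (auto simp: x)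
  note nz = gd[THEN gd_nonzero]
  define n c where "n = 1 - mon (- tt)" and "c = (1 - mon (r - q - tt)) * (1 - mon (q - r))"
  have f1: "f * fac LD p q r = n / c * f * (1 / (1 - mon (p - q - tt)))"
    "f' * fac LD p' q r = n / c * f' * (1 / (1 - mon (p' - q - tt)))"
    by (simp_all add: fac_def n_def c_def mult_ac)
  have s: "mon (sg p + ww - sg r) = shift_S (mon (q + tt - p'))" "mon (sg p' + ww - sg r) = shift_S (mon (q + tt - p))"
    using e by (intro shift_S_mono; auto simp: expo_components)+
  have flip: "1 - mon (q + tt - u) = - (mon (q + tt - u) * (1 - mon (u - q - tt)))" for u
    by (rule mon_flip) simp
  define K where "K = mon (q + tt - p - p')"
  have K: "mon (q + tt - p) = K * mon p'" "mon (q + tt - p') = K * mon p"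
    by (simp_all add: K_def mon_add mon_diff)
  have "f * fac LD p q r * (1 - mon (q + tt - p)) = - (n / c * K) * (f * mon p')"
    "f' * fac LD p' q r * (1 - mon (q + tt - p')) = - (n / c * K) * (f' * mon p)"
    unfolding f1 flip unfolding K using nz by (simp_all add: mult_ac)
  then have "f * fac LD p q r * (1 - mon (q + tt - p)) + f' * fac LD p' q r * (1 - mon (q + tt - p')) =
     - (n / c * K) * (f * mon p' + f' * mon p)"
    by (simp only: distrib_left)
  then have "shift_S (f * fac LD p q r * (1 - mon (q + tt - p)) + f' * fac LD p' q r * (1 - mon (q + tt - p'))) = 0"
    using eq by simp
  moreover have "sg p + ww + (sg p' + ww) = sg (tt + q) + sg r + ww"
    using e by (auto simp: expo_components)
  ultimately show ?thesis by (simp add: x s)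
qed

text \<open>The computation is that of \<open>pair2_D\<close> with Q in place of R as new second
  slot. R may differ here, because \<open>C\<close> sees it only in 1/(1 - R/Q), and this quotient
  is built into type 4.\<close>

lemma pair4_C:
  assumes "pair4 x x'" "good LC x" "good LC x'"
  shows "pair3 (ap LC x) (ap LC x')"
proof -
  obtain f p q r f' p' r' where x: "x = MVec f p q r" "x' = MVec f' p' q r'"
    and e: "p + p' = q + q + (1, 1, 0)" and eq: "f * mon p' * (1 - mon (r' - q)) + f' * mon p * (1 - mon (r - q)) = 0"
    using assms(1) by (cases x; cases x') auto
  have gd: "gd (p - q - tt)" "gd (p' - q - tt)" "gd (r - q)" "gd (r' - q)" using assms by (auto simp: x)
  note nz = gd[THEN gd_nonzero]
  have f1: "f * fac LC p q r = f / (1 - mon (r - q)) * (1 / (1 - mon (p - q - tt)))"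
    "f' * fac LC p' q r' = f' / (1 - mon (r' - q)) * (1 / (1 - mon (p' - q - tt)))"
    by (simp_all add: fac_def)
  have s: "mon (sg p + ww - sg q) = shift_S (mon (q + tt - p'))" "mon (sg p' + ww - sg q) = shift_S (mon (q + tt - p))"
    using e by (intro shift_S_mono; auto simp: expo_components)+
  have flip: "1 - mon (q + tt - u) = - (mon (q + tt - u) * (1 - mon (u - q - tt)))" for u
    by (rule mon_flip) simp
  define K where "K = mon (q + tt - p - p')"
  have K: "mon (q + tt - p) = K * mon p'" "mon (q + tt - p') = K * mon p"
    by (simp_all add: K_def mon_add mon_diff)
  have "f * fac LC p q r * (1 - mon (q + tt - p)) = - K * (f / (1 - mon (r - q)) * mon p')"
    "f' * fac LC p' q r' * (1 - mon (q + tt - p')) = - K * (f' / (1 - mon (r' - q)) * mon p)"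
    unfolding f1 flip unfolding K using nz(1,2) by (simp_all add: mult_ac)
  then have "f * fac LC p q r * (1 - mon (q + tt - p)) + f' * fac LC p' q r' * (1 - mon (q + tt - p')) =
     - K * (f / (1 - mon (r - q)) * mon p' + f' / (1 - mon (r' - q)) * mon p)"
    by (simp only: distrib_left)
  also have "f / (1 - mon (r - q)) * mon p' + f' / (1 - mon (r' - q)) * mon p = 0"
    using eq nz(3,4) by (simp add: divide_simps mult_ac)
  finally have "shift_S (f * fac LC p q r * (1 - mon (q + tt - p)) + f' * fac LC p' q r' * (1 - mon (q + tt - p'))) = 0"
    by simp
  moreover have "sg p + ww + (sg p' + ww) = sg (tt + q) + sg q + ww"
    using e by (auto simp: expo_components)
  ultimately show ?thesis by (simp add: x s)
qed

text \<open>In the image, 1 - R'/Q of the partner is \<open>S\<close> of the denominator 1 - tQ/P of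
  the vector itself, so the two cancel in the relation; the denominator 1 - R/Q is used up by the
  relation before.\<close>

lemma pair4_A:
  assumes "pair4 x x'" "good LA x" "good LA x'"
  shows "pair4 (ap LA x) (ap LA x')"
proof -
  obtain f p q r f' p' r' where x: "x = MVec f p q r" "x' = MVec f' p' q r'"
    and e: "p + p' = q + q + (1, 1, 0)" and eq: "f * mon p' * (1 - mon (r' - q)) + f' * mon p * (1 - mon (r - q)) = 0"
    using assms(1) by (cases x; cases x') auto
  have gd: "gd (tt + q - p)" "gd (tt + q - p')" "gd (r - q)" "gd (r' - q)" using assms by (auto simp: x)
  note nz = gd[THEN gd_nonzero]
  have f1: "f * fac LA p q r = f / (1 - mon (r - q)) * (1 / (1 - mon (tt + q - p)))"
    "f' * fac LA p' q r' = f' / (1 - mon (r' - q)) * (1 / (1 - mon (tt + q - p')))"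
    by (simp_all add: fac_def)
  have s: "mon (sg p + ww - sg q) = shift_S (mon (tt + q - p'))" "mon (sg p' + ww - sg q) = shift_S (mon (tt + q - p))"
    using e by (intro shift_S_mono; auto simp: expo_components)+
  have "f * fac LA p q r * mon p' * (1 - mon (tt + q - p)) + f' * fac LA p' q r' * mon p * (1 - mon (tt + q - p')) =
     f / (1 - mon (r - q)) * mon p' + f' / (1 - mon (r' - q)) * mon p"
    unfolding f1 using nz(1,2) by simp
  also have "\<dots> = 0" using eq nz(3,4) by (simp add: divide_simps mult_ac)
  finally have "shift_S (f * fac LA p q r * mon p' * (1 - mon (tt + q - p)) + f' * fac LA p' q r' * mon p * (1 - mon (tt + q - p'))) = 0"
    by simp
  moreover have "sg p + sg p' = sg q + sg q + (1, 1, 0)"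
    using e by (auto simp: expo_components)
  ultimately show ?thesis by (simp add: x s flip: shift_S_mon)
qed

text \<open>The relation t Q Q' = P R swaps the two denominators of \<open>A\<close>, so both
  vectors acquire the same factor. With R = z2 P the new third slot is in the same position and the
  relation persists.\<close>

lemma pair1_A:
  assumes "pair1 x x'" "yr x = ww"
  shows "pair1 (ap LA x) (ap LA x')"
proof -
  obtain f p q r f' q' where x: "x = MVec f p q r" "x' = MVec f' p q' r"
    and e: "tt + q + q' = p + r" and eq: "f * (1 - mon (tt + q' - r)) + f' * (1 - mon (tt + q - r)) = 0"
    using assms(1) by (cases x; cases x') auto
  have r: "r = p + ww" using assms(2) by (simp add: x algebra_simps)
  have a: "tt + q - p = r - q'" "tt + q' - p = r - q" using e by (auto simp: expo_components)
  define c where "c = 1 / ((1 - mon (r - q)) * (1 - mon (r - q')))"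
  have f1: "fac LA p q r = c" "fac LA p q' r = c"
    by (simp_all add: fac_def c_def a mult.commute)
  have s: "mon (tt + sg q' - (sg p + ww)) = shift_S (mon (tt + q' - r))"
    "mon (tt + sg q - (sg p + ww)) = shift_S (mon (tt + q - r))"
    by (intro shift_S_mono; auto simp: expo_components r)+
  have "f * c * (1 - mon (tt + q' - r)) + f' * c * (1 - mon (tt + q - r)) =
      c * (f * (1 - mon (tt + q' - r)) + f' * (1 - mon (tt + q - r)))"
    by (simp add: algebra_simps)
  then have "shift_S (f * c * (1 - mon (tt + q' - r)) + f' * c * (1 - mon (tt + q - r))) = 0"
    using eq by simp
  moreover have "tt + sg q + sg q' = sg p + (sg p + ww)"
    using e by (auto simp: expo_components r)
  ultimately show ?thesis by (simp add: x s f1)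
qed

text \<open>The images differ in slot P only. With u = tQ/P the factors of \<open>A\<close> and
  \<open>C\<close> contain 1/(1 - u) and 1/(1 - 1/u) = -u/(1 - u), whose ratio -u is minus the ratio
  of the two slots up to \<open>S\<close>.\<close>

lemma pair2_AC:
  assumes "good LA x" "good LC x"
  shows "pair2 (ap LA x) (ap LC x)"
proof -
  obtain f p q r where x: "x = MVec f p q r" by (cases x)
  have gd: "gd (p - q - tt)" "gd (tt + q - p)" using assms by (auto simp: x)
  note nz = gd[THEN gd_nonzero]
  have flip: "1 - mon (p - q - tt) = - (mon (p - q - tt) * (1 - mon (tt + q - p)))" by (rule mon_flip) simp
  have "mon (tt + q) = mon p / mon (p - q - tt)" by (simp flip: mon_diff)
  then have "f * fac LA p q r * mon (tt + q) + f * fac LC p q r * mon p = 0"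
    unfolding fac_def using nz by (simp add: flip divide_simps)
  then have "shift_S (f * fac LA p q r * mon (tt + q) + f * fac LC p q r * mon p) = 0" by simp
  moreover have "sg p + sg (tt + q) = sg q + (sg p + ww) + (1, 1, 0)" by (simp add: expo_components)
  ultimately show ?thesis
    by (simp only: x ap.simps new_p.simps new_q.simps pair2.simps shift_S_simps shift_S_mon)
qed

lemma CD_cancel:
  fixes u T :: "'a :: field"
  assumes "u \<noteq> 0" "T \<noteq> 0" "u \<noteq> 1" "T * u \<noteq> 1"
  shows "(1 - T) / (1 - inverse u) + (1 - inverse T) / ((1 - inverse (T * u)) * (1 - u)) * (1 - T * u) = 0"
proof -
  have "1 - inverse u = - ((1 - u) / u)" "1 - inverse (T * u) = - ((1 - T * u) / (T * u))"
    "1 - inverse T = - ((1 - T) / T)"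
    using assms by (simp_all add: field_simps)
  moreover have "1 - u \<noteq> 0" "1 - T * u \<noteq> 0" using assms by auto
  ultimately show ?thesis using assms by simp
qed

text \<open>The images share slots P and R and carry Q and R in slot Q. After removing the common
  factor 1/(1 - P/(tQ)), what remains is the identity \<open>CD_cancel\<close> in u = Q/R and T =
  t.\<close>

lemma pair1_CD:
  assumes "good LC x" "good LD x" "yr x = ww"
  shows "pair1 (ap LC x) (ap LD x)"
proof -
  obtain f p q r where x: "x = MVec f p q r" by (cases x)
  have r: "r = p + ww" using assms(3) by (simp add: x algebra_simps)
  have gd: "gd (r - q)" "gd (r - q - tt)" "gd (q - r)" using assms by (auto simp: x)
  note nz = gd[THEN gd_nonzero]
  have s: "mon (tt + sg r - (sg p + ww)) = shift_S (mon tt)" "mon (tt + sg q - (sg p + ww)) = shift_S (mon (tt + q - r))"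
    by (intro shift_S_mono; auto simp: expo_components r)+
  define u T where "u = mon (q - r)" and "T = mon tt"
  have m: "mon (tt + q - r) = T * u" "mon (r - q - tt) = inverse (T * u)" "mon (- tt) = inverse T" "mon (r - q) = inverse u"
    by (simp_all add: u_def T_def mon_add mon_diff mon_uminus)
  have ne: "u \<noteq> 0" "T \<noteq> 0" "u \<noteq> 1" "T * u \<noteq> 1"
  proof -
    show "u \<noteq> 0" "T \<noteq> 0" "u \<noteq> 1" using nz(3) by (auto simp: u_def T_def)
    have "inverse (T * u) \<noteq> 1" using nz(2) by (simp only: m) auto
    then show "T * u \<noteq> 1" using inverse_1 by metis
  qed
  have "f * fac LC p q r * (1 - mon tt) + f * fac LD p q r * (1 - mon (tt + q - r)) =
    f / (1 - mon (p - q - tt)) * ((1 - T) / (1 - inverse u) + (1 - inverse T) / ((1 - inverse (T * u)) * (1 - u)) * (1 - T * u))"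
    unfolding fac_def numer.simps dens.simps list.map prod_list.Cons prod_list.Nil m T_def[symmetric] u_def[symmetric]
    by (simp add: distrib_left)
  also have "\<dots> = 0" using CD_cancel[OF ne] by simp
  finally have "f * fac LC p q r * (1 - mon tt) + f * fac LD p q r * (1 - mon (tt + q - r)) = 0" .
  then have "shift_S (f * fac LC p q r * (1 - mon tt) + f * fac LD p q r * (1 - mon (tt + q - r))) = 0" by simp
  moreover have "tt + sg q + sg r = sg (tt + q) + (sg p + ww)" by (simp add: expo_components r)
  ultimately show ?thesis by (simp add: x s)
qed

text \<open>For Q = P the denominator 1 - P/(tQ) of \<open>D\<close> is 1 - 1/t and cancels its
  numerator; the remaining factor matches that of \<open>E\<close> up to sign and a
  monomial.\<close>

lemma pair2_ED:
  assumes "good LE x" "good LD x" "xr x = 0"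
  shows "pair2 (ap LE x) (ap LD x)"
proof -
  obtain f p q r where x: "x = MVec f p q r" by (cases x)
  have q: "q = p" using assms(3) by (simp add: x)
  have gd: "gd (tt + p - r)" "gd (r - p - tt)" "gd (p - r)" using assms by (auto simp: x q)
  note nz = gd[THEN gd_nonzero]
  have "tt \<noteq> 0" by (simp add: tt_def zero_prod_def)
  then have t: "1 - mon (- tt) \<noteq> 0" using mon_eq_1_iff[of "- tt"] by auto
  have flip: "1 - mon (tt + p - r) = - (mon (tt + p - r) * (1 - mon (r - p - tt)))" by (rule mon_flip) simp
  have m: "mon (tt + p - r) = mon (tt + p) / mon r" "mon (r - p - tt) = mon r / mon (tt + p)"
    by (simp_all add: mon_diff mon_add)
  have "f * fac LE p p r * mon (tt + p) + f * fac LD p p r * mon r = 0"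
    unfolding fac_def using nz t by (simp add: m divide_simps) (simp add: algebra_simps)
  then have "shift_S (f * fac LE p p r * mon (tt + p) + f * fac LD p p r * mon r) = 0" by simp
  moreover have "sg r + sg (tt + p) = sg r + (sg p + ww) + (1, 1, 0)" by (simp add: expo_components)
  ultimately show ?thesis
    by (simp only: x q ap.simps new_p.simps new_q.simps pair2.simps shift_S_simps shift_S_mon)
qed

subsection \<open>Formal sums\<close>

lemma Wt_eqI:
  assumes "\<And>N. f - g \<in> Wt N" shows "f = g"
proof (rule qz_coeff_eqI, rule ccontr)
  fix a c assume "qz_coeff f a c \<noteq> qz_coeff g a c"
  then have "qz_coeff (f - g) a c \<noteq> 0" by simp
  moreover have "f - g \<in> Wt (nat (a + c) + 1)" by (rule assms)
  ultimately have "int (nat (a + c) + 1) \<le> a + c" unfolding Wt_def by blast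
  then show False by linarith
qed

text \<open>Summability in the (q, z2)-adic topology. Bounds by \<open>Wt N\<close> pass through
  \<open>S\<close> and products more easily than conditions on single coefficients.\<close>

definition lf :: "('i \<Rightarrow> lseries) \<Rightarrow> bool" where
  "lf f \<longleftrightarrow> (\<forall>i. f i \<in> ring_R) \<and> (\<forall>N. finite {i. f i \<notin> Wt N})"

text \<open>Defined coefficientwise for every family, so that it always lies in R; it is the sum
  whenever \<open>lf f\<close> holds.\<close>

definition fs :: "('i \<Rightarrow> lseries) \<Rightarrow> lseries" where
  "fs f = of_fps2 (Abs_fps (\<lambda>c. Abs_fps (\<lambda>a.
     \<Sum>i | qz_coeff (f i) (int a) (int c) \<noteq> 0. qz_coeff (f i) (int a) (int c))))"

lemma Wt_coeff_0: "f \<in> Wt N \<Longrightarrow> a + c < int N \<Longrightarrow> qz_coeff f a c = 0"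
  unfolding Wt_def by fastforce

lemma lf_finite_coeff: assumes "lf f" shows "finite {i. qz_coeff (f i) a c \<noteq> 0}"
proof (rule finite_subset)
  show "{i. qz_coeff (f i) a c \<noteq> 0} \<subseteq> {i. f i \<notin> Wt (nat (a + c) + 1)}"
    using Wt_coeff_0[of _ "nat (a + c) + 1" a c] by force
  show "finite {i. f i \<notin> Wt (nat (a + c) + 1)}" using assms by (simp add: lf_def)
qed

lemma qz_coeff_fs:
  assumes "lf f" "finite B" "{i. qz_coeff (f i) a c \<noteq> 0} \<subseteq> B"
  shows "qz_coeff (fs f) a c = (\<Sum>i\<in>B. qz_coeff (f i) a c)"
proof -
  have "(\<Sum>i | qz_coeff (f i) a c \<noteq> 0. qz_coeff (f i) a c) = (\<Sum>i\<in>B. qz_coeff (f i) a c)"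
    using assms by (intro sum.mono_neutral_left) auto
  moreover have "(\<Sum>i\<in>B. qz_coeff (f i) a c) = 0" if "a < 0 \<or> c < 0"
    using assms(1) that by (intro sum.neutral) (auto simp: lf_def ring_R_def)
  ultimately show ?thesis by (auto simp: fs_def qz_coeff_of_fps2)
qed

lemma fs_ring_R: "fs f \<in> ring_R"
  by (simp add: fs_def of_fps2_ring_R)

lemma formal_sum_fs: assumes "lf f" shows "formal_sum f UNIV (fs f)"
  unfolding formal_sum_def
  using qz_coeff_fs[OF assms lf_finite_coeff[OF assms] order_refl] lf_finite_coeff[OF assms] assms
  by (auto simp: fs_ring_R lf_def)

lemma formal_sum_unique: "formal_sum f I s \<Longrightarrow> formal_sum f I t \<Longrightarrow> s = t"
  unfolding formal_sum_def by (intro qz_coeff_eqI) metis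

lemma fs_approx:
  assumes "lf f" "finite B" "{i. f i \<notin> Wt N} \<subseteq> B"
  shows "fs f - (\<Sum>i\<in>B. f i) \<in> Wt N"
  unfolding Wt_def
proof (intro CollectI allI impI, rule ccontr)
  fix a c assume nz: "qz_coeff (fs f - (\<Sum>i\<in>B. f i)) a c \<noteq> 0" and n: "\<not> (0 \<le> a \<and> 0 \<le> c \<and> int N \<le> a + c)"
  have "{i. qz_coeff (f i) a c \<noteq> 0} \<subseteq> B"
  proof
    fix i assume i: "i \<in> {i. qz_coeff (f i) a c \<noteq> 0}"
    have "f i \<in> ring_R" using assms by (simp add: lf_def)
    then have "0 \<le> a" "0 \<le> c" using i by (auto simp: ring_R_def linorder_not_less[symmetric])
    with n have "a + c < int N" by auto
    then have "f i \<notin> Wt N" using i Wt_coeff_0[of "f i" N a c] by auto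
    then show "i \<in> B" using assms by auto
  qed
  then have "qz_coeff (fs f) a c = (\<Sum>i\<in>B. qz_coeff (f i) a c)" using assms by (intro qz_coeff_fs)
  with nz show False by (simp add: qz_coeff_sum)
qed

lemma fs_eqI:
  assumes "lf f"
    and "\<And>N. \<exists>B. finite B \<and> {i. f i \<notin> Wt N} \<subseteq> B \<and> s - (\<Sum>i\<in>B. f i) \<in> Wt N"
  shows "fs f = s"
proof (rule Wt_eqI)
  fix N
  obtain B where B: "finite B" "{i. f i \<notin> Wt N} \<subseteq> B" "s - (\<Sum>i\<in>B. f i) \<in> Wt N" using assms(2) by blast
  have "(fs f - (\<Sum>i\<in>B. f i)) - (s - (\<Sum>i\<in>B. f i)) \<in> Wt N"
    by (rule Wt_diff[OF fs_approx[OF assms(1) B(1,2)] B(3)])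
  then show "fs f - s \<in> Wt N" by simp
qed

lemma lf_D: "lf f \<Longrightarrow> finite {i. f i \<notin> Wt N}" "lf f \<Longrightarrow> f i \<in> ring_R"
  by (simp_all add: lf_def)

lemma lf_0: "lf (\<lambda>i. 0)"
  using Wt_0 by (simp add: lf_def Wt_0 ring_R_eq_Wt)

lemma lf_add:
  assumes "lf f" "lf g" shows "lf (\<lambda>i. f i + g i)" "fs (\<lambda>i. f i + g i) = fs f + fs g"
proof -
  have sub: "{i. f i + g i \<notin> Wt N} \<subseteq> {i. f i \<notin> Wt N} \<union> {i. g i \<notin> Wt N}" for N
    using Wt_add by blast
  show lf: "lf (\<lambda>i. f i + g i)"
    unfolding lf_def using assms finite_subset[OF sub] by (auto simp: lf_def)
  show "fs (\<lambda>i. f i + g i) = fs f + fs g"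
  proof (rule fs_eqI[OF lf])
    fix N
    let ?B = "{i. f i \<notin> Wt N} \<union> {i. g i \<notin> Wt N}"
    have "finite ?B" using assms lf_D by blast
    moreover have "(fs f - (\<Sum>i\<in>?B. f i)) + (fs g - (\<Sum>i\<in>?B. g i)) \<in> Wt N"
      by (intro Wt_add fs_approx assms \<open>finite ?B\<close>) auto
    ultimately show "\<exists>B. finite B \<and> {i. f i + g i \<notin> Wt N} \<subseteq> B \<and> fs f + fs g - (\<Sum>i\<in>B. f i + g i) \<in> Wt N"
      using sub by (intro exI[of _ ?B]) (auto simp: sum.distrib algebra_simps)
  qed
qed

lemma lf_mult:
  assumes "lf f" "c \<in> ring_R" shows "lf (\<lambda>i. c * f i)" "fs (\<lambda>i. c * f i) = c * fs f"
proof -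
  have sub: "{i. c * f i \<notin> Wt N} \<subseteq> {i. f i \<notin> Wt N}" for N
    using Wt_mult_ring_R(2)[OF _ assms(2)] by blast
  show lf: "lf (\<lambda>i. c * f i)"
    unfolding lf_def using assms finite_subset[OF sub] by (auto simp: lf_def)
  show "fs (\<lambda>i. c * f i) = c * fs f"
  proof (rule fs_eqI[OF lf])
    fix N
    let ?B = "{i. f i \<notin> Wt N}"
    have "finite ?B" using assms lf_D by blast
    moreover have "c * (fs f - (\<Sum>i\<in>?B. f i)) \<in> Wt N"
      by (intro Wt_mult_ring_R fs_approx assms \<open>finite ?B\<close>) auto
    ultimately show "\<exists>B. finite B \<and> {i. c * f i \<notin> Wt N} \<subseteq> B \<and> c * fs f - (\<Sum>i\<in>B. c * f i) \<in> Wt N"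
      using sub by (intro exI[of _ ?B]) (auto simp: sum_distrib_left algebra_simps)
  qed
qed

lemma lf_shift_S:
  assumes "lf f" shows "lf (\<lambda>i. shift_S (f i))" "fs (\<lambda>i. shift_S (f i)) = shift_S (fs f)"
proof -
  have sub: "{i. shift_S (f i) \<notin> Wt N} \<subseteq> {i. f i \<notin> Wt N}" for N
    using shift_S_Wt by blast
  show lf: "lf (\<lambda>i. shift_S (f i))"
    unfolding lf_def using assms finite_subset[OF sub] shift_S_ring_R by (auto simp: lf_def)
  show "fs (\<lambda>i. shift_S (f i)) = shift_S (fs f)"
  proof (rule fs_eqI[OF lf])
    fix N
    let ?B = "{i. f i \<notin> Wt N}"
    have "finite ?B" using assms lf_D by blast
    moreover have "shift_S (fs f - (\<Sum>i\<in>?B. f i)) \<in> Wt N"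
      by (intro shift_S_Wt fs_approx assms \<open>finite ?B\<close>) auto
    ultimately show "\<exists>B. finite B \<and> {i. shift_S (f i) \<notin> Wt N} \<subseteq> B \<and> shift_S (fs f) - (\<Sum>i\<in>B. shift_S (f i)) \<in> Wt N"
      using sub by (intro exI[of _ ?B]) (auto simp: shift_S_sum)
  qed
qed

lemma lf_sum:
  assumes "finite A" "\<And>j. j \<in> A \<Longrightarrow> lf (f j)"
  shows "lf (\<lambda>i. \<Sum>j\<in>A. f j i)" "fs (\<lambda>i. \<Sum>j\<in>A. f j i) = (\<Sum>j\<in>A. fs (f j))"
proof -
  have "lf (\<lambda>i. \<Sum>j\<in>A. f j i) \<and> fs (\<lambda>i. \<Sum>j\<in>A. f j i) = (\<Sum>j\<in>A. fs (f j))"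
    using assms
  proof (induction A rule: finite_induct)
    case empty
    have "fs (\<lambda>i :: 'b. 0) = 0"
      by (rule fs_eqI[OF lf_0]) (auto intro!: exI[of _ "{}"] simp: Wt_0)
    then show ?case by (simp add: lf_0)
  next
    case (insert j A)
    then have "lf (f j)" "lf (\<lambda>i. \<Sum>j\<in>A. f j i)" by auto
    from lf_add[OF this] show ?case using insert by simp
  qed
  then show "lf (\<lambda>i. \<Sum>j\<in>A. f j i)" "fs (\<lambda>i. \<Sum>j\<in>A. f j i) = (\<Sum>j\<in>A. fs (f j))" by auto
qed

lemma fs_Wt: "lf f \<Longrightarrow> (\<And>i. f i \<in> Wt N) \<Longrightarrow> fs f \<in> Wt N"
  using fs_approx[of f "{}" N] by simp

lemma lfI:
  assumes "\<And>i. f i \<in> Wt (d i)" "\<And>N. finite {i. d i < N}"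
  shows "lf f"
  unfolding lf_def
proof (intro conjI allI)
  show "f i \<in> ring_R" for i using assms(1) by (rule Wt_ring_R)
  have "{i. f i \<notin> Wt N} \<subseteq> {i. d i < N}" for N
  proof
    fix i assume "i \<in> {i. f i \<notin> Wt N}"
    then have "\<not> N \<le> d i" using Wt_mono[OF assms(1)[of i]] by auto
    then show "i \<in> {i. d i < N}" by simp
  qed
  then show "finite {i. f i \<notin> Wt N}" for N using assms(2) by (rule finite_subset)
qed

lemma lf_telescope:
  fixes f r :: "nat \<Rightarrow> lseries"
  assumes "\<And>n. f n = r n - r (Suc n)" "\<And>n. r n \<in> Wt n"
  shows "lf f" "fs f = r 0"
proof -
  have "f n \<in> Wt n" for n
    unfolding assms(1) using assms(2)[of n] assms(2)[of "Suc n"] by (intro Wt_diff) (auto intro: Wt_mono)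
  then show lf: "lf f" by (rule lfI) simp
  have s: "(\<Sum>n<M. f n) = r 0 - r M" for M
    by (induction M) (simp_all add: assms(1))
  show "fs f = r 0"
  proof (rule fs_eqI[OF lf])
    fix N
    have "{i. f i \<notin> Wt N} \<subseteq> {..<N}"
      using \<open>\<And>n. f n \<in> Wt n\<close> Wt_mono by (auto simp: not_less) (meson not_less)
    then show "\<exists>B. finite B \<and> {i. f i \<notin> Wt N} \<subseteq> B \<and> r 0 - sum f B \<in> Wt N"
      by (intro exI[of _ "{..<N}"]) (simp add: s assms(2))
  qed
qed

subsection \<open>Formal sums in the fraction field\<close>

definition is_frac :: "lseries \<Rightarrow> bool" where
  "is_frac c \<longleftrightarrow> (\<exists>u\<in>ring_R. \<exists>v\<in>ring_R. v \<noteq> 0 \<and> c = u / v)"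

lemma frac_ring_R: "c \<in> ring_R \<Longrightarrow> is_frac c"
  unfolding is_frac_def by (intro bexI[of _ c] bexI[of _ 1]) auto

lemma frac_mult: assumes "is_frac c" "is_frac d" shows "is_frac (c * d)"
proof -
  obtain u v u' v' where "u \<in> ring_R" "v \<in> ring_R" "v \<noteq> 0" "c = u / v" "u' \<in> ring_R" "v' \<in> ring_R" "v' \<noteq> 0" "d = u' / v'"
    using assms unfolding is_frac_def by blast
  then show ?thesis unfolding is_frac_def
    by (intro bexI[of _ "u * u'"] bexI[of _ "v * v'"]) (auto simp: ring_R_mult)
qed

lemma frac_add: assumes "is_frac c" "is_frac d" shows "is_frac (c + d)"
proof -
  obtain u v u' v' where "u \<in> ring_R" "v \<in> ring_R" "v \<noteq> 0" "c = u / v" "u' \<in> ring_R" "v' \<in> ring_R" "v' \<noteq> 0" "d = u' / v'"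
    using assms unfolding is_frac_def by blast
  then show ?thesis unfolding is_frac_def
    by (intro bexI[of _ "u * v' + u' * v"] bexI[of _ "v * v'"]) (auto simp: add_frac_eq intro!: ring_R_closed)
qed

lemma frac_inverse: assumes "is_frac c" shows "is_frac (inverse c)"
proof (cases "c = 0")
  case True then show ?thesis using frac_ring_R[of 0] by auto
next
  case False
  obtain u v where "u \<in> ring_R" "v \<in> ring_R" "v \<noteq> 0" "c = u / v" using assms unfolding is_frac_def by blast
  with False show ?thesis unfolding is_frac_def
    by (intro bexI[of _ v] bexI[of _ u]) auto
qed

lemma frac_mon: "is_frac (mon e)"
proof -
  obtain a b c where e: "e = (a, b, c)" by (cases e)
  have "mon e = mon (max a 0, b, max c 0) / mon (max (- a) 0, 0, max (- c) 0)"
    unfolding e mon_diff[symmetric] by (simp add: max_def)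
  then show ?thesis unfolding is_frac_def
    by (intro bexI[of _ "mon (max a 0, b, max c 0)"] bexI[of _ "mon (max (- a) 0, 0, max (- c) 0)"])
      (auto intro: mon_ring_R)
qed

lemma frac_intros:
  "is_frac 0" "is_frac 1" "is_frac (mon e)" "is_frac qq" "is_frac zz1" "is_frac zz2"
  "is_frac c \<Longrightarrow> is_frac d \<Longrightarrow> is_frac (c * d)" "is_frac c \<Longrightarrow> is_frac d \<Longrightarrow> is_frac (c + d)" "is_frac c \<Longrightarrow> is_frac d \<Longrightarrow> is_frac (c - d)"
  "is_frac c \<Longrightarrow> is_frac d \<Longrightarrow> is_frac (c / d)" "is_frac c \<Longrightarrow> is_frac (- c)" "is_frac c \<Longrightarrow> is_frac (inverse c)" "is_frac c \<Longrightarrow> is_frac (c ^ n)"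
proof -
  show 0: "is_frac 0" "is_frac 1" by (auto intro: frac_ring_R)
  show "is_frac (mon e)" "is_frac qq" "is_frac zz1" "is_frac zz2" by (simp_all add: frac_mon qq_mon zz1_mon zz2_mon)
  show "is_frac c \<Longrightarrow> is_frac d \<Longrightarrow> is_frac (c * d)" "is_frac c \<Longrightarrow> is_frac d \<Longrightarrow> is_frac (c + d)" "is_frac c \<Longrightarrow> is_frac (inverse c)"
    "is_frac c \<Longrightarrow> is_frac d \<Longrightarrow> is_frac (c / d)"
    by (auto simp: divide_inverse intro: frac_mult frac_add frac_inverse)
  have m: "is_frac (- 1)" by (rule frac_ring_R) auto
  show n: "is_frac c \<Longrightarrow> is_frac (- c)" for c using frac_mult[OF m, of c] by simp
  show "is_frac c \<Longrightarrow> is_frac d \<Longrightarrow> is_frac (c - d)" using frac_add[of c "- d"] n by simp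
  show "is_frac c \<Longrightarrow> is_frac (c ^ n)" by (induction n) (auto intro: 0 frac_mult)
qed

lemma frac_shift_S: assumes "is_frac c" shows "is_frac (shift_S c)"
proof -
  obtain u v where "u \<in> ring_R" "v \<in> ring_R" "v \<noteq> 0" "c = u / v" using assms unfolding is_frac_def by blast
  then show ?thesis unfolding is_frac_def
    by (intro bexI[of _ "shift_S u"] bexI[of _ "shift_S v"]) (auto simp: shift_S_ring_R)
qed

text \<open>Summability after multiplication by one common denominator e. For small n a denominator
  1 - X can contain an X with exponents of both signs, and its inverse then leaves R.\<close>

definition fsums :: "('i \<Rightarrow> lseries) \<Rightarrow> lseries \<Rightarrow> bool" where
  "fsums f s \<longleftrightarrow> (\<exists>e\<in>ring_R. e \<noteq> 0 \<and> lf (\<lambda>i. e * f i) \<and> fs (\<lambda>i. e * f i) = e * s)"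

lemma fsums_lf: "lf f \<Longrightarrow> fsums f (fs f)"
  unfolding fsums_def by (intro bexI[of _ 1]) auto

lemma fsums_unique: assumes "fsums f s" "fsums f t" shows "s = t"
proof -
  obtain d e where d: "d \<in> ring_R" "d \<noteq> 0" "lf (\<lambda>i. d * f i)" "fs (\<lambda>i. d * f i) = d * s"
    and e: "e \<in> ring_R" "e \<noteq> 0" "lf (\<lambda>i. e * f i)" "fs (\<lambda>i. e * f i) = e * t"
    using assms unfolding fsums_def by blast
  have "e * (d * s) = fs (\<lambda>i. e * (d * f i))" using lf_mult(2)[OF d(3) e(1)] d by simp
  also have "\<dots> = fs (\<lambda>i. d * (e * f i))" by (simp add: mult_ac)
  also have "\<dots> = d * (e * t)" using lf_mult(2)[OF e(3) d(1)] e by simp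
  finally show ?thesis using d e by simp
qed

lemma fsums_fs: "fsums f s \<Longrightarrow> lf f \<Longrightarrow> fs f = s"
  using fsums_unique fsums_lf by blast

lemma fsums_mult: assumes "fsums f s" "is_frac c" shows "fsums (\<lambda>i. c * f i) (c * s)"
proof -
  obtain e where e: "e \<in> ring_R" "e \<noteq> 0" "lf (\<lambda>i. e * f i)" "fs (\<lambda>i. e * f i) = e * s"
    using assms unfolding fsums_def by blast
  obtain u v where uv: "u \<in> ring_R" "v \<in> ring_R" "v \<noteq> 0" "c = u / v" using assms unfolding is_frac_def by blast
  have "(\<lambda>i. e * v * (c * f i)) = (\<lambda>i. u * (e * f i))" using uv by (auto simp: field_simps)
  then have "lf (\<lambda>i. e * v * (c * f i))" "fs (\<lambda>i. e * v * (c * f i)) = e * v * (c * s)"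
    using lf_mult[OF e(3) uv(1)] e uv by (auto simp: field_simps)
  then show ?thesis unfolding fsums_def using e uv by (intro bexI[of _ "e * v"]) (auto simp: ring_R_mult)
qed

lemma fsums_add: assumes "fsums f s" "fsums g t" shows "fsums (\<lambda>i. f i + g i) (s + t)"
proof -
  obtain d e where d: "d \<in> ring_R" "d \<noteq> 0" "lf (\<lambda>i. d * f i)" "fs (\<lambda>i. d * f i) = d * s"
    and e: "e \<in> ring_R" "e \<noteq> 0" "lf (\<lambda>i. e * g i)" "fs (\<lambda>i. e * g i) = e * t"
    using assms unfolding fsums_def by blast
  have "(\<lambda>i. d * e * (f i + g i)) = (\<lambda>i. e * (d * f i) + d * (e * g i))" by (auto simp: algebra_simps)
  then have "lf (\<lambda>i. d * e * (f i + g i))" "fs (\<lambda>i. d * e * (f i + g i)) = d * e * (s + t)"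
    using lf_add[OF lf_mult(1)[OF d(3) e(1)] lf_mult(1)[OF e(3) d(1)]]
      lf_mult(2)[OF d(3) e(1)] lf_mult(2)[OF e(3) d(1)] d e by (auto simp: algebra_simps)
  then show ?thesis unfolding fsums_def using d e by (intro bexI[of _ "d * e"]) (auto simp: ring_R_mult)
qed

lemma fsums_shift_S: assumes "fsums f s" shows "fsums (\<lambda>i. shift_S (f i)) (shift_S s)"
proof -
  obtain e where e: "e \<in> ring_R" "e \<noteq> 0" "lf (\<lambda>i. e * f i)" "fs (\<lambda>i. e * f i) = e * s"
    using assms unfolding fsums_def by blast
  show ?thesis unfolding fsums_def
    using lf_shift_S[OF e(3)] e by (intro bexI[of _ "shift_S e"]) (auto simp: shift_S_ring_R)
qed

lemma fsums_telescope:
  fixes f r :: "nat \<Rightarrow> lseries"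
  assumes "e \<in> ring_R" "e \<noteq> 0" "\<And>n. f n = r n - r (Suc n)" "\<And>n. e * r n \<in> Wt n"
  shows "fsums f (r 0)"
proof -
  have "e * f n = e * r n - e * r (Suc n)" for n by (simp add: assms(3) right_diff_distrib)
  from lf_telescope[of "\<lambda>n. e * f n" "\<lambda>n. e * r n", OF this assms(4)] show ?thesis
    unfolding fsums_def using assms(1,2) by blast
qed

subsection \<open>Infinite products\<close>

definition unit1 :: "lseries \<Rightarrow> bool" where
  "unit1 u \<longleftrightarrow> 1 - u \<in> Wt 1"

lemma Wt_power: "y \<in> Wt 1 \<Longrightarrow> y ^ n \<in> Wt n"
proof (induction n)
  case 0
  show ?case using ring_R_1 by (simp add: ring_R_eq_Wt)
next
  case (Suc n)
  then show ?case using Wt_mult[of y 1 "y ^ n" n] by simp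
qed

lemma unit1_ring_R: assumes "unit1 u" shows "u \<in> ring_R"
proof -
  have "1 - u \<in> ring_R" using assms Wt_ring_R unfolding unit1_def by blast
  from Wt_diff[of 1 0, folded ring_R_eq_Wt, OF ring_R_1 this] show ?thesis by simp
qed

lemma ring_R_diff: "f \<in> ring_R \<Longrightarrow> g \<in> ring_R \<Longrightarrow> f - g \<in> ring_R"
  by (rule ring_R_closed)

text \<open>1/u is the geometric series in y = 1 - u; multiplied by u it telescopes to 1.\<close>

lemma unit1_inverse: assumes "unit1 u" shows "u \<noteq> 0" "1 / u \<in> ring_R"
proof -
  define y where "y = 1 - u"
  have y: "y \<in> Wt 1" using assms by (simp add: y_def unit1_def)
  have t: "lf (\<lambda>n. y ^ n - y ^ Suc n)" "fs (\<lambda>n. y ^ n - y ^ Suc n) = y ^ 0"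
    by (rule lf_telescope[of _ "\<lambda>n. y ^ n"], simp, rule Wt_power[OF y])+
  have lf: "lf (\<lambda>n. y ^ n)" by (rule lfI[OF Wt_power[OF y]]) simp
  have "fs (\<lambda>n. u * y ^ n) = u * fs (\<lambda>n. y ^ n)"
    by (rule lf_mult(2)[OF lf unit1_ring_R[OF assms]])
  moreover have "(\<lambda>n. u * y ^ n) = (\<lambda>n. y ^ n - y ^ Suc n)" by (simp add: y_def algebra_simps)
  ultimately have e: "u * fs (\<lambda>n. y ^ n) = 1" using t by simp
  then show "u \<noteq> 0" by auto
  then have "1 / u = fs (\<lambda>n. y ^ n)" using e by (simp add: field_simps)
  then show "1 / u \<in> ring_R" by (simp add: fs_ring_R)
qed

lemma unit1_divide: "unit1 u \<Longrightarrow> f \<in> Wt N \<Longrightarrow> f / u \<in> Wt N"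
  using Wt_mult_ring_R(1)[of f N "1 / u"] unit1_inverse by simp

lemma unit1_1: "unit1 1" by (simp add: unit1_def Wt_0)

lemma unit1_mult: assumes "unit1 u" "unit1 v" shows "unit1 (u * v)"
proof -
  have eq: "1 - u * v = (1 - u) * v + (1 - v)" by (simp add: algebra_simps)
  have "(1 - u) * v \<in> Wt 1"
    using assms by (intro Wt_mult_ring_R(1) unit1_ring_R) (simp_all only: unit1_def)
  then show ?thesis using assms unfolding unit1_def eq by (intro Wt_add)
qed

lemma unit1_minus: "y \<in> Wt 1 \<Longrightarrow> unit1 (1 - y)" by (simp add: unit1_def)

lemma qq_power_mon: "qq ^ n = mon (int n, 0, 0)"
  by (simp add: qq_mon mon_power)

lemma qpoch_0 [simp]: "qpoch x 0 = 1" and qpoch_Suc: "qpoch x (Suc n) = qpoch x n * (1 - qq ^ n * x)"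
  by (simp_all add: qpoch_def)

lemma qpoch_Suc': "qpoch x (Suc n) = (1 - x) * qpoch (qq * x) n"
  unfolding qpoch_def prod.lessThan_Suc_shift by (simp add: mult_ac)

lemma qq_power_Wt: "x \<in> Wt N \<Longrightarrow> qq ^ n * x \<in> Wt (n + N)"
  unfolding qq_power_mon by (intro Wt_mult mon_Wt) auto

lemma qq_power_ring_R: "x \<in> ring_R \<Longrightarrow> qq ^ n * x \<in> ring_R"
  unfolding qq_power_mon by (intro ring_R_mult mon_ring_R) auto

lemma qpoch_ring_R: "x \<in> ring_R \<Longrightarrow> qpoch x n \<in> ring_R"
proof (induction n)
  case (Suc n)
  then show ?case unfolding qpoch_Suc
    by (intro ring_R_mult ring_R_diff ring_R_1 qq_power_ring_R[of x])
qed (simp add: ring_R_1)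

text \<open>The factor 1 - q^n x differs from 1 by degree n, so the partial products form a
  convergent sequence with error in \<open>Wt n\<close>. Limits are unique, so the definite
  description in \<open>qpoch_inf\<close> picks this one.\<close>

lemma qpoch_inf:
  assumes x: "x \<in> ring_R"
  shows "qpoch_inf x \<in> ring_R" "qpoch_inf x - qpoch x n \<in> Wt n"
proof -
  define d where "d = (\<lambda>n. qpoch x (Suc n) - qpoch x n)"
  define L where "L = 1 + fs d"
  have d: "d n \<in> Wt n" for n
  proof -
    have qx: "qq ^ n * x \<in> Wt n"
      using qq_power_Wt[of x 0 n] x unfolding ring_R_eq_Wt by (simp only: add_0_right)
    have "d n = - (qpoch x n * (qq ^ n * x))" by (simp add: d_def qpoch_Suc algebra_simps)
    also have "\<dots> \<in> Wt n"
      by (rule Wt_uminus[OF Wt_mult_ring_R(2)[OF qx qpoch_ring_R[OF x]]])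
    finally show ?thesis .
  qed
  then have lf: "lf d" by (rule lfI) simp
  have L: "L - qpoch x n \<in> Wt n" for n
  proof -
    have "{i. d i \<notin> Wt n} \<subseteq> {..<n}"
    proof
      fix i assume "i \<in> {i. d i \<notin> Wt n}"
      then have "\<not> n \<le> i" using Wt_mono[OF d[of i]] by blast
      then show "i \<in> {..<n}" by simp
    qed
    then have "fs d - (\<Sum>i<n. d i) \<in> Wt n" by (intro fs_approx lf) auto
    moreover have "(\<Sum>i<n. d i) = qpoch x n - 1" unfolding d_def by (subst sum_lessThan_telescope) simp
    ultimately show ?thesis by (simp add: L_def algebra_simps)
  qed
  have LR: "L \<in> ring_R" unfolding L_def by (intro ring_R_closed fs_ring_R)
  have lim: "formal_limit (qpoch x) L"
    unfolding formal_limit_def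
  proof (intro conjI allI qpoch_ring_R x LR)
    fix a c
    show "\<forall>\<^sub>F n in sequentially. qz_coeff (qpoch x n) a c = qz_coeff L a c"
    proof (rule eventually_sequentiallyI)
      fix n assume "nat (a + c) + 1 \<le> n"
      then have "qz_coeff (L - qpoch x n) a c = 0" by (intro Wt_coeff_0[OF L]) auto
      then show "qz_coeff (qpoch x n) a c = qz_coeff L a c" by simp
    qed
  qed
  have "M = L" if M: "formal_limit (qpoch x) M" for M
  proof (rule qz_coeff_eqI)
    fix a c
    have "\<forall>\<^sub>F n in sequentially. qz_coeff (qpoch x n) a c = qz_coeff M a c \<and> qz_coeff (qpoch x n) a c = qz_coeff L a c"
      using lim M unfolding formal_limit_def by (intro eventually_conj) auto
    then have "\<exists>n. qz_coeff (qpoch x n) a c = qz_coeff M a c \<and> qz_coeff (qpoch x n) a c = qz_coeff L a c"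
      by (rule eventually_happens'[OF sequentially_bot])
    then show "qz_coeff M a c = qz_coeff L a c" by auto
  qed
  with lim have "qpoch_inf x = L" unfolding qpoch_inf_def by (rule the_equality)
  with L LR show "qpoch_inf x \<in> ring_R" "qpoch_inf x - qpoch x n \<in> Wt n" by auto
qed

lemma qpoch_inf_rec:
  assumes x: "x \<in> ring_R" shows "qpoch_inf x = (1 - x) * qpoch_inf (qq * x)"
proof (rule Wt_eqI)
  fix N
  have qx: "qq * x \<in> ring_R" using qq_power_Wt[of x 0 1] x Wt_ring_R by (auto simp: ring_R_eq_Wt)
  have "qpoch_inf x - qpoch x (Suc N) \<in> Wt N" using qpoch_inf(2)[OF x, of "Suc N"] by (rule Wt_mono) simp
  moreover have "(1 - x) * (qpoch_inf (qq * x) - qpoch (qq * x) N) \<in> Wt N"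
    using x by (intro Wt_mult_ring_R qpoch_inf qx ring_R_closed) auto
  ultimately have "(qpoch_inf x - qpoch x (Suc N)) - (1 - x) * (qpoch_inf (qq * x) - qpoch (qq * x) N) \<in> Wt N" by auto
  then show "qpoch_inf x - (1 - x) * qpoch_inf (qq * x) \<in> Wt N" by (simp add: qpoch_Suc' algebra_simps)
qed

lemma shift_S_qpoch: "shift_S (qpoch x n) = qpoch (shift_S x) n"
  by (induction n) (simp_all add: qpoch_Suc)

lemma shift_S_qpoch_inf:
  assumes x: "x \<in> ring_R" shows "shift_S (qpoch_inf x) = qpoch_inf (shift_S x)"
proof (rule Wt_eqI)
  fix N
  have "shift_S (qpoch_inf x - qpoch x N) - (qpoch_inf (shift_S x) - qpoch (shift_S x) N) \<in> Wt N"
    by (intro Wt_diff shift_S_Wt qpoch_inf shift_S_ring_R x)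
  then show "shift_S (qpoch_inf x) - qpoch_inf (shift_S x) \<in> Wt N" by (simp add: shift_S_qpoch)
qed

lemma unit1_qpoch: "x \<in> Wt 1 \<Longrightarrow> unit1 (qpoch x n)"
proof (induction n)
  case (Suc n)
  then show ?case using Wt_mono[OF qq_power_Wt[of x 1 n], of 1] unfolding qpoch_Suc
    by (intro unit1_mult unit1_minus) auto
qed (simp add: unit1_1)

lemma unit1_qpoch_inf: assumes "x \<in> Wt 1" shows "unit1 (qpoch_inf x)"
proof -
  have "1 - qpoch x 1 \<in> Wt 1" using unit1_qpoch[OF assms, of 1] by (simp only: unit1_def)
  moreover have "qpoch_inf x - qpoch x 1 \<in> Wt 1" using assms Wt_ring_R by (intro qpoch_inf) auto
  ultimately have "(1 - qpoch x 1) - (qpoch_inf x - qpoch x 1) \<in> Wt 1" by (rule Wt_diff)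
  then show ?thesis by (simp add: unit1_def)
qed

subsection \<open>The scalars \<open>f\<^sub>n\<close>\<close>

definition XX :: lseries where "XX = zz1 * zz2 ^ 2"

lemma XX_mon: "XX = mon (0, 1, 2)" by (simp add: XX_def mon.simps)

lemma XX_Wt: "qq ^ n * XX \<in> Wt 1"
  unfolding XX_mon qq_power_mon mon_add[symmetric] by (simp add: mon_Wt)

lemma qq_Wt: "0 < n \<Longrightarrow> qq ^ n \<in> Wt 1" and qq_Wt': "qq \<in> Wt 1"
  using mon_Wt[of 1 0 1 0] unfolding qq_power_mon by (simp_all add: mon_Wt flip: qq_mon)

text \<open>The scalar f_(n+1) without 1 - q^(2n+2) X and 1/(1 - q^(n+1) z2), where X = z1 z2^2.
  Indices start at 0, so \<open>GG n\<close> belongs to v_(n+1).\<close>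

definition GG :: "nat \<Rightarrow> lseries" where
  "GG n = (- 1) ^ n * qq ^ (n * (n + 1) div 2) / (qpoch_inf qq * qpoch qq n * qpoch_inf (qq ^ (n + 2) * XX))"

lemma GG_nonzero: "qpoch_inf qq \<noteq> 0" "qpoch qq n \<noteq> 0" "qpoch_inf (qq ^ m * XX) \<noteq> 0"
  using unit1_inverse(1)[OF unit1_qpoch_inf[OF qq_Wt']] unit1_inverse(1)[OF unit1_qpoch[OF qq_Wt']]
    unit1_inverse(1)[OF unit1_qpoch_inf[OF XX_Wt]] by auto

lemma sign_Wt: "f \<in> Wt N \<Longrightarrow> (- 1) ^ n * f \<in> Wt N"
  by (induction n) auto

lemma triangle_bound: "n \<le> n * (n + 1) div (2 :: nat)"
  by (induction n) auto

lemma GG_Wt: "GG n \<in> Wt (n * (n + 1) div 2)"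
proof -
  have "qq ^ (n * (n + 1) div 2) \<in> Wt (n * (n + 1) div 2)" unfolding qq_power_mon by (rule mon_Wt) auto
  then have "(- 1) ^ n * qq ^ (n * (n + 1) div 2) \<in> Wt (n * (n + 1) div 2)" by (rule sign_Wt)
  then show ?thesis unfolding GG_def
    by (intro unit1_divide unit1_mult unit1_qpoch unit1_qpoch_inf qq_Wt' XX_Wt)
qed

lemma GG_Suc: "GG (Suc n) = - GG n * qq ^ Suc n * (1 - qq ^ (n + 2) * XX) / (1 - qq ^ Suc n)"
proof -
  have e: "Suc n * (Suc n + 1) div 2 = n * (n + 1) div 2 + Suc n" by simp
  define P I a b where "P = qpoch qq n" and "I = qpoch_inf (qq ^ (Suc n + 2) * XX)"
    and "a = 1 - qq ^ (n + 2) * XX" and "b = 1 - qq ^ Suc n"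
  have "qpoch_inf (qq ^ (n + 2) * XX) = (1 - qq ^ (n + 2) * XX) * qpoch_inf (qq ^ (Suc n + 2) * XX)"
    using qpoch_inf_rec[OF Wt_ring_R[OF XX_Wt[of "n + 2"]]] by (simp add: mult_ac)
  then have 1: "qpoch_inf (qq ^ (n + 2) * XX) = a * I" by (simp only: a_def I_def)
  have 2: "qpoch qq (Suc n) = P * b" by (simp add: P_def b_def qpoch_Suc mult.commute)
  have "a \<noteq> 0" unfolding a_def by (rule unit1_inverse(1)[OF unit1_minus[OF XX_Wt]])
  then show ?thesis
    unfolding GG_def e 1 2 P_def[symmetric] I_def[symmetric] a_def[symmetric] b_def[symmetric]
      power_add[of qq "n * (n + 1) div 2" "Suc n"]
    by (simp del: power_Suc) (simp add: mult_ac)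
qed

lemma coeff_f_GG: "coeff_f (Suc n) = GG n * (1 - qq ^ (2 * Suc n) * XX) / (1 - qq ^ Suc n * zz2)"
proof -
  have e: "Suc n * (Suc n - 1) div 2 = n * (n + 1) div 2" by (simp add: mult.commute)
  show ?thesis unfolding coeff_f_def GG_def e XX_def by (simp add: mult_ac)
qed

lemma coeff_f_Wt: "coeff_f (Suc n) \<in> Wt n"
proof -
  have "zz2 \<in> Wt 1" using mon_Wt[of 0 1 1 0] by (simp flip: zz2_mon)
  then have "qq ^ Suc n * zz2 \<in> Wt 1" using Wt_mono[OF qq_power_Wt[of zz2 1 "Suc n"], of 1] by (simp del: power_Suc)
  moreover have "GG n * (1 - qq ^ (2 * Suc n) * XX) \<in> Wt n"
    by (intro Wt_mult_ring_R(1) ring_R_diff ring_R_1 Wt_ring_R[OF XX_Wt] Wt_mono[OF GG_Wt triangle_bound])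
  ultimately show ?thesis unfolding coeff_f_GG by (intro unit1_divide unit1_minus)
qed

text \<open>The value at \<kappa> = 1 of the functional \<open>Bf\<close> on f_(n+1) v_(n+1). It is
  singled out because its sum has a closed form.\<close>

definition GG_term :: "nat \<Rightarrow> lseries" where
  "GG_term n = GG n * (1 - qq ^ (2 * Suc n) * XX) / ((1 - mon (int n + 1, 1, 2)) * (1 - mon (int n + 1, 0, 0)))"

lemma GG_term_telescope:
  "GG_term n = GG n / (1 - qq ^ Suc n * XX) - GG (Suc n) / (1 - qq ^ Suc (Suc n) * XX)"
proof -
  have m: "mon (int n + 1, 1, 2) = qq ^ Suc n * XX" "mon (int n + 1, 0, 0) = qq ^ Suc n"
    by (simp_all only: XX_mon qq_power_mon mon_add[symmetric]) (simp_all add: algebra_simps)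
  have nz: "1 - qq ^ Suc m * XX \<noteq> 0" "1 - qq ^ Suc m \<noteq> 0" for m
    using unit1_inverse(1)[OF unit1_minus[OF XX_Wt]] unit1_inverse(1)[OF unit1_minus[OF qq_Wt]] by blast+
  define N where "N = qq ^ Suc n"
  have 2: "qq ^ (2 * Suc n) = N * N" by (simp add: N_def mult_2 flip: power_add)
  have 3: "qq ^ (n + 2) = qq * N" "qq ^ Suc (Suc n) = qq * N" by (simp_all add: N_def)
  show ?thesis
    unfolding GG_term_def m GG_Suc 2 3 N_def[symmetric] using nz[of n] nz(1)[of "Suc n"]
    unfolding 3 N_def[symmetric] by (simp add: divide_simps) (simp add: algebra_simps)
qed

lemma qX_ring_R: "qq * XX \<in> ring_R"
  using Wt_ring_R[OF XX_Wt[of 1]] by simp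

lemma GG_0: "GG 0 / (1 - qq ^ Suc 0 * XX) = 1 / (qpoch_inf qq * qpoch_inf (qq * XX))"
  unfolding GG_def using qpoch_inf_rec[OF qX_ring_R] by (simp add: power2_eq_square mult_ac)

lemma fsums_GG_term: "fsums GG_term (1 / (qpoch_inf qq * qpoch_inf (qq * XX)))"
proof -
  have "fsums GG_term (GG 0 / (1 - qq ^ Suc 0 * XX))"
  proof (rule fsums_telescope[of 1])
    show "1 * (GG n / (1 - qq ^ Suc n * XX)) \<in> Wt n" for n
      unfolding mult_1 by (intro unit1_divide unit1_minus XX_Wt Wt_mono[OF GG_Wt triangle_bound])
  qed (simp_all add: GG_term_telescope ring_R_1 del: power_Suc)
  then show ?thesis by (simp only: GG_0)
qed

subsection \<open>Scalars of merged vectors\<close>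

text \<open>Inverse of \<open>sg\<close>; it adjusts a parameter when the functional is pulled
  inside \<open>S\<close>.\<close>

fun unsg :: "expo \<Rightarrow> expo" where "unsg (a, b, c) = (a - c, b, c)"

lemma unsg_components [simp]: "fst (unsg e) = fst e - snd (snd e)" "fst (snd (unsg e)) = fst (snd e)" "snd (snd (unsg e)) = snd (snd e)"
  by (cases e; simp)+

text \<open>Interpolates between two scalars: at \<kappa> = 1 it is the scalar of \<open>B\<close>
  before \<open>S\<close>, up to 1/(1 - R/P); at \<kappa> = R/P the numerator cancels and it is that
  of \<open>E\<close>, up to 1/(1 - P/R).\<close>

fun Bf :: "expo \<Rightarrow> mvec \<Rightarrow> lseries" where
  "Bf \<kappa> (MVec f p q r) = f * (1 - mon (q - p)) / ((1 - mon (tt + q - p - \<kappa>)) * (1 - mon (q - r + \<kappa>)))"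

text \<open>The intermediate functional: \<open>Bf\<close> on (C + D) D y reduces to
  \<open>Hf\<close> on y, and \<open>Hf\<close> summed over the images under \<open>B\<close>,
  \<open>D\<close>, \<open>E\<close> reduces to \<open>Bf\<close> again. Its value at q^-1 also
  describes the vector \<open>vT\<close>.\<close>

fun Hf :: "expo \<Rightarrow> mvec \<Rightarrow> lseries" where
  "Hf \<kappa> (MVec f p q r) = f / ((1 - mon (p - r + ww - \<kappa> - (2, 0, 0))) * (1 - mon (p - q - tt + \<kappa> + (1, 0, 0))))"

text \<open>Here \<rho> = R/Q, i = 1/t, and b, c carry the parameter. The pole at \<rho> = 1
  disappears because (1 - b \<rho>)(1 - c \<rho>) - \<rho> (1 - b)(1 - c) = (1 - \<rho>)(1 - b c
  \<rho>).\<close>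

lemma CD_sum_field:
  fixes b c \<rho> i :: "'a :: field"
  assumes "b \<noteq> 1" "c \<noteq> 1" "b * \<rho> \<noteq> 1" "c * \<rho> \<noteq> 1" "\<rho> \<noteq> 1" "\<rho> \<noteq> 0" "\<rho> * i \<noteq> 1"
  shows "1 / (1 - \<rho>) * (1 - i) / ((1 - b) * (1 - c)) + (1 - i) / ((1 - \<rho> * i) * (1 - inverse \<rho>)) * (1 - \<rho> * i) / ((1 - b * \<rho>) * (1 - c * \<rho>)) =
    (1 - i) * (1 - b * c * \<rho>) / ((1 - b) * (1 - c) * (1 - b * \<rho>) * (1 - c * \<rho>))"
proof -
  define u v s w where "u = 1 - b" and "v = 1 - c" and "s = 1 - b * \<rho>" and "w = 1 - c * \<rho>"
  define n z \<sigma> where "n = 1 - i" and "z = 1 - \<rho> * i" and "\<sigma> = 1 - \<rho>"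
  have nz: "u \<noteq> 0" "v \<noteq> 0" "s \<noteq> 0" "w \<noteq> 0" "z \<noteq> 0" "\<sigma> \<noteq> 0"
    using assms by (auto simp: u_def v_def s_def w_def z_def \<sigma>_def)
  have i: "1 - inverse \<rho> = - \<sigma> / \<rho>" using assms by (simp add: field_simps \<sigma>_def)
  have e: "s * w - \<rho> * (u * v) = \<sigma> * (1 - b * c * \<rho>)"
    by (simp add: u_def v_def s_def w_def \<sigma>_def algebra_simps)
  have "1 / \<sigma> * n / (u * v) + n / (z * (- \<sigma> / \<rho>)) * z / (s * w) = n * (s * w - \<rho> * (u * v)) / (\<sigma> * (u * v * s * w))"
    using nz assms(6) by (simp add: divide_simps) (simp add: algebra_simps)
  also have "\<dots> = n * (1 - b * c * \<rho>) / (u * v * s * w)" using nz unfolding e by simp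
  finally show ?thesis unfolding i unfolding n_def z_def \<sigma>_def u_def v_def s_def w_def .
qed

definition Cm :: "expo \<Rightarrow> expo \<Rightarrow> lseries" where
  "Cm \<kappa> d = shift_S (shift_S ((1 - mon (- tt)) / ((1 - mon (d - tt)) * (1 - mon (- d))))) *
     shift_S ((1 - mon (- tt)) / ((1 - mon (sg (tt - d) - tt)) * (1 - mon (- unsg \<kappa> - (1, 0, 0))) *
       (1 - mon (sg (d - tt) - ww + unsg \<kappa> + (1, 0, 0)))))"

text \<open>The numerator 1 - b c \<rho> of the field identity is \<open>S\<close> of 1 - P/(tQ), a
  denominator of the inner \<open>D\<close>. After this cancellation P survives only inside
  \<open>Hf\<close>, and the remaining constant depends on \<kappa> and R/Q alone.\<close>

lemma Bf_CD_D:
  assumes g: "good LD y" "good LC (ap LD y)" "good LD (ap LD y)"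
    and y: "y = MVec f p q r"
    and nz: "- unsg \<kappa> - (1, 0, 0) \<noteq> 0" "sg (r - q - tt) - ww + unsg \<kappa> + (1, 0, 0) \<noteq> 0"
      "p - r + ww - unsg (unsg \<kappa>) - (2, 0, 0) \<noteq> 0" "p - q - tt + unsg (unsg \<kappa>) + (1, 0, 0) \<noteq> 0"
  shows "Bf \<kappa> (ap LC (ap LD y)) + Bf \<kappa> (ap LD (ap LD y)) = Cm \<kappa> (r - q) * shift_S (shift_S (Hf (unsg (unsg \<kappa>)) y))"
proof -
  define F where "F = shift_S (f * fac LD p q r)"
  define P Q R where "P = sg (tt + q)" and "Q = sg r" and "R = sg p + ww"
  have u: "ap LD y = MVec F P Q R" by (simp add: y F_def P_def Q_def R_def del: shift_S_simps)
  define b c \<rho> i where "b = mon (- unsg \<kappa> - (1, 0, 0))" and "c = mon (sg (r - q - tt) - ww + unsg \<kappa> + (1, 0, 0))"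
    and "\<rho> = mon (R - Q)" and "i = mon (- tt)"
  have gd1: "gd (p - q - tt)" "gd (r - q - tt)" "gd (q - r)" using g(1) by (auto simp: y)
  have gd2: "gd (P - Q - tt)" "gd (R - Q)" "gd (R - Q - tt)" "gd (Q - R)" using g(2,3) unfolding u by auto
  have m: "mon (R - Q - tt) = \<rho> * i" "mon (Q - R) = inverse \<rho>"
    unfolding \<rho>_def i_def mon_add[symmetric] mon_uminus[symmetric] mon_eq_iff by simp_all
  have bcr: "b * \<rho> = shift_S (mon (p - r + ww - unsg (unsg \<kappa>) - (2, 0, 0)))"
      "c * \<rho> = shift_S (mon (p - q - tt + unsg (unsg \<kappa>) + (1, 0, 0)))"
      "b * c * \<rho> = shift_S (mon (p - q - tt))"
    unfolding b_def c_def \<rho>_def shift_S_mon mon_add[symmetric] mon_eq_iff Q_def R_def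
    by (auto simp: expo_components)
  have S1: "shift_S (mon x) \<noteq> 1" if "x \<noteq> 0" for x
    using that shift_S_inject[of "mon x" 1] by (auto simp: mon_eq_1_iff)
  have "b \<noteq> 1" "c \<noteq> 1" using nz(1,2) unfolding b_def c_def mon_eq_1_iff by blast+
  moreover have "b * \<rho> \<noteq> 1" "c * \<rho> \<noteq> 1" unfolding bcr by (rule S1[OF nz(3)], rule S1[OF nz(4)])
  moreover have "\<rho> \<noteq> 1" "\<rho> \<noteq> 0" "\<rho> * i \<noteq> 1"
    using gd_nonzero[OF gd2(2)] gd_nonzero[OF gd2(3)] unfolding m(1) by (auto simp: \<rho>_def)
  ultimately have key: "1 / (1 - \<rho>) * (1 - i) / ((1 - b) * (1 - c)) + (1 - i) / ((1 - \<rho> * i) * (1 - inverse \<rho>)) * (1 - \<rho> * i) / ((1 - b * \<rho>) * (1 - c * \<rho>)) =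
      (1 - i) * (1 - b * c * \<rho>) / ((1 - b) * (1 - c) * (1 - b * \<rho>) * (1 - c * \<rho>))"
    by (intro CD_sum_field)
  have e: "mon (sg Q - sg (tt + Q)) = shift_S i" "mon (tt + sg Q - sg (tt + Q) - \<kappa>) = shift_S b"
    "mon (sg Q - (sg P + ww) + \<kappa>) = shift_S c" "mon (sg R - sg (tt + Q)) = shift_S (\<rho> * i)"
    "mon (tt + sg R - sg (tt + Q) - \<kappa>) = shift_S (b * \<rho>)" "mon (sg R - (sg P + ww) + \<kappa>) = shift_S (c * \<rho>)"
    unfolding i_def b_def c_def \<rho>_def mon_add[symmetric] shift_S_mon mon_eq_iff
    by (auto simp: expo_components P_def Q_def R_def)
  have "Bf \<kappa> (ap LC (MVec F P Q R)) + Bf \<kappa> (ap LD (MVec F P Q R)) =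
    shift_S (F / (1 - mon (P - Q - tt)) * (1 / (1 - \<rho>) * (1 - i) / ((1 - b) * (1 - c)) + (1 - i) / ((1 - \<rho> * i) * (1 - inverse \<rho>)) * (1 - \<rho> * i) / ((1 - b * \<rho>) * (1 - c * \<rho>))))"
    unfolding ap.simps new_p.simps new_q.simps Bf.simps e fac_def numer.simps dens.simps list.map prod_list.Cons prod_list.Nil m
    unfolding \<rho>_def[symmetric] i_def[symmetric]
    by (simp only: shift_S_simps distrib_left times_divide_eq_left times_divide_eq_right divide_divide_eq_left mult_1_left mult_1_right mult_ac)
  also have "\<dots> = shift_S (F / (1 - mon (P - Q - tt)) * ((1 - i) * (1 - b * c * \<rho>) / ((1 - b) * (1 - c) * (1 - b * \<rho>) * (1 - c * \<rho>))))"
    unfolding key ..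
  also have "\<dots> =
     shift_S (shift_S ((1 - i) / ((1 - mon (r - q - tt)) * (1 - mon (q - r))))) * shift_S ((1 - i) / ((1 - mon (P - Q - tt)) * (1 - b) * (1 - c))) *
     shift_S (shift_S f / ((1 - b * \<rho>) * (1 - c * \<rho>)))"
  proof -
    have "1 - b * c * \<rho> = shift_S (1 - mon (p - q - tt))" by (simp add: bcr(3))
    then have "1 - b * c * \<rho> \<noteq> 0" using gd_nonzero[OF gd1(1)] by (simp only: shift_S_eq_0_iff) simp
    then have "shift_S (1 - b * c * \<rho>) \<noteq> 0" unfolding shift_S_eq_0_iff .
    moreover have "F = shift_S (f * ((1 - i) / ((1 - mon (r - q - tt)) * (1 - mon (q - r))))) / (1 - b * c * \<rho>)"
      unfolding F_def bcr(3) by (simp add: fac_def i_def mult_ac)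
    ultimately show ?thesis unfolding shift_S_simps(6,8) by (simp add: mult_ac del: shift_S_simps(2,4))
  qed
  also have "shift_S f / ((1 - b * \<rho>) * (1 - c * \<rho>)) = shift_S (Hf (unsg (unsg \<kappa>)) y)"
    unfolding bcr(1,2) by (simp add: y)
  also have "P - Q - tt = sg (tt - (r - q)) - tt" by (simp add: expo_components P_def Q_def)
  finally show ?thesis
    unfolding u Cm_def by (simp only: i_def b_def c_def minus_diff_eq)
qed

lemma BDE_sum_poly:
  fixes x y t B :: "'a :: comm_ring_1"
  shows "(1 - x) * (y - t * x) * (1 - B * t * x) * (B * y - x) * (1 - B * y) * (B * t - 1) +
     (t - 1) * x\<^sup>2 * (1 - y) * (1 - B) * (B * t * y - 1) * (1 - B * y) * (B * t - 1) -
     (1 - t * x) * (y - x) * (1 - B) * (B * t * y - 1) * (1 - B * t * x) * (B * y - x) =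
     (t - 1) * (1 - x) * B\<^sup>2 * (1 - t * x) * (y - x) * (1 - y) * (y - t * x)"
  by (simp add: algebra_simps power2_eq_square)

text \<open>With x = Q/P, y = R/P, B = 1/\<kappa>' the summands on the left are the values of
  \<open>Hf\<close> on the images under \<open>B\<close>, \<open>D\<close>, \<open>E\<close>. On the
  right x occurs only in the factor that defines \<open>Bf\<close>.\<close>

lemma BDE_sum_field:
  fixes x y t B :: "'a :: field"
  assumes "x \<noteq> 0" "y \<noteq> 0" "t \<noteq> 0" "B \<noteq> 0" "t * x \<noteq> 1" "x \<noteq> y" "y \<noteq> 1" "B \<noteq> 1" "B * t * y \<noteq> 1" "t * x \<noteq> y"
    "B * t * x \<noteq> 1" "x \<noteq> B * y" "B * y \<noteq> 1" "B * t \<noteq> 1"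
  shows "(1 - x) / ((1 - t * x) * (1 - x / y) * (1 - y)) / ((1 - B) * (1 - 1 / (B * t * y))) +
     (1 - 1 / t) / ((1 - 1 / (t * x)) * (1 - y / (t * x)) * (1 - x / y)) / ((1 - B * t * x) * (1 - x / (B * y))) +
     1 / ((1 - t * x / y) * (1 - 1 / y)) / ((1 - B * y) * (1 - 1 / (B * t))) =
     (1 - 1 / t) / ((1 - B) * (1 - B * y) * (1 - 1 / (B * t)) * (1 - 1 / (B * t * y))) * ((1 - x) / ((1 - B * t * x) * (1 - x / (B * y))))"
proof -
  define a b c d e g where "a = 1 - t * x" and "b = y - x" and "c = 1 - y" and "d = 1 - B" and "e = B * t * y - 1" and "g = y - t * x"
  define h i j l u v where "h = 1 - B * t * x" and "i = B * y - x" and "j = 1 - B * y" and "l = B * t - 1" and "u = 1 - x" and "v = t - 1"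
  note defs = a_def b_def c_def d_def e_def g_def h_def i_def j_def l_def u_def v_def
  have nz: "a \<noteq> 0" "b \<noteq> 0" "c \<noteq> 0" "d \<noteq> 0" "e \<noteq> 0" "g \<noteq> 0" "h \<noteq> 0" "i \<noteq> 0" "j \<noteq> 0" "l \<noteq> 0"
    using assms by (auto simp: defs)
  have r: "1 - x / y = b / y" "1 - 1 / (B * t * y) = e / (B * t * y)" "1 - 1 / t = v / t" "1 - 1 / (t * x) = - a / (t * x)"
    "1 - y / (t * x) = - g / (t * x)" "1 - x / (B * y) = i / (B * y)" "1 - t * x / y = g / y" "1 - 1 / y = - c / y" "1 - 1 / (B * t) = l / (B * t)"
    using assms(1-4) by (simp_all add: defs diff_divide_distrib)
  have p: "u * g * h * i * j * l + v * x\<^sup>2 * c * d * e * j * l - a * b * d * e * h * i = v * u * B\<^sup>2 * a * b * c * g"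
    unfolding defs by (rule BDE_sum_poly)
  have "u / (a * (b / y) * c) / (d * (e / (B * t * y))) + v / t / (- a / (t * x) * (- g / (t * x)) * (b / y)) / (h * (i / (B * y))) +
     1 / (g / y * (- c / y)) / (j * (l / (B * t))) =
     y\<^sup>2 * B * t * ((u * g * h * i * j * l + v * x\<^sup>2 * c * d * e * j * l - a * b * d * e * h * i) / (a * b * c * d * e * g * h * i * j * l))"
  proof -
    have 1: "u / (a * (b / y) * c) / (d * (e / (B * t * y))) = y\<^sup>2 * B * t * (u / (a * b * c * d * e))"
      by (simp add: power2_eq_square mult_ac)
    have 2: "v / t / (- a / (t * x) * (- g / (t * x)) * (b / y)) / (h * (i / (B * y))) = y\<^sup>2 * B * t * (v * x\<^sup>2 / (a * g * b * h * i))"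
      using assms(3) by (simp add: power2_eq_square mult_ac)
    have 3: "1 / (g / y * (- c / y)) / (j * (l / (B * t))) = y\<^sup>2 * B * t * (- 1 / (g * c * j * l))"
      by (simp add: power2_eq_square mult_ac)
    have n: "u / (a * b * c * d * e) = u * g * h * i * j * l / (a * b * c * d * e * g * h * i * j * l)"
      "v * x\<^sup>2 / (a * g * b * h * i) = v * x\<^sup>2 * c * d * e * j * l / (a * b * c * d * e * g * h * i * j * l)"
      "- 1 / (g * c * j * l) = - (a * b * d * e * h * i) / (a * b * c * d * e * g * h * i * j * l)"
      using nz by simp_all
    show ?thesis unfolding 1 2 3 n diff_divide_distrib add_divide_distrib distrib_left right_diff_distrib by simp
  qed
  also have "\<dots> = v / t / (d * j * (l / (B * t)) * (e / (B * t * y))) * (u / (h * (i / (B * y))))"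
    unfolding p using nz assms(1-4) by (simp add: power2_eq_square mult_ac)
  finally show ?thesis unfolding r unfolding defs .
qed

definition KK :: "expo \<Rightarrow> expo \<Rightarrow> lseries" where
  "KK \<kappa> y = (1 - mon (- tt)) /
     ((1 - mon (- \<kappa>)) * (1 - mon (y - \<kappa>)) * (1 - mon (\<kappa> - tt)) * (1 - mon (\<kappa> - tt - y)))"

lemma BDE_sum:
  assumes g: "\<And>L. good L v" and v: "v = MVec f p q r" and \<kappa>: "\<kappa>' = unsg \<kappa> + (2, 0, 0)"
    and nz: "\<kappa>' \<noteq> 0" "\<kappa>' \<noteq> tt + (r - p)" "r - p - \<kappa>' \<noteq> 0" "\<kappa>' \<noteq> tt"
      "tt + q - p - \<kappa>' \<noteq> 0" "q - r + \<kappa>' \<noteq> 0"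
  shows "Hf \<kappa> (ap LB v) + Hf \<kappa> (ap LD v) + Hf \<kappa> (ap LE v) = shift_S (KK \<kappa>' (r - p) * Bf \<kappa>' v)"
proof -
  define x y t B where "x = mon (q - p)" and "y = mon (r - p)" and "t = mon tt" and "B = mon (- \<kappa>')"
  note defs = x_def y_def t_def B_def
  have gd: "gd (tt + q - p)" "gd (q - r)" "gd (r - p)" "gd (tt + q - r)"
    using g[of LB] g[of LE] by (auto simp: v)
  have ne: "tt + q - p \<noteq> 0" "q - r \<noteq> 0" "r - p \<noteq> 0" "tt + q - r \<noteq> 0"
    using gd[THEN gd_nonzero] mon_0 by auto
  have nz0: "x \<noteq> 0" "y \<noteq> 0" "t \<noteq> 0" "B \<noteq> 0" by (simp_all add: defs)
  have m: "mon (tt + q - p) = t * x" "mon (q - r) = x / y" "mon (r - p) = y" "mon (tt + q - r) = t * x / y"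
    "mon (p - q - tt) = 1 / (t * x)" "mon (r - q - tt) = y / (t * x)" "mon (p - r) = 1 / y" "mon (- tt) = 1 / t"
    "mon (q - p) = x"
    "mon (- \<kappa>') = B" "mon (r - p - \<kappa>') = B * y" "mon (\<kappa>' - tt) = 1 / (B * t)" "mon (\<kappa>' - tt - (r - p)) = 1 / (B * t * y)"
    "mon (tt + q - p - \<kappa>') = B * t * x" "mon (q - r + \<kappa>') = x / (B * y)"
    unfolding defs mon_add[symmetric] unfolding mon_diff[symmetric] unfolding mon_0[symmetric] mon_diff[symmetric] mon_eq_iff
    by (simp only: expo_components fst_add snd_add fst_diff snd_diff fst_uminus snd_uminus fst_zero snd_zero, linarith?)+
  have n: "t * x \<noteq> 1" "x \<noteq> y" "y \<noteq> 1" "B \<noteq> 1" "B * t * y \<noteq> 1" "t * x \<noteq> y"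
    "B * t * x \<noteq> 1" "x \<noteq> B * y" "B * y \<noteq> 1" "B * t \<noteq> 1"
  proof -
    have "mon (tt + q - p) \<noteq> 1" "mon (q - r) \<noteq> 1" "mon (r - p) \<noteq> 1" "mon (tt + q - r) \<noteq> 1" "mon (- \<kappa>') \<noteq> 1"
      "mon (\<kappa>' - tt - (r - p)) \<noteq> 1" "mon (tt + q - p - \<kappa>') \<noteq> 1" "mon (q - r + \<kappa>') \<noteq> 1" "mon (r - p - \<kappa>') \<noteq> 1" "mon (\<kappa>' - tt) \<noteq> 1"
      unfolding mon_eq_1_iff using nz ne by (simp_all add: diff_diff_eq)
    then show "t * x \<noteq> 1" "x \<noteq> y" "y \<noteq> 1" "B \<noteq> 1" "B * t * y \<noteq> 1" "t * x \<noteq> y"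
        "B * t * x \<noteq> 1" "x \<noteq> B * y" "B * y \<noteq> 1" "B * t \<noteq> 1"
      unfolding m using nz0 by auto
  qed
  have key: "(1 - x) / ((1 - t * x) * (1 - x / y) * (1 - y)) / ((1 - B) * (1 - 1 / (B * t * y))) +
     (1 - 1 / t) / ((1 - 1 / (t * x)) * (1 - y / (t * x)) * (1 - x / y)) / ((1 - B * t * x) * (1 - x / (B * y))) +
     1 / ((1 - t * x / y) * (1 - 1 / y)) / ((1 - B * y) * (1 - 1 / (B * t))) =
     (1 - 1 / t) / ((1 - B) * (1 - B * y) * (1 - 1 / (B * t)) * (1 - 1 / (B * t * y))) * ((1 - x) / ((1 - B * t * x) * (1 - x / (B * y))))"
    by (rule BDE_sum_field) (use nz0 n in auto)
  have e: "sg p - (sg p + ww) + ww - \<kappa> - (2, 0, 0) = sg (- \<kappa>')"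
    "sg p - sg r - tt + \<kappa> + (1, 0, 0) = sg (\<kappa>' - tt - (r - p))"
    "sg (tt + q) - (sg p + ww) + ww - \<kappa> - (2, 0, 0) = sg (tt + q - p - \<kappa>')"
    "sg (tt + q) - sg r - tt + \<kappa> + (1, 0, 0) = sg (q - r + \<kappa>')"
    "sg r - (sg p + ww) + ww - \<kappa> - (2, 0, 0) = sg (r - p - \<kappa>')"
    "sg r - sg r - tt + \<kappa> + (1, 0, 0) = sg (\<kappa>' - tt)"
    unfolding \<kappa> by (simp_all add: expo_components)
  have "Hf \<kappa> (ap LB v) + Hf \<kappa> (ap LD v) + Hf \<kappa> (ap LE v) = shift_S (f * (
     (1 - x) / ((1 - t * x) * (1 - x / y) * (1 - y)) / ((1 - B) * (1 - 1 / (B * t * y))) +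
     (1 - 1 / t) / ((1 - 1 / (t * x)) * (1 - y / (t * x)) * (1 - x / y)) / ((1 - B * t * x) * (1 - x / (B * y))) +
     1 / ((1 - t * x / y) * (1 - 1 / y)) / ((1 - B * y) * (1 - 1 / (B * t)))))"
    unfolding v ap.simps new_p.simps new_q.simps Hf.simps e fac_def numer.simps dens.simps list.map prod_list.Cons prod_list.Nil
      m shift_S_mon[symmetric]
    by (simp only: shift_S_simps distrib_left times_divide_eq_left times_divide_eq_right divide_divide_eq_left mult_1_left mult_1_right mult_ac)
  also have "\<dots> = shift_S (KK \<kappa>' (r - p) * Bf \<kappa>' v)"
    unfolding key v Bf.simps KK_def m by (simp only: times_divide_eq_left times_divide_eq_right divide_divide_eq_left mult_ac)
  finally show ?thesis .
qed

subsection \<open>The vectors \<open>L\<^sup>s v\<^sub>\<infinity>\<close>\<close>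

text \<open>\<open>v_vec n\<close> is f_(n+1) v_(n+1).\<close>

definition v_vec :: "nat \<Rightarrow> mvec" where
  "v_vec n = MVec (coeff_f (Suc n)) 0 (int n + 1, 0, 1) (0, 0, 1)"

definition DBDE :: "mvec list \<Rightarrow> mvec list" where
  "DBDE xs = map (ap LD) (map (ap LB) xs @ map (ap LD) xs @ map (ap LE) xs)"

fun U_list :: "nat \<Rightarrow> nat \<Rightarrow> mvec list" where
  "U_list 0 n = [v_vec n]"
| "U_list (Suc s) n = map (ap LC) (DBDE (U_list s n)) @ map (ap LD) (DBDE (U_list s n))"

text \<open>All entries of L^s v_inf share P = q^(3 s^2) z1^s z2^(2s) and R = q^(2s) z2 P; only Q
  varies. This makes merging possible.\<close>

definition pU :: "nat \<Rightarrow> expo" where "pU s = (3 * int s * int s, int s, 2 * int s)"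
definition rU :: "nat \<Rightarrow> expo" where "rU s = pU s + (2 * int s, 0, 1)"

text \<open>The possible values of Q/P. The first alternative descends from the v_n through powers
  of D^3, the second enters through \<open>C\<close> and \<open>B\<close>, the third through
  \<open>E\<close>.\<close>

definition xU :: "nat \<Rightarrow> expo \<Rightarrow> bool" where
  "xU s x \<longleftrightarrow> (\<exists>i. 2 * int s < i \<and> x = (i, 0, 1)) \<or> (\<exists>j. 1 \<le> j \<and> x = (- j, - 1, - 1)) \<or>
     (\<exists>a. 1 \<le> a \<and> a < 2 * int s \<and> x = (a, - 1, 0))"

fun Uent :: "nat \<Rightarrow> mvec \<Rightarrow> bool" where
  "Uent s (MVec f p q r) \<longleftrightarrow> p = pU s \<and> r = rU s \<and> xU s (q - p)"

lemma Uent_ratios: "Uent s v \<Longrightarrow> yr v = (2 * int s, 0, 1)" "Uent s v \<Longrightarrow> xU s (xr v)"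
  by (cases v; simp add: rU_def)+

lemma Uent_famv: "Uent s v \<Longrightarrow> famv v"
proof -
  assume v: "Uent s v"
  have "fam x (2 * int s, 0, 1)" if "xU s x" for x
    using that unfolding xU_def
  proof (elim disjE exE conjE)
    fix i assume "2 * int s < i" "x = (i, 0, 1)"
    then show ?thesis using fam.G1[of "2 * int s" i] by simp
  next
    fix j assume "1 \<le> j" "x = (- j, - 1, - 1)"
    then show ?thesis using fam.G3[of j "2 * int s"] by simp
  next
    fix a assume "1 \<le> a" "a < 2 * int s" "x = (a, - 1, 0)"
    then show ?thesis using fam.H3[of a "2 * int s"] by simp
  qed
  then show "famv v" using Uent_ratios[OF v] by (simp add: famv_def)
qed

lemma Uent_v_vec: "Uent 0 (v_vec n)"
  by (simp add: v_vec_def pU_def rU_def xU_def zero_prod_def)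

lemma pU_step: "sg (tt + sg (sg (pU s) + ww)) = pU (Suc s)" "sg (sg (tt + sg (rU s))) + ww = rU (Suc s)"
  "sg (rU s) = sg (sg (pU s)) + (1, 0, 1)"
  by (simp_all add: expo_components pU_def rU_def algebra_simps)

lemma Uent_step:
  assumes "Uent s v" "L \<in> {LB, LD, LE}" "M \<in> {LC, LD}"
  shows "Uent (Suc s) (ap M (ap LD (ap L v)))"
proof -
  obtain f p q r where v: "v = MVec f p q r" by (cases v)
  define u where "u = ap M (ap LD (ap L v))"
  obtain f' p' q' r' where u: "u = MVec f' p' q' r'" by (cases u)
  have "p = pU s" "r = rU s" and x: "xU s (q - p)" using assms(1) by (auto simp: v)
  then have "p' = pU (Suc s)" "r' = rU (Suc s)"
    using u pU_step[of s] assms(2,3) unfolding u_def v by auto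
  moreover have "xU (Suc s) (xr u)"
  proof (cases "M = LC")
    case True
    then show ?thesis unfolding u_def xU_def by (auto simp: expo_components intro!: exI[of _ 1])
  next
    case False
    have y: "yr v = (2 * int s, 0, 1)" using Uent_ratios assms(1) by blast
    have xv: "xU s (xr v)" using x by (simp add: v)
    have "xr u = sg (sg (- yr (ap L v))) - (0, 1, 0)"
      using False assms(3) unfolding u_def by (auto simp: expo_components)
    moreover have "xU (Suc s) (sg (sg (- yr (ap L v))) - (0, 1, 0))"
    proof (cases "L = LD")
      case True
      have e: "sg (sg (- yr (ap L v))) - (0, 1, 0) = sg (sg (sg (xr v + tt))) - (2, 1, 1)"
        unfolding True by (simp add: expo_components)
      from xv show ?thesis unfolding e xU_def
      proof (elim disjE exE conjE)
        fix i :: int assume "2 * int s < i" "xr v = (i, 0, 1)"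
        then show "(\<exists>i. 2 * int (Suc s) < i \<and> sg (sg (sg (xr v + tt))) - (2, 1, 1) = (i, 0, 1)) \<or>
          (\<exists>j. 1 \<le> j \<and> sg (sg (sg (xr v + tt))) - (2, 1, 1) = (- j, - 1, - 1)) \<or>
          (\<exists>a. 1 \<le> a \<and> a < 2 * int (Suc s) \<and> sg (sg (sg (xr v + tt))) - (2, 1, 1) = (a, - 1, 0))"
          by (intro disjI1 exI[of _ "i + 4"]) (simp add: expo_components)
      next
        fix j :: int assume "1 \<le> j" "xr v = (- j, - 1, - 1)"
        then show "(\<exists>i. 2 * int (Suc s) < i \<and> sg (sg (sg (xr v + tt))) - (2, 1, 1) = (i, 0, 1)) \<or>
          (\<exists>j. 1 \<le> j \<and> sg (sg (sg (xr v + tt))) - (2, 1, 1) = (- j, - 1, - 1)) \<or>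
          (\<exists>a. 1 \<le> a \<and> a < 2 * int (Suc s) \<and> sg (sg (sg (xr v + tt))) - (2, 1, 1) = (a, - 1, 0))"
          by (intro disjI2[OF disjI1] exI[of _ "j + 2"]) (simp add: expo_components)
      next
        fix a :: int assume "1 \<le> a" "a < 2 * int s" "xr v = (a, - 1, 0)"
        then show "(\<exists>i. 2 * int (Suc s) < i \<and> sg (sg (sg (xr v + tt))) - (2, 1, 1) = (i, 0, 1)) \<or>
          (\<exists>j. 1 \<le> j \<and> sg (sg (sg (xr v + tt))) - (2, 1, 1) = (- j, - 1, - 1)) \<or>
          (\<exists>a. 1 \<le> a \<and> a < 2 * int (Suc s) \<and> sg (sg (sg (xr v + tt))) - (2, 1, 1) = (a, - 1, 0))"
          by (intro disjI2[OF disjI2] exI[of _ "a + 1"]) (simp add: expo_components)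
      qed
    next
      case False
      then consider "L = LB" | "L = LE" using assms(2) by auto
      then show ?thesis
      proof cases
        case 1
        then show ?thesis unfolding xU_def
          by (intro disjI2[OF disjI1] exI[of _ 2]) (simp add: expo_components)
      next
        case 2
        then show ?thesis unfolding xU_def
          by (intro disjI2[OF disjI2] exI[of _ "2 * int s + 1"]) (simp add: expo_components y)
      qed
    qed
    ultimately show ?thesis by simp
  qed
  ultimately show ?thesis unfolding u_def[symmetric] u by (simp add: u)
qed

lemma U_list_Uent: "v \<in> set (U_list s n) \<Longrightarrow> Uent s v"
proof (induction s arbitrary: v)
  case 0
  then show ?case by (simp add: Uent_v_vec)
next
  case (Suc s)
  from Suc.prems obtain u M L where "u \<in> set (U_list s n)" "L \<in> {LB, LD, LE}" "M \<in> {LC, LD}" "v = ap M (ap LD (ap L u))"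
    by (auto simp: DBDE_def simp del: ap.simps)
  then show ?case using Uent_step[OF Suc.IH] by blast
qed

lemma sum_list_U_Suc:
  fixes g :: "mvec \<Rightarrow> lseries"
  shows "(\<Sum>x\<leftarrow>U_list (Suc s) n. g x) = (\<Sum>v\<leftarrow>U_list s n.
     (g (ap LC (ap LD (ap LB v))) + g (ap LD (ap LD (ap LB v)))) + (g (ap LC (ap LD (ap LD v))) + g (ap LD (ap LD (ap LD v)))) +
     (g (ap LC (ap LD (ap LE v))) + g (ap LD (ap LD (ap LE v)))))"
proof -
  have add: "(\<Sum>x\<leftarrow>xs. h x + h' x) = (\<Sum>x\<leftarrow>xs. h x) + (\<Sum>x\<leftarrow>xs. h' x)" for xs :: "mvec list" and h h' :: "mvec \<Rightarrow> lseries"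
    by (rule sum_list_addf)
  have "(\<Sum>x\<leftarrow>U_list (Suc s) n. g x) = (\<Sum>y\<leftarrow>DBDE (U_list s n). g (ap LC y) + g (ap LD y))"
    unfolding U_list.simps add by (simp add: comp_def)
  also have "\<dots> = (\<Sum>v\<leftarrow>U_list s n. g (ap LC (ap LD (ap LB v))) + g (ap LD (ap LD (ap LB v)))) +
      (\<Sum>v\<leftarrow>U_list s n. g (ap LC (ap LD (ap LD v))) + g (ap LD (ap LD (ap LD v)))) +
      (\<Sum>v\<leftarrow>U_list s n. g (ap LC (ap LD (ap LE v))) + g (ap LD (ap LD (ap LE v))))"
    unfolding DBDE_def map_append map_map sum_list_append by (simp add: comp_def add.assoc)
  finally show ?thesis by (simp only: add)
qed

text \<open>Parameters that keep the denominators below nonzero. They include 1, q and R/P, and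
  \<open>step_param\<close> stays among them when s drops by one.\<close>

definition ok_param :: "nat \<Rightarrow> expo \<Rightarrow> bool" where
  "ok_param s \<kappa> \<longleftrightarrow> (\<exists>j\<ge>0. \<kappa> = (j, 0, 0)) \<or> (\<exists>a\<ge>2 * int s. \<kappa> = (a, 0, 1))"

text \<open>The parameter after pulling out one L: two \<open>S\<close> come from (C + D) D, one
  from B + D + E.\<close>

definition step_param :: "expo \<Rightarrow> expo" where "step_param \<kappa> = unsg (unsg (unsg \<kappa>)) + (2, 0, 0)"

lemma ok_step: "ok_param (Suc s) \<kappa> \<Longrightarrow> ok_param s (step_param \<kappa>)"
  by (auto simp: ok_param_def step_param_def)

text \<open>The images of v under \<open>B\<close>, \<open>D\<close>, \<open>E\<close> share Q and
  R, so the constant of \<open>Bf_CD_D\<close> is the same for all three and the three values of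
  \<open>Hf\<close> can be added by \<open>BDE_sum\<close>.\<close>

lemma Bf_recursion:
  assumes v: "Uent s v" and \<kappa>: "ok_param (Suc s) \<kappa>"
  shows "(Bf \<kappa> (ap LC (ap LD (ap LB v))) + Bf \<kappa> (ap LD (ap LD (ap LB v)))) + (Bf \<kappa> (ap LC (ap LD (ap LD v))) + Bf \<kappa> (ap LD (ap LD (ap LD v)))) +
     (Bf \<kappa> (ap LC (ap LD (ap LE v))) + Bf \<kappa> (ap LD (ap LD (ap LE v)))) =
     Cm \<kappa> (- 2 * int s - 1, 0, 0) * shift_S (shift_S (shift_S (KK (step_param \<kappa>) (2 * int s, 0, 1) * Bf (step_param \<kappa>) v)))"
proof -
  obtain f p q r where vv: "v = MVec f p q r" by (cases v)
  have pr: "p = pU s" "r = p + (2 * int s, 0, 1)" and xqp: "xU s (q - p)" using v by (auto simp: vv rU_def)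
  obtain x where q: "q = p + x" and xU: "xU s x" using xqp that[of "q - p"] by simp
  obtain x1 x2 x3 where x: "x = (x1, x2, x3)" by (cases x)
  have xc: "x2 = 0 \<and> x3 = 1 \<and> 2 * int s < x1 \<or> x2 = - 1 \<and> x3 = - 1 \<and> x1 \<le> - 1 \<or> x2 = - 1 \<and> x3 = 0 \<and> 1 \<le> x1 \<and> x1 < 2 * int s"
    using xU unfolding xU_def x by (elim disjE exE conjE) simp_all
  obtain k1 k2 k3 where k: "\<kappa> = (k1, k2, k3)" by (cases \<kappa>)
  have kc: "k2 = 0" "k3 = 0 \<and> 0 \<le> k1 \<or> k3 = 1 \<and> 2 * int s + 2 \<le> k1"
    using \<kappa> unfolding ok_param_def k by (elim disjE exE conjE; simp)+
  have fv: "famv v" using v by (rule Uent_famv)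
  have one: "Bf \<kappa> (ap LC (ap LD (ap L v))) + Bf \<kappa> (ap LD (ap LD (ap L v))) = Cm \<kappa> (- 2 * int s - 1, 0, 0) * shift_S (shift_S (Hf (unsg (unsg \<kappa>)) (ap L v)))"
    if L: "L = LB \<or> L = LD \<or> L = LE" for L
  proof -
    define y where "y = ap L v"
    obtain F P Q R where yy: "y = MVec F P Q R" by (cases y)
    have PQR: "P = new_p L p q r" "Q = sg r" "R = sg p + ww"
      using yy L unfolding y_def vv by auto
    have fy: "famv y" using L fv Uent_ratios(1)[OF v] unfolding y_def
      by (auto intro!: famv_ap simp: y_ok_def e_ok_def)
    have fDy: "famv (ap LD y)" using fy by (rule famv_ap)
    have d: "R - Q = (- 2 * int s - 1, 0, 0)" unfolding PQR pr by (simp add: expo_components pU_def)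
    show ?thesis
      unfolding d[symmetric] y_def[symmetric]
    proof (rule Bf_CD_D[OF famv_good[OF fy] famv_good[OF fDy] famv_good[OF fDy] yy])
      show "- unsg \<kappa> - (1, 0, 0) \<noteq> 0" "sg (R - Q - tt) - ww + unsg \<kappa> + (1, 0, 0) \<noteq> 0"
        unfolding d using kc by (simp_all add: expo_components k) linarith
      show "P - R + ww - unsg (unsg \<kappa>) - (2, 0, 0) \<noteq> 0" "P - Q - tt + unsg (unsg \<kappa>) + (1, 0, 0) \<noteq> 0"
        using L kc xc unfolding PQR pr(2) q by (elim disjE; simp add: expo_components k x)+
    qed
  qed
  have "Hf (unsg (unsg \<kappa>)) (ap LB v) + Hf (unsg (unsg \<kappa>)) (ap LD v) + Hf (unsg (unsg \<kappa>)) (ap LE v) =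
      shift_S (KK (step_param \<kappa>) (r - p) * Bf (step_param \<kappa>) v)"
  proof (rule BDE_sum[OF famv_good[OF fv] vv])
    show "step_param \<kappa> \<noteq> 0" "step_param \<kappa> \<noteq> tt + (r - p)" "r - p - step_param \<kappa> \<noteq> 0" "step_param \<kappa> \<noteq> tt"
      "tt + q - p - step_param \<kappa> \<noteq> 0" "q - r + step_param \<kappa> \<noteq> 0"
      using kc xc unfolding step_param_def pr(2) q by (elim disjE; simp add: expo_components k x)+
  qed (simp add: step_param_def)
  moreover have "r - p = (2 * int s, 0, 1)" by (simp add: pr(2))
  ultimately have "Hf (unsg (unsg \<kappa>)) (ap LB v) + Hf (unsg (unsg \<kappa>)) (ap LD v) + Hf (unsg (unsg \<kappa>)) (ap LE v) =
      shift_S (KK (step_param \<kappa>) (2 * int s, 0, 1) * Bf (step_param \<kappa>) v)" by simp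
  then have "shift_S (shift_S (Hf (unsg (unsg \<kappa>)) (ap LB v) + Hf (unsg (unsg \<kappa>)) (ap LD v) + Hf (unsg (unsg \<kappa>)) (ap LE v))) =
      shift_S (shift_S (shift_S (KK (step_param \<kappa>) (2 * int s, 0, 1) * Bf (step_param \<kappa>) v)))" by (simp only:)
  then show ?thesis
    unfolding one[OF disjI1[OF refl]] one[OF disjI2[OF disjI1[OF refl]]] one[OF disjI2[OF disjI2[OF refl]]]
    by (simp only: distrib_left[symmetric] shift_S_simps(3))
qed

text \<open>Denominators that are not units occur in the first M terms only. These are cleared one
  after the other, and the factor q^(c+M) then supplies the degree that the first M terms
  lack.\<close>

lemma eventually_clear:
  fixes \<rho> :: "nat \<Rightarrow> lseries" and c :: nat
  assumes fr: "\<And>n. is_frac (\<rho> n)" and ev: "\<And>n. M \<le> n \<Longrightarrow> mon (int c, 0, 0) * \<rho> n \<in> Wt n"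
  shows "\<exists>e\<in>ring_R. e \<noteq> 0 \<and> (\<forall>n. e * \<rho> n \<in> Wt n)"
proof -
  have "\<exists>e\<in>ring_R. e \<noteq> 0 \<and> (\<forall>n<M'. e * \<rho> n \<in> ring_R)" for M'
  proof (induction M')
    case 0
    then show ?case using ring_R_1 by (intro bexI[of _ 1]) auto
  next
    case (Suc M')
    then obtain e where e: "e \<in> ring_R" "e \<noteq> 0" "\<And>n. n < M' \<Longrightarrow> e * \<rho> n \<in> ring_R" by blast
    obtain u v where uv: "u \<in> ring_R" "v \<in> ring_R" "v \<noteq> 0" "\<rho> M' = u / v" using fr unfolding is_frac_def by blast
    have "v * e * \<rho> n \<in> ring_R" if "n < Suc M'" for n
    proof (cases "n = M'")
      case True
      have "v * (u / v) = u" using uv(3) by simp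
      then have "v * e * \<rho> n = e * u" unfolding True uv(4) by (metis mult.assoc mult.commute)
      then show ?thesis by (simp only: ring_R_mult[OF e(1) uv(1)])
    next
      case False
      then have "v * (e * \<rho> n) \<in> ring_R" using that by (intro ring_R_mult[OF uv(2) e(3)]) auto
      then show ?thesis by (simp only: mult.assoc)
    qed
    then show ?case using e uv by (intro bexI[of _ "v * e"]) (auto intro: ring_R_mult)
  qed
  then obtain e where e: "e \<in> ring_R" "e \<noteq> 0" "\<And>n. n < M \<Longrightarrow> e * \<rho> n \<in> ring_R" by blast
  have "mon (int (c + M), 0, 0) * e * \<rho> n \<in> Wt n" for n
  proof (cases "n < M")
    case True
    have "mon (int (c + M), 0, 0) * (e * \<rho> n) \<in> Wt (c + M)"
      using e(3)[OF True] by (intro Wt_mult_ring_R(1) mon_Wt) auto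
    then show ?thesis using True by (auto simp: mult.assoc intro: Wt_mono)
  next
    case False
    have m: "mon (int (c + M), 0, 0) = mon (int c, 0, 0) * mon (int M, 0, 0)" by (simp flip: mon_add)
    have "mon (int c, 0, 0) * \<rho> n * (mon (int M, 0, 0) * e) \<in> Wt n"
      using False e(1) by (intro Wt_mult_ring_R(1) ev ring_R_mult mon_ring_R) auto
    then show ?thesis unfolding m by (simp only: mult_ac)
  qed
  then show ?thesis using e by (intro bexI[of _ "mon (int (c + M), 0, 0) * e"]) (auto intro!: ring_R_mult mon_ring_R)
qed

lemma fsums_exists:
  fixes \<rho> :: "nat \<Rightarrow> lseries" and c :: nat
  assumes "\<And>n. is_frac (\<rho> n)" "\<And>n. M \<le> n \<Longrightarrow> mon (int c, 0, 0) * \<rho> n \<in> Wt n"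
  shows "\<exists>s. fsums \<rho> s"
proof -
  obtain e where e: "e \<in> ring_R" "e \<noteq> 0" "\<And>n. e * \<rho> n \<in> Wt n" using eventually_clear[OF assms] by blast
  have "lf (\<lambda>n. e * \<rho> n)" by (rule lfI[OF e(3)]) simp
  then show ?thesis unfolding fsums_def using e by (intro exI[of _ "fs (\<lambda>n. e * \<rho> n) / e"] bexI[of _ e]) auto
qed

section \<open>Sums of the functionals over v_inf and over L^s v_inf\<close>

lemma frac_Cm: "is_frac (Cm \<kappa> d)" and frac_KK: "is_frac (KK \<kappa> y)"
  unfolding Cm_def KK_def by (intro frac_intros frac_shift_S)+

text \<open>The value of \<open>Bf\<close> \<kappa> on f_(n+1) v_(n+1). As a series in n it is very
  well poised with base q^2 X.\<close>

definition term_v :: "expo \<Rightarrow> nat \<Rightarrow> lseries" where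
  "term_v \<kappa> n = GG n * (1 - mon (2 * int n + 2, 1, 2)) /
     ((1 - mon ((int n + 1, 1, 2) - \<kappa>)) * (1 - mon ((int n + 1, 0, 0) + \<kappa>)))"

lemma mon_gen_nonzero: "e \<noteq> 0 \<Longrightarrow> 1 - mon e \<noteq> 0"
  using mon_eq_1_iff[of e] by auto

lemma expo_neq_0: "(a, b, c) \<noteq> (0 :: expo) \<longleftrightarrow> a \<noteq> 0 \<or> b \<noteq> 0 \<or> c \<noteq> 0"
  by (auto simp: zero_prod_def)

lemma Bf_v_vec: "Bf \<kappa> (v_vec n) = term_v \<kappa> n"
proof -
  have e: "tt + (int n + 1, 0, 1) - 0 - \<kappa> = (int n + 1, 1, 2) - \<kappa>" "(int n + 1, 0, 1) - (0, 0, 1) + \<kappa> = (int n + 1, 0, 0) + \<kappa>"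
    by (simp_all add: expo_components)
  have m: "qq ^ (2 * Suc n) * XX = mon (2 * int n + 2, 1, 2)" "qq ^ Suc n * zz2 = mon (int n + 1, 0, 1)"
    unfolding qq_power_mon XX_mon zz2_mon mon_add[symmetric] by (simp_all add: algebra_simps)
  have "1 - mon (int n + 1, 0, 1) \<noteq> 0" by (rule mon_gen_nonzero) (simp add: expo_neq_0)
  then show ?thesis
    unfolding v_vec_def Bf.simps e coeff_f_GG m term_v_def by simp
qed

lemma GG_mon_Wt: "int n \<le> a + int (n * (n + 1) div 2) \<Longrightarrow> mon (a, 0, 0) * GG n \<in> Wt n"
proof -
  assume a: "int n \<le> a + int (n * (n + 1) div 2)"
  define t where "t = n * (n + 1) div 2"
  have "mon (a, 0, 0) * qq ^ t \<in> Wt n"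
    using a unfolding qq_power_mon mon_add[symmetric] t_def[symmetric] by (auto intro!: mon_Wt)
  then have "(- 1) ^ n * (mon (a, 0, 0) * qq ^ t) \<in> Wt n" by (rule sign_Wt)
  then have "(- 1) ^ n * (mon (a, 0, 0) * qq ^ t) / (qpoch_inf qq * qpoch qq n * qpoch_inf (qq ^ (n + 2) * XX)) \<in> Wt n"
    by (intro unit1_divide unit1_mult unit1_qpoch unit1_qpoch_inf qq_Wt' XX_Wt)
  then show ?thesis by (simp add: GG_def t_def mult_ac)
qed

lemma GG_ring_R: "GG n \<in> ring_R"
  by (rule Wt_ring_R[OF GG_Wt])

lemma frac_term_v: "is_frac (term_v \<kappa> n)"
  unfolding term_v_def by (intro frac_intros frac_ring_R[OF GG_ring_R])

lemma term_v_denominators: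
  assumes "ok_param 0 \<kappa>"
  shows "\<exists>M. \<forall>n\<ge>M. unit1 (1 - mon ((int n + 1, 1, 2) - \<kappa>)) \<and> unit1 (1 - mon ((int n + 1, 0, 0) + \<kappa>))"
proof -
  obtain j c where k: "\<kappa> = (j, 0, c)" "0 \<le> j" "c = 0 \<or> c = 1" using assms unfolding ok_param_def by fastforce
  have "unit1 (1 - mon ((int n + 1, 1, 2) - \<kappa>)) \<and> unit1 (1 - mon ((int n + 1, 0, 0) + \<kappa>))" if "nat j \<le> n" for n
    using that k by (auto intro!: unit1_minus mon_Wt)
  then show ?thesis by blast
qed

lemma term_v_Wt:
  assumes "unit1 (1 - mon ((int n + 1, 1, 2) - \<kappa>))" "unit1 (1 - mon ((int n + 1, 0, 0) + \<kappa>))"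
    "int n \<le> a + int (n * (n + 1) div 2)"
  shows "mon (a, 0, 0) * term_v \<kappa> n \<in> Wt n"
proof -
  have "mon (a, 0, 0) * GG n * (1 - mon (2 * int n + 2, 1, 2)) /
     ((1 - mon ((int n + 1, 1, 2) - \<kappa>)) * (1 - mon ((int n + 1, 0, 0) + \<kappa>))) \<in> Wt n"
    using assms by (intro unit1_divide unit1_mult Wt_mult_ring_R(1) GG_mon_Wt ring_R_diff ring_R_1 mon_ring_R) auto
  then show ?thesis by (simp add: term_v_def mult_ac)
qed

text \<open>The sum of \<open>Bf\<close> \<kappa> over L^s v_inf. For s = 0 the choice picks the
  sum, which is unique if it exists; for larger s the recursion is the definition, and
  \<open>fsums_BB\<close> shows that it computes the sum for admissible \<kappa>.\<close>

fun BB :: "expo \<Rightarrow> nat \<Rightarrow> lseries" where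
  "BB \<kappa> 0 = (SOME s. fsums (term_v \<kappa>) s)"
| "BB \<kappa> (Suc s) = Cm \<kappa> (- 2 * int s - 1, 0, 0) * shift_S (shift_S (shift_S (KK (step_param \<kappa>) (2 * int s, 0, 1) * BB (step_param \<kappa>) s)))"

lemma fsums_BB_0: assumes "ok_param 0 \<kappa>" shows "fsums (term_v \<kappa>) (BB \<kappa> 0)"
proof -
  obtain M where M: "\<And>n. M \<le> n \<Longrightarrow> unit1 (1 - mon ((int n + 1, 1, 2) - \<kappa>)) \<and> unit1 (1 - mon ((int n + 1, 0, 0) + \<kappa>))"
    using term_v_denominators[OF assms] by blast
  have "mon (int 0, 0, 0) * term_v \<kappa> n \<in> Wt n" if "M \<le> n" for n
    using M[OF that] triangle_bound[of n] by (intro term_v_Wt) linarith+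
  from fsums_exists[of "term_v \<kappa>", OF frac_term_v this] have "\<exists>s. fsums (term_v \<kappa>) s" .
  then show ?thesis unfolding BB.simps by (rule someI_ex)
qed

lemma fsums_BB: "ok_param s \<kappa> \<Longrightarrow> fsums (\<lambda>n. \<Sum>x\<leftarrow>U_list s n. Bf \<kappa> x) (BB \<kappa> s)"
proof (induction s arbitrary: \<kappa>)
  case 0
  then show ?case using fsums_BB_0 by (simp only: U_list.simps list.map sum_list.Cons sum_list.Nil add_0_right Bf_v_vec)
next
  case (Suc s)
  let ?c = "Cm \<kappa> (- 2 * int s - 1, 0, 0)" and ?k = "KK (step_param \<kappa>) (2 * int s, 0, 1)"
  have SL: "(\<Sum>x\<leftarrow>xs. c * shift_S (shift_S (shift_S (k * h x)))) = c * shift_S (shift_S (shift_S (k * (\<Sum>x\<leftarrow>xs. h x))))"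
    for xs :: "mvec list" and c k and h :: "mvec \<Rightarrow> lseries"
    by (induction xs) (simp_all add: distrib_left)
  have "fsums (\<lambda>n. \<Sum>x\<leftarrow>U_list s n. Bf (step_param \<kappa>) x) (BB (step_param \<kappa>) s)"
    by (rule Suc.IH[OF ok_step[OF Suc.prems]])
  then have "fsums (\<lambda>n. ?c * shift_S (shift_S (shift_S (?k * (\<Sum>x\<leftarrow>U_list s n. Bf (step_param \<kappa>) x))))) (BB \<kappa> (Suc s))"
    unfolding BB.simps by (intro fsums_mult fsums_shift_S frac_Cm frac_KK)
  moreover have "(\<Sum>x\<leftarrow>U_list (Suc s) n. Bf \<kappa> x) = ?c * shift_S (shift_S (shift_S (?k * (\<Sum>x\<leftarrow>U_list s n. Bf (step_param \<kappa>) x))))" for n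
    unfolding sum_list_U_Suc SL[symmetric]
    by (intro arg_cong[of _ _ sum_list] map_cong refl Bf_recursion U_list_Uent Suc.prems)
  ultimately show ?case by simp
qed

text \<open>The parameter \<kappa>' with S \<kappa>' = q \<kappa>.\<close>

definition prime_param :: "expo \<Rightarrow> expo" where "prime_param \<kappa> = unsg \<kappa> + (1, 0, 0)"

lemma ok_prime: "ok_param s \<kappa> \<Longrightarrow> ok_param s (prime_param \<kappa>)"
  by (auto simp: ok_param_def prime_param_def)

lemma step_prime: "step_param (prime_param \<kappa>) = prime_param (step_param \<kappa>)"
  by (simp add: expo_components step_param_def prime_param_def)

text \<open>\<open>S\<close> replaces X by q^2 X, which amounts to raising the index by one, up to
  two factors. This index shift is what makes the q-difference relation telescope.\<close>

lemma shift_S_GG: "shift_S (GG n) = GG (Suc n) * (1 - mon (int n + 3, 1, 2)) * (1 - mon (- int n - 1, 0, 0))"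
proof -
  have X: "XX \<in> ring_R" "\<And>m. qq ^ m * XX \<in> ring_R" using Wt_ring_R[OF XX_Wt] Wt_ring_R[OF XX_Wt[of 0]] by auto
  have q: "qq \<in> ring_R" using Wt_ring_R[OF qq_Wt'] .
  have sX: "qq ^ (n + 2) * shift_S XX = qq ^ (n + 4) * XX"
    unfolding XX_mon qq_power_mon shift_S_mon mon_add[symmetric] by (simp add: add.commute flip: mon_add)
  have rec: "qpoch_inf (qq ^ (n + 3) * XX) = (1 - qq ^ (n + 3) * XX) * qpoch_inf (qq ^ (n + 4) * XX)"
    using qpoch_inf_rec[OF X(2)[of "n + 3"]] by (simp add: mult_ac power_add numeral_eq_Suc)
  have nz: "1 - qq ^ (n + 3) * XX \<noteq> 0" "1 - mon (int n + 1, 0, 0) \<noteq> 0"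
    using unit1_inverse(1)[OF unit1_minus[OF XX_Wt]] by (blast, intro mon_gen_nonzero) (simp add: expo_neq_0)
  have m: "qq ^ (n + 3) * XX = mon (int n + 3, 1, 2)" unfolding XX_mon qq_power_mon mon_add[symmetric] by simp
  have sg: "shift_S ((- 1) ^ n) = (- 1) ^ n" by (induction n) simp_all
  have sq: "shift_S (qq ^ j) = qq ^ j" for j by simp
  define T where "T = qq ^ (n * (n + 1) div 2)"
  define P where "P = qpoch_inf qq * qpoch qq n * qpoch_inf (qq ^ (n + 4) * XX)"
  have "shift_S (GG n) = (- 1) ^ n * T / P"
    unfolding GG_def shift_S_simps(6,8) sg sq shift_S_qpoch shift_S_qpoch_inf[OF q] shift_S_qpoch_inf[OF X(2)] sX shift_S_vars
      T_def P_def ..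
  moreover have "GG (Suc n) = - ((- 1) ^ n * (T * mon (int n + 1, 0, 0)) / (P * (1 - mon (int n + 1, 0, 0)) * (1 - mon (int n + 3, 1, 2))))"
  proof -
    have t: "Suc n * (Suc n + 1) div 2 = n * (n + 1) div 2 + Suc n" by simp
    have q: "qq ^ Suc n = mon (int n + 1, 0, 0)" by (simp add: qq_power_mon add.commute del: power_Suc)
    have n3: "Suc n + 2 = n + 3" by simp
    show ?thesis
      unfolding GG_def t power_add[of qq _ "Suc n"] qpoch_Suc n3 rec q T_def[symmetric] P_def unfolding m
      using q by (simp add: mult_ac)
  qed
  moreover have "1 - mon (- int n - 1, 0, 0) = - ((1 - mon (int n + 1, 0, 0)) / mon (int n + 1, 0, 0))"
  proof -
    have "mon (- int n - 1, 0, 0) = 1 / mon (int n + 1, 0, 0)"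
      unfolding mon_0[symmetric] mon_diff[symmetric] by (simp add: zero_prod_def)
    then show ?thesis by (simp add: diff_divide_distrib)
  qed
  ultimately show ?thesis using nz unfolding m by simp
qed

lemma fsums_telescope_ev:
  fixes f \<rho> :: "nat \<Rightarrow> lseries" and c :: nat
  assumes "\<And>n. f n = \<rho> n - \<rho> (Suc n)" "\<And>n. is_frac (\<rho> n)" "\<And>n. M \<le> n \<Longrightarrow> mon (int c, 0, 0) * \<rho> n \<in> Wt n"
  shows "fsums f (\<rho> 0)"
proof -
  obtain e where "e \<in> ring_R" "e \<noteq> 0" "\<And>n. e * \<rho> n \<in> Wt n" using eventually_clear[OF assms(2,3)] by blast
  then show ?thesis using assms(1) by (intro fsums_telescope) auto
qed

text \<open>\<open>S\<close> moves the n-th summand for \<kappa>' to position n + 1 of a series w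
  whose terms are \<open>term_v\<close> \<kappa> times polynomial-like factors. The difference from
  c times the original series telescopes, with boundary value 0.\<close>

lemma BB_shift_0:
  assumes ok: "ok_param 0 \<kappa>"
  shows "shift_S (BB (prime_param \<kappa>) 0) = (1 - mon (\<kappa> + (1, 0, 0))) * (1 - mon ((1, 1, 2) - \<kappa>)) * BB \<kappa> 0"
proof -
  define c where "c = (1 - mon (\<kappa> + (1, 0, 0))) * (1 - mon ((1, 1, 2) - \<kappa>))"
  define w where "w = (\<lambda>n. (1 - mon (int n + 2, 1, 2)) * (1 - mon (- int n, 0, 0)) * term_v \<kappa> n)"
  \<comment> \<open>The telescoping certificate: w n - c \<open>term_v\<close> \<kappa> n = g (n +
    1) - g n. Both w and g vanish at n = 0, since they contain 1 - q^(-n) and 1 - q^n.\<close>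
  define g where "g = (\<lambda>n. GG n * (1 - mon (int n, 0, 0)) * mon (- int n, 0, 0))"
  obtain M where M: "\<And>n. M \<le> n \<Longrightarrow> unit1 (1 - mon ((int n + 1, 1, 2) - \<kappa>)) \<and> unit1 (1 - mon ((int n + 1, 0, 0) + \<kappa>))"
    using term_v_denominators[OF ok] by blast
  have nzk: "\<And>n. 1 - mon ((int n + 1, 1, 2) - \<kappa>) \<noteq> 0" "\<And>n. 1 - mon ((int n + 1, 0, 0) + \<kappa>) \<noteq> 0"
    using ok unfolding ok_param_def by (intro mon_gen_nonzero; auto simp: zero_prod_def)+
  have w: "shift_S (term_v (prime_param \<kappa>) n) = w (Suc n)" for n
  proof -
    have e: "sg ((int n + 1, 1, 2) - prime_param \<kappa>) = (int (Suc n) + 1, 1, 2) - \<kappa>"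
      "sg ((int n + 1, 0, 0) + prime_param \<kappa>) = (int (Suc n) + 1, 0, 0) + \<kappa>"
      "sg (2 * int n + 2, 1, 2) = (2 * int (Suc n) + 2, 1, 2)" "(int n + 3, 1, 2) = (int (Suc n) + 2, 1, 2 :: int)" "- int n - 1 = - int (Suc n)"
      by (simp_all add: expo_components prime_param_def)
    show ?thesis
      unfolding term_v_def shift_S_simps(2,4,6,8) shift_S_mon e shift_S_GG w_def by (simp only: times_divide_eq_left times_divide_eq_right mult_ac)
  qed
  have d: "w n - c * term_v \<kappa> n = - (g n - g (Suc n))" for n
  proof -
    define N K X q where "N = mon (int n + 1, 0, 0)" and "K = mon \<kappa>" and "X = mon (0, 1, 2)" and "q = mon (1, 0, 0)"
    have nz: "N \<noteq> 0" "K \<noteq> 0" "q \<noteq> 0" by (simp_all add: N_def K_def q_def)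
    have e: "mon (int n + 2, 1, 2) = q * N * X" "mon (- int n, 0, 0) = q / N" "mon (\<kappa> + (1, 0, 0)) = q * K"
      "mon ((1, 1, 2) - \<kappa>) = q * X / K" "mon (2 * int n + 2, 1, 2) = N * N * X" "mon ((int n + 1, 1, 2) - \<kappa>) = N * X / K"
      "mon ((int n + 1, 0, 0) + \<kappa>) = N * K" "mon (int n, 0, 0) = N / q" "mon (int (Suc n), 0, 0) = N" "mon (- int (Suc n), 0, 0) = 1 / N"
      unfolding N_def K_def X_def q_def mon_0[symmetric] unfolding mon_add[symmetric] unfolding mon_diff[symmetric] mon_eq_iff
      by (simp_all add: expo_components)
    have u: "1 - N * X / K \<noteq> 0" "1 - N * K \<noteq> 0" using nzk[of n] unfolding e by this
    have N1: "1 - N \<noteq> 0" unfolding N_def by (intro mon_gen_nonzero) (simp add: expo_neq_0)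
    \<comment> \<open>The difference of the two prefactors is a multiple of the denominators of
      \<open>term_v\<close>, so \<kappa> drops out of the certificate.\<close>
    have id: "(1 - q * N * X) * (1 - q / N) - (1 - q * K) * (1 - q * X / K) = - (q / N) * ((1 - N * X / K) * (1 - N * K))"
      using nz by (simp add: divide_simps) (simp add: algebra_simps)
    have "w n - c * term_v \<kappa> n = ((1 - q * N * X) * (1 - q / N) - (1 - q * K) * (1 - q * X / K)) * term_v \<kappa> n"
      unfolding w_def c_def e by (simp add: algebra_simps)
    also have "\<dots> = - (q / N) * GG n * (1 - N * N * X)"
    proof -
      have "- a * uu * (G / uu) = - a * G" if "uu \<noteq> 0" for a uu G :: lseries using that by simp
      moreover have "(1 - N * X / K) * (1 - N * K) \<noteq> 0" using u by simp
      ultimately have "- (q / N) * ((1 - N * X / K) * (1 - N * K)) * (GG n * (1 - N * N * X) / ((1 - N * X / K) * (1 - N * K))) =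
          - (q / N) * (GG n * (1 - N * N * X))" .
      then show ?thesis unfolding id term_v_def e by (simp only: mult.assoc)
    qed
    finally have 1: "w n - c * term_v \<kappa> n = - (q / N) * GG n * (1 - N * N * X)" .
    have G: "GG (Suc n) = - GG n * N * (1 - q * N * X) / (1 - N)"
    proof -
      have "qq ^ Suc n = N" "qq ^ (n + 2) * XX = q * N * X"
        unfolding N_def q_def X_def qq_power_mon XX_mon mon_add[symmetric] mon_eq_iff by (simp_all add: expo_components)
      then show ?thesis using GG_Suc[of n] by (simp only: )
    qed
    have "g (Suc n) = - GG n * (1 - q * N * X)" unfolding g_def e G using nz N1 by simp
    moreover have "g n = GG n * (1 - N / q) * (q / N)" unfolding g_def e ..
    ultimately show ?thesis unfolding 1 using nz by (simp add: divide_simps) (simp add: algebra_simps)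
  qed
  define \<rho> where "\<rho> = (\<lambda>n. - w n - g n)"
  \<comment> \<open>Both w and g contain q^(-n). The quadratic exponent in \<open>GG\<close> absorbs
    it, once the terms are multiplied by q^2.\<close>
  have tri: "2 * int n \<le> 2 + int (n * (n + 1) div 2)" for n
  proof -
    have "2 * n \<le> 2 + n * (n + 1) div 2"
    proof (cases "n \<le> 3")
      case True
      then have "n = 0 \<or> n = 1 \<or> n = 2 \<or> n = 3" by auto
      then show ?thesis by auto
    next
      case False
      then have "4 * n \<le> n * (n + 1)" by (simp add: mult.commute)
      then show ?thesis by linarith
    qed
    then show ?thesis by linarith
  qed
  have "fsums (\<lambda>n. shift_S (term_v (prime_param \<kappa>) n) - c * term_v \<kappa> n) (\<rho> 0)"
  proof (rule fsums_telescope_ev[where c = 2 and M = M])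
    fix n
    have "shift_S (term_v (prime_param \<kappa>) n) - c * term_v \<kappa> n = w (Suc n) - w n + (w n - c * term_v \<kappa> n)" unfolding w by simp
    then show "shift_S (term_v (prime_param \<kappa>) n) - c * term_v \<kappa> n = \<rho> n - \<rho> (Suc n)" unfolding d \<rho>_def by simp
    show "is_frac (\<rho> n)" unfolding \<rho>_def w_def g_def by (intro frac_intros frac_term_v frac_ring_R[OF GG_ring_R])
    assume n: "M \<le> n"
    note u = M[OF n, THEN conjunct1] M[OF n, THEN conjunct2]
    have m: "mon (2, 0, 0) * mon (- int n, 0, 0) = mon (2 - int n, 0, 0)" unfolding mon_add[symmetric] by simp
    have "(1 - mon (int n + 2, 1, 2)) * (mon (2, 0, 0) * term_v \<kappa> n - mon (2 - int n, 0, 0) * term_v \<kappa> n) \<in> Wt n"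
      using tri[of n] triangle_bound[of n] by (intro Wt_mult_ring_R(2) Wt_diff term_v_Wt u ring_R_diff ring_R_1 mon_ring_R) linarith+
    moreover have "(1 - mon (int n, 0, 0)) * (mon (2 - int n, 0, 0) * GG n) \<in> Wt n"
      using tri[of n] by (intro Wt_mult_ring_R(2) GG_mon_Wt ring_R_diff ring_R_1 mon_ring_R) linarith+
    ultimately have "- ((1 - mon (int n + 2, 1, 2)) * (mon (2, 0, 0) * term_v \<kappa> n - mon (2 - int n, 0, 0) * term_v \<kappa> n)) -
       (1 - mon (int n, 0, 0)) * (mon (2 - int n, 0, 0) * GG n) \<in> Wt n" by (intro Wt_diff Wt_uminus)
    then show "mon (int 2, 0, 0) * \<rho> n \<in> Wt n"
      unfolding \<rho>_def w_def g_def m[symmetric] by (simp add: algebra_simps)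
  qed
  moreover have "\<rho> 0 = 0" by (simp add: \<rho>_def w_def g_def flip: zero_prod_def)
  ultimately have z: "fsums (\<lambda>n. shift_S (term_v (prime_param \<kappa>) n) - c * term_v \<kappa> n) 0" by simp
  have "is_frac c" unfolding c_def by (intro frac_intros)
  then have "fsums (\<lambda>n. c * term_v \<kappa> n) (c * BB \<kappa> 0)" by (intro fsums_mult fsums_BB_0 ok)
  from fsums_add[OF z this] have "fsums (\<lambda>n. shift_S (term_v (prime_param \<kappa>) n)) (c * BB \<kappa> 0)" by simp
  moreover have "fsums (\<lambda>n. shift_S (term_v (prime_param \<kappa>) n)) (shift_S (BB (prime_param \<kappa>) 0))"
    by (intro fsums_shift_S fsums_BB_0 ok_prime ok)
  ultimately show ?thesis using fsums_unique unfolding c_def by blast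
qed

section \<open>The q-difference relation for all s\<close>

lemma Cm_U: "Cm \<kappa> (- 2 * int s - 1, 0, 0) = (1 - mon (- 2, - 1, - 1)) * (1 - mon (- 1, - 1, - 1)) /
    ((1 - mon (- 2 * int s - 3, - 1, - 1)) * (1 - mon (2 * int s + 1, 0, 0)) * (1 - mon (2 * int s + 2, 0, 0)) *
     (1 - mon (- \<kappa> - (1, 0, 0))) * (1 - mon (\<kappa> - (2 * int s + 3, 1, 2))))"
proof -
  have e: "sg (- 1, - 1, - 1) = (- 2, - 1, - 1)" "sg (- tt) = (- 1, - 1, - 1)"
    "sg (sg ((- 2 * int s - 1, 0, 0) - tt)) = (- 2 * int s - 3, - 1, - 1)"
    "sg (sg (- (- 2 * int s - 1, 0, 0))) = (2 * int s + 1, 0, 0)"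
    "sg (sg (tt - (- 2 * int s - 1, 0, 0)) - tt) = (2 * int s + 2, 0, 0)"
    "sg (- unsg \<kappa> - (1, 0, 0)) = - \<kappa> - (1, 0, 0)"
    "sg (sg ((- 2 * int s - 1, 0, 0) - tt) - ww + unsg \<kappa> + (1, 0, 0)) = \<kappa> - (2 * int s + 3, 1, 2)"
    by (simp_all add: expo_components)
  show ?thesis unfolding Cm_def shift_S_simps(2,4,6,8) shift_S_mon e
    by (simp only: times_divide_eq_left times_divide_eq_right divide_divide_eq_left mult_ac)
qed

lemma KK_U: "shift_S (shift_S (shift_S (KK (step_param \<kappa>) (2 * int s, 0, 1)))) = (1 - mon (- 3, - 1, - 1)) /
    ((1 - mon (- \<kappa> - (2, 0, 0))) * (1 - mon ((2 * int s + 1, 0, 1) - \<kappa>)) * (1 - mon (\<kappa> + (- 1, - 1, - 1))) *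
     (1 - mon (\<kappa> - (2 * int s + 4, 1, 2))))"
proof -
  have e: "sg (sg (sg (- tt))) = (- 3, - 1, - 1)" "sg (sg (sg (- step_param \<kappa>))) = - \<kappa> - (2, 0, 0)"
    "sg (sg (sg ((2 * int s, 0, 1) - step_param \<kappa>))) = (2 * int s + 1, 0, 1) - \<kappa>"
    "sg (sg (sg (step_param \<kappa> - tt))) = \<kappa> + (- 1, - 1, - 1)"
    "sg (sg (sg (step_param \<kappa> - tt - (2 * int s, 0, 1)))) = \<kappa> - (2 * int s + 4, 1, 2)"
    by (simp_all add: expo_components step_param_def)
  show ?thesis unfolding KK_def shift_S_simps(2,4,6,8) shift_S_mon e ..
qed

lemma BB_Suc: "BB \<kappa> (Suc s) = Cm \<kappa> (- 2 * int s - 1, 0, 0) * shift_S (shift_S (shift_S (KK (step_param \<kappa>) (2 * int s, 0, 1)))) *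
    shift_S (shift_S (shift_S (BB (step_param \<kappa>) s)))"
  by (simp only: BB.simps shift_S_simps(6) mult.assoc)

text \<open>Since \<open>prime_param\<close> and \<open>step_param\<close> commute, S^3 of the
  relation for s at \<open>step_param\<close> \<kappa> yields the relation for s + 1, after
  comparing the constants pulled out by L. This comparison produces q^(4s) and the factors
  containing 2s.\<close>

lemma BB_shift:
  "ok_param s \<kappa> \<Longrightarrow> shift_S ((1 - mon (- tt)) * BB (prime_param \<kappa>) s) =
     shift_S (mon (4 * int s, 0, 0) * (1 - mon (- 2 * int s, - 1, - 1))) * (1 - mon (\<kappa> + (1, 0, 0))) *
     (1 - mon ((2 * int s + 1, 1, 2) - \<kappa>)) * BB \<kappa> s"
proof (induction s arbitrary: \<kappa>)
  case 0
  have "(- 2 * int 0, - 1, - 1) = - tt" by (simp add: expo_components)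
  then show ?case unfolding shift_S_simps(6) BB_shift_0[OF 0] by (simp add: mult_ac flip: zero_prod_def)
next
  case (Suc s)
  define b3 b4 where "b3 = shift_S (shift_S (shift_S (BB (step_param \<kappa>) s)))"
    and "b4 = shift_S (shift_S (shift_S (shift_S (BB (prime_param (step_param \<kappa>)) s))))"
  define q4 where "q4 = mon (4 * int s, 0, 0)"
  have ih: "(1 - mon (- 4, - 1, - 1)) * b4 = q4 * (1 - mon (- 2 * int s - 4, - 1, - 1)) * (1 - mon (\<kappa> + (3, 0, 0))) *
      (1 - mon ((2 * int s + 5, 1, 2) - \<kappa>)) * b3"
  proof -
    have e: "sg (sg (sg (sg (- tt)))) = (- 4, - 1, - 1)" "sg (sg (sg (sg (4 * int s, 0, 0)))) = (4 * int s, 0, 0)"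
      "sg (sg (sg (sg (- 2 * int s, - 1, - 1)))) = (- 2 * int s - 4, - 1, - 1)"
      "sg (sg (sg (step_param \<kappa> + (1, 0, 0)))) = \<kappa> + (3, 0, 0)"
      "sg (sg (sg ((2 * int s + 1, 1, 2) - step_param \<kappa>))) = (2 * int s + 5, 1, 2) - \<kappa>"
      by (simp_all add: expo_components step_param_def)
    from arg_cong[OF Suc.IH[OF ok_step[OF Suc.prems]], of "\<lambda>x. shift_S (shift_S (shift_S x))"] show ?thesis
      unfolding shift_S_simps(2,4,6) shift_S_mon e b3_def b4_def q4_def .
  qed
  have l: "shift_S ((1 - mon (- tt)) * BB (prime_param \<kappa>) (Suc s)) = (1 - mon (- 1, - 1, - 1)) *
     ((1 - mon (- 3, - 1, - 1)) * (1 - mon (- 2, - 1, - 1)) /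
      ((1 - mon (- 2 * int s - 4, - 1, - 1)) * (1 - mon (2 * int s + 1, 0, 0)) * (1 - mon (2 * int s + 2, 0, 0)) *
       (1 - mon (- \<kappa> - (2, 0, 0))) * (1 - mon (\<kappa> - (2 * int s + 4, 1, 2)))) *
     ((1 - mon (- 4, - 1, - 1)) /
      ((1 - mon (- \<kappa> - (3, 0, 0))) * (1 - mon ((2 * int s + 1, 0, 1) - \<kappa>)) * (1 - mon (\<kappa> + (- 1, - 1, - 1))) *
       (1 - mon (\<kappa> - (2 * int s + 5, 1, 2))))) * b4)"
  proof -
    have e: "sg (- 2, - 1, - 1) = (- 3, - 1, - 1)" "sg (- 1, - 1, - 1) = (- 2, - 1, - 1)" "sg (- tt) = (- 1, - 1, - 1)"
      "sg (- 3, - 1, - 1) = (- 4, - 1, - 1)" "sg (- 2 * int s - 3, - 1, - 1) = (- 2 * int s - 4, - 1, - 1)"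
      "sg (2 * int s + 1, 0, 0) = (2 * int s + 1, 0, 0)" "sg (2 * int s + 2, 0, 0) = (2 * int s + 2, 0, 0)"
      "sg (- prime_param \<kappa> - (1, 0, 0)) = - \<kappa> - (2, 0, 0)" "sg (prime_param \<kappa> - (2 * int s + 3, 1, 2)) = \<kappa> - (2 * int s + 4, 1, 2)"
      "sg (- prime_param \<kappa> - (2, 0, 0)) = - \<kappa> - (3, 0, 0)" "sg ((2 * int s + 1, 0, 1) - prime_param \<kappa>) = (2 * int s + 1, 0, 1) - \<kappa>"
      "sg (prime_param \<kappa> + (- 1, - 1, - 1)) = \<kappa> + (- 1, - 1, - 1)" "sg (prime_param \<kappa> - (2 * int s + 4, 1, 2)) = \<kappa> - (2 * int s + 5, 1, 2)"
      by (simp_all add: expo_components prime_param_def)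
    show ?thesis
      unfolding BB_Suc Cm_U KK_U[of "prime_param \<kappa>"] 
      unfolding step_prime 
      unfolding shift_S_simps(2,4,6,8) b4_def
      unfolding shift_S_mon
      unfolding e ..
  qed
  have f: "1 - mon (\<kappa> + (3, 0, 0)) = - (mon (\<kappa> + (3, 0, 0)) * (1 - mon (- \<kappa> - (3, 0, 0))))"
    "1 - mon ((2 * int s + 5, 1, 2) - \<kappa>) = - (mon ((2 * int s + 5, 1, 2) - \<kappa>) * (1 - mon (\<kappa> - (2 * int s + 5, 1, 2))))"
    "1 - mon (\<kappa> + (1, 0, 0)) = - (mon (\<kappa> + (1, 0, 0)) * (1 - mon (- \<kappa> - (1, 0, 0))))"
    "1 - mon ((2 * int s + 3, 1, 2) - \<kappa>) = - (mon ((2 * int s + 3, 1, 2) - \<kappa>) * (1 - mon (\<kappa> - (2 * int s + 3, 1, 2))))"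
    by (rule mon_flip, simp add: expo_components)+
  obtain k1 k2 k3 where k: "\<kappa> = (k1, k2, k3)" by (cases \<kappa>)
  have kc: "k2 = 0" "0 \<le> k1" "0 \<le> k3" "k3 = 0 \<or> 2 * int s + 2 \<le> k1"
    using Suc.prems unfolding ok_param_def k by (elim disjE exE conjE; simp)+
  have kd: "2 * int s + 1 = k1 \<longrightarrow> k3 \<noteq> 1" using kc by auto
  have nz: "1 - mon (- 4, - 1, - 1) \<noteq> 0" "1 - mon (- 2 * int s - 4, - 1, - 1) \<noteq> 0" "1 - mon (- 2 * int s - 3, - 1, - 1) \<noteq> 0"
    "1 - mon (- \<kappa> - (3, 0, 0)) \<noteq> 0" "1 - mon (\<kappa> - (2 * int s + 5, 1, 2)) \<noteq> 0"
    "1 - mon (- \<kappa> - (1, 0, 0)) \<noteq> 0" "1 - mon (\<kappa> - (2 * int s + 3, 1, 2)) \<noteq> 0"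
    "1 - mon (2 * int s + 1, 0, 0) \<noteq> 0" "1 - mon (2 * int s + 2, 0, 0) \<noteq> 0" "1 - mon (- \<kappa> - (2, 0, 0)) \<noteq> 0"
    "1 - mon (\<kappa> - (2 * int s + 4, 1, 2)) \<noteq> 0" "1 - mon ((2 * int s + 1, 0, 1) - \<kappa>) \<noteq> 0" "1 - mon (\<kappa> + (- 1, - 1, - 1)) \<noteq> 0"
    by (rule mon_gen_nonzero, use kc(1-3) kd in \<open>simp add: expo_neq_0 k\<close>)+
  have mm: "q4 * (mon (\<kappa> + (3, 0, 0)) * mon ((2 * int s + 5, 1, 2) - \<kappa>)) =
      mon (4 * int (Suc s), 0, 0) * (mon (\<kappa> + (1, 0, 0)) * mon ((2 * int s + 3, 1, 2) - \<kappa>))"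
    unfolding q4_def mon_add[symmetric] mon_eq_iff by (simp add: expo_components)
  define m3 m5 m1 m2 where "m3 = mon (\<kappa> + (3, 0, 0))" and "m5 = mon ((2 * int s + 5, 1, 2) - \<kappa>)"
    and "m1 = mon (\<kappa> + (1, 0, 0))" and "m2 = mon ((2 * int s + 3, 1, 2) - \<kappa>)"
  define a1 a2 a3 a4 where "a1 = 1 - mon (- 1, - 1, - 1)" and "a2 = 1 - mon (- 2, - 1, - 1)" and "a3 = 1 - mon (- 3, - 1, - 1)" and "a4 = 1 - mon (- 4, - 1, - 1)"
  define u3 u4 where "u3 = 1 - mon (- 2 * int s - 3, - 1, - 1)" and "u4 = 1 - mon (- 2 * int s - 4, - 1, - 1)"
  define c1 c2 where "c1 = 1 - mon (2 * int s + 1, 0, 0)" and "c2 = 1 - mon (2 * int s + 2, 0, 0)"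
  define k1 k2 k3 where "k1 = 1 - mon (- \<kappa> - (1, 0, 0))" and "k2 = 1 - mon (- \<kappa> - (2, 0, 0))" and "k3 = 1 - mon (- \<kappa> - (3, 0, 0))"
  define l3 l4 l5 where "l3 = 1 - mon (\<kappa> - (2 * int s + 3, 1, 2))" and "l4 = 1 - mon (\<kappa> - (2 * int s + 4, 1, 2))" and "l5 = 1 - mon (\<kappa> - (2 * int s + 5, 1, 2))"
  define y z where "y = 1 - mon ((2 * int s + 1, 0, 1) - \<kappa>)" and "z = 1 - mon (\<kappa> + (- 1, - 1, - 1))"
  note D = m3_def[symmetric] m5_def[symmetric] m1_def[symmetric] m2_def[symmetric] a1_def[symmetric] a2_def[symmetric] a3_def[symmetric] a4_def[symmetric]
    u3_def[symmetric] u4_def[symmetric] c1_def[symmetric] c2_def[symmetric] k1_def[symmetric] k2_def[symmetric] k3_def[symmetric]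
    l3_def[symmetric] l4_def[symmetric] l5_def[symmetric] y_def[symmetric] z_def[symmetric]
  have r: "shift_S (mon (4 * int (Suc s), 0, 0) * (1 - mon (- 2 * int (Suc s), - 1, - 1))) = mon (4 * int (Suc s), 0, 0) * u3"
  proof -
    have "sg (4 * int (Suc s), 0, 0) = (4 * int (Suc s), 0, 0)" "sg (- 2 * int (Suc s), - 1, - 1) = (- 2 * int s - 3, - 1, - 1)" by simp_all
    then show ?thesis unfolding shift_S_simps(2,4,6) shift_S_mon u3_def by (simp only:)
  qed
  have e: "(2 * int (Suc s) + 1, 1, 2) - \<kappa> = (2 * int s + 3, 1, 2) - \<kappa>" by simp
  note nz' = nz[unfolded D]
  have b4: "b4 = q4 * (m3 * m5) * u4 * k3 * l5 * b3 / a4"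
    using ih[unfolded f, unfolded D] nz'(1) by (simp add: eq_divide_eq mult_ac)
  define M4 where "M4 = mon (4 * int (Suc s), 0, 0)"
  have "a1 * (a3 * a2 / (u4 * c1 * c2 * k2 * l4) * (a4 / (k3 * y * z * l5)) * (M4 * (m1 * m2) * u4 * k3 * l5 * b3 / a4)) =
      M4 * u3 * - (m1 * k1) * - (m2 * l3) * (a2 * a1 / (u3 * c1 * c2 * k1 * l3) * (a3 / (k2 * y * z * l4)) * b3)"
  proof -
    define C where "C = c1 * c2 * k2 * l4 * y * z"
    have "a1 * (a3 * a2 / (u4 * c1 * c2 * k2 * l4) * (a4 / (k3 * y * z * l5)) * (M4 * (m1 * m2) * u4 * k3 * l5 * b3 / a4)) =
        u4 * (a4 * (k3 * (l5 * (a1 * a2 * a3 * b3 * M4 * m1 * m2)))) / (u4 * (a4 * (k3 * (l5 * C))))"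
      by (simp only: times_divide_eq_left times_divide_eq_right divide_divide_eq_left mult_ac C_def)
    also have "\<dots> = (a1 * a2 * a3 * b3 * M4 * m1 * m2) / C" using nz'(1,2,4,5) by (simp only: mult_divide_mult_cancel_left not_False_eq_True)
    also have "\<dots> = u3 * (k1 * (l3 * (a1 * a2 * a3 * b3 * M4 * m1 * m2))) / (u3 * (k1 * (l3 * C)))"
      using nz'(3,6,7) by (simp only: mult_divide_mult_cancel_left not_False_eq_True)
    also have "\<dots> = M4 * u3 * - (m1 * k1) * - (m2 * l3) * (a2 * a1 / (u3 * c1 * c2 * k1 * l3) * (a3 / (k2 * y * z * l4)) * b3)"
      by (simp only: times_divide_eq_left times_divide_eq_right divide_divide_eq_left mult_minus_left mult_minus_right minus_minus mult_ac C_def)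
    finally show ?thesis .
  qed
  then show ?case
    unfolding l unfolding BB_Suc Cm_U KK_U e r f unfolding D b3_def[symmetric] b4 mm[unfolded D] M4_def .
qed

subsection \<open>The merged vectors\<close>

text \<open>\<open>yB s\<close> and \<open>yE s\<close> are B L^s v_inf and E L^s v_inf with all
  entries merged, Q having left the slots. Their scalars are the functional at \<kappa> = 1 and
  \<kappa> = R/P, divided by 1 - R/P and 1 - P/R.\<close>

definition yB :: "nat \<Rightarrow> mvec" where
  "yB s = MVec (shift_S (BB 0 s / (1 - mon (2 * int s, 0, 1)))) (sg (pU s)) (sg (rU s)) (sg (pU s) + ww)"

definition yE :: "nat \<Rightarrow> mvec" where
  "yE s = MVec (shift_S (BB (2 * int s, 0, 1) s / (1 - mon (- 2 * int s, 0, - 1)))) (sg (rU s)) (sg (rU s)) (sg (pU s) + ww)"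

definition cT :: "nat \<Rightarrow> lseries" where
  "cT s = (1 - mon (- tt)) / ((1 - mon (- 2 * int s - 1, - 1, - 1)) * (1 - mon (2 * int s + 1, 0, 0)))"

definition WT :: "nat \<Rightarrow> lseries" where
  "WT s = shift_S (cT s * shift_S (KK (1, 0, 0) (2 * int s, 0, 1) * BB (1, 0, 0) s))"

text \<open>Represents D (B + D + E) L^s v_inf under \<open>A\<close> or \<open>C\<close>. The
  entries differ in R, so R is normalized to q^-1 Q and the scalar compensates with 1 -
  q^-1.\<close>

definition vT :: "nat \<Rightarrow> mvec" where
  "vT s = MVec ((1 - mon (- 1, 0, 0)) * WT s) (sg (tt + sg (rU s))) (sg (rU s)) (sg (rU s) - (1, 0, 0))"

lemma ok_params: "ok_param s 0" "ok_param s (1, 0, 0)" "ok_param s (2 * int s, 0, 1)"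
  by (auto simp: ok_param_def zero_prod_def)

section \<open>Relations between the merged vectors\<close>

lemma scal_yB: "scal (yB s) = shift_S (BB 0 s) / (1 - mon (2 * int s + 1, 0, 1))"
proof -
  have "sg (2 * int s, 0, 1) = (2 * int s + 1, 0, 1)" by simp
  then show ?thesis unfolding yB_def mvec.sel shift_S_simps(2,4,8) shift_S_mon by (simp only:)
qed

text \<open>The q-difference relation at \<kappa> = 1: there \<kappa>' = q is the parameter that
  occurs in \<open>WT\<close>.\<close>

lemma WT_yB: "WT s * (1 - mon (2 * int s + 1, 0, 0)) = scal (yB s) * mon (6 * int s + 4, 1, 2)"
proof -
  have e: "sg (- tt) = (- 1, - 1, - 1)" "sg (- 1, - 1, - 1) = (- 2, - 1, - 1)" "sg (- 2 * int s - 1, - 1, - 1) = (- 2 * int s - 2, - 1, - 1)"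
    "sg (2 * int s + 1, 0, 0) = (2 * int s + 1, 0, 0)" "sg (sg (- (1, 0, 0))) = (- 1, 0, 0)"
    "sg (sg ((2 * int s, 0, 1) - (1, 0, 0))) = (2 * int s + 1, 0, 1)" "sg (sg ((1, 0, 0) - tt)) = (- 1, - 1, - 1)"
    "sg (sg ((1, 0, 0) - tt - (2 * int s, 0, 1))) = (- 2 * int s - 3, - 1, - 2)"
    "sg (sg (4 * int s, 0, 0)) = (4 * int s, 0, 0)" "sg (sg (- 2 * int s, - 1, - 1)) = (- 2 * int s - 2, - 1, - 1)"
    "sg (0 + (1, 0, 0)) = (1, 0, 0)" "sg ((2 * int s + 1, 1, 2) - 0) = (2 * int s + 3, 1, 2)"
    by (simp_all add: expo_components)
  have p: "prime_param 0 = (1, 0, 0)" by (simp add: expo_components prime_param_def)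
  define b b1 where "b = shift_S (BB 0 s)" and "b1 = shift_S (shift_S (BB (1, 0, 0) s))"
  define q4 where "q4 = mon (4 * int s, 0, 0)"
  have rel: "(1 - mon (- 2, - 1, - 1)) * b1 = q4 * (1 - mon (- 2 * int s - 2, - 1, - 1)) * (1 - mon (1, 0, 0)) * (1 - mon (2 * int s + 3, 1, 2)) * b"
    using arg_cong[OF BB_shift[OF ok_params(1)], of shift_S s]
    unfolding p shift_S_simps(2,4,6) shift_S_mon e b_def b1_def q4_def .
  have W: "WT s = (1 - mon (- 1, - 1, - 1)) / ((1 - mon (- 2 * int s - 2, - 1, - 1)) * (1 - mon (2 * int s + 1, 0, 0))) *
      ((1 - mon (- 2, - 1, - 1)) / ((1 - mon (- 1, 0, 0)) * (1 - mon (2 * int s + 1, 0, 1)) * (1 - mon (- 1, - 1, - 1)) * (1 - mon (- 2 * int s - 3, - 1, - 2))) * b1)"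
    unfolding WT_def cT_def KK_def shift_S_simps(2,4,6,8) shift_S_mon e b1_def ..
  have f: "1 - mon (1, 0, 0) = - (mon (1, 0, 0) * (1 - mon (- 1, 0, 0)))"
    "1 - mon (2 * int s + 3, 1, 2) = - (mon (2 * int s + 3, 1, 2) * (1 - mon (- 2 * int s - 3, - 1, - 2)))"
    by (rule mon_flip, simp add: expo_components)+
  have nz: "1 - mon (- 1, - 1, - 1) \<noteq> 0" "1 - mon (- 2, - 1, - 1) \<noteq> 0" "1 - mon (- 2 * int s - 2, - 1, - 1) \<noteq> 0" "1 - mon (2 * int s + 1, 0, 0) \<noteq> 0"
    "1 - mon (- 1, 0, 0) \<noteq> 0" "1 - mon (2 * int s + 1, 0, 1) \<noteq> 0" "1 - mon (- 2 * int s - 3, - 1, - 2) \<noteq> 0"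
    by (rule mon_gen_nonzero, simp add: expo_neq_0)+
  have mm: "q4 * (mon (1, 0, 0) * mon (2 * int s + 3, 1, 2)) = mon (6 * int s + 4, 1, 2)"
    unfolding q4_def mon_add[symmetric] mon_eq_iff by (simp add: expo_components)
  define m1 m2 where "m1 = mon (1, 0, 0)" and "m2 = mon (2 * int s + 3, 1, 2)"
  define a1 a2 u2 c1 k1 y l where "a1 = 1 - mon (- 1, - 1, - 1)" and "a2 = 1 - mon (- 2, - 1, - 1)" and "u2 = 1 - mon (- 2 * int s - 2, - 1, - 1)"
    and "c1 = 1 - mon (2 * int s + 1, 0, 0)" and "k1 = 1 - mon (- 1, 0, 0)" and "y = 1 - mon (2 * int s + 1, 0, 1)" and "l = 1 - mon (- 2 * int s - 3, - 1, - 2)"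
  note D = m1_def[symmetric] m2_def[symmetric] a1_def[symmetric] a2_def[symmetric] u2_def[symmetric] c1_def[symmetric] k1_def[symmetric] y_def[symmetric] l_def[symmetric]
  note nz' = nz[unfolded D]
  have "WT s * c1 = a2 * b1 / (u2 * k1 * y * l)"
    unfolding W[unfolded D] using nz' by simp
  also have "a2 * b1 = q4 * (m1 * m2) * (u2 * k1 * l * b)"
    using rel[unfolded f, unfolded D] by (simp only: mult_ac mult_minus_left mult_minus_right minus_minus)
  also have "q4 * (m1 * m2) * (u2 * k1 * l * b) / (u2 * k1 * y * l) = q4 * (m1 * m2) * b / y"
    using nz' by simp
  finally show ?thesis
    unfolding scal_yB b_def[symmetric] D mm[symmetric, unfolded D] by (simp add: mult_ac)
qed

lemma pair4_yB_vT: "pair4 (yB s) (vT s)"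
proof -
  have f: "1 - mon (- (2 * int s) - 1, 0, 0) = - (mon (- (2 * int s) - 1, 0, 0) * (1 - mon (2 * int s + 1, 0, 0)))"
    by (rule mon_flip, simp add: expo_components)
  have e: "sg (pU s) + ww - sg (rU s) = (- (2 * int s) - 1, 0, 0)" "sg (rU s) - (1, 0, 0) - sg (rU s) = (- 1, 0, 0)"
    by (simp_all add: expo_components rU_def)
  have m: "mon (sg (tt + sg (rU s))) = mon (6 * int s + 4, 1, 2) * mon (sg (pU s)) * mon (- (2 * int s) - 1, 0, 0)"
    unfolding mon_add[symmetric] mon_eq_iff by (simp add: expo_components rU_def pU_def)
  have "(1 - mon (- 1, 0, 0)) * mon (sg (pU s)) * mon (- (2 * int s) - 1, 0, 0) * (scal (yB s) * mon (6 * int s + 4, 1, 2) - WT s * (1 - mon (2 * int s + 1, 0, 0))) = 0"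
    unfolding WT_yB by simp
  moreover have "sg (pU s) + sg (tt + sg (rU s)) = sg (rU s) + sg (rU s) + (1, 1, 0)"
    by (simp add: expo_components rU_def pU_def)
  moreover obtain b where y: "yB s = MVec b (sg (pU s)) (sg (rU s)) (sg (pU s) + ww)" and b: "scal (yB s) = b"
    by (simp add: yB_def del: shift_S_simps)
  ultimately show ?thesis
    unfolding vT_def y pair4.simps e m f b by (simp add: algebra_simps)
qed

text \<open>\<open>BB 0 (Suc s)\<close> is built from the parameter \<open>step_param 0\<close> =
  q^2, which is \<kappa>' for \<kappa> = q. So the q-difference relation at \<kappa> = q compares it
  with \<open>WT s\<close>.\<close>

lemma pair1_yB_vT: "pair1 (yB (Suc s)) (ap LA (vT s))"
proof -
  have e: "sg (- 2, - 1, - 1) = (- 3, - 1, - 1)" "sg (- 1, - 1, - 1) = (- 2, - 1, - 1)" "sg (- 2 * int s - 3, - 1, - 1) = (- 2 * int s - 4, - 1, - 1)"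
    "sg (2 * int s + 1, 0, 0) = (2 * int s + 1, 0, 0)" "sg (2 * int s + 2, 0, 0) = (2 * int s + 2, 0, 0)" "sg (- 0 - (1, 0, 0)) = (- 1, 0, 0)"
    "sg (0 - (2 * int s + 3, 1, 2)) = (- 2 * int s - 5, - 1, - 2)" "sg (- 3, - 1, - 1) = (- 4, - 1, - 1)" "sg (- 0 - (2, 0, 0)) = (- 2, 0, 0)"
    "sg ((2 * int s + 1, 0, 1) - 0) = (2 * int s + 2, 0, 1)" "sg (0 + (- 1, - 1, - 1)) = (- 2, - 1, - 1)"
    "sg (0 - (2 * int s + 4, 1, 2)) = (- 2 * int s - 6, - 1, - 2)"
    by (simp_all add: expo_components)
  have e': "sg (sg (sg (sg (- tt)))) = (- 4, - 1, - 1)" "sg (sg (sg (sg (4 * int s, 0, 0)))) = (4 * int s, 0, 0)"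
    "sg (sg (sg (sg (- 2 * int s, - 1, - 1)))) = (- 2 * int s - 4, - 1, - 1)" "sg (sg (sg ((1, 0, 0) + (1, 0, 0)))) = (2, 0, 0)"
    "sg (sg (sg ((2 * int s + 1, 1, 2) - (1, 0, 0)))) = (2 * int s + 6, 1, 2)"
    by (simp_all add: expo_components)
  have e'': "sg (sg (- tt)) = (- 2, - 1, - 1)" "sg (sg (- 2 * int s - 1, - 1, - 1)) = (- 2 * int s - 3, - 1, - 1)" "sg (sg (2 * int s + 1, 0, 0)) = (2 * int s + 1, 0, 0)"
    "sg (- 2, - 1, - 1) = (- 3, - 1, - 1)" "sg (sg (sg (- (1, 0, 0)))) = (- 1, 0, 0)" "sg (sg (sg ((2 * int s, 0, 1) - (1, 0, 0)))) = (2 * int s + 2, 0, 1)"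
    "sg (sg (sg ((1, 0, 0) - tt))) = (- 2, - 1, - 1)" "sg (sg (sg ((1, 0, 0) - tt - (2 * int s, 0, 1)))) = (- 2 * int s - 5, - 1, - 2)"
    by (simp_all add: expo_components)
  have p: "prime_param (1, 0, 0) = (2, 0, 0)" "step_param 0 = (2, 0, 0)" by (simp_all add: expo_components prime_param_def step_param_def)
  define b b2 where "b = shift_S (shift_S (shift_S (BB (1, 0, 0) s)))" and "b2 = shift_S (shift_S (shift_S (shift_S (BB (2, 0, 0) s))))"
  define q4 where "q4 = mon (4 * int s, 0, 0)"
  have rel: "(1 - mon (- 4, - 1, - 1)) * b2 = q4 * (1 - mon (- 2 * int s - 4, - 1, - 1)) * (1 - mon (2, 0, 0)) * (1 - mon (2 * int s + 6, 1, 2)) * b"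
    using arg_cong[OF BB_shift[OF ok_params(2)], of "\<lambda>x. shift_S (shift_S (shift_S x))" s]
    unfolding p shift_S_simps(2,4,6) shift_S_mon e' b_def b2_def q4_def .
  have B: "shift_S (BB 0 (Suc s)) = (1 - mon (- 3, - 1, - 1)) * (1 - mon (- 2, - 1, - 1)) /
      ((1 - mon (- 2 * int s - 4, - 1, - 1)) * (1 - mon (2 * int s + 1, 0, 0)) * (1 - mon (2 * int s + 2, 0, 0)) *
       (1 - mon (- 1, 0, 0)) * (1 - mon (- 2 * int s - 5, - 1, - 2))) *
      ((1 - mon (- 4, - 1, - 1)) / ((1 - mon (- 2, 0, 0)) * (1 - mon (2 * int s + 2, 0, 1)) * (1 - mon (- 2, - 1, - 1)) * (1 - mon (- 2 * int s - 6, - 1, - 2)))) * b2"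
    unfolding BB_Suc Cm_U KK_U unfolding p unfolding shift_S_simps(2,4,6,8) shift_S_mon e b2_def ..
  have W: "shift_S (WT s) = (1 - mon (- 2, - 1, - 1)) / ((1 - mon (- 2 * int s - 3, - 1, - 1)) * (1 - mon (2 * int s + 1, 0, 0))) *
      ((1 - mon (- 3, - 1, - 1)) / ((1 - mon (- 1, 0, 0)) * (1 - mon (2 * int s + 2, 0, 1)) * (1 - mon (- 2, - 1, - 1)) * (1 - mon (- 2 * int s - 5, - 1, - 2))) * b)"
  proof -
    have "sg (sg (sg (- tt))) = (- 3, - 1, - 1)" by (simp add: expo_components)
    then show ?thesis
      unfolding WT_def cT_def KK_def shift_S_simps(2,4,6,8) shift_S_mon b_def unfolding e'' by (simp only: )
  qed
  have f: "1 - mon (2, 0, 0) = - (mon (2, 0, 0) * (1 - mon (- 2, 0, 0)))"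
    "1 - mon (2 * int s + 6, 1, 2) = - (mon (2 * int s + 6, 1, 2) * (1 - mon (- 2 * int s - 6, - 1, - 2)))"
    "1 - mon (2 * int s + 3, 1, 1) = - (mon (2 * int s + 3, 1, 1) * (1 - mon (- 2 * int s - 3, - 1, - 1)))"
    "1 - mon (- 2 * int s - 2, 0, 0) = - (mon (- 2 * int s - 2, 0, 0) * (1 - mon (2 * int s + 2, 0, 0)))"
    "1 - mon (- 2 * int s - 3, 0, - 1) = - (mon (- 2 * int s - 3, 0, - 1) * (1 - mon (2 * int s + 3, 0, 1)))"
    by (rule mon_flip, simp add: expo_components)+
  have nz: "1 - mon (- 2, - 1, - 1) \<noteq> 0" "1 - mon (- 4, - 1, - 1) \<noteq> 0" "1 - mon (- 2 * int s - 4, - 1, - 1) \<noteq> 0" "1 - mon (- 2, 0, 0) \<noteq> 0"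
    "1 - mon (- 2 * int s - 6, - 1, - 2) \<noteq> 0" "1 - mon (- 2 * int s - 3, - 1, - 1) \<noteq> 0" "1 - mon (2 * int s + 2, 0, 0) \<noteq> 0" "1 - mon (2 * int s + 3, 0, 1) \<noteq> 0"
    "1 - mon (2 * int s + 1, 0, 0) \<noteq> 0" "1 - mon (- 1, 0, 0) \<noteq> 0" "1 - mon (2 * int s + 2, 0, 1) \<noteq> 0" "1 - mon (- 2 * int s - 5, - 1, - 2) \<noteq> 0"
    by (rule mon_gen_nonzero, simp add: expo_neq_0)+
  have mm: "mon (- 2 * int s - 3, 0, - 1) * (q4 * (mon (2, 0, 0) * mon (2 * int s + 6, 1, 2))) * mon (- 2 * int s - 2, 0, 0) = mon (2 * int s + 3, 1, 1)"
    unfolding q4_def mon_add[symmetric] mon_eq_iff by (simp add: expo_components)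
  define m1 m2 m3 m4 m5 where "m1 = mon (2, 0, 0)" and "m2 = mon (2 * int s + 6, 1, 2)" and "m3 = mon (2 * int s + 3, 1, 1)" and "m4 = mon (- 2 * int s - 2, 0, 0)" and "m5 = mon (- 2 * int s - 3, 0, - 1)"
  define a2 a3 a4 u3 u4 c1 c2 k1 k2 y2 y3 l5 l6 where "a2 = 1 - mon (- 2, - 1, - 1)" and "a3 = 1 - mon (- 3, - 1, - 1)" and "a4 = 1 - mon (- 4, - 1, - 1)"
    and "u3 = 1 - mon (- 2 * int s - 3, - 1, - 1)" and "u4 = 1 - mon (- 2 * int s - 4, - 1, - 1)"
    and "c1 = 1 - mon (2 * int s + 1, 0, 0)" and "c2 = 1 - mon (2 * int s + 2, 0, 0)" and "k1 = 1 - mon (- 1, 0, 0)" and "k2 = 1 - mon (- 2, 0, 0)"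
    and "y2 = 1 - mon (2 * int s + 2, 0, 1)" and "y3 = 1 - mon (2 * int s + 3, 0, 1)"
    and "l5 = 1 - mon (- 2 * int s - 5, - 1, - 2)" and "l6 = 1 - mon (- 2 * int s - 6, - 1, - 2)"
  note D = m1_def[symmetric] m2_def[symmetric] m3_def[symmetric] m4_def[symmetric] m5_def[symmetric] a2_def[symmetric] a3_def[symmetric] a4_def[symmetric]
    u3_def[symmetric] u4_def[symmetric] c1_def[symmetric] c2_def[symmetric] k1_def[symmetric] k2_def[symmetric] y2_def[symmetric] y3_def[symmetric] l5_def[symmetric] l6_def[symmetric]
  note nz' = nz[unfolded D]
  define G where "G = a3 * b / (c1 * k1 * y2 * l5)"
  have Bv: "shift_S (BB 0 (Suc s)) = q4 * (m1 * m2) / c2 * G"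
  proof -
    have "a4 * b2 = q4 * (m1 * m2) * (u4 * k2 * l6 * b)"
      using rel[unfolded f, unfolded D] by (simp only: mult_ac mult_minus_left mult_minus_right minus_minus)
    moreover have "shift_S (BB 0 (Suc s)) = (a4 * b2) * (a3 / (u4 * c1 * c2 * k1 * l5 * k2 * y2 * l6))"
      unfolding B[unfolded D] using nz' by (simp add: mult_ac)
    ultimately have "shift_S (BB 0 (Suc s)) = q4 * (m1 * m2) * (u4 * k2 * l6 * b) * (a3 / (u4 * c1 * c2 * k1 * l5 * k2 * y2 * l6))" by simp
    also have "\<dots> = q4 * (m1 * m2) / c2 * G" unfolding G_def using nz' by (simp add: mult_ac)
    finally show ?thesis .
  qed
  have Wv: "shift_S (WT s) = G / u3" unfolding W[unfolded D] G_def using nz' by simp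
  have sB: "scal (yB (Suc s)) = q4 * (m1 * m2) / c2 * G / y3"
  proof -
    have s3: "(2 * int (Suc s) + 1, 0, 1) = (2 * int s + 3, 0, 1 :: int)" by simp
    show ?thesis unfolding scal_yB Bv s3 unfolding D ..
  qed
  define F where "F = shift_S (WT s / (1 - mon (- 2 * int s - 2, 0, 0)))"
  have vA: "ap LA (vT s) = MVec F (sg (pU (Suc s))) (sg (sg (rU s))) (sg (pU (Suc s)) + ww)"
  proof -
    have r: "sg (rU s) - (1, 0, 0) - sg (rU s) = (- 1, 0, 0)" "tt + sg (rU s) - sg (tt + sg (rU s)) = (- 2 * int s - 2, 0, 0)"
      "sg (tt + sg (rU s)) = pU (Suc s)"
      by (simp_all add: expo_components rU_def pU_def algebra_simps)
    show ?thesis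
      unfolding vT_def ap.simps new_p.simps new_q.simps fac_def dens.simps numer.simps list.map prod_list.Cons prod_list.Nil r(1,2) F_def
      unfolding r(3) using nz(10) by simp
  qed
  have Fv: "F = G / u3 / - (m4 * c2)"
  proof -
    have "sg (- 2 * int s - 2, 0, 0) = (- 2 * int s - 2, 0, 0)" by simp
    then have "F = shift_S (WT s) / (1 - mon (- 2 * int s - 2, 0, 0))" unfolding F_def shift_S_simps(2,4,8) shift_S_mon by (simp only:)
    then show ?thesis unfolding Wv f(4) unfolding D .
  qed
  have ex: "tt + sg (sg (rU s)) - (sg (pU (Suc s)) + ww) = (- 2 * int s - 3, 0, - 1)" "tt + sg (rU (Suc s)) - (sg (pU (Suc s)) + ww) = (2 * int s + 3, 1, 1)"
    by (simp_all add: expo_components rU_def pU_def algebra_simps)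
  have "scal (yB (Suc s)) * - (m5 * y3) + F * - (m3 * u3) = 0"
  proof -
    have m4: "m4 \<noteq> 0" by (simp add: m4_def)
    have "m3 = m5 * (q4 * (m1 * m2)) * m4" using mm unfolding D by simp
    then show ?thesis unfolding sB Fv using nz' m4 by (simp add: mult_ac)
  qed
  then have "scal (yB (Suc s)) * (1 - mon (- 2 * int s - 3, 0, - 1)) + F * (1 - mon (2 * int s + 3, 1, 1)) = 0"
    unfolding f unfolding D .
  moreover have "tt + sg (rU (Suc s)) + sg (sg (rU s)) = sg (pU (Suc s)) + (sg (pU (Suc s)) + ww)"
    by (simp add: expo_components rU_def pU_def algebra_simps)
  ultimately show ?thesis
    unfolding vA yB_def pair1.simps ex mvec.sel by simp
qed

text \<open>A condition that makes y and E y cancel and passes on to E^2 y, where the exponent of z2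
  in R is larger by one. The equation for the scalar lets \<open>S f\<close>, which occurs in E y,
  be traded for f.\<close>

fun square_E :: "mvec \<Rightarrow> bool" where
  "square_E (MVec f p q r) \<longleftrightarrow> q = p \<and> sg r = p \<and> 0 < snd (snd r) \<and>
     shift_S f = f * mon (snd (snd r), 0, 0) * (1 - mon (snd (snd r), 0, 1)) * (1 - mon (snd (snd r) + 1, 1, 1))"

text \<open>At \<kappa> = R/P one has \<kappa>' = \<kappa>, so the q-difference relation expresses
  \<open>S\<close> of the scalar by the scalar itself. The number c = 2 s + 1 is the exponent of z2
  in R.\<close>

lemma square_E_yE: "square_E (yE s)"
proof -
  have p: "prime_param (2 * int s, 0, 1) = (2 * int s, 0, 1)" by (simp add: expo_components prime_param_def)
  define c where "c = 2 * int s + 1"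
  define b b2 where "b = shift_S (BB (2 * int s, 0, 1) s)" and "b2 = shift_S (shift_S (BB (2 * int s, 0, 1) s))"
  have e: "sg (sg (- tt)) = (- 2, - 1, - 1)" "sg (sg (4 * int s, 0, 0)) = (4 * int s, 0, 0)"
    "sg (sg (- 2 * int s, - 1, - 1)) = (- c - 1, - 1, - 1)" "sg ((2 * int s, 0, 1) + (1, 0, 0)) = (c + 1, 0, 1)"
    "sg ((2 * int s + 1, 1, 2) - (2 * int s, 0, 1)) = (2, 1, 1)"
    by (simp_all add: expo_components c_def)
  have rel: "(1 - mon (- 2, - 1, - 1)) * b2 = mon (4 * int s, 0, 0) * (1 - mon (- c - 1, - 1, - 1)) * (1 - mon (c + 1, 0, 1)) * (1 - mon (2, 1, 1)) * b"
    using arg_cong[OF BB_shift[OF ok_params(3)], of shift_S s]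
    unfolding p shift_S_simps(2,4,6) shift_S_mon e b_def b2_def .
  have f: "1 - mon (2, 1, 1) = - (mon (2, 1, 1) * (1 - mon (- 2, - 1, - 1)))"
    "1 - mon (- c - 1, - 1, - 1) = - (mon (- c - 1, - 1, - 1) * (1 - mon (c + 1, 1, 1)))"
    "1 - mon (- c, 0, - 1) = - (mon (- c, 0, - 1) * (1 - mon (c, 0, 1)))"
    "1 - mon (- c - 1, 0, - 1) = - (mon (- c - 1, 0, - 1) * (1 - mon (c + 1, 0, 1)))"
    by (rule mon_flip, simp add: expo_components)+
  have nz: "1 - mon (- 2, - 1, - 1) \<noteq> 0" "1 - mon (c, 0, 1) \<noteq> 0" "1 - mon (c + 1, 0, 1) \<noteq> 0"
    by (rule mon_gen_nonzero, simp add: expo_neq_0)+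
  define m1 m2 m3 m4 m5 where "m1 = mon (2, 1, 1)" and "m2 = mon (- c - 1, - 1, - 1)" and "m3 = mon (- c, 0, - 1)" and "m4 = mon (- c - 1, 0, - 1)" and "m5 = mon (4 * int s, 0, 0)"
  define u v w z where "u = 1 - mon (- 2, - 1, - 1)" and "v = 1 - mon (c + 1, 1, 1)" and "w = 1 - mon (c, 0, 1)" and "z = 1 - mon (c + 1, 0, 1)"
  note D = m1_def[symmetric] m2_def[symmetric] m3_def[symmetric] m4_def[symmetric] m5_def[symmetric] u_def[symmetric] v_def[symmetric] w_def[symmetric] z_def[symmetric]
  have mm: "m5 * m2 * m1 * m3 = m4 * mon (c, 0, 0)"
    unfolding m1_def m2_def m3_def m4_def m5_def mon_add[symmetric] mon_eq_iff by (simp add: expo_components c_def)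
  have m0: "m3 \<noteq> 0" "m4 \<noteq> 0" by (simp_all add: m3_def m4_def)
  have "u * b2 = u * (m5 * m2 * m1 * v * z * b)" using rel[unfolded f, unfolded D] by (simp add: mult_ac)
  then have b2: "b2 = m5 * m2 * m1 * v * z * b" using nz(1) unfolding D by simp
  have s: "sg (- 2 * int s, 0, - 1) = (- c, 0, - 1)" "sg (- c, 0, - 1) = (- c - 1, 0, - 1)" by (simp_all add: c_def)
  have g: "scal (yE s) = b / - (m3 * w)" unfolding yE_def mvec.sel shift_S_simps(2,4,8) shift_S_mon s b_def[symmetric] f(3) unfolding D ..
  have "shift_S (scal (yE s)) = b2 / - (m4 * z)"
    unfolding yE_def mvec.sel shift_S_simps(2,4,8) shift_S_mon s b2_def[symmetric] f(4) unfolding D ..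
  also have "\<dots> = - (m5 * m2 * m1 * m3 * v * b / (m3 * m4))" unfolding b2 using nz(3) m0 unfolding D by simp
  also have "\<dots> = b / - (m3 * w) * mon (c, 0, 0) * w * v" unfolding mm using m0 nz(2) unfolding D by (simp add: mult_ac)
  finally have "shift_S (scal (yE s)) = scal (yE s) * mon (c, 0, 0) * w * v" unfolding g .
  moreover have c: "snd (snd (sg (pU s) + ww)) = c" by (simp add: pU_def c_def)
  moreover have y: "yE s = MVec (scal (yE s)) (sg (rU s)) (sg (rU s)) (sg (pU s) + ww)" by (simp add: yE_def del: shift_S_simps)
  moreover have "sg (sg (pU s) + ww) = sg (rU s)" by (simp add: expo_components pU_def rU_def)
  moreover have "0 < c" by (simp add: c_def)
  ultimately show ?thesis by (subst y, unfold square_E.simps c) (simp only: w_def v_def)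
qed

text \<open>With P = S R, \<open>E\<close> maps [P, P, R] to [P, P, z2 S P]; only slot R changes,
  which is the shape of type 3.\<close>

lemma square_E_pair3:
  assumes "square_E y"
  shows "pair3 y (ap LE y)" "square_E (ap LE (ap LE y))"
proof -
  obtain f p r where y: "y = MVec f p p r" and p: "sg r = p" and c0: "0 < snd (snd r)"
    and sf: "shift_S f = f * mon (snd (snd r), 0, 0) * (1 - mon (snd (snd r), 0, 1)) * (1 - mon (snd (snd r) + 1, 1, 1))"
    using assms by (cases y) auto
  define c where "c = snd (snd r)"
  obtain r1 r2 where r: "r = (r1, r2, c)" by (cases r) (auto simp: c_def)
  have pr: "p - r = (c, 0, 0)" "p = (r1 + c, r2, c)" using p by (auto simp: r zero_prod_def)
  note sf = sf[folded c_def]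
  have c: "0 < c" using c0 by (simp add: c_def)
  define f1 where "f1 = shift_S f / ((1 - mon (c + 1, 1, 1)) * (1 - mon (c, 0, 0)))"
  have y1: "ap LE y = MVec f1 p p (sg p + ww)"
  proof -
    have e: "tt + p - r = (c, 1, 1)" "sg (c, 1, 1) = (c + 1, 1, 1)" "sg (c, 0, 0) = (c, 0, 0)" using pr by (simp_all add: expo_components r)
    show ?thesis
      unfolding y ap.simps new_p.simps new_q.simps fac_def numer.simps dens.simps list.map prod_list.Cons prod_list.Nil e(1) pr(1) p f1_def
        shift_S_simps(2,4,6,8) shift_S_mon e by simp
  qed
  have nz: "1 - mon (c + 1, 1, 1) \<noteq> 0" "1 - mon (c, 0, 0) \<noteq> 0" "1 - mon (c + 1, 0, 1) \<noteq> 0" "1 - mon (c + 1, 0, 0) \<noteq> 0"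
    using c by (intro mon_gen_nonzero; simp add: expo_neq_0)+
  have f1: "f1 = f * mon (c, 0, 0) * (1 - mon (c, 0, 1)) / (1 - mon (c, 0, 0))"
    unfolding f1_def sf using nz(1) by simp
  have fl: "1 - mon (- c, 0, 0) = - (mon (- c, 0, 0) * (1 - mon (c, 0, 0)))"
    by (rule mon_flip) simp
  have mc: "mon (c, 0, 0) * mon (- c, 0, 0) = 1" unfolding mon_add[symmetric] by (simp flip: zero_prod_def)
  have ex: "sg p + ww - p = (c, 0, 1)" "r - p = (- c, 0, 0)" using pr by (simp_all add: expo_components r)
  have "f * (1 - mon (c, 0, 1)) + f1 * (1 - mon (- c, 0, 0)) = f * (1 - mon (c, 0, 1)) * (1 - mon (c, 0, 0) * mon (- c, 0, 0))"
  proof -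
    have "f1 * (1 - mon (- c, 0, 0)) = - (f * mon (c, 0, 0) * (1 - mon (c, 0, 1)) * mon (- c, 0, 0))"
      unfolding f1 fl using nz(2) by simp
    then show ?thesis by (simp add: algebra_simps)
  qed
  also have "\<dots> = 0" unfolding mc by simp
  finally show "pair3 y (ap LE y)"
    unfolding y1 unfolding y pair3.simps ex using pr by (simp add: expo_components r)
  define h where "h = - mon (2 * c + 1, 0, 1) / ((1 - mon (c, 0, 0)) * (1 - mon (- c, 1, 0)))"
  have y2: "ap LE (ap LE y) = MVec (shift_S f * h) (sg (sg p + ww)) (sg (sg p + ww)) (sg p + ww)"
  proof -
    have e: "tt + p - (sg p + ww) = (- c, 1, 0)" "p - (sg p + ww) = (- c, 0, - 1)"
      "sg (c, 0, 0) = (c, 0, 0)" "sg (c, 0, 1) = (c + 1, 0, 1)" "sg (- c, 1, 0) = (- c, 1, 0)" "sg (- c, 0, - 1) = (- c - 1, 0, - 1)"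
      using pr by (simp_all add: expo_components)
    have fl2: "1 - mon (- c - 1, 0, - 1) = - (mon (- c - 1, 0, - 1) * (1 - mon (c + 1, 0, 1)))" by (rule mon_flip) simp
    have mi: "mon (- c - 1, 0, - 1) = 1 / mon (c + 1, 0, 1)" unfolding mon_0[symmetric] mon_diff[symmetric] mon_eq_iff by (simp add: zero_prod_def)
    have m2: "mon (2 * c + 1, 0, 1) = mon (c, 0, 0) * mon (c + 1, 0, 1)" unfolding mon_add[symmetric] mon_eq_iff by simp
    have "shift_S (f1 * (1 / ((1 - mon (- c, 1, 0)) * ((1 - mon (- c, 0, - 1)) * 1)))) = shift_S f * h"
      unfolding f1 shift_S_simps(2,4,6,8) shift_S_mon e h_def fl2 unfolding mi m2 using nz(3) by simp
    then show ?thesis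
      unfolding y1 ap.simps new_p.simps new_q.simps fac_def numer.simps dens.simps list.map prod_list.Cons prod_list.Nil e(1,2) by simp
  qed
  have "shift_S (shift_S f * h) = shift_S f * h * mon (c + 1, 0, 0) * (1 - mon (c + 1, 0, 1)) * (1 - mon (c + 1 + 1, 1, 1))"
  proof -
    have e: "sg (c, 0, 0) = (c, 0, 0)" "sg (c, 0, 1) = (c + 1, 0, 1)" "sg (c + 1, 1, 1) = (c + 1 + 1, 1, 1)" "sg (- c, 1, 0) = (- c, 1, 0)"
      "sg (2 * c + 1, 0, 1) = (2 * c + 2, 0, 1)" by simp_all
    have "mon (2 * c + 2, 0, 1) * mon (c, 0, 0) = mon (2 * c + 1, 0, 1) * mon (c + 1, 0, 0)" unfolding mon_add[symmetric] mon_eq_iff by simp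
    moreover have "shift_S (shift_S f) = shift_S f * mon (c, 0, 0) * (1 - mon (c + 1, 0, 1)) * (1 - mon (c + 1 + 1, 1, 1))"
      using arg_cong[OF sf, of shift_S] unfolding shift_S_simps(2,4,6) shift_S_mon e .
    moreover have "x * n * v * w * (- m / d) = x * (- k / d) * l * v * w" if "m * n = k * l" for x n v w m d k l :: lseries
    proof -
      have "x * n * v * w * (- m / d) = - (x * v * w * (m * n) / d)" by simp
      then show ?thesis unfolding that by simp
    qed
    ultimately show ?thesis
      unfolding h_def shift_S_simps(2,4,5,6,8) shift_S_mon e by (simp only:)
  qed
  moreover have "snd (snd (sg p + ww)) = c + 1" using pr by simp
  ultimately show "square_E (ap LE (ap LE y))"
    unfolding y2 square_E.simps using c by simp
qed

subsection \<open>Words in the operators\<close>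

text \<open>Residues 0, 1, 2 of t stand for types 3, 1, 2, the order in which \<open>D\<close> runs
  through them, so that each \<open>D\<close> adds one to t.\<close>

definition pr :: "nat \<Rightarrow> mvec \<Rightarrow> mvec \<Rightarrow> bool" where
  "pr t x x' \<longleftrightarrow> (if t mod 3 = 0 then pair3 x x' else if t mod 3 = 1 then pair1 x x' else pair2 x x')"

lemma pr_D:
  assumes "pr t x x'" "famv x" "famv x'" shows "pr (Suc t) (ap LD x) (ap LD x')"
proof -
  note fD = famv_ap(1)[OF assms(2)] famv_ap(1)[OF assms(3)]
  note g = famv_good[OF assms(2)] famv_good[OF assms(3)] famv_good[OF fD(1)] famv_good[OF fD(2)]
  have "t mod 3 < 3" by simp
  then have "t mod 3 = 0 \<or> t mod 3 = 1 \<or> t mod 3 = 2" by linarith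
  then consider "t mod 3 = 0" "Suc t mod 3 = 1" | "t mod 3 = 1" "Suc t mod 3 = 2" | "t mod 3 = 2" "Suc t mod 3 = 0"
    by (auto simp: mod_Suc)
  then show ?thesis
    using assms(1) pair3_D[of x x'] pair1_D[of x x'] pair2_D[of x x'] g
    unfolding pr_def by cases auto
qed

abbreviation apw :: "letter list \<Rightarrow> mvec \<Rightarrow> mvec" where "apw \<equiv> foldr ap"
declare foldr_replicate [simp del]
abbreviation Ds :: "nat \<Rightarrow> letter list" where "Ds n \<equiv> replicate n LD"

lemma famv_Ds: "famv x \<Longrightarrow> famv (apw (Ds n) x)"
  by (induction n) (simp_all add: famv_ap(1))

lemma pr_Ds: "pr t x x' \<Longrightarrow> famv x \<Longrightarrow> famv x' \<Longrightarrow> pr (t + n) (apw (Ds n) x) (apw (Ds n) x')"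
  by (induction n) (simp_all add: pr_D famv_Ds)

definition AC :: "nat \<Rightarrow> nat \<Rightarrow> nat \<Rightarrow> mvec \<Rightarrow> lseries" where
  "AC k i l x = cmp k i l (ap LA x) + cmp k i l (ap LC x)"

definition BE :: "nat \<Rightarrow> nat \<Rightarrow> nat \<Rightarrow> mvec \<Rightarrow> lseries" where
  "BE k i l x = cmp k i l (ap LB x) + cmp k i l (ap LE x)"

lemma pr_AC:
  assumes "pr t x x'" "famv x" "famv x'" "(t + n) mod 3 = 0"
  shows "AC k i l (apw (Ds n) x) + AC k i l (apw (Ds n) x') = 0"
proof -
  have p: "pair3 (apw (Ds n) x) (apw (Ds n) x')" using pr_Ds[OF assms(1-3), of n] assms(4) by (simp add: pr_def)
  note g = famv_good[OF famv_Ds[OF assms(2)]] famv_good[OF famv_Ds[OF assms(3)]]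
  have z: "a + c = 0 \<Longrightarrow> b + d = 0 \<Longrightarrow> a + b + (c + d) = 0" for a b c d :: lseries by (metis add.left_commute add.assoc add_0_right)
  show ?thesis unfolding AC_def by (intro z opp_cmp pair3_AC[OF p] g) auto
qed

lemma pr_BE:
  assumes "pr t x x'" "famv x" "famv x'" "(t + n) mod 3 = 1"
  shows "BE k i l (apw (Ds n) x) + BE k i l (apw (Ds n) x') = 0"
proof -
  have p: "pair1 (apw (Ds n) x) (apw (Ds n) x')" using pr_Ds[OF assms(1-3), of n] assms(4) by (simp add: pr_def)
  note g = famv_good[OF famv_Ds[OF assms(2)]] famv_good[OF famv_Ds[OF assms(3)]]
  have z: "a + c = 0 \<Longrightarrow> b + d = 0 \<Longrightarrow> a + b + (c + d) = 0" for a b c d :: lseries by (metis add.left_commute add.assoc add_0_right)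
  show ?thesis unfolding BE_def by (intro z opp_cmp pair1_BE[OF p] g) auto
qed

section \<open>The five families of merged summands\<close>

abbreviation As :: "nat \<Rightarrow> letter list" where "As m \<equiv> replicate m LA"
abbreviation Es :: "nat \<Rightarrow> letter list" where "Es m \<equiv> replicate m LE"

text \<open>The five families at n = 0. \<open>fE m s\<close> is the merged E^(m+1) L^s v_inf, since
  \<open>yE\<close> already contains one \<open>E\<close>; \<open>gA\<close> carries m + 1 letters
  \<open>A\<close>, since \<open>vT\<close> represents a sum only under \<open>A\<close> or
  \<open>C\<close>.\<close>

definition fA :: "nat \<Rightarrow> nat \<Rightarrow> mvec" where "fA m s = apw (As m) (yB s)"
definition fC :: "nat \<Rightarrow> nat \<Rightarrow> mvec" where "fC m s = ap LC (apw (As m) (yB s))"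
definition fE :: "nat \<Rightarrow> nat \<Rightarrow> mvec" where "fE m s = apw (Es m) (yE s)"
definition gC :: "nat \<Rightarrow> nat \<Rightarrow> mvec" where "gC m s = ap LC (apw (As m) (vT s))"
definition gA :: "nat \<Rightarrow> nat \<Rightarrow> mvec" where "gA m s = ap LA (apw (As m) (vT s))"

lemma yB_ratios: "xr (yB s) = (2 * int s + 1, 0, 1)" "yr (yB s) = ww"
  and yE_ratios: "xr (yE s) = 0" "yr (yE s) = (- (2 * int s + 1), 0, 0)"
  and vT_ratios: "xr (vT s) = (- (2 * int s + 2), - 1, - 1)"
  by (simp_all add: yB_def yE_def vT_def expo_components rU_def pU_def del: shift_S_simps)

lemma vT_good: "good LA (vT s)" "good LC (vT s)"
proof -
  have e: "tt + sg (rU s) - sg (tt + sg (rU s)) = (- (2 * int s + 2), 0, 0)"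
    "sg (tt + sg (rU s)) - sg (rU s) - tt = (2 * int s + 2, 0, 0)" "sg (rU s) - (1, 0, 0) - sg (rU s) = (- 1, 0, 0)"
    by (simp_all add: expo_components rU_def pU_def)
  show "good LA (vT s)" "good LC (vT s)"
    unfolding vT_def good.simps dens.simps e by (auto simp: gd_def)
qed

lemma fA_famv: "famv (fA m s)" "x_ok (xr (fA m s))" "yr (fA m s) = ww"
proof -
  have "famv (fA m s) \<and> x_ok (xr (fA m s)) \<and> yr (fA m s) = ww"
  proof (induction m)
    case 0
    show ?case using fam.G1[of 0 "2 * int s + 1"] by (simp add: fA_def famv_def yB_ratios x_ok_def ww_def)
  next
    case (Suc m)
    then show ?case using fam_A[of "xr (fA m s)"] famv_ap(2)[of "fA m s"] by (simp add: fA_def)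
  qed
  then show "famv (fA m s)" "x_ok (xr (fA m s))" "yr (fA m s) = ww" by auto
qed

lemma vT_x_ok: "x_ok (xr (apw (As m) (vT s)))"
proof (induction m)
  case 0
  have "x_ok (- (2 * int s + 2), - 1, - 1)" unfolding x_ok_def by (intro exI[of _ "2 * int s + 2"]) auto
  then show ?case by (simp add: vT_ratios)
next
  case (Suc m)
  then show ?case using fam_A by simp
qed

lemma gA_famv: "famv (gA m s)" "yr (gA m s) = ww" "famv (gC m s)" "famv (fC m s)"
  using famv_ap(2,3)[OF vT_x_ok] famv_ap(3)[OF fA_famv(2)] by (simp_all add: gA_def gC_def fC_def fA_def)

lemma vT_As_good: "L = LA \<or> L = LC \<Longrightarrow> good L (apw (As m) (vT s))"
proof (cases m)
  case (Suc j)
  then show ?thesis using famv_good[OF gA_famv(1)[of j s]] by (simp add: gA_def)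
qed (auto simp: vT_good)

lemma fE_famv: "famv (fE m s)" "e_ok (yr (fE m s))" "xr (fE m s) = 0"
proof -
  have "famv (fE m s) \<and> e_ok (yr (fE m s)) \<and> xr (fE m s) = 0"
  proof (induction m)
    case 0
    have "fam (0, 0, 0) (- (2 * int s + 1), 0, 0)" by (rule fam.H1) auto
    moreover have "e_ok (- (2 * int s + 1), 0, 0)" unfolding e_ok_def by (intro disjI2 exI[of _ "2 * int s + 1"]) auto
    ultimately show ?case by (simp add: fE_def famv_def yE_ratios zero_prod_def)
  next
    case (Suc m)
    then show ?case using fam_E[of "yr (fE m s)"] famv_ap(5)[of "fE m s"] by (simp add: fE_def)
  qed
  then show "famv (fE m s)" "e_ok (yr (fE m s))" "xr (fE m s) = 0" by auto
qed

section \<open>Pairings among the five families\<close>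

lemma pr_fC: "pr 1 (fC m s) (ap LD (fA m s))" "pr 1 (gC (Suc m) s) (ap LD (gA m s))"
  using pair1_CD[OF famv_good famv_good, OF fA_famv(1) fA_famv(1) fA_famv(3)]
    pair1_CD[OF famv_good famv_good, OF gA_famv(1) gA_famv(1) gA_famv(2)]
  by (simp_all add: pr_def fC_def fA_def gA_def gC_def)

lemma pr_fA: "pr 2 (fA (Suc m) s) (fC m s)" "pr 2 (gA m s) (gC m s)"
  using pair2_AC[OF famv_good famv_good, OF fA_famv(1) fA_famv(1)] pair2_AC[OF vT_As_good vT_As_good]
  by (simp_all add: pr_def fC_def fA_def gA_def gC_def)

lemma pr_fE: "pr 2 (fE (Suc m) s) (ap LD (fE m s))"
  using pair2_ED[OF famv_good famv_good, OF fE_famv(1) fE_famv(1) fE_famv(3)] by (simp add: pr_def fE_def)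

lemma pr_fE_pair: "pr 0 (fE (2 * j) s) (fE (Suc (2 * j)) s)"
proof -
  have "square_E (fE (2 * j) s)"
  proof (induction j)
    case 0
    show ?case by (simp add: fE_def square_E_yE)
  next
    case (Suc j)
    then show ?case using square_E_pair3(2)[OF Suc] by (simp add: fE_def)
  qed
  then show ?thesis using square_E_pair3(1) by (simp add: pr_def fE_def)
qed

text \<open>The type 4 relation between \<open>yB s\<close> and \<open>vT s\<close> is preserved by
  \<open>A\<close>, and \<open>C\<close> turns it into type 3.\<close>

lemma pr_fC_gC: "pr 0 (fC m s) (gC m s)"
proof -
  have "pair4 (apw (As m) (yB s)) (apw (As m) (vT s))"
  proof (induction m)
    case 0
    show ?case by (simp add: pair4_yB_vT)
  next
    case (Suc m)
    then show ?case using pair4_A[OF Suc] famv_good[OF fA_famv(1)[of m s]] vT_As_good[of LA m s] by (simp add: fA_def)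
  qed
  then show ?thesis
    using pair4_C famv_good[OF fA_famv(1)[of m s]] vT_As_good[of LC m s] by (simp add: pr_def fC_def gC_def fA_def)
qed

text \<open>This pairing links s + 1 with s. It leaves the summands A^m B v_inf without a partner;
  these enter the telescoping instead.\<close>

lemma pr_fA_gA: "pr 1 (fA m (Suc s)) (gA m s)"
proof (induction m)
  case 0
  show ?case by (simp add: pr_def fA_def gA_def pair1_yB_vT)
next
  case (Suc m)
  then show ?case using pair1_A[of "fA m (Suc s)" "gA m s"] fA_famv(3) by (simp add: pr_def fA_def gA_def)
qed

subsection \<open>Degrees\<close>

text \<open>N counts one more than \<open>div_level\<close>, because the passage from
  [1, q^i z2, z2] to slots divisible by z2 gains no degree. With this offset every operator other
  than \<open>B\<close> raises N by one.\<close>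

definition reach :: "nat \<Rightarrow> mvec \<Rightarrow> bool" where
  "reach N x \<longleftrightarrow> famv x \<and> simple x \<and> (div_level (N - 1) x \<or> v_level N x)"

lemma v_level_p: "v_level N (ap L (MVec f 0 (i, 0, 1) (0, 0, 1))) \<Longrightarrow> L = LA \<or> L = LB"
  by (cases L) (auto simp: expo_components zero_prod_def tt_def)

lemma level_step:
  assumes "simple x" "div_level (N - 1) x \<or> v_level N x" "good L x" "L \<noteq> LB"
  shows "div_level N (ap L x) \<or> v_level (Suc N) (ap L x)"
  using assms(2)
proof
  assume "div_level (N - 1) x"
  then have "div_level (Suc (N - 1)) (ap L x)" using assms div_level_ap by blast
  then show ?thesis using div_level_mono[of "Suc (N - 1)" "ap L x" N] by auto
next
  assume v: "v_level N x"
  show ?thesis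
  proof (cases "L = LA")
    case True
    then show ?thesis using v_level_ap[OF assms(3) v] by auto
  next
    case False
    have "\<not> v_level N (ap L x)" using v v_level_p[of N L] False assms(4) by (cases x) auto
    then show ?thesis using v_level_ap[OF assms(3) v] False by auto
  qed
qed

lemma reach_step: "reach N x \<Longrightarrow> famv (ap L x) \<Longrightarrow> L \<noteq> LB \<Longrightarrow> reach (Suc N) (ap L x)"
  using level_step[of x N L] famv_good[of x L] simple_ap[of x L] unfolding reach_def by auto

lemma reach_B: assumes "reach N x" "famv (ap LB x)" shows "reach N (ap LB x)"
proof -
  have r: "famv x" "simple x" "div_level (N - 1) x \<or> v_level N x" using assms(1) by (auto simp: reach_def)
  note g = famv_good[OF r(1)]
  from r(3) have "div_level (N - 1) (ap LB x) \<or> v_level N (ap LB x)"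
  proof
    assume "div_level (N - 1) x"
    then have "div_level (Suc (N - 1)) (ap LB x)" using r g div_level_ap by blast
    then show ?thesis using div_level_mono[of "Suc (N - 1)" "ap LB x" "N - 1"] by auto
  next
    assume "v_level N x"
    then show ?thesis using v_level_ap[OF g, of N LB] div_level_mono[of N "ap LB x" "N - 1"] by auto
  qed
  then show ?thesis using assms(2) r g simple_ap[of x LB] unfolding reach_def by blast
qed

lemma reach_mono: "reach N x \<Longrightarrow> M \<le> N \<Longrightarrow> reach M x"
  unfolding reach_def using div_level_mono[of "N - 1" x "M - 1"] v_level_mono[of N x M] by auto

lemma reach_cmp:
  assumes "reach N x" "0 < k" "i \<le> l" "l \<le> k" shows "cmp k i l x \<in> Wt (N - 1)" "cmp k i l (ap L x) \<in> Wt (N - 1)"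
proof -
  have r: "famv x" "simple x" "div_level (N - 1) x \<or> v_level N x" using assms(1) by (auto simp: reach_def)
  then have lx: "level (N - 1) x" unfolding level_def using v_level_mono[of N x "N - 1"] by auto
  show "cmp k i l x \<in> Wt (N - 1)" by (rule level_cmp[OF lx assms(2-4)])
  show "cmp k i l (ap L x) \<in> Wt (N - 1)" by (rule level_cmp[OF level_ap[OF lx famv_good[OF r(1)]] assms(2-4)])
qed

lemma reach_Ds: "reach N x \<Longrightarrow> reach (n + N) (apw (Ds n) x)"
  by (induction n) (simp_all add: reach_step famv_ap(1)[OF famv_Ds] reach_def[of _ x])

lemma reach_As: "reach N x \<Longrightarrow> x_ok (xr x) \<Longrightarrow> reach (m + N) (apw (As m) x) \<and> x_ok (xr (apw (As m) x))"
proof (induction m)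
  case (Suc m)
  then show ?case using reach_step[of "m + N" "apw (As m) x" LA] famv_ap(2)[of "apw (As m) x"] fam_A by simp
qed simp

lemma reach_C: "reach N x \<Longrightarrow> x_ok (xr x) \<Longrightarrow> reach (Suc N) (ap LC x)"
  using reach_step[of N x LC] famv_ap(3)[of x] by simp

lemma reach_Es: "reach N x \<Longrightarrow> e_ok (yr x) \<Longrightarrow> reach (m + N) (apw (Es m) x) \<and> e_ok (yr (apw (Es m) x))"
proof (induction m)
  case (Suc m)
  then show ?case using reach_step[of "m + N" "apw (Es m) x" LE] famv_ap(5)[of "apw (Es m) x"] fam_E by simp
qed simp

lemma Uent_ok: "Uent s x \<Longrightarrow> y_ok (yr x)" "Uent s x \<Longrightarrow> e_ok (yr x)"
  using Uent_ratios(1)[of s x] unfolding y_ok_def e_ok_def by auto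

lemma reach_BDE:
  assumes "reach N x" "Uent s x" "L \<in> {LB, LD, LE}" shows "reach N (ap L x)"
  using assms reach_B[of N x] famv_ap(4)[of x] famv_ap(1)[of x] famv_ap(5)[of x] Uent_ok[of s x]
    reach_mono[of "Suc N" _ N] reach_step[of N x LD] reach_step[of N x LE]
  unfolding reach_def[of N x] by auto

lemma DBDE_x_ok:
  assumes "Uent s x" "L \<in> {LB, LD, LE}" shows "x_ok (xr (ap LD (ap L x)))"
proof -
  have "xr (ap LD (ap L x)) = (- (2 * int s + 2), - 1, - 1)"
    using assms Uent_ratios(1)[OF assms(1)] by (auto simp: expo_components)
  then show ?thesis unfolding x_ok_def by (intro exI[of _ "2 * int s + 2"]) auto
qed

lemma reach_DBDE: "reach N x \<Longrightarrow> Uent s x \<Longrightarrow> L \<in> {LB, LD, LE} \<Longrightarrow> reach (Suc N) (ap LD (ap L x))"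
  using reach_step[of N "ap L x" LD] reach_BDE[of N x s L] famv_ap(1)[of "ap L x"] by (simp add: reach_def[of _ "ap L x"])

lemma v_vec_reach: "reach n (v_vec n)"
proof -
  have "famv (v_vec n)" by (rule Uent_famv[OF Uent_v_vec])
  moreover have "simple (v_vec n)" "v_level n (v_vec n)"
    using coeff_f_Wt[of n] Wt_ring_R[OF coeff_f_Wt[of n]] by (auto simp: v_vec_def zero_prod_def)
  ultimately show ?thesis by (simp add: reach_def)
qed

lemma U_list_reach: "x \<in> set (U_list s n) \<Longrightarrow> reach (n + 2 * s) x"
proof (induction s arbitrary: x)
  case 0
  then show ?case by (simp add: v_vec_reach)
next
  case (Suc s)
  from Suc.prems obtain u M L where u: "u \<in> set (U_list s n)" and LM: "L \<in> {LB, LD, LE}" "M \<in> {LC, LD}" "x = ap M (ap LD (ap L u))"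
    by (auto simp: DBDE_def simp del: ap.simps)
  note U = U_list_Uent[OF u]
  have "reach (Suc (n + 2 * s)) (ap LD (ap L u))" by (rule reach_DBDE[OF Suc.IH[OF u] U LM(1)])
  moreover have "famv x" by (rule Uent_famv[OF U_list_Uent[OF Suc.prems]])
  ultimately have "reach (Suc (Suc (n + 2 * s))) x" using reach_step LM by auto
  then show ?case by simp
qed

subsection \<open>Merging vectors of the same shape\<close>

lemma frac_fac: "is_frac (fac L p q r)"
  by (cases L) (auto simp: fac_def intro!: frac_intros)

lemma frac_shift_S_pow: "is_frac f \<Longrightarrow> is_frac ((shift_S ^^ n) f)"
  by (induction n) (auto intro: frac_shift_S)

lemma shift_S_pow_mult: "(shift_S ^^ n) (f * g) = (shift_S ^^ n) f * (shift_S ^^ n) g"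
  and shift_S_pow_add: "(shift_S ^^ n) (f + g) = (shift_S ^^ n) f + (shift_S ^^ n) g"
  and shift_S_pow_0: "(shift_S ^^ n) 0 = 0"
  by (induction n) simp_all

lemma fsums_shift_S_pow: "fsums f s \<Longrightarrow> fsums (\<lambda>i. (shift_S ^^ n) (f i)) ((shift_S ^^ n) s)"
  by (induction n) (auto intro: fsums_shift_S)

text \<open>A letter applies \<open>S\<close> to the scalar and multiplies it by a factor that
  depends on the slots alone. Vectors with equal slots may therefore be summed before a word is
  applied to them.\<close>

lemma cmp_apw:
  "\<exists>g. is_frac g \<and> (\<forall>f. cmp k i l (apw W (MVec f p q r)) = (shift_S ^^ length W) f * g)"
proof (induction W arbitrary: p q r rule: rev_induct)
  case Nil
  show ?case by (intro exI[of _ "mon p ^ (k - l) * mon q ^ (l - i) * mon r ^ i"]) (auto intro!: frac_intros)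
next
  case (snoc L W)
  obtain g where g: "is_frac g"
    "\<And>f. cmp k i l (apw W (MVec f (new_p L p q r) (new_q L p q r) (sg p + ww))) = (shift_S ^^ length W) f * g"
    using snoc by blast
  let ?h = "(shift_S ^^ length W) (shift_S (fac L p q r)) * g"
  have "cmp k i l (apw (W @ [L]) (MVec f p q r)) = (shift_S ^^ length (W @ [L])) f * ?h" for f
  proof -
    have "(shift_S ^^ length (W @ [L])) f = (shift_S ^^ length W) (shift_S f)" by (simp add: funpow_swap1)
    then show ?thesis by (simp add: g(2) shift_S_pow_mult mult.assoc)
  qed
  moreover have "is_frac ?h" by (intro frac_intros frac_shift_S_pow frac_shift_S frac_fac g(1))
  ultimately show ?case by blast
qed

lemma merge:
  assumes s: "fsums (\<lambda>n. \<Sum>y\<leftarrow>ys n. scal y) b" and sh: "\<And>n y. y \<in> set (ys n) \<Longrightarrow> y = MVec (scal y) p q r"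
  shows "fsums (\<lambda>n. \<Sum>y\<leftarrow>ys n. cmp k i l (apw W y)) (cmp k i l (apw W (MVec b p q r)))"
proof -
  obtain g where g: "is_frac g" "\<And>f. cmp k i l (apw W (MVec f p q r)) = (shift_S ^^ length W) f * g"
    using cmp_apw by blast
  have "(\<Sum>y\<leftarrow>xs. cmp k i l (apw W y)) = g * (shift_S ^^ length W) (\<Sum>y\<leftarrow>xs. scal y)"
    if "\<And>y. y \<in> set xs \<Longrightarrow> y = MVec (scal y) p q r" for xs
    using that
  proof (induction xs)
    case (Cons y xs)
    have "y = MVec (scal y) p q r" by (rule Cons.prems) simp
    then have "cmp k i l (apw W y) = (shift_S ^^ length W) (scal y) * g" using g(2)[of "scal y"] by metis
    then show ?case using Cons by (simp add: shift_S_pow_add algebra_simps)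
  qed (simp add: shift_S_pow_0)
  then have "(\<Sum>y\<leftarrow>ys n. cmp k i l (apw W y)) = g * (shift_S ^^ length W) (\<Sum>y\<leftarrow>ys n. scal y)" for n
    using sh by blast
  moreover have "fsums (\<lambda>n. g * (shift_S ^^ length W) (\<Sum>y\<leftarrow>ys n. scal y)) (g * (shift_S ^^ length W) b)"
    by (intro fsums_mult fsums_shift_S_pow s g(1))
  ultimately show ?thesis unfolding g(2) by (simp add: mult.commute)
qed

lemma sum_list_scale_shift:
  fixes h :: "mvec \<Rightarrow> lseries"
  shows "(\<Sum>x\<leftarrow>xs. shift_S (c * h x)) = shift_S (c * (\<Sum>x\<leftarrow>xs. h x))"
    "(\<Sum>x\<leftarrow>xs. c * h x) = c * (\<Sum>x\<leftarrow>xs. h x)"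
    "(\<Sum>x\<leftarrow>xs. shift_S (h x)) = shift_S (\<Sum>x\<leftarrow>xs. h x)"
  by (induction xs) (simp_all add: distrib_left)

lemma merge_B:
  "fsums (\<lambda>n. \<Sum>y\<leftarrow>map (ap LB) (U_list s n). cmp k i l (apw W y)) (cmp k i l (apw W (yB s)))"
  unfolding yB_def
proof (rule merge)
  have e: "scal (ap LB x) = shift_S (1 / (1 - mon (2 * int s, 0, 1)) * Bf 0 x)" if x: "Uent s x" for x
  proof -
    obtain f p q r where v: "x = MVec f p q r" by (cases x)
    have "r - p = (2 * int s, 0, 1)" using Uent_ratios(1)[OF x] by (simp add: v)
    then show ?thesis by (simp add: v fac_def mult_ac del: shift_S_simps)
  qed
  have "(\<Sum>y\<leftarrow>map (ap LB) (U_list s n). scal y) = shift_S (1 / (1 - mon (2 * int s, 0, 1)) * (\<Sum>x\<leftarrow>U_list s n. Bf 0 x))" for n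
    unfolding list.map_comp comp_def sum_list_scale_shift(1)[symmetric]
    by (intro arg_cong[of _ _ sum_list] map_cong refl e U_list_Uent)
  moreover have "fsums (\<lambda>n. shift_S (1 / (1 - mon (2 * int s, 0, 1)) * (\<Sum>x\<leftarrow>U_list s n. Bf 0 x))) (shift_S (1 / (1 - mon (2 * int s, 0, 1)) * BB 0 s))"
    by (intro fsums_shift_S fsums_mult fsums_BB ok_params frac_intros)
  ultimately show "fsums (\<lambda>n. \<Sum>y\<leftarrow>map (ap LB) (U_list s n). scal y) (shift_S (BB 0 s / (1 - mon (2 * int s, 0, 1))))"
    by (simp del: shift_S_simps)
  fix n y assume "y \<in> set (map (ap LB) (U_list s n))"
  then obtain x where "x \<in> set (U_list s n)" and y: "y = ap LB x" by auto
  then have "Uent s x" by (intro U_list_Uent)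
  then show "y = MVec (scal y) (sg (pU s)) (sg (rU s)) (sg (pU s) + ww)" unfolding y by (cases x) auto
qed

lemma merge_E:
  "fsums (\<lambda>n. \<Sum>y\<leftarrow>map (ap LE) (U_list s n). cmp k i l (apw W y)) (cmp k i l (apw W (yE s)))"
  unfolding yE_def
proof (rule merge)
  have e: "scal (ap LE x) = shift_S (1 / (1 - mon (- 2 * int s, 0, - 1)) * Bf (2 * int s, 0, 1) x)" if x: "Uent s x" for x
  proof -
    obtain f p q r where v: "x = MVec f p q r" by (cases x)
    have y: "r - p = (2 * int s, 0, 1)" using Uent_ratios(1)[OF x] by (simp add: v)
    then have "p - r = - (2 * int s, 0, 1)" by (metis minus_diff_eq)
    then have e1: "p - r = (- 2 * int s, 0, - 1)" by simp
    \<comment> \<open>For \<kappa> = R/P the second denominator of \<open>Bf\<close> becomes its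
      numerator 1 - Q/P, and the first becomes the denominator 1 - tQ/R of \<open>E\<close>.\<close>
    have e: "tt + q - p - (2 * int s, 0, 1) = tt + q - r" "q - r + (2 * int s, 0, 1) = q - p"
      unfolding y[symmetric] by simp_all
    have "xU s (q - p)" using Uent_ratios(2)[OF x] by (simp add: v)
    then have "q - p \<noteq> 0" unfolding xU_def by (elim disjE exE conjE) (simp_all add: expo_neq_0)
    then have nz: "1 - mon (q - p) \<noteq> 0" by (rule mon_gen_nonzero)
    have "f * fac LE p q r = 1 / (1 - mon (- 2 * int s, 0, - 1)) * (f * (1 - mon (q - p)) / ((1 - mon (tt + q - r)) * (1 - mon (q - p))))"
      unfolding fac_def numer.simps dens.simps list.map prod_list.Cons prod_list.Nil e1 using nz by (simp add: mult_ac)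
    then show ?thesis unfolding v ap.simps mvec.sel Bf.simps e by (simp only:)
  qed
  have "(\<Sum>y\<leftarrow>map (ap LE) (U_list s n). scal y) = shift_S (1 / (1 - mon (- 2 * int s, 0, - 1)) * (\<Sum>x\<leftarrow>U_list s n. Bf (2 * int s, 0, 1) x))" for n
    unfolding list.map_comp comp_def sum_list_scale_shift(1)[symmetric]
    by (intro arg_cong[of _ _ sum_list] map_cong refl e U_list_Uent)
  moreover have "fsums (\<lambda>n. shift_S (1 / (1 - mon (- 2 * int s, 0, - 1)) * (\<Sum>x\<leftarrow>U_list s n. Bf (2 * int s, 0, 1) x)))
      (shift_S (1 / (1 - mon (- 2 * int s, 0, - 1)) * BB (2 * int s, 0, 1) s))"
    by (intro fsums_shift_S fsums_mult fsums_BB ok_params frac_intros)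
  ultimately show "fsums (\<lambda>n. \<Sum>y\<leftarrow>map (ap LE) (U_list s n). scal y) (shift_S (BB (2 * int s, 0, 1) s / (1 - mon (- 2 * int s, 0, - 1))))"
    by (simp del: shift_S_simps)
  fix n y assume "y \<in> set (map (ap LE) (U_list s n))"
  then obtain x where "x \<in> set (U_list s n)" and y: "y = ap LE x" by auto
  then have "Uent s x" by (intro U_list_Uent)
  then show "y = MVec (scal y) (sg (rU s)) (sg (rU s)) (sg (pU s) + ww)" unfolding y by (cases x) auto
qed

text \<open>\<open>A\<close> and \<open>C\<close> see the entry \<open>R\<close> only through the factor \<open>1 / (1 - R/Q)\<close>, so it can be normalized.\<close>

fun repl :: "mvec \<Rightarrow> mvec" where
  "repl (MVec f p q r) = MVec ((1 - mon (- 1, 0, 0)) * (f / (1 - mon (r - q)))) p q (q - (1, 0, 0))"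

lemma ap_repl: "L = LA \<or> L = LC \<Longrightarrow> ap L (repl y) = ap L y"
proof (cases y)
  case (MVec f p q r)
  assume L: "L = LA \<or> L = LC"
  have nz: "1 - mon (- 1, 0, 0) \<noteq> 0" by (rule mon_gen_nonzero) (simp add: expo_neq_0)
  have e: "q - (1, 0, 0) - q = (- 1, 0, 0)" by (simp add: expo_components)
  have "(1 - mon (- 1, 0, 0)) * (f / (1 - mon (r - q))) * fac L p q (q - (1, 0, 0)) = f * fac L p q r"
    using L nz by (auto simp: fac_def e)
  then show ?thesis using L by (auto simp: MVec simp del: shift_S_simps)
qed

text \<open>\<open>repl\<close> divides the scalar of the image by its 1 - R/Q. Together with the
  denominator 1 - P/(tQ) of \<open>D\<close> this is \<open>Hf\<close> at q^-1; the other two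
  denominators depend only on s and form \<open>cT\<close>.\<close>

lemma scal_repl_D:
  assumes x: "Uent s x" and L: "L \<in> {LB, LD, LE}"
  shows "scal (repl (ap LD (ap L x))) = (1 - mon (- 1, 0, 0)) * shift_S (cT s * Hf (- 1, 0, 0) (ap L x))"
    "\<exists>f. repl (ap LD (ap L x)) = MVec f (sg (tt + sg (rU s))) (sg (rU s)) (sg (rU s) - (1, 0, 0))"
proof -
  obtain f p q r where v: "x = MVec f p q r" by (cases x)
  obtain F P Q R where y: "ap L x = MVec F P Q R" by (cases "ap L x")
  have pr: "p = pU s" "r = rU s" using x by (auto simp: v)
  have QR: "Q = sg (rU s)" "R = sg (pU s) + ww" using y L unfolding v pr by auto
  have e: "P - R + ww - (- 1, 0, 0) - (2, 0, 0) = P - R + ww - (1, 0, 0)" "P - Q - tt + (- 1, 0, 0) + (1, 0, 0) = P - Q - tt"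
    "sg P + ww - sg R = sg (P - R + ww - (1, 0, 0))" "R - Q - tt = (- 2 * int s - 1, - 1, - 1)" "Q - R = (2 * int s + 1, 0, 0)"
    by (simp_all add: expo_components QR rU_def pU_def)
  have "shift_S (F * fac LD P Q R) / (1 - mon (sg P + ww - sg R)) = shift_S (cT s * Hf (- 1, 0, 0) (MVec F P Q R))"
    unfolding fac_def numer.simps dens.simps list.map prod_list.Cons prod_list.Nil cT_def Hf.simps e
    by (simp add: shift_S_mon mult_ac)
  then show "scal (repl (ap LD (ap L x))) = (1 - mon (- 1, 0, 0)) * shift_S (cT s * Hf (- 1, 0, 0) (ap L x))"
    unfolding y by (simp only: ap.simps repl.simps mvec.sel new_q.simps)
  have "sg R = sg (rU s)" by (simp add: expo_components QR rU_def pU_def)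
  then show "\<exists>f. repl (ap LD (ap L x)) = MVec f (sg (tt + sg (rU s))) (sg (rU s)) (sg (rU s) - (1, 0, 0))"
    unfolding y by (simp add: QR del: shift_S_simps)
qed

lemma scal_repl_sum:
  assumes x: "Uent s x"
  shows "scal (repl (ap LD (ap LB x))) + scal (repl (ap LD (ap LD x))) + scal (repl (ap LD (ap LE x))) =
    (1 - mon (- 1, 0, 0)) * shift_S (cT s * shift_S (KK (1, 0, 0) (2 * int s, 0, 1) * Bf (1, 0, 0) x))"
proof -
  obtain f p q r where v: "x = MVec f p q r" by (cases x)
  have y: "r - p = (2 * int s, 0, 1)" "xU s (q - p)" using Uent_ratios[OF x] by (simp_all add: v)
  then obtain x' where q: "q = p + x'" and r: "r = p + (2 * int s, 0, 1)" and xU: "xU s x'"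
    using that[of "q - p"] by (simp add: algebra_simps)
  obtain x1 x2 x3 where x': "x' = (x1, x2, x3)" by (cases x')
  have xc: "x2 = 0 \<and> x3 = 1 \<and> 2 * int s < x1 \<or> x2 = - 1 \<and> x3 = - 1 \<and> x1 \<le> - 1 \<or> x2 = - 1 \<and> x3 = 0 \<and> 1 \<le> x1 \<and> x1 < 2 * int s"
    using xU unfolding xU_def x' by (elim disjE exE conjE) simp_all
  have "Hf (- 1, 0, 0) (ap LB x) + Hf (- 1, 0, 0) (ap LD x) + Hf (- 1, 0, 0) (ap LE x) = shift_S (KK (1, 0, 0) (r - p) * Bf (1, 0, 0) x)"
  proof (rule BDE_sum[OF famv_good[OF Uent_famv[OF x]] v])
    show "(1, 0, 0) \<noteq> (0 :: expo)" "(1, 0, 0) \<noteq> tt + (r - p)" "r - p - (1, 0, 0) \<noteq> 0" "(1, 0, 0) \<noteq> tt"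
      "tt + q - p - (1, 0, 0) \<noteq> 0" "q - r + (1, 0, 0) \<noteq> 0"
      using xc unfolding r q by (elim disjE; simp add: expo_components x')+
  qed (simp add: expo_components)
  then have H: "Hf (- 1, 0, 0) (ap LB x) + Hf (- 1, 0, 0) (ap LD x) + Hf (- 1, 0, 0) (ap LE x) =
      shift_S (KK (1, 0, 0) (2 * int s, 0, 1) * Bf (1, 0, 0) x)" unfolding y .
  show ?thesis
    unfolding H[symmetric] using scal_repl_D(1)[OF x, of LB] scal_repl_D(1)[OF x, of LD] scal_repl_D(1)[OF x, of LE]
    by (simp add: distrib_left del: ap.simps)
qed

lemma sum_list_DBDE:
  fixes g :: "mvec \<Rightarrow> lseries"
  shows "(\<Sum>y\<leftarrow>DBDE xs. g y) = (\<Sum>x\<leftarrow>xs. g (ap LD (ap LB x)) + g (ap LD (ap LD x)) + g (ap LD (ap LE x)))"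
  unfolding DBDE_def by (induction xs) (simp_all add: add_ac del: ap.simps)

lemma merge_T:
  assumes "L = LA \<or> L = LC"
  shows "fsums (\<lambda>n. \<Sum>y\<leftarrow>DBDE (U_list s n). cmp k i l (apw (W @ [L]) y)) (cmp k i l (apw (W @ [L]) (vT s)))"
proof -
  have "fsums (\<lambda>n. \<Sum>y\<leftarrow>map repl (DBDE (U_list s n)). cmp k i l (apw (W @ [L]) y)) (cmp k i l (apw (W @ [L]) (vT s)))"
    unfolding vT_def
  proof (rule merge)
    have "(\<Sum>y\<leftarrow>map repl (DBDE (U_list s n)). scal y) =
        (1 - mon (- 1, 0, 0)) * shift_S (cT s * shift_S (KK (1, 0, 0) (2 * int s, 0, 1) * (\<Sum>x\<leftarrow>U_list s n. Bf (1, 0, 0) x)))" for n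
    proof -
      have "(\<Sum>y\<leftarrow>map repl (DBDE (U_list s n)). scal y) =
          (\<Sum>x\<leftarrow>U_list s n. (1 - mon (- 1, 0, 0)) * shift_S (cT s * shift_S (KK (1, 0, 0) (2 * int s, 0, 1) * Bf (1, 0, 0) x)))"
        unfolding list.map_comp comp_def sum_list_DBDE
        by (intro arg_cong[of _ _ sum_list] map_cong refl scal_repl_sum U_list_Uent)
      then show ?thesis unfolding sum_list_scale_shift .
    qed
    moreover have "fsums (\<lambda>n. (1 - mon (- 1, 0, 0)) * shift_S (cT s * shift_S (KK (1, 0, 0) (2 * int s, 0, 1) * (\<Sum>x\<leftarrow>U_list s n. Bf (1, 0, 0) x))))
        ((1 - mon (- 1, 0, 0)) * WT s)"
      unfolding WT_def cT_def by (intro fsums_mult fsums_shift_S fsums_BB ok_params frac_intros frac_KK)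
    ultimately show "fsums (\<lambda>n. \<Sum>y\<leftarrow>map repl (DBDE (U_list s n)). scal y) ((1 - mon (- 1, 0, 0)) * WT s)" by simp
    fix n y assume "y \<in> set (map repl (DBDE (U_list s n)))"
    then obtain x M where "x \<in> set (U_list s n)" "M \<in> {LB, LD, LE}" "y = repl (ap LD (ap M x))"
      by (auto simp: DBDE_def simp del: ap.simps)
    then show "y = MVec (scal y) (sg (tt + sg (rU s))) (sg (rU s)) (sg (rU s) - (1, 0, 0))"
      using scal_repl_D(2)[OF U_list_Uent, of x s n M] by auto
  qed
  then show ?thesis using ap_repl[OF assms] by (simp add: comp_def del: ap.simps)
qed

text \<open>The bound n + N - 1 gives summability over the entries of L^s v_inf and, through
  \<open>merged_Wt\<close>, also a degree bound for the merged vector.\<close>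

definition merged :: "nat \<Rightarrow> nat \<Rightarrow> nat \<Rightarrow> (nat \<Rightarrow> mvec list) \<Rightarrow> letter list \<Rightarrow> mvec \<Rightarrow> nat \<Rightarrow> bool" where
  "merged k i l ys W y N \<longleftrightarrow> (\<forall>n. \<forall>z\<in>set (ys n). cmp k i l (apw W z) \<in> Wt (n + N - 1)) \<and>
     fs (\<lambda>n. \<Sum>z\<leftarrow>ys n. cmp k i l (apw W z)) = cmp k i l (apw W y)"

lemma list_lf:
  assumes "\<And>n z. z \<in> set (ys n) \<Longrightarrow> f z \<in> Wt (n + N - 1)" shows "lf (\<lambda>n. \<Sum>z\<leftarrow>ys n. f z)"
proof (rule lfI)
  show "(\<Sum>z\<leftarrow>ys n. f z) \<in> Wt (n + N - 1)" for n using assms by (intro Wt_sum_list)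
  have "{n. n + N - 1 < M} \<subseteq> {..M}" for M by auto
  then show "finite {n. n + N - 1 < M}" for M by (rule finite_subset) simp
qed

lemma merged_lf: "merged k i l ys W y N \<Longrightarrow> lf (\<lambda>n. \<Sum>z\<leftarrow>ys n. cmp k i l (apw W z))"
  unfolding merged_def by (intro list_lf[of ys _ N]) auto

lemma merged_Wt: assumes "merged k i l ys W y N" shows "cmp k i l (apw W y) \<in> Wt (N - 1)"
proof -
  have "(\<Sum>z\<leftarrow>ys n. cmp k i l (apw W z)) \<in> Wt (N - 1)" for n
  proof (rule Wt_sum_list)
    fix z assume "z \<in> set (ys n)"
    then have "cmp k i l (apw W z) \<in> Wt (n + N - 1)" using assms by (simp add: merged_def)
    then show "cmp k i l (apw W z) \<in> Wt (N - 1)" by (rule Wt_mono) simp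
  qed
  from fs_Wt[OF merged_lf[OF assms] this] show ?thesis using assms by (simp add: merged_def)
qed

lemma mergedI:
  assumes "fsums (\<lambda>n. \<Sum>z\<leftarrow>ys n. cmp k i l (apw W z)) (cmp k i l (apw W y))"
    and "\<And>n z. z \<in> set (ys n) \<Longrightarrow> cmp k i l (apw W z) \<in> Wt (n + N - 1)"
  shows "merged k i l ys W y N"
  unfolding merged_def using assms fsums_fs[OF assms(1) list_lf[of ys _ N]] by auto

section \<open>Merged words, one component at a time\<close>

locale indices = fixes k i l :: nat assumes k: "0 < k" and il: "i \<le> l" "l \<le> k"
begin

text \<open>V is an optional last letter, so that a summand and its image under one further operator
  are covered by the same statement with the same bound.\<close>

lemma reach_word:
  assumes "reach N x" "V = [] \<or> V = [L]" "M \<le> n + N - 1" shows "cmp k i l (apw (V @ Ds n) x) \<in> Wt M"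
  using assms(2)
proof
  assume "V = []"
  then show ?thesis using Wt_mono[OF reach_cmp(1)[OF reach_Ds[OF assms(1)] k il] assms(3)] by simp
next
  assume "V = [L]"
  then show ?thesis using Wt_mono[OF reach_cmp(2)[OF reach_Ds[OF assms(1)] k il] assms(3)] by simp
qed

lemma reach_A_word:
  assumes "reach N x" "x_ok (xr x)" "V = [] \<or> V = [L]" "M \<le> n + m + N - 1"
  shows "cmp k i l (apw (V @ Ds n @ As m) x) \<in> Wt M"
  using reach_word[OF reach_As[OF assms(1,2), of m, THEN conjunct1] assms(3), of M n] assms(4) by (simp add: add.assoc del: ap.simps)

lemma reach_C_word:
  assumes "reach N x" "x_ok (xr x)" "V = [] \<or> V = [L]" "M \<le> n + m + N - 1"
  shows "cmp k i l (apw (V @ Ds n @ LC # As m) x) \<in> Wt M"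
  using reach_word[OF reach_C assms(3), of "m + N" "apw (As m) x" M n] reach_As[OF assms(1,2), of m] assms(4)
  by (simp add: add.assoc del: ap.simps)

lemma reach_E_word:
  assumes "reach N x" "e_ok (yr x)" "V = [] \<or> V = [L]" "M \<le> n + m + N - 1"
  shows "cmp k i l (apw (V @ Ds n @ Es m) x) \<in> Wt M"
  using reach_word[OF reach_Es[OF assms(1,2), of m, THEN conjunct1] assms(3), of M n] assms(4) by (simp add: add.assoc del: ap.simps)

lemma list_B: assumes "z \<in> set (map (ap LB) (U_list s n))" shows "reach (n + 2 * s) z" "x_ok (xr z)"
proof -
  obtain x where x: "x \<in> set (U_list s n)" "z = ap LB x" using assms by auto
  note U = U_list_Uent[OF x(1)]
  show "reach (n + 2 * s) z" unfolding x(2) by (rule reach_BDE[OF U_list_reach[OF x(1)] U]) simp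
  show "x_ok (xr z)" unfolding x(2) using fam_B[OF Uent_ok(1)[OF U]] by simp
qed

lemma list_E: assumes "z \<in> set (map (ap LE) (U_list s n))" shows "reach (n + 2 * s) z" "e_ok (yr z)"
proof -
  obtain x where x: "x \<in> set (U_list s n)" "z = ap LE x" using assms by auto
  note U = U_list_Uent[OF x(1)]
  show "reach (n + 2 * s) z" unfolding x(2) by (rule reach_BDE[OF U_list_reach[OF x(1)] U]) simp
  show "e_ok (yr z)" unfolding x(2) using fam_E[OF Uent_ok(2)[OF U]] by simp
qed

lemma list_T: assumes "z \<in> set (DBDE (U_list s n))" shows "reach (n + 2 * s) z" "x_ok (xr z)"
proof -
  obtain x M where x: "x \<in> set (U_list s n)" "M \<in> {LB, LD, LE}" "z = ap LD (ap M x)"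
    using assms by (auto simp: DBDE_def simp del: ap.simps)
  note U = U_list_Uent[OF x(1)]
  show "reach (n + 2 * s) z" unfolding x(3) using reach_DBDE[OF U_list_reach[OF x(1)] U x(2)] by (rule reach_mono) simp
  show "x_ok (xr z)" unfolding x(3) by (rule DBDE_x_ok[OF U x(2)])
qed

lemma merged_fA: assumes "V = [] \<or> V = [L]"
  shows "merged k i l (\<lambda>n. map (ap LB) (U_list s n)) (V @ Ds n @ As m) (yB s) (n + m + 2 * s)"
  by (intro mergedI merge_B reach_A_word[OF list_B assms]) (auto simp del: ap.simps)

lemma merged_fC: assumes "V = [] \<or> V = [L]"
  shows "merged k i l (\<lambda>n. map (ap LB) (U_list s n)) (V @ Ds n @ LC # As m) (yB s) (n + m + 2 * s)"
  by (intro mergedI merge_B reach_C_word[OF list_B assms]) (auto simp del: ap.simps)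

lemma merged_fE: assumes "V = [] \<or> V = [L]"
  shows "merged k i l (\<lambda>n. map (ap LE) (U_list s n)) (V @ Ds n @ Es m) (yE s) (n + m + 2 * s)"
  by (intro mergedI merge_E reach_E_word[OF list_E assms]) (auto simp del: ap.simps)

lemma merge_T': "W \<noteq> [] \<Longrightarrow> last W \<in> {LA, LC} \<Longrightarrow>
  fsums (\<lambda>n. \<Sum>y\<leftarrow>DBDE (U_list s n). cmp k i l (apw W y)) (cmp k i l (apw W (vT s)))"
  using merge_T[where L = "last W" and W = "butlast W"] by (simp del: foldr_append)

lemma last_word: "last (V @ Ds n @ L # As m) = (if m = 0 then L else LA)"
  by (cases m) auto

lemma merged_gC: assumes "V = [] \<or> V = [L]"
  shows "merged k i l (\<lambda>n. DBDE (U_list s n)) (V @ Ds n @ LC # As m) (vT s) (n + m + 2 * s)"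
  using last_word[of V n LC m]
  by (intro mergedI merge_T' reach_C_word[OF list_T assms]) (auto simp del: ap.simps)

lemma merged_gA: assumes "V = [] \<or> V = [L]"
  shows "merged k i l (\<lambda>n. DBDE (U_list s n)) (V @ Ds n @ As (Suc m)) (vT s) (n + m + 2 * s)"
proof (intro mergedI merge_T')
  show "V @ Ds n @ As (Suc m) \<noteq> []" by simp
  show "last (V @ Ds n @ As (Suc m)) \<in> {LA, LC}" using last_word[of V n LA m] by simp
  show "cmp k i l (apw (V @ Ds n @ As (Suc m)) z) \<in> Wt (n' + (n + m + 2 * s) - 1)" if "z \<in> set (DBDE (U_list s n'))" for n' z
    by (rule reach_A_word[OF list_T[OF that] assms]) simp
qed

end

subsection \<open>The vectors \<open>A\<^sup>m B v\<^sub>\<infinity>\<close>\<close>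

lemma BB_0: "BB 0 0 = 1 / (qpoch_inf qq * qpoch_inf (qq * XX))"
proof -
  have "term_v 0 n = GG_term n" for n
  proof -
    have "qq ^ (2 * Suc n) * XX = mon (2 * int n + 2, 1, 2)" "int n + 2 - 1 = int n + 1"
      unfolding qq_power_mon XX_mon mon_add[symmetric] by (simp_all add: algebra_simps)
    then show ?thesis unfolding term_v_def GG_term_def by (simp only: diff_zero add_0_right)
  qed
  then have "term_v 0 = GG_term" ..
  then have "fsums (term_v 0) (1 / (qpoch_inf qq * qpoch_inf (qq * XX)))" using fsums_GG_term by (simp only:)
  then show ?thesis using fsums_unique[OF fsums_BB_0[OF ok_params(1)]] by blast
qed

lemma coeff_f_mon: "coeff_f (Suc n) = GG n * (1 - mon (2 * int n + 2, 1, 2)) / (1 - mon (int n + 1, 0, 1))"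
proof -
  have "qq ^ (2 * Suc n) * XX = mon (2 * int n + 2, 1, 2)" "qq ^ Suc n * zz2 = mon (int n + 1, 0, 1)"
    unfolding qq_power_mon XX_mon zz2_mon mon_add[symmetric] by (simp_all add: algebra_simps)
  then show ?thesis unfolding coeff_f_GG by (simp only:)
qed

text \<open>By the closed form \<open>BB_0\<close>, B v_inf is the first summand of v_inf. Together
  with \<open>A_v_vec\<close>, the sum of A^m B v_inf over m is v_inf again, which closes the
  telescoping at s = 0.\<close>

lemma yB_0: "yB 0 = v_vec 0"
proof -
  have nz: "1 - mon (3, 1, 2) \<noteq> 0" "1 - mon (1, 0, 0) \<noteq> 0" by (rule mon_gen_nonzero, simp add: expo_neq_0)+
  have "qq ^ Suc 0 * XX = mon (1, 1, 2)" unfolding XX_mon qq_power_mon mon_add[symmetric] by simp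
  then have "BB 0 0 = GG 0 / (1 - mon (1, 1, 2))" unfolding BB_0 using GG_0 by (simp only:)
  then have "shift_S (BB 0 0) = shift_S (GG 0) / (1 - mon (3, 1, 2))" by (simp add: shift_S_mon)
  also have "\<dots> = GG (Suc 0) * (1 - mon (- 1, 0, 0))" unfolding shift_S_GG using nz by simp
  also have "GG (Suc 0) = - GG 0 * mon (1, 0, 0) * (1 - mon (2, 1, 2)) / (1 - mon (1, 0, 0))"
  proof -
    have "qq ^ (0 + 2) * XX = mon (2, 1, 2)" "qq ^ Suc 0 = mon (1, 0, 0)" unfolding XX_mon qq_power_mon mon_add[symmetric] by simp_all
    then show ?thesis using GG_Suc[of 0] by (simp only:)
  qed
  also have "1 - mon (- 1, 0, 0) = - (mon (- 1, 0, 0) * (1 - mon (1, 0, 0)))" by (rule mon_flip) simp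
  also have "- GG 0 * mon (1, 0, 0) * (1 - mon (2, 1, 2)) / (1 - mon (1, 0, 0)) * - (mon (- 1, 0, 0) * (1 - mon (1, 0, 0))) =
      GG 0 * (1 - mon (2, 1, 2)) * (mon (1, 0, 0) * mon (- 1, 0, 0))" using nz by simp
  also have "mon (1, 0, 0) * mon (- 1, 0, 0) = 1" unfolding mon_add[symmetric] by (simp flip: zero_prod_def)
  finally have "scal (yB 0) = coeff_f (Suc 0)" unfolding scal_yB coeff_f_mon by simp
  then show ?thesis by (simp add: yB_def v_vec_def pU_def rU_def ww_def zero_prod_def del: shift_S_simps)
qed

lemma A_v_vec: "ap LA (v_vec n) = v_vec (Suc n)"
proof -
  have e: "tt + (int n + 1, 0, 1) - 0 = (int n + 1, 1, 2)" "(0, 0, 1) - (int n + 1, 0, 1) = ((- int n - 1, 0, 0) :: expo)"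
    "sg (int n + 1, 1, 2) = (int n + 3, 1, 2)" "sg (- int n - 1, 0, 0) = (- int n - 1, 0, 0)" "sg (2 * int n + 2, 1, 2) = (2 * int n + 4, 1, 2)"
    "sg (int n + 1, 0, 1) = (int n + 2, 0, 1)"
    by (simp_all add: expo_components)
  have e': "(2 * int (Suc n) + 2, 1, 2) = (2 * int n + 4, 1, 2 :: int)" "(int (Suc n) + 1, 0, 1) = (int n + 2, 0, 1 :: int)" by simp_all
  have nz: "1 - mon (int n + 3, 1, 2) \<noteq> 0" "1 - mon (- int n - 1, 0, 0) \<noteq> 0" by (rule mon_gen_nonzero, simp add: expo_neq_0)+
  have "shift_S (coeff_f (Suc n) * fac LA 0 (int n + 1, 0, 1) (0, 0, 1)) = coeff_f (Suc (Suc n))"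
    unfolding fac_def numer.simps dens.simps list.map prod_list.Cons prod_list.Nil e coeff_f_mon shift_S_simps(2,4,6,8) shift_S_mon e e' shift_S_GG
    using nz by simp
  then show ?thesis unfolding v_vec_def ap.simps by (simp add: sg_0 ww_def zero_prod_def del: shift_S_simps)
qed

lemma fA_0: "fA m 0 = v_vec m"
  by (induction m) (simp_all add: fA_def yB_0 A_v_vec)

subsection \<open>The cancellation\<close>

text \<open>\<open>A\<close>, \<open>C\<close>, \<open>E\<close>, \<open>H\<close>, \<open>G\<close>
  stand for sums over m and s of values on \<open>fA\<close>, \<open>fC\<close>, \<open>fE\<close>,
  \<open>gC\<close>, \<open>gA\<close>; a suffix z restricts to m = 0, sz to s = 0. In a block of
  three consecutive n all but such boundary sums cancels, \<open>E\<close> partly across blocks, and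
  the recursion for \<open>U\<close> adds the boundary sums to U (3 j) - U (3 j + 3).\<close>

lemma telescope3:
  fixes A C E H G U Az Asz Ez Hz :: "nat \<Rightarrow> 'g :: ab_group_add"
  assumes "\<And>j. C (3 * j) + A (3 * j + 1) = 0" "\<And>j. H (3 * j) - Hz (3 * j) + G (3 * j + 1) = 0"
    "\<And>j. A (3 * j) - Asz (3 * j) + G (3 * j) = 0"
    "\<And>j. E (3 * j + 1) = 0" "\<And>j. C (3 * j + 1) + H (3 * j + 1) = 0"
    "\<And>j. A (3 * j + 2) - Az (3 * j + 2) + C (3 * j + 2) = 0" "\<And>j. G (3 * j + 2) + H (3 * j + 2) = 0"
    "\<And>j. E (3 * j + 2) - Ez (3 * j + 2) + E (3 * j + 3) = 0"
    and U: "\<And>n. U n - Asz n = Hz n + Az (n + 2) + Ez (n + 2) + U (n + 3)"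
  shows "(\<Sum>n<3 * N. A n + C n + E n + H n + G n) = U 0 + E 0 - U (3 * N) - E (3 * N)"
proof (induction N)
  case (Suc N)
  have e: "Asz (3 * N) + Hz (3 * N) + Az (3 * N + 2) + Ez (3 * N + 2) = U (3 * N) - U (3 * N + 3)"
    using U[of "3 * N"] by (simp add: algebra_simps)
  have s: "{..<3 * Suc N} = {..<Suc (Suc (Suc (3 * N)))}" by auto
  have "(\<Sum>n<3 * Suc N. A n + C n + E n + H n + G n) = (\<Sum>n<3 * N. A n + C n + E n + H n + G n) +
     (A (3 * N) + C (3 * N) + E (3 * N) + H (3 * N) + G (3 * N)) +
     (A (3 * N + 1) + C (3 * N + 1) + E (3 * N + 1) + H (3 * N + 1) + G (3 * N + 1)) +
     (A (3 * N + 2) + C (3 * N + 2) + E (3 * N + 2) + H (3 * N + 2) + G (3 * N + 2))"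
    unfolding s by (simp add: add.assoc)
  also have "\<dots> = (\<Sum>n<3 * N. A n + C n + E n + H n + G n) + (C (3 * N) + A (3 * N + 1)) + (H (3 * N) - Hz (3 * N) + G (3 * N + 1)) +
     (A (3 * N) - Asz (3 * N) + G (3 * N)) + E (3 * N + 1) + (C (3 * N + 1) + H (3 * N + 1)) + (A (3 * N + 2) - Az (3 * N + 2) + C (3 * N + 2)) +
     (G (3 * N + 2) + H (3 * N + 2)) + (E (3 * N + 2) - Ez (3 * N + 2) + E (3 * N + 3)) + E (3 * N) - E (3 * N + 3) +
     (Asz (3 * N) + Hz (3 * N) + Az (3 * N + 2) + Ez (3 * N + 2))"
    by (simp add: algebra_simps)
  also have "\<dots> = U 0 + E 0 - U (3 * N + 3) - E (3 * N + 3)"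
    unfolding assms(1-8) e Suc by (simp add: algebra_simps)
  also have "3 * N + 3 = 3 * Suc N" by simp
  finally show ?case .
qed simp

lemma sum_shift: "f M = 0 \<Longrightarrow> (\<Sum>m<M. f (Suc m)) = (\<Sum>m<M. f m) - f (0 :: nat)" for f :: "nat \<Rightarrow> 'g :: ab_group_add"
  using sum.lessThan_Suc_shift[of f M] by simp

lemma sum_pairs: "(\<And>j. f (2 * j) + f (Suc (2 * j)) = 0) \<Longrightarrow> (\<Sum>m<2 * B. f m) = 0" for f :: "nat \<Rightarrow> 'g :: ab_group_add"
  by (induction B) (simp_all add: add.assoc)

definition dsum :: "nat \<Rightarrow> (nat \<Rightarrow> nat \<Rightarrow> 'g :: ab_group_add) \<Rightarrow> 'g" where
  "dsum M f = (\<Sum>m<M. \<Sum>s<M. f m s)"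

lemma dsum_cancel: "(\<And>m s. f m s + g m s = 0) \<Longrightarrow> dsum M f + dsum M g = 0"
  unfolding dsum_def by (simp flip: sum.distrib)

lemma dsum_shift: "(\<And>s. f M s = 0) \<Longrightarrow> dsum M (\<lambda>m s. f (Suc m) s) = dsum M f - (\<Sum>s<M. f 0 s)"
  unfolding dsum_def using sum_shift[of "\<lambda>m. \<Sum>s<M. f m s" M] by simp

lemma dsum_cancel_shift:
  "(\<And>m s. f (Suc m) s + g m s = 0) \<Longrightarrow> (\<And>s. f M s = 0) \<Longrightarrow> dsum M f - (\<Sum>s<M. f 0 s) + dsum M g = 0"
  using dsum_cancel[of "\<lambda>m s. f (Suc m) s" g M] dsum_shift[of f M] by simp

lemma dsum_cancel_shift2:
  assumes "\<And>m s. f m (Suc s) + g m s = 0" "\<And>m. f m M = 0"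
  shows "dsum M f - (\<Sum>m<M. f m 0) + dsum M g = 0"
proof -
  have "dsum M f - (\<Sum>m<M. f m 0) = dsum M (\<lambda>m s. f m (Suc s))"
    unfolding dsum_def sum_subtractf[symmetric] using sum_shift[of "f _" M] assms(2) by (intro sum.cong refl) simp
  then show ?thesis using dsum_cancel[OF assms(1)] by simp
qed

lemma dsum_pairs: "(\<And>j s. f (2 * j) s + f (Suc (2 * j)) s = 0) \<Longrightarrow> dsum (2 * B) f = 0"
  unfolding dsum_def by (intro sum_pairs) (simp flip: sum.distrib)

text \<open>\<psi> n x abstracts a coefficient of (B + E) D^n x, or of (A + C) D^(n+2) x; in both
  cases pairs vanish for t + n = 1 modulo 3. M is even so that E^(2j) and E^(2j+1) lie in the same
  range.\<close>

lemma cancel_sum: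
  fixes \<psi> :: "nat \<Rightarrow> mvec \<Rightarrow> 'g :: ab_group_add"
  assumes c: "\<And>t n x x'. pr t x x' \<Longrightarrow> famv x \<Longrightarrow> famv x' \<Longrightarrow> (t + n) mod 3 = 1 \<Longrightarrow> \<psi> n x + \<psi> n x' = 0"
    and d: "\<And>n x. \<psi> n (ap LD x) = \<psi> (Suc n) x"
    and M: "M = 2 * B"
    and van: "\<And>n m s. M \<le> m \<or> M \<le> s \<or> 3 * N \<le> n \<Longrightarrow> \<psi> n (fA m s) = 0 \<and> \<psi> n (fC m s) = 0 \<and> \<psi> n (fE m s) = 0 \<and> \<psi> n (gC m s) = 0 \<and> \<psi> n (gA m s) = 0"
    and u: "\<And>n s. u n (Suc s) = \<psi> n (gC 0 s) + \<psi> (n + 2) (fA 0 s) + \<psi> (n + 2) (fE 0 s) + u (n + 3) s"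
      "\<And>n. u n 0 = (\<Sum>m<M. \<psi> n (fA m 0))" and uv: "\<And>n s. M \<le> s \<or> 3 * N \<le> n \<Longrightarrow> u n s = 0"
  shows "(\<Sum>n<3 * N. \<Sum>m<M. \<Sum>s<M. \<psi> n (fA m s) + \<psi> n (fC m s) + \<psi> n (fE m s) + \<psi> n (gC m s) + \<psi> n (gA m s)) =
    (\<Sum>s<M. u 0 s) + (\<Sum>m<M. \<Sum>s<M. \<psi> 0 (fE m s))"
proof -
  note S0 = dsum_cancel and Sm = dsum_cancel_shift and Ss = dsum_cancel_shift2
  note van' = van[THEN conjunct1] van[THEN conjunct2, THEN conjunct1] van[THEN conjunct2, THEN conjunct2, THEN conjunct1]
    van[THEN conjunct2, THEN conjunct2, THEN conjunct2, THEN conjunct1] van[THEN conjunct2, THEN conjunct2, THEN conjunct2, THEN conjunct2]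
  note fv = fA_famv(1) gA_famv(1,3,4) fE_famv(1) famv_ap(1)[OF fA_famv(1)] famv_ap(1)[OF gA_famv(1)] famv_ap(1)[OF fE_famv(1)]
  have mods: "(1 + 3 * j) mod 3 = 1" "(2 + (3 * j + 2)) mod 3 = 1" "(0 + (3 * j + 1)) mod 3 = (1 :: nat)" for j :: nat by presburger+
  have "(\<Sum>n<3 * N. dsum M (\<lambda>m s. \<psi> n (fA m s)) + dsum M (\<lambda>m s. \<psi> n (fC m s)) + dsum M (\<lambda>m s. \<psi> n (fE m s)) + dsum M (\<lambda>m s. \<psi> n (gC m s)) + dsum M (\<lambda>m s. \<psi> n (gA m s))) =
      (\<Sum>s<M. u 0 s) + dsum M (\<lambda>m s. \<psi> 0 (fE m s)) - (\<Sum>s<M. u (3 * N) s) - dsum M (\<lambda>m s. \<psi> (3 * N) (fE m s))"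
  proof (rule telescope3[where Hz = "\<lambda>n. \<Sum>s<M. \<psi> n (gC 0 s)" and Az = "\<lambda>n. \<Sum>s<M. \<psi> n (fA 0 s)" and Asz = "\<lambda>n. \<Sum>m<M. \<psi> n (fA m 0)"
        and Ez = "\<lambda>n. \<Sum>s<M. \<psi> n (fE 0 s)"])
    fix j
    show "dsum M (\<lambda>m s. \<psi> (3 * j) (fC m s)) + dsum M (\<lambda>m s. \<psi> (3 * j + 1) (fA m s)) = 0"
      using c[OF pr_fC(1) fv(4) fv(6) mods(1)] by (intro S0) (simp add: d)
    show "dsum M (\<lambda>m s. \<psi> (3 * j) (gC m s)) - (\<Sum>s<M. \<psi> (3 * j) (gC 0 s)) + dsum M (\<lambda>m s. \<psi> (3 * j + 1) (gA m s)) = 0"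
      using c[OF pr_fC(2) fv(3) fv(7) mods(1)] by (intro Sm van') (auto simp: d)
    show "dsum M (\<lambda>m s. \<psi> (3 * j) (fA m s)) - (\<Sum>m<M. \<psi> (3 * j) (fA m 0)) + dsum M (\<lambda>m s. \<psi> (3 * j) (gA m s)) = 0"
      using c[OF pr_fA_gA fv(1) fv(2) mods(1)] by (intro Ss van') auto
    show "dsum M (\<lambda>m s. \<psi> (3 * j + 1) (fE m s)) = 0"
      using c[OF pr_fE_pair fv(5) fv(5) mods(3)] unfolding M by (rule dsum_pairs)
    show "dsum M (\<lambda>m s. \<psi> (3 * j + 1) (fC m s)) + dsum M (\<lambda>m s. \<psi> (3 * j + 1) (gC m s)) = 0"
      using c[OF pr_fC_gC fv(4) fv(3) mods(3)] by (intro S0)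
    show "dsum M (\<lambda>m s. \<psi> (3 * j + 2) (fA m s)) - (\<Sum>s<M. \<psi> (3 * j + 2) (fA 0 s)) + dsum M (\<lambda>m s. \<psi> (3 * j + 2) (fC m s)) = 0"
      using c[OF pr_fA(1) fv(1) fv(4) mods(2)] by (intro Sm van') auto
    show "dsum M (\<lambda>m s. \<psi> (3 * j + 2) (gA m s)) + dsum M (\<lambda>m s. \<psi> (3 * j + 2) (gC m s)) = 0"
      using c[OF pr_fA(2) fv(2) fv(3) mods(2)] by (intro S0)
    show "dsum M (\<lambda>m s. \<psi> (3 * j + 2) (fE m s)) - (\<Sum>s<M. \<psi> (3 * j + 2) (fE 0 s)) + dsum M (\<lambda>m s. \<psi> (3 * j + 3) (fE m s)) = 0"
      using c[OF pr_fE fv(5) fv(8) mods(2)] by (intro Sm van') (auto simp: d numeral_3_eq_3)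
  next
    fix n
    have "(\<Sum>s<M. u n s) - u n 0 = (\<Sum>s<M. u n (Suc s))" using sum_shift[of "u n" M] uv by simp
    then show "(\<Sum>s<M. u n s) - (\<Sum>m<M. \<psi> n (fA m 0)) =
        (\<Sum>s<M. \<psi> n (gC 0 s)) + (\<Sum>s<M. \<psi> (n + 2) (fA 0 s)) + (\<Sum>s<M. \<psi> (n + 2) (fE 0 s)) + (\<Sum>s<M. u (n + 3) s)"
      unfolding u by (simp add: sum.distrib)
  qed
  moreover have "(\<Sum>s<M. u (3 * N) s) = 0" "dsum M (\<lambda>m s. \<psi> (3 * N) (fE m s)) = 0" using uv van'(3) by (simp_all add: dsum_def)
  ultimately show ?thesis by (simp add: dsum_def sum.distrib)
qed

section \<open>Images of the summands under A + C and B + E\<close>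

lemma word_vectors:
  "apw (L # Ds n @ As m) (yB s) = ap L (apw (Ds n) (fA m s))" "apw (L # Ds n @ LC # As m) (yB s) = ap L (apw (Ds n) (fC m s))"
  "apw (L # Ds n @ Es m) (yE s) = ap L (apw (Ds n) (fE m s))" "apw (L # Ds n @ LC # As m) (vT s) = ap L (apw (Ds n) (gC m s))"
  "apw (L # Ds n @ As (Suc m)) (vT s) = ap L (apw (Ds n) (gA m s))"
  "apw (Ds n @ As m) (yB s) = apw (Ds n) (fA m s)" "apw (Ds n @ LC # As m) (yB s) = apw (Ds n) (fC m s)"
  "apw (Ds n @ Es m) (yE s) = apw (Ds n) (fE m s)" "apw (Ds n @ LC # As m) (vT s) = apw (Ds n) (gC m s)"
  "apw (Ds n @ As (Suc m)) (vT s) = apw (Ds n) (gA m s)"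
  by (simp_all add: fA_def fC_def fE_def gA_def gC_def del: ap.simps)

lemma Ds_D: "apw (Ds n) (ap LD x) = apw (Ds (Suc n)) x"
  by (induction n) simp_all

lemma sum_list_add: "(\<Sum>x\<leftarrow>xs. f x + g x) = (\<Sum>x\<leftarrow>xs. f x) + (\<Sum>x\<leftarrow>xs. g x)" for f g :: "mvec \<Rightarrow> lseries"
  by (rule sum_list_addf)

lemma sum_list_map_ap: "(\<Sum>z\<leftarrow>map (ap L) xs. f z) = (\<Sum>x\<leftarrow>xs. f (ap L x))" for f :: "mvec \<Rightarrow> lseries"
  by (simp add: comp_def)

text \<open>After \<open>E\<close> the slots P and Q agree, so the numerator 1 - Q/P of
  \<open>B\<close> is zero.\<close>

lemma B_fE: "cmp k i l (ap LB (fE m s)) = 0"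
proof -
  obtain f p q r where v: "fE m s = MVec f p q r" by (cases "fE m s")
  have "q = p" using fE_famv(3)[of m s] by (simp add: v)
  then show ?thesis by (simp add: v fac_def)
qed

context indices begin

definition phi :: "letter \<Rightarrow> letter \<Rightarrow> mvec \<Rightarrow> lseries" where
  "phi L M x = cmp k i l (ap L x) + cmp k i l (ap M x)"

text \<open>L^s v_inf stays an infinite sum here: its entries have different Q and cannot be
  merged.\<close>

definition UU :: "letter \<Rightarrow> letter \<Rightarrow> nat \<Rightarrow> nat \<Rightarrow> lseries" where
  "UU L M n s = fs (\<lambda>j. \<Sum>x\<leftarrow>U_list s j. phi L M (apw (Ds n) x))"

lemma phi_merged:
  assumes "\<And>L. merged k i l ys (L # Ds n @ W) y N"
  shows "lf (\<lambda>j. \<Sum>z\<leftarrow>ys j. phi L M (apw (Ds n) (apw W z)))"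
    "fs (\<lambda>j. \<Sum>z\<leftarrow>ys j. phi L M (apw (Ds n) (apw W z))) = phi L M (apw (Ds n) (apw W y))"
    "phi L M (apw (Ds n) (apw W y)) \<in> Wt (N - 1)"
proof -
  have lf: "lf (\<lambda>j. \<Sum>z\<leftarrow>ys j. cmp k i l (ap L (apw (Ds n) (apw W z))))"
    and f: "fs (\<lambda>j. \<Sum>z\<leftarrow>ys j. cmp k i l (ap L (apw (Ds n) (apw W z)))) = cmp k i l (ap L (apw (Ds n) (apw W y)))"
    and w: "cmp k i l (ap L (apw (Ds n) (apw W y))) \<in> Wt (N - 1)" for L
    using merged_lf[OF assms[of L]] assms[of L] merged_Wt[OF assms[of L]] by (simp_all add: merged_def del: ap.simps)
  show "lf (\<lambda>j. \<Sum>z\<leftarrow>ys j. phi L M (apw (Ds n) (apw W z)))"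
    unfolding phi_def sum_list_add by (intro lf_add lf)
  show "fs (\<lambda>j. \<Sum>z\<leftarrow>ys j. phi L M (apw (Ds n) (apw W z))) = phi L M (apw (Ds n) (apw W y))"
    unfolding phi_def sum_list_add lf_add(2)[OF lf lf] f ..
  show "phi L M (apw (Ds n) (apw W y)) \<in> Wt (N - 1)"
    unfolding phi_def by (intro Wt_add w)
qed

lemmas phi_fA = phi_merged[OF merged_fA[of "[_]", simplified append_Cons append_Nil, OF disjI2[OF refl]]]
lemmas phi_fC = phi_merged[OF merged_fC[of "[_]", simplified append_Cons append_Nil, OF disjI2[OF refl]]]
lemmas phi_fE = phi_merged[OF merged_fE[of "[_]", simplified append_Cons append_Nil, OF disjI2[OF refl]]]
lemmas phi_gC = phi_merged[OF merged_gC[of "[_]", simplified append_Cons append_Nil, OF disjI2[OF refl]]]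
lemmas phi_gA = phi_merged[OF merged_gA[of "[_]", simplified append_Cons append_Nil, OF disjI2[OF refl]]]

lemma phi_Wt:
  "phi L M (apw (Ds n) (fA m s)) \<in> Wt (n + m + 2 * s - 1)" "phi L M (apw (Ds n) (fC m s)) \<in> Wt (n + m + 2 * s - 1)"
  "phi L M (apw (Ds n) (fE m s)) \<in> Wt (n + m + 2 * s - 1)" "phi L M (apw (Ds n) (gC m s)) \<in> Wt (n + m + 2 * s - 1)"
  "phi L M (apw (Ds n) (gA m s)) \<in> Wt (n + m + 2 * s - 1)"
proof -
  have "phi L M (apw (Ds n) (apw (As m) (yB s))) \<in> Wt (n + m + 2 * s - 1)" "phi L M (apw (Ds n) (apw (LC # As m) (yB s))) \<in> Wt (n + m + 2 * s - 1)"
    "phi L M (apw (Ds n) (apw (Es m) (yE s))) \<in> Wt (n + m + 2 * s - 1)" "phi L M (apw (Ds n) (apw (LC # As m) (vT s))) \<in> Wt (n + m + 2 * s - 1)"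
    "phi L M (apw (Ds n) (apw (As (Suc m)) (vT s))) \<in> Wt (n + m + 2 * s - 1)"
    by (rule phi_fA(3) phi_fC(3) phi_fE(3) phi_gC(3) phi_gA(3))+
  then show "phi L M (apw (Ds n) (fA m s)) \<in> Wt (n + m + 2 * s - 1)" "phi L M (apw (Ds n) (fC m s)) \<in> Wt (n + m + 2 * s - 1)"
    "phi L M (apw (Ds n) (fE m s)) \<in> Wt (n + m + 2 * s - 1)" "phi L M (apw (Ds n) (gC m s)) \<in> Wt (n + m + 2 * s - 1)"
    "phi L M (apw (Ds n) (gA m s)) \<in> Wt (n + m + 2 * s - 1)"
    by (simp_all add: fA_def fC_def fE_def gA_def gC_def del: ap.simps)
qed

lemma phi_U_Wt: "x \<in> set (U_list s j) \<Longrightarrow> phi L M (apw (Ds n) x) \<in> Wt (j + (n + 2 * s) - 1)"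
  unfolding phi_def using reach_word[OF U_list_reach, of x s j "[L]" L] reach_word[OF U_list_reach, of x s j "[M]" M]
  by (intro Wt_add) (simp_all del: ap.simps)

lemma UU_lf: "lf (\<lambda>j. \<Sum>x\<leftarrow>U_list s j. phi L M (apw (Ds n) x))"
  by (rule list_lf) (rule phi_U_Wt)

lemma UU_Wt: "UU L M n s \<in> Wt (n + 2 * s - 1)"
  unfolding UU_def by (intro fs_Wt[OF UU_lf] Wt_sum_list Wt_mono[OF phi_U_Wt]) auto

text \<open>Expands L^(s+1) = (C + D) D (B + D + E) L^s into C D (B + D + E), D^2 B, D^2 E and D^3
  applied to L^s v_inf; all but the last can be merged.\<close>

lemma UU_Suc: "UU L M n (Suc s) = phi L M (apw (Ds n) (gC 0 s)) + phi L M (apw (Ds (n + 2)) (fA 0 s)) +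
  phi L M (apw (Ds (n + 2)) (fE 0 s)) + UU L M (n + 3) s"
proof -
  have e: "(\<Sum>x\<leftarrow>U_list (Suc s) j. phi L M (apw (Ds n) x)) =
      (\<Sum>z\<leftarrow>DBDE (U_list s j). phi L M (apw (Ds n) (apw (LC # As 0) z))) +
      (\<Sum>z\<leftarrow>map (ap LB) (U_list s j). phi L M (apw (Ds (n + 2)) (apw (As 0) z))) +
      (\<Sum>z\<leftarrow>map (ap LE) (U_list s j). phi L M (apw (Ds (n + 2)) (apw (Es 0) z))) +
      (\<Sum>x\<leftarrow>U_list s j. phi L M (apw (Ds (n + 3)) x))" for j
  proof -
    have D: "apw (Ds n) (ap LD (ap LD x)) = apw (Ds (n + 2)) x" "apw (Ds (n + 2)) (ap LD x) = apw (Ds (n + 3)) x" for x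
      unfolding Ds_D by (simp_all add: numeral_eq_Suc)
    have "(\<Sum>x\<leftarrow>U_list (Suc s) j. phi L M (apw (Ds n) x)) =
      (\<Sum>z\<leftarrow>DBDE (U_list s j). phi L M (apw (Ds n) (ap LC z))) + (\<Sum>z\<leftarrow>DBDE (U_list s j). phi L M (apw (Ds n) (ap LD z)))"
      by (simp add: comp_def del: ap.simps)
    moreover have "(\<Sum>z\<leftarrow>DBDE (U_list s j). phi L M (apw (Ds n) (ap LD z))) = (\<Sum>x\<leftarrow>U_list s j. phi L M (apw (Ds (n + 2)) (ap LB x))) +
      (\<Sum>x\<leftarrow>U_list s j. phi L M (apw (Ds (n + 3)) x)) + (\<Sum>x\<leftarrow>U_list s j. phi L M (apw (Ds (n + 2)) (ap LE x)))"
      unfolding sum_list_DBDE D sum_list_add ..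
    moreover have "apw (LC # As 0) z = ap LC z" "apw (As 0) z = z" "apw (Es 0) z = z" for z by simp_all
    ultimately show ?thesis unfolding sum_list_map_ap by (simp only: add_ac)
  qed
  show ?thesis
    unfolding UU_def e
    unfolding lf_add(2)[OF lf_add(1)[OF lf_add(1)[OF phi_gC(1) phi_fA(1)] phi_fE(1)] UU_lf]
      lf_add(2)[OF lf_add(1)[OF phi_gC(1) phi_fA(1)] phi_fE(1)] lf_add(2)[OF phi_gC(1) phi_fA(1)] phi_gC(2) phi_fA(2) phi_fE(2)
    by (simp add: fA_def fE_def gC_def del: ap.simps)
qed

text \<open>Evaluates A + C on D (B + D + E) L^s v_inf twice: expanded over \<open>B\<close>,
  \<open>D\<close>, \<open>E\<close>, and merged into \<open>vT\<close>.\<close>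

lemma UU_2: "UU LA LC 2 s + phi LA LC (apw (Ds 1) (fA 0 s)) + phi LA LC (apw (Ds 1) (fE 0 s)) = cmp k i l (gA 0 s) + cmp k i l (gC 0 s)"
proof -
  have m: "merged k i l (\<lambda>j. DBDE (U_list s j)) (LA # Ds 0 @ []) (vT s) (0 + 0 + 2 * s)"
    "merged k i l (\<lambda>j. DBDE (U_list s j)) (LC # Ds 0 @ []) (vT s) (0 + 0 + 2 * s)"
    using merged_gA[of "[]" LA s 0 0] merged_gC[of "[]" LA s 0 0] by simp_all
  have "phi LA LC z = cmp k i l (apw (LA # Ds 0 @ []) z) + cmp k i l (apw (LC # Ds 0 @ []) z)" for z by (simp add: phi_def)
  then have "fs (\<lambda>j. \<Sum>z\<leftarrow>DBDE (U_list s j). phi LA LC z) = cmp k i l (apw (LA # Ds 0 @ []) (vT s)) + cmp k i l (apw (LC # Ds 0 @ []) (vT s))"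
    using m lf_add(2)[OF merged_lf[OF m(1)] merged_lf[OF m(2)]] by (simp add: sum_list_add merged_def del: ap.simps)
  moreover have e: "(\<Sum>z\<leftarrow>DBDE (U_list s j). phi LA LC z) = (\<Sum>x\<leftarrow>U_list s j. phi LA LC (apw (Ds 2) x)) +
      (\<Sum>z\<leftarrow>map (ap LB) (U_list s j). phi LA LC (apw (Ds 1) (apw (As 0) z))) +
      (\<Sum>z\<leftarrow>map (ap LE) (U_list s j). phi LA LC (apw (Ds 1) (apw (Es 0) z)))" for j
    unfolding sum_list_DBDE sum_list_add sum_list_map_ap by (simp add: numeral_eq_Suc add_ac del: ap.simps)
  ultimately show ?thesis
    unfolding e lf_add(2)[OF lf_add(1)[OF UU_lf phi_fA(1)] phi_fE(1)] lf_add(2)[OF UU_lf phi_fA(1)] phi_fA(2) phi_fE(2) UU_def[symmetric]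
    by (simp add: fA_def fE_def gA_def gC_def del: ap.simps)
qed

lemma UU_0: "UU LB LE 0 s = cmp k i l (fA 0 s) + cmp k i l (fE 0 s)"
proof -
  have m: "merged k i l (\<lambda>j. map (ap LB) (U_list s j)) [] (yB s) (0 + 0 + 2 * s)"
    "merged k i l (\<lambda>j. map (ap LE) (U_list s j)) [] (yE s) (0 + 0 + 2 * s)"
    using merged_fA[of "[]" LA s 0 0] merged_fE[of "[]" LA s 0 0] by simp_all
  have "(\<Sum>x\<leftarrow>U_list s j. phi LB LE (apw (Ds 0) x)) =
     (\<Sum>z\<leftarrow>map (ap LB) (U_list s j). cmp k i l (apw [] z)) + (\<Sum>z\<leftarrow>map (ap LE) (U_list s j). cmp k i l (apw [] z))" for j
    unfolding sum_list_map_ap phi_def by (simp add: sum_list_add del: ap.simps)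
  then have "UU LB LE 0 s = cmp k i l (apw [] (yB s)) + cmp k i l (apw [] (yE s))"
    unfolding UU_def using m lf_add(2)[OF merged_lf[OF m(1)] merged_lf[OF m(2)]] by (simp add: merged_def del: ap.simps map_map list.map_comp)
  then show ?thesis by (simp add: fA_def fE_def)
qed

text \<open>By \<open>fA_0\<close> the entries of v_inf are the vectors A^m B v_inf, and only
  finitely many reach a given coefficient.\<close>

lemma qz_coeff_UU_start:
  assumes "a + c < int M" shows "qz_coeff (UU L L' n 0) a c = (\<Sum>m<Suc M. qz_coeff (phi L L' (apw (Ds n) (fA m 0))) a c)"
proof -
  have e: "(\<lambda>j. \<Sum>x\<leftarrow>U_list 0 j. phi L L' (apw (Ds n) x)) = (\<lambda>j. phi L L' (apw (Ds n) (fA j 0)))"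
    by (simp add: fA_0 del: ap.simps)
  have "{j. qz_coeff (phi L L' (apw (Ds n) (fA j 0))) a c \<noteq> 0} \<subseteq> {..<Suc M}"
  proof
    fix j assume "j \<in> {j. qz_coeff (phi L L' (apw (Ds n) (fA j 0))) a c \<noteq> 0}"
    then have "\<not> a + c < int (n + j + 2 * 0 - 1)" using Wt_coeff_0[OF phi_Wt(1)] by blast
    then show "j \<in> {..<Suc M}" using assms by auto
  qed
  moreover have "lf (\<lambda>j. phi L L' (apw (Ds n) (fA j 0)))"
    using UU_lf[of L L' n 0] unfolding e .
  ultimately show ?thesis
    unfolding UU_def e by (intro qz_coeff_fs) auto
qed

lemma pr_phi:
  "pr t x x' \<Longrightarrow> famv x \<Longrightarrow> famv x' \<Longrightarrow> (t + n) mod 3 = 0 \<Longrightarrow> phi LA LC (apw (Ds n) x) + phi LA LC (apw (Ds n) x') = 0"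
  "pr t x x' \<Longrightarrow> famv x \<Longrightarrow> famv x' \<Longrightarrow> (t + n) mod 3 = 1 \<Longrightarrow> phi LB LE (apw (Ds n) x) + phi LB LE (apw (Ds n) x') = 0"
  using pr_AC[of t x x' n k i l] pr_BE[of t x x' n k i l] by (simp_all add: phi_def AC_def BE_def)

definition trm :: "nat \<Rightarrow> nat \<Rightarrow> nat \<Rightarrow> lseries" where
  "trm n m s = cmp k i l (apw (Ds n) (fA m s)) + cmp k i l (apw (Ds n) (fC m s)) + cmp k i l (apw (Ds n) (fE m s)) +
     cmp k i l (apw (Ds n) (gC m s)) + cmp k i l (apw (Ds n) (gA m s))"

definition phi5 :: "letter \<Rightarrow> letter \<Rightarrow> nat \<Rightarrow> nat \<Rightarrow> nat \<Rightarrow> lseries" where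
  "phi5 L M n m s = phi L M (apw (Ds n) (fA m s)) + phi L M (apw (Ds n) (fC m s)) + phi L M (apw (Ds n) (fE m s)) +
     phi L M (apw (Ds n) (gC m s)) + phi L M (apw (Ds n) (gA m s))"

text \<open>The shift h = 2 turns the residue 0, at which \<open>A\<close> and \<open>C\<close>
  cancel, into the residue 1 of \<open>B\<close> and \<open>E\<close>. N exceeds the degree of the
  coefficient, so everything outside the box vanishes.\<close>

lemma qz_cancel:
  assumes h: "(h = 0 \<and> (L, L') = (LB, LE)) \<or> (h = 2 \<and> (L, L') = (LA, LC))" and N: "a + c + 2 < int N"
  shows "(\<Sum>n<3 * N. \<Sum>m<2 * N. \<Sum>s<2 * N. qz_coeff (phi5 L L' (n + h) m s) a c) =
     (\<Sum>s<2 * N. qz_coeff (UU L L' h s) a c) + (\<Sum>m<2 * N. \<Sum>s<2 * N. qz_coeff (phi L L' (apw (Ds h) (fE m s))) a c)"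
proof -
  define \<psi> where "\<psi> = (\<lambda>n x. qz_coeff (phi L L' (apw (Ds (n + h)) x)) a c)"
  define u where "u = (\<lambda>n s. qz_coeff (UU L L' (n + h) s) a c)"
  have "(\<Sum>n<3 * N. \<Sum>m<2 * N. \<Sum>s<2 * N. \<psi> n (fA m s) + \<psi> n (fC m s) + \<psi> n (fE m s) + \<psi> n (gC m s) + \<psi> n (gA m s)) =
    (\<Sum>s<2 * N. u 0 s) + (\<Sum>m<2 * N. \<Sum>s<2 * N. \<psi> 0 (fE m s))"
  proof (rule cancel_sum)
    fix t n x x' assume p: "pr t x x'" "famv x" "famv x'" "(t + n) mod 3 = 1"
    have "phi L L' (apw (Ds (n + h)) x) + phi L L' (apw (Ds (n + h)) x') = 0"
      using h
    proof (elim disjE conjE)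
      assume "h = 2" "(L, L') = (LA, LC)"
      moreover have "(t + (n + 2)) mod 3 = 0" using p(4) by presburger
      ultimately show ?thesis by (simp only: prod.inject pr_phi(1)[OF p(1-3)])
    qed (use pr_phi(2)[OF p] in auto)
    then show "\<psi> n x + \<psi> n x' = 0" unfolding \<psi>_def qz_coeff_simps(2)[symmetric] by simp
  next
    show "\<psi> n (ap LD x) = \<psi> (Suc n) x" for n x unfolding \<psi>_def Ds_D by simp
    show "2 * N = 2 * N" ..
    show "\<psi> n (fA m s) = 0 \<and> \<psi> n (fC m s) = 0 \<and> \<psi> n (fE m s) = 0 \<and> \<psi> n (gC m s) = 0 \<and> \<psi> n (gA m s) = 0"
      if "2 * N \<le> m \<or> 2 * N \<le> s \<or> 3 * N \<le> n" for n m s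
    proof -
      have "a + c < int (n + h + m + 2 * s - 1)" using that N by auto
      then show ?thesis unfolding \<psi>_def by (intro conjI Wt_coeff_0[OF phi_Wt(1)] Wt_coeff_0[OF phi_Wt(2)] Wt_coeff_0[OF phi_Wt(3)]
          Wt_coeff_0[OF phi_Wt(4)] Wt_coeff_0[OF phi_Wt(5)])
    qed
    show "u n (Suc s) = \<psi> n (gC 0 s) + \<psi> (n + 2) (fA 0 s) + \<psi> (n + 2) (fE 0 s) + u (n + 3) s" for n s
      using UU_Suc[of L L' "n + h" s] by (simp add: u_def \<psi>_def add_ac del: replicate.simps)
    show "u n 0 = (\<Sum>m<2 * N. \<psi> n (fA m 0))" for n
    proof -
      have "2 * N = Suc (2 * N - 1)" "a + c < int (2 * N - 1)" if "0 < N" using that N by auto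
      moreover have "u n 0 = 0" if "N = 0"
        unfolding u_def using that N by (intro Wt_coeff_0[OF UU_Wt]) auto
      ultimately show ?thesis unfolding u_def \<psi>_def using qz_coeff_UU_start[of a c "2 * N - 1" L L' "n + h"] by (cases "N = 0") auto
    qed
    show "u n s = 0" if "2 * N \<le> s \<or> 3 * N \<le> n" for n s
      unfolding u_def using that N by (intro Wt_coeff_0[OF UU_Wt]) auto
  qed
  then show ?thesis by (simp add: \<psi>_def u_def phi5_def)
qed

end

section \<open>The series satisfies the difference equation\<close>

context indices begin

lemma cmp_Wt:
  "cmp k i l (apw (Ds n) (fA m s)) \<in> Wt (n + m + 2 * s - 1)" "cmp k i l (apw (Ds n) (fC m s)) \<in> Wt (n + m + 2 * s - 1)"
  "cmp k i l (apw (Ds n) (fE m s)) \<in> Wt (n + m + 2 * s - 1)" "cmp k i l (apw (Ds n) (gC m s)) \<in> Wt (n + m + 2 * s - 1)"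
  "cmp k i l (apw (Ds n) (gA m s)) \<in> Wt (n + m + 2 * s - 1)"
  unfolding word_vectors(6-10)[symmetric]
  using merged_Wt[OF merged_fA[of "[]", OF disjI1[OF refl]]] merged_Wt[OF merged_fC[of "[]", OF disjI1[OF refl]]]
    merged_Wt[OF merged_fE[of "[]", OF disjI1[OF refl]]] merged_Wt[OF merged_gC[of "[]", OF disjI1[OF refl]]]
    merged_Wt[OF merged_gA[of "[]", OF disjI1[OF refl]]]
  by (simp_all only: append_Nil)

lemma trm_Wt: "trm n m s \<in> Wt (n + m + 2 * s - 1)" and phi5_Wt: "phi5 L M n m s \<in> Wt (n + m + 2 * s - 1)"
  unfolding trm_def phi5_def by (intro Wt_add cmp_Wt phi_Wt)+

text \<open>Of all images under \<open>A\<close> and \<open>C\<close> exactly the summands with n =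
  0 survive in which \<open>A\<close> or \<open>C\<close> acts last. The layers n = 0 and n = 1 lie
  before the range of \<open>qz_cancel\<close> and are treated by hand.\<close>

lemma cancel_AC:
  assumes N: "a + c + 2 < int N"
  shows "(\<Sum>n<3 * N + 2. dsum (2 * N) (\<lambda>m s. qz_coeff (phi5 LA LC n m s) a c)) =
    dsum (2 * N) (\<lambda>m s. qz_coeff (cmp k i l (fA (Suc m) s) + cmp k i l (fC m s) + cmp k i l (gC m s) + cmp k i l (gA m s)) a c)"
proof -
  define M where "M = 2 * N"
  define \<psi> where "\<psi> = (\<lambda>n x. qz_coeff (phi LA LC (apw (Ds n) x)) a c)"
  define \<chi> where "\<chi> = (\<lambda>x. qz_coeff (cmp k i l x) a c)"
  have c: "\<psi> n x + \<psi> n x' = 0" if "pr t x x'" "famv x" "famv x'" "(t + n) mod 3 = 0" for t n x x'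
    using pr_phi(1)[OF that] unfolding \<psi>_def qz_coeff_simps(2)[symmetric] by simp
  have d: "\<psi> n (ap LD x) = \<psi> (Suc n) x" for n x unfolding \<psi>_def Ds_D by simp
  have z: "\<psi> n (fA M s) = 0" "\<psi> n (gA M s) = 0" "\<psi> n (fE M s) = 0" "\<chi> (gC M s) = 0" "\<chi> (gA M s) = 0" for n s
  proof -
    have "a + c < int (n + M + 2 * s - 1)" "a + c < int (0 + M + 2 * s - 1)" using N by (auto simp: M_def)
    note Wt_coeff_0[OF phi_Wt(1) this(1)] Wt_coeff_0[OF phi_Wt(5) this(1)] Wt_coeff_0[OF phi_Wt(3) this(1)]
      Wt_coeff_0[OF cmp_Wt(4) this(2)] Wt_coeff_0[OF cmp_Wt(5) this(2)]
    then show "\<psi> n (fA M s) = 0" "\<psi> n (gA M s) = 0" "\<psi> n (fE M s) = 0" "\<chi> (gC M s) = 0" "\<chi> (gA M s) = 0"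
      by (simp_all add: \<psi>_def \<chi>_def)
  qed
  note fv = fA_famv(1) gA_famv(1,3,4) fE_famv(1) famv_ap(1)[OF fE_famv(1)]
  define F where "F = (\<lambda>n. dsum M (\<lambda>m s. qz_coeff (phi5 LA LC n m s) a c))"
  have F: "F n = dsum M (\<lambda>m s. \<psi> n (fA m s)) + dsum M (\<lambda>m s. \<psi> n (fC m s)) + dsum M (\<lambda>m s. \<psi> n (fE m s)) +
      dsum M (\<lambda>m s. \<psi> n (gC m s)) + dsum M (\<lambda>m s. \<psi> n (gA m s))" for n
    by (simp add: F_def phi5_def \<psi>_def dsum_def sum.distrib del: replicate.simps)
  \<comment> \<open>At n = 0 the pairs of type 3 die. What is left, A + C on \<open>fA\<close> and
    \<open>gA\<close>, consists of summands with n = 0 again.\<close>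
  have c0: "dsum M (\<lambda>m s. \<psi> 0 (fC m s)) + dsum M (\<lambda>m s. \<psi> 0 (gC m s)) = 0"
    using c[OF pr_fC_gC fv(4) fv(3), of 0] by (intro dsum_cancel) simp
  have e0: "dsum M (\<lambda>m s. \<psi> 0 (fE m s)) = 0"
    unfolding M_def using c[OF pr_fE_pair fv(5) fv(5), of 0] by (intro dsum_pairs) simp
  have "F 0 = (dsum M (\<lambda>m s. \<psi> 0 (fC m s)) + dsum M (\<lambda>m s. \<psi> 0 (gC m s))) + dsum M (\<lambda>m s. \<psi> 0 (fE m s)) +
      dsum M (\<lambda>m s. \<psi> 0 (fA m s)) + dsum M (\<lambda>m s. \<psi> 0 (gA m s))" unfolding F by (simp only: add_ac)
  then have F0: "F 0 = dsum M (\<lambda>m s. \<psi> 0 (fA m s)) + dsum M (\<lambda>m s. \<psi> 0 (gA m s))" unfolding c0 e0 by (simp only: add_0)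
  \<comment> \<open>At n = 1 the pairs of type 2 die, up to boundary terms with m = 0; the partner
    of E^(m+1) is D E^m and therefore sits in the layer n = 2.\<close>
  have a1: "dsum M (\<lambda>m s. \<psi> 1 (fA m s)) - (\<Sum>s<M. \<psi> 1 (fA 0 s)) + dsum M (\<lambda>m s. \<psi> 1 (fC m s)) = 0"
    using c[OF pr_fA(1) fv(1) fv(4), of 1] z by (intro dsum_cancel_shift) simp_all
  have g1: "dsum M (\<lambda>m s. \<psi> 1 (gA m s)) + dsum M (\<lambda>m s. \<psi> 1 (gC m s)) = 0"
    using c[OF pr_fA(2) fv(2) fv(3), of 1] by (intro dsum_cancel) simp
  have e1: "dsum M (\<lambda>m s. \<psi> 1 (fE m s)) - (\<Sum>s<M. \<psi> 1 (fE 0 s)) + dsum M (\<lambda>m s. \<psi> 2 (fE m s)) = 0"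
    using c[OF pr_fE fv(5) fv(6), of 1] z by (intro dsum_cancel_shift) (simp_all add: d numeral_2_eq_2)
  have F1: "F 1 + dsum M (\<lambda>m s. \<psi> 2 (fE m s)) = (\<Sum>s<M. \<psi> 1 (fA 0 s)) + (\<Sum>s<M. \<psi> 1 (fE 0 s))"
  proof -
    have "x - x0 + y = 0 \<Longrightarrow> v + w = 0 \<Longrightarrow> z - z0 + u = 0 \<Longrightarrow> x + y + z + w + v + u = x0 + z0"
      for x y z w v u x0 z0 :: "complex fls" by (simp add: algebra_simps eq_neg_iff_add_eq_0[symmetric])
    from this[OF a1 g1 e1] show ?thesis unfolding F .
  qed
  have F2: "(\<Sum>n<3 * N. F (n + 2)) = (\<Sum>s<M. qz_coeff (UU LA LC 2 s) a c) + dsum M (\<lambda>m s. \<psi> 2 (fE m s))"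
    using qz_cancel[of 2 LA LC a c N] N by (simp add: F_def dsum_def \<psi>_def M_def del: replicate.simps)
  \<comment> \<open>The boundary terms of the layer n = 1 and the telescoped remainder of n >= 2 add
    up to the terms m = 0 of \<open>gA\<close> and \<open>gC\<close> that the index shift in
    \<open>G0'\<close> takes away.\<close>
  have U: "(\<Sum>s<M. \<psi> 1 (fA 0 s)) + (\<Sum>s<M. \<psi> 1 (fE 0 s)) + (\<Sum>s<M. qz_coeff (UU LA LC 2 s) a c) = (\<Sum>s<M. \<chi> (gA 0 s)) + (\<Sum>s<M. \<chi> (gC 0 s))"
  proof -
    have "\<psi> 1 (fA 0 s) + \<psi> 1 (fE 0 s) + qz_coeff (UU LA LC 2 s) a c = \<chi> (gA 0 s) + \<chi> (gC 0 s)" for s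
      using arg_cong[OF UU_2[of s], of "\<lambda>f. qz_coeff f a c"] by (simp add: \<psi>_def \<chi>_def add_ac del: replicate.simps)
    then show ?thesis by (simp only: sum.distrib[symmetric])
  qed
  have A0: "dsum M (\<lambda>m s. \<psi> 0 (fA m s)) = dsum M (\<lambda>m s. \<chi> (fA (Suc m) s)) + dsum M (\<lambda>m s. \<chi> (fC m s))"
    by (simp add: dsum_def \<psi>_def \<chi>_def phi_def fA_def fC_def sum.distrib del: ap.simps)
  have G0: "dsum M (\<lambda>m s. \<psi> 0 (gA m s)) = dsum M (\<lambda>m s. \<chi> (gA (Suc m) s)) + dsum M (\<lambda>m s. \<chi> (gC (Suc m) s))"
    by (simp add: dsum_def \<psi>_def \<chi>_def phi_def gA_def gC_def sum.distrib del: ap.simps)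
  have G0': "dsum M (\<lambda>m s. \<chi> (gA (Suc m) s)) = dsum M (\<lambda>m s. \<chi> (gA m s)) - (\<Sum>s<M. \<chi> (gA 0 s))"
    "dsum M (\<lambda>m s. \<chi> (gC (Suc m) s)) = dsum M (\<lambda>m s. \<chi> (gC m s)) - (\<Sum>s<M. \<chi> (gC 0 s))"
    by (rule dsum_shift, rule z)+
  have "(\<Sum>n<3 * N + 2. F n) = F 0 + F 1 + (\<Sum>n<3 * N. F (n + 2))"
    by (simp add: sum.lessThan_Suc_shift numeral_2_eq_2 add.assoc del: sum.lessThan_Suc)
  also have "\<dots> = F 0 + (F 1 + dsum M (\<lambda>m s. \<psi> 2 (fE m s))) + (\<Sum>s<M. qz_coeff (UU LA LC 2 s) a c)"
    unfolding F2 by simp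
  also have "\<dots> = dsum M (\<lambda>m s. \<chi> (fA (Suc m) s)) + dsum M (\<lambda>m s. \<chi> (fC m s)) + dsum M (\<lambda>m s. \<chi> (gC m s)) + dsum M (\<lambda>m s. \<chi> (gA m s))"
    using U unfolding F1 F0 A0 G0 G0' by (simp add: algebra_simps)
  also have "\<dots> = dsum M (\<lambda>m s. qz_coeff (cmp k i l (fA (Suc m) s) + cmp k i l (fC m s) + cmp k i l (gC m s) + cmp k i l (gA m s)) a c)"
    by (simp add: \<chi>_def dsum_def sum.distrib)
  finally show ?thesis by (simp add: F_def M_def)
qed

text \<open>The counterpart of \<open>cancel_AC\<close>: the summands with n = 0 survive in which
  \<open>B\<close> or \<open>E\<close> acts last. Here no early layers have to be treated
  separately.\<close>

lemma cancel_BE: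
  assumes N: "a + c + 2 < int N"
  shows "(\<Sum>n<3 * N + 2. dsum (2 * N) (\<lambda>m s. qz_coeff (phi5 LB LE n m s) a c)) =
    (\<Sum>s<2 * N. qz_coeff (cmp k i l (fA 0 s)) a c) + dsum (2 * N) (\<lambda>m s. qz_coeff (cmp k i l (fE m s)) a c)"
proof -
  define M where "M = 2 * N"
  define \<chi> where "\<chi> = (\<lambda>x. qz_coeff (cmp k i l x) a c)"
  define F where "F = (\<lambda>n. dsum M (\<lambda>m s. qz_coeff (phi5 LB LE n m s) a c))"
  have z: "F n = 0" if "3 * N \<le> n" for n
    unfolding F_def dsum_def using that N by (intro sum.neutral ballI Wt_coeff_0[OF phi5_Wt]) auto
  have ze: "\<chi> (fE M s) = 0" for s
  proof -
    have "a + c < int (0 + M + 2 * s - 1)" using N by (auto simp: M_def)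
    from Wt_coeff_0[OF cmp_Wt(3) this] show ?thesis by (simp add: \<chi>_def)
  qed
  have e: "(\<lambda>m s. qz_coeff (phi LB LE (apw (Ds 0) (fE m s))) a c) = (\<lambda>m s. \<chi> (fE (Suc m) s))"
    by (intro ext) (simp add: phi_def \<chi>_def B_fE del: ap.simps, simp add: fE_def del: ap.simps)
  have "(\<Sum>n<3 * N + 2. F n) = (\<Sum>n<3 * N. F n)" using z by (simp add: numeral_2_eq_2)
  also have "\<dots> = (\<Sum>s<M. qz_coeff (UU LB LE 0 s) a c) + dsum M (\<lambda>m s. qz_coeff (phi LB LE (apw (Ds 0) (fE m s))) a c)"
    using qz_cancel[of 0 LB LE a c N] N by (simp add: F_def dsum_def M_def del: replicate.simps)
  also have "dsum M (\<lambda>m s. qz_coeff (phi LB LE (apw (Ds 0) (fE m s))) a c) = dsum M (\<lambda>m s. \<chi> (fE m s)) - (\<Sum>s<M. \<chi> (fE 0 s))"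
    unfolding e by (rule dsum_shift) (rule ze)
  also have "(\<Sum>s<M. qz_coeff (UU LB LE 0 s) a c) = (\<Sum>s<M. \<chi> (fA 0 s)) + (\<Sum>s<M. \<chi> (fE 0 s))"
    by (simp add: UU_0 \<chi>_def sum.distrib)
  finally show ?thesis by (simp add: F_def M_def \<chi>_def)
qed

text \<open>The images under \<open>D\<close> supply the layers n >= 1, and the two preceding lemmas
  supply the layer n = 0, split according to the operator that acts last.\<close>

lemma cancel_total:
  assumes N: "a + c + 2 < int N"
  shows "(\<Sum>n<3 * N + 2. dsum (2 * N) (\<lambda>m s. qz_coeff (trm (Suc n) m s + phi5 LA LC n m s + phi5 LB LE n m s) a c)) =
    (\<Sum>n<3 * N + 2. dsum (2 * N) (\<lambda>m s. qz_coeff (trm n m s) a c))"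
proof -
  define M where "M = 2 * N"
  define \<chi> where "\<chi> = (\<lambda>x. qz_coeff (cmp k i l x) a c)"
  define T where "T = (\<lambda>n. dsum M (\<lambda>m s. qz_coeff (trm n m s) a c))"
  have zT: "T (3 * N + 2) = 0"
    unfolding T_def dsum_def using N by (intro sum.neutral ballI Wt_coeff_0[OF trm_Wt]) auto
  have zA: "\<chi> (fA M s) = 0" for s
  proof -
    have "a + c < int (0 + M + 2 * s - 1)" using N by (auto simp: M_def)
    from Wt_coeff_0[OF cmp_Wt(1) this] show ?thesis by (simp add: \<chi>_def)
  qed
  have sA: "dsum M (\<lambda>m s. \<chi> (fA (Suc m) s)) = dsum M (\<lambda>m s. \<chi> (fA m s)) - (\<Sum>s<M. \<chi> (fA 0 s))"
    by (rule dsum_shift) (rule zA)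
  have "(\<Sum>n<3 * N + 2. dsum M (\<lambda>m s. qz_coeff (trm (Suc n) m s + phi5 LA LC n m s + phi5 LB LE n m s) a c)) =
      (\<Sum>n<3 * N + 2. T (Suc n)) + (\<Sum>n<3 * N + 2. dsum M (\<lambda>m s. qz_coeff (phi5 LA LC n m s) a c)) +
      (\<Sum>n<3 * N + 2. dsum M (\<lambda>m s. qz_coeff (phi5 LB LE n m s) a c))"
    by (simp add: T_def dsum_def sum.distrib)
  also have "(\<Sum>n<3 * N + 2. dsum M (\<lambda>m s. qz_coeff (phi5 LA LC n m s) a c)) =
      dsum M (\<lambda>m s. \<chi> (fA (Suc m) s)) + dsum M (\<lambda>m s. \<chi> (fC m s)) + dsum M (\<lambda>m s. \<chi> (gC m s)) + dsum M (\<lambda>m s. \<chi> (gA m s))"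
    using cancel_AC[OF N] by (simp add: M_def \<chi>_def dsum_def sum.distrib)
  also have "(\<Sum>n<3 * N + 2. dsum M (\<lambda>m s. qz_coeff (phi5 LB LE n m s) a c)) = (\<Sum>s<M. \<chi> (fA 0 s)) + dsum M (\<lambda>m s. \<chi> (fE m s))"
    using cancel_BE[OF N] by (simp add: M_def \<chi>_def)
  also have "(\<Sum>n<3 * N + 2. T (Suc n)) = (\<Sum>n<3 * N + 2. T n) - T 0" by (rule sum_shift) (rule zT)
  also have "T 0 = dsum M (\<lambda>m s. \<chi> (fA m s)) + dsum M (\<lambda>m s. \<chi> (fC m s)) + dsum M (\<lambda>m s. \<chi> (fE m s)) + dsum M (\<lambda>m s. \<chi> (gC m s)) + dsum M (\<lambda>m s. \<chi> (gA m s))"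
    by (simp add: T_def trm_def \<chi>_def dsum_def sum.distrib)
  finally show ?thesis unfolding sA by (simp add: M_def T_def algebra_simps)
qed

definition total :: lseries where "total = fs (\<lambda>(n, m, s). trm n m s)"

lemma lf_box:
  assumes "\<And>n m s. f (n, m, s) \<in> Wt (n + m + 2 * s - 1)" shows "lf f"
proof (rule lfI)
  show "f x \<in> Wt (fst x + fst (snd x) + 2 * snd (snd x) - 1)" for x using assms by (cases x) auto
  show "finite {x :: nat \<times> nat \<times> nat. fst x + fst (snd x) + 2 * snd (snd x) - 1 < N}" for N
    by (rule finite_subset[of _ "{..N} \<times> {..N} \<times> {..N}"]) auto
qed

lemma fs_box:
  assumes f: "\<And>n m s. f (n, m, s) \<in> Wt (n + m + 2 * s - 1)" and N: "a + c + 2 < int N"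
  shows "qz_coeff (fs f) a c = (\<Sum>n<3 * N + 2. dsum (2 * N) (\<lambda>m s. qz_coeff (f (n, m, s)) a c))"
proof -
  have "qz_coeff (fs f) a c = (\<Sum>x\<in>{..<3 * N + 2} \<times> {..<2 * N} \<times> {..<2 * N}. qz_coeff (f x) a c)"
  proof (rule qz_coeff_fs[OF lf_box[OF f]])
    show "{x. qz_coeff (f x) a c \<noteq> 0} \<subseteq> {..<3 * N + 2} \<times> {..<2 * N} \<times> {..<2 * N}"
    proof
      fix x assume x: "x \<in> {x. qz_coeff (f x) a c \<noteq> 0}"
      obtain n m s where nms: "x = (n, m, s)" by (cases x)
      have "\<not> a + c < int (n + m + 2 * s - 1)" using x Wt_coeff_0[OF f] unfolding nms by blast
      then show "x \<in> {..<3 * N + 2} \<times> {..<2 * N} \<times> {..<2 * N}" using N by (auto simp: nms)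
    qed
  qed auto
  then show ?thesis unfolding dsum_def sum.cartesian_product by (simp add: case_prod_unfold)
qed

lemma fs_total: "fs (\<lambda>(n, m, s). trm (Suc n) m s + phi5 LA LC n m s + phi5 LB LE n m s) = total"
proof (rule qz_coeff_eqI)
  fix a c
  have w: "trm (Suc n) m s + phi5 LA LC n m s + phi5 LB LE n m s \<in> Wt (n + m + 2 * s - 1)" for n m s
    by (intro Wt_add phi5_Wt Wt_mono[OF trm_Wt]) auto
  obtain N where N: "a + c + 2 < int N" by (rule that[of "nat (a + c + 3)"]) linarith
  show "qz_coeff (fs (\<lambda>(n, m, s). trm (Suc n) m s + phi5 LA LC n m s + phi5 LB LE n m s)) a c = qz_coeff total a c"
    unfolding total_def using fs_box[of "\<lambda>(n, m, s). trm (Suc n) m s + phi5 LA LC n m s + phi5 LB LE n m s", OF _ N] w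
      fs_box[of "\<lambda>(n, m, s). trm n m s", OF _ N] trm_Wt cancel_total[OF N]
    by simp
qed

lemma matrix_trm:
  "(\<Sum>(i', l')\<in>index_set k. matrix_M k i l i' l' * shift_S (indices.trm k i' l' n m s)) =
    trm (Suc n) m s + phi5 LA LC n m s + phi5 LB LE n m s"
proof -
  have one: "(\<Sum>(i', l')\<in>index_set k. matrix_M k i l i' l' * shift_S (cmp k i' l' (apw (Ds n) x))) =
      cmp k i l (apw (Ds (Suc n)) x) + phi LA LC (apw (Ds n) x) + phi LB LE (apw (Ds n) x)" if "famv x" for x
    unfolding matrix_ap[OF famv_good[OF famv_Ds[OF that]] il] phi_def by (simp add: add_ac del: ap.simps)
  have "matrix_M k i l i' l' * shift_S (indices.trm k i' l' n m s) = matrix_M k i l i' l' * shift_S (cmp k i' l' (apw (Ds n) (fA m s))) +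
      matrix_M k i l i' l' * shift_S (cmp k i' l' (apw (Ds n) (fC m s))) + matrix_M k i l i' l' * shift_S (cmp k i' l' (apw (Ds n) (fE m s))) +
      matrix_M k i l i' l' * shift_S (cmp k i' l' (apw (Ds n) (gC m s))) + matrix_M k i l i' l' * shift_S (cmp k i' l' (apw (Ds n) (gA m s)))"
    if "(i', l') \<in> index_set k" for i' l'
  proof -
    interpret J: indices k i' l' using k that by unfold_locales (auto simp: index_set_def)
    show ?thesis unfolding J.trm_def shift_S_simps(3) distrib_left ..
  qed
  then have "(\<Sum>(i', l')\<in>index_set k. matrix_M k i l i' l' * shift_S (indices.trm k i' l' n m s)) =
     (\<Sum>(i', l')\<in>index_set k. matrix_M k i l i' l' * shift_S (cmp k i' l' (apw (Ds n) (fA m s)))) +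
     (\<Sum>(i', l')\<in>index_set k. matrix_M k i l i' l' * shift_S (cmp k i' l' (apw (Ds n) (fC m s)))) +
     (\<Sum>(i', l')\<in>index_set k. matrix_M k i l i' l' * shift_S (cmp k i' l' (apw (Ds n) (fE m s)))) +
     (\<Sum>(i', l')\<in>index_set k. matrix_M k i l i' l' * shift_S (cmp k i' l' (apw (Ds n) (gC m s)))) +
     (\<Sum>(i', l')\<in>index_set k. matrix_M k i l i' l' * shift_S (cmp k i' l' (apw (Ds n) (gA m s))))"
    unfolding sum.distrib[symmetric] by (intro sum.cong refl) (simp only: split_paired_all prod.case)
  then show ?thesis
    unfolding one[OF fA_famv(1)] one[OF gA_famv(4)] one[OF fE_famv(1)] one[OF gA_famv(3)] one[OF gA_famv(1)]
    by (simp add: trm_def phi5_def add_ac del: replicate.simps)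
qed

end

lemma index_indices: "0 < k \<Longrightarrow> (i, l) \<in> index_set k \<Longrightarrow> indices k i l"
  by unfold_locales (auto simp: index_set_def)

lemma matrix_M_ring_R: "matrix_M k i l i' l' \<in> ring_R"
proof -
  have "qq * zz1 * zz2 \<in> ring_R" "zz2 \<in> ring_R"
    unfolding qq_mon zz1_mon zz2_mon mon_add[symmetric] by (simp_all add: mon_ring_R)
  then have "(qq * zz1 * zz2) ^ a * zz2 ^ b \<in> ring_R" for a b by (intro ring_R_mult[OF ring_R_power ring_R_power])
  then show ?thesis unfolding matrix_M_def by (simp add: ring_R_closed(1))
qed

lemma finite_index_set: "finite (index_set k)"
  by (rule finite_subset[of _ "{..k} \<times> {..k}"]) (auto simp: index_set_def)

lemma total_equation:
  assumes "0 < k" "(i, l) \<in> index_set k"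
  shows "indices.total k i l = (\<Sum>(i', l')\<in>index_set k. matrix_M k i l i' l' * shift_S (indices.total k i' l'))"
proof -
  interpret I: indices k i l by (rule index_indices[OF assms])
  define g where "g = (\<lambda>il (n, m, s). matrix_M k i l (fst il) (snd il) * shift_S (indices.trm k (fst il) (snd il) n m s))"
  have g: "lf (g il)" "fs (g il) = matrix_M k i l (fst il) (snd il) * shift_S (indices.total k (fst il) (snd il))" if "il \<in> index_set k" for il
  proof -
    interpret J: indices k "fst il" "snd il" by (rule index_indices[OF assms(1)]) (use that in simp)
    have "lf (\<lambda>(n, m, s). J.trm n m s)" using J.lf_box[of "\<lambda>(n, m, s). J.trm n m s"] J.trm_Wt by simp
    from lf_mult[OF lf_shift_S(1)[OF this] matrix_M_ring_R] lf_shift_S(2)[OF this]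
    show "lf (g il)" "fs (g il) = matrix_M k i l (fst il) (snd il) * shift_S (indices.total k (fst il) (snd il))"
      unfolding g_def J.total_def by (simp_all add: case_prod_unfold)
  qed
  have "(\<lambda>(n, m, s). I.trm (Suc n) m s + I.phi5 LA LC n m s + I.phi5 LB LE n m s) = (\<lambda>x. \<Sum>il\<in>index_set k. g il x)"
    unfolding I.matrix_trm[symmetric] g_def by (auto simp: case_prod_unfold)
  then have "I.total = fs (\<lambda>x. \<Sum>il\<in>index_set k. g il x)" using I.fs_total by simp
  also have "\<dots> = (\<Sum>il\<in>index_set k. fs (g il))" by (rule lf_sum(2)[OF finite_index_set]) (rule g(1))
  also have "\<dots> = (\<Sum>(i', l')\<in>index_set k. matrix_M k i l i' l' * shift_S (indices.total k i' l'))"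
    by (rule sum.cong) (auto simp: g(2))
  finally show ?thesis .
qed

subsection \<open>The initial condition\<close>

text \<open>Insert q^(j m) into the m-th term and call the sum E j. Telescoping gives E j = (1 -
  q^(j+1)) E (j+1), and E j tends to 1, which forces E 0 = (q)_inf.\<close>

lemma euler_identity: "lf (\<lambda>m. (- 1) ^ m * qq ^ (m * (m + 1) div 2) / qpoch qq m)"
  "fs (\<lambda>m. (- 1) ^ m * qq ^ (m * (m + 1) div 2) / qpoch qq m) = qpoch_inf qq"
proof -
  define t where "t = (\<lambda>j m. (- 1) ^ m * qq ^ (m * (m + 1) div 2 + j * m) / qpoch qq m)"
  have tW: "t j m \<in> Wt (m * (m + 1) div 2 + j * m)" for j m
  proof -
    have "qq ^ (m * (m + 1) div 2 + j * m) \<in> Wt (m * (m + 1) div 2 + j * m)" unfolding qq_power_mon by (rule mon_Wt) auto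
    then show ?thesis unfolding t_def by (intro unit1_divide sign_Wt unit1_qpoch qq_Wt')
  qed
  have tW': "t j m \<in> Wt m" for j m using triangle_bound[of m] by (intro Wt_mono[OF tW]) linarith
  have lf: "lf (t j)" for j by (rule lfI[OF tW']) simp
  define E where "E = (\<lambda>j. fs (t j))"
  have nz: "qpoch qq m \<noteq> 0" "1 - qq ^ Suc m \<noteq> 0" for m
    using GG_nonzero(2) unit1_inverse(1)[OF unit1_minus[OF qq_Wt]] by blast+
  have rec: "E j = (1 - qq ^ Suc j) * E (Suc j)" for j
  proof -
    \<comment> \<open>w is both the difference of the terms for j and j + 1 and, shifted by one
      index, a multiple of the term for j + 1; this makes the recursion telescope.\<close>
    define w where "w = (\<lambda>m. t j m * (1 - qq ^ m))"
    have wS: "w (Suc m) = - (qq ^ Suc j * t (Suc j) m)" for m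
    proof -
      have e: "Suc m * (Suc m + 1) div 2 + j * Suc m = Suc j + (m * (m + 1) div 2 + Suc j * m)" by simp
      have "qpoch qq (Suc m) = qpoch qq m * (1 - qq ^ Suc m)" by (simp add: qpoch_Suc mult.commute)
      then show ?thesis unfolding w_def t_def e power_add[of qq "Suc j"] using nz[of m] by (simp del: power_Suc) simp
    qed
    have t0: "t j m - t (Suc j) m = w m" for m
    proof -
      have "m * (m + 1) div 2 + Suc j * m = (m * (m + 1) div 2 + j * m) + m" by simp
      then have "t (Suc j) m = t j m * qq ^ m" unfolding t_def by (simp add: power_add)
      then show ?thesis unfolding w_def by (simp add: right_diff_distrib)
    qed
    have "fs (\<lambda>m. t j m - (1 - qq ^ Suc j) * t (Suc j) m) = w 0"
    proof (rule lf_telescope(2))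
      fix m
      have "t j m - (1 - qq ^ Suc j) * t (Suc j) m = (t j m - t (Suc j) m) + qq ^ Suc j * t (Suc j) m" by (simp add: algebra_simps)
      then show "t j m - (1 - qq ^ Suc j) * t (Suc j) m = w m - w (Suc m)" unfolding t0 wS by simp
      show "w m \<in> Wt m" unfolding w_def using qq_power_ring_R[OF ring_R_1, of m]
        by (intro Wt_mult_ring_R(1) tW' ring_R_diff ring_R_1) simp
    qed
    moreover have "w 0 = 0" by (simp add: w_def)
    moreover have "fs (\<lambda>m. t j m + (- (1 - qq ^ Suc j)) * t (Suc j) m) = E j + (- (1 - qq ^ Suc j)) * E (Suc j)"
    proof -
      have r: "- (1 - qq ^ Suc j) \<in> ring_R" using qq_power_ring_R[OF ring_R_1, of "Suc j"] by (intro ring_R_closed) simp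
      show ?thesis unfolding E_def lf_add(2)[OF lf lf_mult(1)[OF lf r]] lf_mult(2)[OF lf r] ..
    qed
    moreover have "(\<lambda>m. t j m - (1 - qq ^ Suc j) * t (Suc j) m) = (\<lambda>m. t j m + (- (1 - qq ^ Suc j)) * t (Suc j) m)"
      by (intro ext) (simp only: diff_conv_add_uminus mult_minus_left)
    ultimately have "E j + (- (1 - qq ^ Suc j)) * E (Suc j) = 0" by (simp only:)
    then show ?thesis by (simp only: mult_minus_left eq_neg_iff_add_eq_0[symmetric] minus_minus)
  qed
  have E0: "E 0 = qpoch qq j * E j" for j
  proof (induction j)
    case (Suc j)
    then show ?case using rec[of j] by (simp add: qpoch_Suc mult_ac)
  qed simp
  have E1: "E j - 1 \<in> Wt j" for j
  proof -
    have "{m. t j m \<notin> Wt j} \<subseteq> {0}"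
    proof
      fix m assume m: "m \<in> {m. t j m \<notin> Wt j}"
      have "j \<le> m * (m + 1) div 2 + j * m" if "m \<noteq> 0" using that by (cases m) auto
      then show "m \<in> {0}" using m Wt_mono[OF tW] by blast
    qed
    then have "fs (t j) - (\<Sum>m\<in>{0}. t j m) \<in> Wt j" by (intro fs_approx lf) auto
    moreover have "t j 0 = 1" by (simp add: t_def)
    ultimately show ?thesis by (simp add: E_def)
  qed
  have "E 0 = qpoch_inf qq"
  proof (rule Wt_eqI)
    fix N
    have "qpoch qq N * (E N - 1) \<in> Wt N" by (intro Wt_mult_ring_R(2) E1 qpoch_ring_R Wt_ring_R[OF qq_Wt'])
    moreover have "qpoch_inf qq - qpoch qq N \<in> Wt N" by (rule qpoch_inf(2)[OF Wt_ring_R[OF qq_Wt']])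
    ultimately have "qpoch qq N * (E N - 1) - (qpoch_inf qq - qpoch qq N) \<in> Wt N" by (rule Wt_diff)
    then show "E 0 - qpoch_inf qq \<in> Wt N" unfolding E0[of N] by (simp add: algebra_simps)
  qed
  moreover have "t 0 = (\<lambda>m. (- 1) ^ m * qq ^ (m * (m + 1) div 2) / qpoch qq m)" by (simp add: t_def)
  ultimately show "lf (\<lambda>m. (- 1) ^ m * qq ^ (m * (m + 1) div 2) / qpoch qq m)"
    "fs (\<lambda>m. (- 1) ^ m * qq ^ (m * (m + 1) div 2) / qpoch qq m) = qpoch_inf qq"
    using lf[of 0] by (simp_all add: E_def)
qed

section \<open>Reduction modulo z2\<close>

lemma Wt1_diff: "f \<in> Wt1 N \<Longrightarrow> g \<in> Wt1 N \<Longrightarrow> f - g \<in> Wt1 N" and Wt1_0: "0 \<in> Wt1 N"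
  by (auto simp: Wt1_def)

lemma Wt1_coeff: "f \<in> Wt1 N \<Longrightarrow> qz_coeff f a 0 = 0"
  by (simp add: Wt1_def)

lemma qpoch_Wt1: assumes "x \<in> Wt1 0" shows "qpoch x n - 1 \<in> Wt1 0"
proof (induction n)
  case (Suc n)
  have x: "qq ^ n * x \<in> Wt1 0" using assms qq_power_ring_R[OF ring_R_1, of n] by (intro Wt1_mult') auto
  have r: "x \<in> ring_R" using assms Wt_ring_R by (auto simp: Wt1_def)
  have "qpoch x (Suc n) - 1 = (qpoch x n - 1) - qpoch x n * (qq ^ n * x)" by (simp add: qpoch_Suc algebra_simps)
  then show ?case by (simp only: Wt1_diff[OF Suc Wt1_mult'[OF x qpoch_ring_R[OF r]]])
qed (simp add: Wt1_0)

lemma qpoch_inf_Wt1: assumes "x \<in> Wt1 0" shows "qpoch_inf x - 1 \<in> Wt1 0"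
proof -
  have r: "x \<in> ring_R" using assms Wt_ring_R by (auto simp: Wt1_def)
  have "qz_coeff (qpoch_inf x - 1) a 0 = 0" for a
  proof -
    have "qz_coeff (qpoch_inf x - qpoch x (nat a + 1)) a 0 = 0"
      by (rule Wt_coeff_0[OF qpoch_inf(2)[OF r]]) auto
    moreover have "qz_coeff (qpoch x (nat a + 1) - 1) a 0 = 0" by (rule Wt1_coeff[OF qpoch_Wt1[OF assms]])
    ultimately show ?thesis by simp
  qed
  moreover have "qpoch_inf x - 1 \<in> Wt 0" unfolding ring_R_eq_Wt[symmetric] by (intro ring_R_diff qpoch_inf(1) r ring_R_1)
  ultimately show ?thesis by (simp add: Wt1_def)
qed

lemma XX_Wt1: "qq ^ n * XX \<in> Wt1 0"
  unfolding XX_mon qq_power_mon mon_add[symmetric] by (simp add: mon_Wt1)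

text \<open>Modulo z2 every factor with z2 or X becomes 1; what remains is a term of Euler's series
  divided by (q)_inf.\<close>

lemma coeff_f_start: "coeff_f (Suc m) - (- 1) ^ m * qq ^ (m * (m + 1) div 2) / qpoch qq m / qpoch_inf qq \<in> Wt1 0"
proof -
  define d where "d = (1 - qq ^ Suc m * zz2) * qpoch_inf (qq ^ (m + 2) * XX)"
  define n where "n = 1 - qq ^ (2 * Suc m) * XX"
  define g where "g = (- 1) ^ m * qq ^ (m * (m + 1) div 2) / qpoch qq m / qpoch_inf qq"
  have z: "qq ^ Suc m * zz2 \<in> Wt1 0" "qq ^ Suc m * zz2 \<in> Wt 1"
    unfolding zz2_mon qq_power_mon mon_add[symmetric] by (simp_all add: mon_Wt1 mon_Wt)
  have u: "unit1 d" unfolding d_def by (intro unit1_mult unit1_minus unit1_qpoch_inf XX_Wt z)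
  have g: "g \<in> ring_R"
    unfolding g_def using sign_Wt[of "qq ^ (m * (m + 1) div 2)" 0 m] qq_power_ring_R[OF ring_R_1, of "m * (m + 1) div 2"]
    unfolding ring_R_eq_Wt by (intro unit1_divide unit1_qpoch unit1_qpoch_inf qq_Wt') simp
  have P: "qpoch_inf (qq ^ (m + 2) * XX) - 1 \<in> Wt1 0" by (rule qpoch_inf_Wt1[OF XX_Wt1])
  have Pr: "qpoch_inf (qq ^ (m + 2) * XX) \<in> ring_R" by (rule unit1_ring_R[OF unit1_qpoch_inf[OF XX_Wt]])
  have "n - d = (qq ^ Suc m * zz2) * qpoch_inf (qq ^ (m + 2) * XX) - (qpoch_inf (qq ^ (m + 2) * XX) - 1) - qq ^ (2 * Suc m) * XX"
    by (simp add: n_def d_def algebra_simps)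
  also have "\<dots> \<in> Wt1 0" by (intro Wt1_diff Wt1_mult z P Pr XX_Wt1)
  finally have "(n - d) * (g * (1 / d)) \<in> Wt1 0"
    by (intro Wt1_mult ring_R_mult g unit1_inverse(2)[OF u])
  moreover have "coeff_f (Suc m) = g * n / d"
    unfolding coeff_f_GG GG_def g_def n_def d_def by (simp add: mult_ac)
  moreover have "g * n / d - g = (n - d) * (g * (1 / d))"
    using unit1_inverse(1)[OF u] by (simp add: divide_simps) (simp add: algebra_simps)
  ultimately show ?thesis by (simp add: g_def)
qed

lemma fs_coeff_f_start: "qz_coeff (fs (\<lambda>m. coeff_f (Suc m))) a 0 = (if a = 0 then 1 else 0)"
proof -
  define g where "g = (\<lambda>m. (- 1) ^ m * qq ^ (m * (m + 1) div 2) / qpoch qq m / qpoch_inf qq)"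
  have u: "unit1 (qpoch_inf qq)" by (rule unit1_qpoch_inf[OF qq_Wt'])
  have g: "g = (\<lambda>m. 1 / qpoch_inf qq * ((- 1) ^ m * qq ^ (m * (m + 1) div 2) / qpoch qq m))" by (simp add: g_def mult.commute)
  have lg: "lf g" "fs g = 1"
    unfolding g lf_mult(2)[OF euler_identity(1) unit1_inverse(2)[OF u]] euler_identity(2)
    using lf_mult(1)[OF euler_identity(1) unit1_inverse(2)[OF u]] unit1_inverse(1)[OF u] by simp_all
  have lc: "lf (\<lambda>m. coeff_f (Suc m))" by (rule lfI[OF coeff_f_Wt]) simp
  have eq: "qz_coeff (coeff_f (Suc m)) a 0 = qz_coeff (g m) a 0" for m
    using Wt1_coeff[OF coeff_f_start[of m], of a] by (simp add: g_def)
  have "qz_coeff (fs (\<lambda>m. coeff_f (Suc m))) a 0 = (\<Sum>m | qz_coeff (g m) a 0 \<noteq> 0. qz_coeff (g m) a 0)"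
    using qz_coeff_fs[OF lc lf_finite_coeff[OF lg(1), of a 0], of a 0] unfolding eq by simp
  also have "\<dots> = qz_coeff (fs g) a 0" using qz_coeff_fs[OF lg(1) lf_finite_coeff[OF lg(1), of a 0], of a 0] by simp
  finally show ?thesis by (simp add: lg(2))
qed

text \<open>Divisibility by z2 without tracking degrees, which is all that the value at z2 = 0
  depends on.\<close>

definition dv :: "mvec \<Rightarrow> bool" where "dv x \<longleftrightarrow> famv x \<and> simple x \<and> div_level 0 x"

lemma dv_ap: "dv x \<Longrightarrow> famv (ap L x) \<Longrightarrow> dv (ap L x)"
  unfolding dv_def using div_level_ap[of x L 0] div_level_mono[of "Suc 0" "ap L x" 0] simple_ap[of x L] famv_good[of x L] by auto

lemma dv_start: assumes "reach N x" "famv (ap L x)" "L \<in> {LC, LD, LE}" shows "dv (ap L x)"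
proof -
  have r: "famv x" "simple x" "div_level (N - 1) x \<or> v_level N x" using assms(1) by (auto simp: reach_def)
  note g = famv_good[OF r(1)]
  from r(3) have "div_level 0 (ap L x)"
  proof
    assume "div_level (N - 1) x"
    from div_level_ap[OF r(2) g this] show ?thesis by (rule div_level_mono) simp
  next
    assume v: "v_level N x"
    have "\<not> v_level N (ap L x)" using v v_level_p[of N L] assms(3) by (cases x) auto
    then have "div_level N (ap L x)" using v_level_ap[OF g v, of L] assms(3) by auto
    then show ?thesis by (rule div_level_mono) simp
  qed
  then show ?thesis using assms(2) r g simple_ap[of x L] by (simp add: dv_def)
qed

lemma dv_Ds: "dv x \<Longrightarrow> dv (apw (Ds n) x)"
  by (induction n) (simp_all add: dv_ap famv_ap(1) dv_def[of "apw _ _"])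

lemma dv_Ds_start: "reach N x \<Longrightarrow> dv (apw (Ds (Suc n)) x)"
proof (induction n)
  case 0
  then show ?case using dv_start[of N x LD] famv_ap(1)[of x] by (simp add: reach_def[of N x])
next
  case (Suc n)
  then show ?case using dv_ap[of "apw (Ds (Suc n)) x" LD] famv_ap(1)[of "apw (Ds (Suc n)) x"] by (simp add: dv_def[of "ap _ _"])
qed

lemma dv_As: "dv x \<Longrightarrow> x_ok (xr x) \<Longrightarrow> dv (apw (As m) x) \<and> x_ok (xr (apw (As m) x))"
proof (induction m)
  case (Suc m)
  then show ?case using dv_ap[of "apw (As m) x" LA] famv_ap(2)[of "apw (As m) x"] fam_A by simp
qed simp

context indices begin

lemma dv_coeff: "dv x \<Longrightarrow> qz_coeff (cmp k i l x) a 0 = 0"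
  unfolding dv_def using div_level_cmp[of x 0, OF _ _ k il] by (auto intro: Wt1_coeff)

lemma merged_dv:
  assumes "merged k i l ys W y N" "\<And>j z. z \<in> set (ys j) \<Longrightarrow> dv (apw W z)"
  shows "qz_coeff (cmp k i l (apw W y)) a 0 = 0"
proof -
  have z: "qz_coeff (\<Sum>z\<leftarrow>ys j. cmp k i l (apw W z)) a 0 = 0" for j
  proof -
    have "qz_coeff (\<Sum>z\<leftarrow>xs. cmp k i l (apw W z)) a 0 = 0" if "\<And>z. z \<in> set xs \<Longrightarrow> dv (apw W z)" for xs
      using that by (induction xs) (simp_all add: dv_coeff)
    then show ?thesis using assms(2) by blast
  qed
  have "qz_coeff (fs (\<lambda>j. \<Sum>z\<leftarrow>ys j. cmp k i l (apw W z))) a 0 = (\<Sum>j\<in>{}. qz_coeff (\<Sum>z\<leftarrow>ys j. cmp k i l (apw W z)) a 0)"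
    by (rule qz_coeff_fs[OF merged_lf[OF assms(1)]]) (auto simp: z)
  then show ?thesis using assms(1) by (simp add: merged_def)
qed

lemma U_dv: "x \<in> set (U_list (Suc s) j) \<Longrightarrow> dv x"
proof -
  assume x: "x \<in> set (U_list (Suc s) j)"
  then obtain y L where y: "y \<in> set (DBDE (U_list s j))" "x = ap L y" "L \<in> {LC, LD}" by (auto simp del: ap.simps)
  show "dv x" unfolding y(2) using y Uent_famv[OF U_list_Uent[OF x]] by (intro dv_start[OF list_T(1)[OF y(1)]]) auto
qed

text \<open>For n > 0 some \<open>D\<close>, and for s > 0 some L, has been applied to v_inf, and
  either puts a factor z2 into every slot. The excluded case n = s = 0 is A^m B v_inf.\<close>

lemma start_zero:
  assumes "0 < n \<or> 0 < s" shows "qz_coeff (cmp k i l (apw (Ds n) (fA m s))) a 0 = 0"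
proof -
  have "qz_coeff (cmp k i l (apw (Ds n @ As m) (yB s))) a 0 = 0"
  proof (rule merged_dv[OF merged_fA[of "[]" LA, unfolded append_Nil, OF disjI1[OF refl]]])
    fix j z assume z: "z \<in> set (map (ap LB) (U_list s j))"
    note r = list_B[OF z]
    show "dv (apw (Ds n @ As m) z)"
    proof (cases n)
      case (Suc n')
      then show ?thesis using dv_Ds_start[OF reach_As[OF r, THEN conjunct1], of n' m] by (simp del: replicate.simps ap.simps)
    next
      case 0
      then obtain s' where s: "s = Suc s'" using assms by (cases s) auto
      obtain x where x: "x \<in> set (U_list s j)" "z = ap LB x" using z by auto
      have "dv z" unfolding x(2) using U_dv[OF x(1)[unfolded s]] r(1) unfolding x(2) by (intro dv_ap) (auto simp: reach_def)
      then show ?thesis using dv_As[OF _ r(2), of m] by (simp add: 0)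
    qed
  qed
  then show ?thesis by (simp only: word_vectors)
qed

lemma start_zero':
  "qz_coeff (cmp k i l (apw (Ds n) (fC m s))) a 0 = 0" "qz_coeff (cmp k i l (apw (Ds n) (fE m s))) a 0 = 0"
  "qz_coeff (cmp k i l (apw (Ds n) (gC m s))) a 0 = 0" "qz_coeff (cmp k i l (apw (Ds n) (gA m s))) a 0 = 0"
proof -
  have C: "dv (apw (Ds n @ LC # As m) z)" if "reach N z" "x_ok (xr z)" for N z
    using dv_start[of "m + N" "apw (As m) z" LC] reach_As[OF that, of m] famv_ap(3)[of "apw (As m) z"] dv_Ds
    by (simp del: ap.simps)
  have "qz_coeff (cmp k i l (apw (Ds n @ LC # As m) (yB s))) a 0 = 0"
    by (rule merged_dv[OF merged_fC[of "[]" LA, unfolded append_Nil, OF disjI1[OF refl]]]) (rule C[OF list_B])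
  then show "qz_coeff (cmp k i l (apw (Ds n) (fC m s))) a 0 = 0" by (simp only: word_vectors)
  have "qz_coeff (cmp k i l (apw (Ds n @ LC # As m) (vT s))) a 0 = 0"
    by (rule merged_dv[OF merged_gC[of "[]" LA, unfolded append_Nil, OF disjI1[OF refl]]]) (rule C[OF list_T])
  then show "qz_coeff (cmp k i l (apw (Ds n) (gC m s))) a 0 = 0" by (simp only: word_vectors)
  have E: "dv (apw (Es m) z)" if "dv z" "e_ok (yr z)" for z
  proof -
    have "dv (apw (Es m) z) \<and> e_ok (yr (apw (Es m) z))"
    proof (induction m)
      case (Suc m)
      then show ?case using dv_ap[of "apw (Es m) z" LE] famv_ap(5)[of "apw (Es m) z"] fam_E by simp
    qed (use that in simp)
    then show ?thesis ..
  qed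
  have "qz_coeff (cmp k i l (apw (Ds n @ Es m) (yE s))) a 0 = 0"
  proof (rule merged_dv[OF merged_fE[of "[]" LA, unfolded append_Nil, OF disjI1[OF refl]]])
    fix j z assume z: "z \<in> set (map (ap LE) (U_list s j))"
    note r = list_E[OF z]
    obtain x where x: "x \<in> set (U_list s j)" "z = ap LE x" using z by auto
    have "dv z" unfolding x(2) using r(1) unfolding x(2) by (intro dv_start[OF U_list_reach[OF x(1)]]) (auto simp: reach_def)
    then show "dv (apw (Ds n @ Es m) z)" using dv_Ds[OF E[OF _ r(2)]] by simp
  qed
  then show "qz_coeff (cmp k i l (apw (Ds n) (fE m s))) a 0 = 0" by (simp only: word_vectors)
  have "qz_coeff (cmp k i l (apw (Ds n @ As (Suc m)) (vT s))) a 0 = 0"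
  proof (rule merged_dv[OF merged_gA[of "[]" LA, unfolded append_Nil, OF disjI1[OF refl]]])
    fix j z assume z: "z \<in> set (DBDE (U_list s j))"
    note r = list_T[OF z]
    obtain x L where x: "x \<in> set (U_list s j)" "L \<in> {LB, LD, LE}" "z = ap LD (ap L x)"
      using z by (auto simp: DBDE_def simp del: ap.simps)
    have "dv z" unfolding x(3) using r(1) unfolding x(3)
      by (intro dv_start[OF reach_BDE[OF U_list_reach[OF x(1)] U_list_Uent[OF x(1)] x(2)]]) (auto simp: reach_def)
    then show "dv (apw (Ds n @ As (Suc m)) z)" using dv_Ds[OF dv_As[OF _ r(2), THEN conjunct1], of n "Suc m"] by (simp del: ap.simps replicate.simps)
  qed
  then show "qz_coeff (cmp k i l (apw (Ds n) (gA m s))) a 0 = 0" by (simp only: word_vectors)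
qed

lemma cmp_v_vec: "cmp k i l (v_vec m) = coeff_f (Suc m) * (mon (int m + 1, 0, 1) ^ (l - i) * zz2 ^ i)"
proof -
  have "mon (0, 0, 1) = zz2" "mon (0, 0) = (1 :: lseries) \<or> True" by (simp_all add: zz2_mon)
  then show ?thesis by (simp add: v_vec_def mult.assoc)
qed

text \<open>Only f_(m+1) v_(m+1) = A^m B v_inf contributes at z2 = 0. For l > 0 the component
  contains a slot Q or R and is divisible by z2; for l = 0 it is the sum of all f_n, which is 1 at
  z2 = 0 by Euler's identity.\<close>

lemma total_start: "qz_coeff total a 0 = (if a = 0 \<and> i = 0 \<and> l = 0 then 1 else 0)"
proof -
  have z: "qz_coeff (trm n m s) a 0 = (if n = 0 \<and> s = 0 then qz_coeff (cmp k i l (v_vec m)) a 0 else 0)" for n m s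
    using start_zero[of n s m a] start_zero'[of n m s a] by (auto simp: trm_def fA_0)
  define K where "K = nat a + 2"
  have "qz_coeff total a 0 = (\<Sum>x\<in>(\<lambda>m. (0, m, 0)) ` {..<K}. qz_coeff (case x of (n, m, s) \<Rightarrow> trm n m s) a 0)"
    unfolding total_def
  proof (rule qz_coeff_fs)
    show "lf (\<lambda>(n, m, s). trm n m s)" using lf_box[of "\<lambda>(n, m, s). trm n m s"] trm_Wt by simp
    show "{x. qz_coeff (case x of (n, m, s) \<Rightarrow> trm n m s) a 0 \<noteq> 0} \<subseteq> (\<lambda>m. (0, m, 0)) ` {..<K}"
    proof
      fix x assume x: "x \<in> {x. qz_coeff (case x of (n, m, s) \<Rightarrow> trm n m s) a 0 \<noteq> 0}"
      obtain n m s where nms: "x = (n, m, s)" by (cases x)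
      have nz: "qz_coeff (trm n m s) a 0 \<noteq> 0" using x by (simp add: nms)
      then have "n = 0" "s = 0" using z[of n m s] by (auto split: if_splits)
      moreover have "\<not> a + 0 < int (n + m + 2 * s - 1)" using nz Wt_coeff_0[OF trm_Wt] by blast
      ultimately show "x \<in> (\<lambda>m. (0, m, 0)) ` {..<K}" by (auto simp: nms K_def)
    qed
  qed auto
  also have "\<dots> = (\<Sum>m<K. qz_coeff (cmp k i l (v_vec m)) a 0)"
    by (subst sum.reindex) (auto simp: inj_on_def z)
  also have "\<dots> = (if a = 0 \<and> i = 0 \<and> l = 0 then 1 else 0)"
  proof (cases "l = 0")
    case True
    then have "i = 0" using il by simp
    have "(\<Sum>m<K. qz_coeff (coeff_f (Suc m)) a 0) = qz_coeff (fs (\<lambda>m. coeff_f (Suc m))) a 0"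
    proof (rule qz_coeff_fs[symmetric])
      show "lf (\<lambda>m. coeff_f (Suc m))" by (rule lfI[OF coeff_f_Wt]) simp
      show "{m. qz_coeff (coeff_f (Suc m)) a 0 \<noteq> 0} \<subseteq> {..<K}"
      proof
        fix m assume "m \<in> {m. qz_coeff (coeff_f (Suc m)) a 0 \<noteq> 0}"
        then have "\<not> a + 0 < int m" using Wt_coeff_0[OF coeff_f_Wt] by blast
        then show "m \<in> {..<K}" by (auto simp: K_def)
      qed
    qed simp
    moreover have "cmp k i l (v_vec m) = coeff_f (Suc m)" for m unfolding cmp_v_vec using True \<open>i = 0\<close> by simp
    ultimately have "(\<Sum>m<K. qz_coeff (cmp k i l (v_vec m)) a 0) = qz_coeff (fs (\<lambda>m. coeff_f (Suc m))) a 0" by simp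
    then show ?thesis using True \<open>i = 0\<close> unfolding fs_coeff_f_start by simp
  next
    case False
    have "cmp k i l (v_vec m) \<in> Wt1 0" for m
    proof -
      have w: "mon (int m + 1, 0, 1) \<in> Wt1 0" "zz2 \<in> Wt1 0" unfolding zz2_mon by (simp_all add: mon_Wt1)
      then have r: "mon (int m + 1, 0, 1) \<in> ring_R" "zz2 \<in> ring_R" using Wt_ring_R by (auto simp: Wt1_def)
      have p: "x ^ Suc n \<in> Wt1 0" if "x \<in> Wt1 0" "x \<in> ring_R" for x n using that by (simp add: Wt1_mult ring_R_power)
      have "mon (int m + 1, 0, 1) ^ (l - i) * zz2 ^ i \<in> Wt1 0"
      proof (cases "i = 0")
        case True
        then show ?thesis using False p[OF w(1) r(1), of "l - 1"] by simp
      next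
        case False
        then show ?thesis using p[OF w(2) r(2), of "i - 1"] r by (intro Wt1_mult' ring_R_power) simp_all
      qed
      from Wt1_mult'[OF this Wt_ring_R[OF coeff_f_Wt]] show ?thesis unfolding cmp_v_vec .
    qed
    then have "qz_coeff (cmp k i l (v_vec m)) a 0 = 0" for m by (rule Wt1_coeff)
    then show ?thesis using False by simp
  qed
  finally show ?thesis .
qed

end

subsection \<open>Uniqueness of the solution\<close>

lemma matrix_M_mon: "matrix_M k i l i' l' = 0 \<or> (\<exists>e :: nat. matrix_M k i l i' l' = mon (int e, int e, int e + int i))"
proof -
  have "(qq * zz1 * zz2) ^ e * zz2 ^ i = mon (int e, int e, int e + int i)" for e
  proof -
    have "(qq * zz1 * zz2) ^ e * zz2 ^ i = mon (1, 1, 1) ^ e * mon (0, 0, 1) ^ i"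
      by (simp add: qq_mon zz1_mon zz2_mon flip: mon_add)
    then show ?thesis by (simp only: mon_power mon_add[symmetric]) simp
  qed
  moreover have "matrix_M k i l i' l' = 0 \<or> (\<exists>e. matrix_M k i l i' l' = (qq * zz1 * zz2) ^ e * zz2 ^ i)"
    unfolding matrix_M_def by auto
  ultimately show ?thesis by metis
qed

text \<open>Lexicographic induction on (c, a) for the coefficient of q^a z2^c in the difference of
  two solutions; the initial condition settles c = 0.\<close>

lemma chi_solution_unique:
  assumes \<chi>: "chi_solution k \<chi>" "chi_solution k \<chi>'"
  shows "\<chi> = \<chi>'"
proof -
  define d where "d = (\<lambda>i l. \<chi> i l - \<chi>' i l)"
  have dR: "d i l \<in> ring_R" if "(i, l) \<in> index_set k" for i l
    using \<chi> that unfolding d_def chi_solution_def by (auto intro: ring_R_diff)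
  have deq: "d i l = (\<Sum>(i', l')\<in>index_set k. matrix_M k i l i' l' * shift_S (d i' l'))" if "(i, l) \<in> index_set k" for i l
  proof -
    have "\<chi> i l = (\<Sum>(i', l')\<in>index_set k. matrix_M k i l i' l' * shift_S (\<chi> i' l'))"
      "\<chi>' i l = (\<Sum>(i', l')\<in>index_set k. matrix_M k i l i' l' * shift_S (\<chi>' i' l'))"
      using \<chi> that unfolding chi_solution_def by blast+
    then have "d i l = (\<Sum>(i', l')\<in>index_set k. matrix_M k i l i' l' * shift_S (\<chi> i' l')) - (\<Sum>(i', l')\<in>index_set k. matrix_M k i l i' l' * shift_S (\<chi>' i' l'))"
      unfolding d_def by (simp only:)
    then show ?thesis by (simp add: d_def right_diff_distrib sum_subtractf case_prod_unfold)
  qed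
  have "\<forall>(a :: nat) i l. (i, l) \<in> index_set k \<longrightarrow> qz_coeff (d i l) (int a) (int c) = 0" for c
  proof (induction c rule: less_induct)
    case (less c)
    show ?case
    proof (cases "c = 0")
      case True
      have "fls_nth (\<chi> i l) 0 = fls_nth (\<chi>' i l) 0" if "(i, l) \<in> index_set k" for i l
        using \<chi> that unfolding chi_solution_def by fastforce
      then show ?thesis unfolding True d_def by (simp add: qz_coeff_def)
    next
      case False
      have "qz_coeff (d i l) (int a) (int c) = 0" if "(i, l) \<in> index_set k" for a i l
        using that
      proof (induction a arbitrary: i l rule: less_induct)
        case (less a)
        note outer = \<open>\<And>y. y < c \<Longrightarrow> \<forall>a i l. (i, l) \<in> index_set k \<longrightarrow> qz_coeff (d i l) (int a) (int y) = 0\<close>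
        have low: "qz_coeff (d i' l') a' c' = 0" if "(i', l') \<in> index_set k" "c' < int c \<or> c' = int c \<and> a' < int a" for i' l' a' c'
        proof (cases "a' < 0 \<or> c' < 0")
          case True
          then show ?thesis using dR[OF that(1)] unfolding ring_R_def by blast
        next
          case False
          then have e: "a' = int (nat a')" "c' = int (nat c')" by auto
          show ?thesis using that(2)
          proof
            assume "c' < int c"
            then have "nat c' < c" using False by linarith
            from outer[OF this] that(1) show ?thesis by (subst e(1), subst e(2)) blast
          next
            assume "c' = int c \<and> a' < int a"
            then show ?thesis using less.IH[of "nat a'" i' l'] False that(1) by auto
          qed
        qed
        have term0: "qz_coeff (matrix_M k i l i' l' * shift_S (d i' l')) (int a) (int c) = 0" if "(i', l') \<in> index_set k" for i' l'
          using matrix_M_mon[of k i l i' l']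
        proof (elim disjE exE)
          fix e :: nat assume e: "matrix_M k i l i' l' = mon (int e, int e, int e + int i)"
          \<comment> \<open>If e + i > 0, the exponent of z2 drops. Otherwise \<open>S\<close> draws
            q^a z2^c from q^(a-c) z2^c, where the exponent of q is smaller because c > 0.\<close>
          have "qz_coeff (d i' l') (int a - int e - (int c - (int e + int i))) (int c - (int e + int i)) = 0"
            using that False by (intro low) auto
          then show ?thesis unfolding e qz_coeff_mon_times qz_coeff_shift_S by simp
        qed simp
        show ?case unfolding deq[OF less.prems] qz_coeff_sum by (rule sum.neutral) (use term0 in auto)
      qed
      then show ?thesis by blast
    qed
  qed
  then have z: "qz_coeff (d i l) a c = 0" if "(i, l) \<in> index_set k" for i l a c
  proof (cases "a < 0 \<or> c < 0")
    case True
    then show ?thesis using dR[OF that] unfolding ring_R_def by blast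
  next
    case False
    then have "a = int (nat a)" "c = int (nat c)" by auto
    with \<open>\<And>c. \<forall>(a :: nat) i l. (i, l) \<in> index_set k \<longrightarrow> qz_coeff (d i l) (int a) (int c) = 0\<close> that show ?thesis by metis
  qed
  show ?thesis
  proof (intro ext)
    fix i l
    show "\<chi> i l = \<chi>' i l"
    proof (cases "(i, l) \<in> index_set k")
      case True
      have "d i l = 0" by (rule qz_coeff_eqI) (simp add: z[OF True])
      then show ?thesis by (simp add: d_def)
    next
      case False
      then show ?thesis using \<chi> unfolding chi_solution_def by metis
    qed
  qed
qed

lemma chi_total: assumes "0 < k" "(i, l) \<in> index_set k" shows "chi k i l = indices.total k i l"
proof -
  define X where "X = (\<lambda>i l. if (i, l) \<in> index_set k then indices.total k i l else 0)"
  have "chi_solution k X"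
    unfolding chi_solution_def
  proof (intro conjI ballI allI impI; (unfold split_paired_all prod.case)?)
    fix i l assume il: "(i, l) \<in> index_set k"
    interpret I: indices k i l by (rule index_indices[OF assms(1) il])
    show "X i l \<in> ring_R" using il by (simp add: X_def I.total_def fs_ring_R)
    have "X i l = (\<Sum>(i', l')\<in>index_set k. matrix_M k i l i' l' * shift_S (indices.total k i' l'))"
      using total_equation[OF assms(1) il] il by (simp add: X_def)
    also have "\<dots> = (\<Sum>(i', l')\<in>index_set k. matrix_M k i l i' l' * shift_S (X i' l'))"
      by (rule sum.cong) (auto simp: X_def)
    finally show "X i l = (\<Sum>(i', l')\<in>index_set k. matrix_M k i l i' l' * shift_S (X i' l'))" .
    show "fls_nth (X i l) 0 = (if i = 0 \<and> l = 0 then 1 else 0)"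
    proof (rule fls_eqI)
      fix a
      show "fls_nth (fls_nth (X i l) 0) a = fls_nth (if i = 0 \<and> l = 0 then 1 else 0) a"
        using I.total_start[of a] il by (auto simp: X_def qz_coeff_def)
    qed
  next
    fix i l assume "(i, l) \<notin> index_set k"
    then show "X i l = 0" by (simp add: X_def)
  qed
  then have "chi k = X" unfolding chi_def using chi_solution_unique by (intro the_equality) auto
  then show ?thesis using assms(2) by (simp add: X_def)
qed

subsection \<open>The operators on formal sums\<close>

definition fv :: "(nat \<Rightarrow> mvec list) \<Rightarrow> formal_vec option" where
  "fv vs = Some (\<lambda>n. map to_svec (vs n))"

text \<open>Carries definedness and simplicity from one operator to the next; the degree plays its
  part elsewhere, so the bound is set to 0.\<close>

definition all_reach :: "(nat \<Rightarrow> mvec list) \<Rightarrow> bool" where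
  "all_reach vs \<longleftrightarrow> (\<forall>n. \<forall>x\<in>set (vs n). reach 0 x)"

lemma extend_op_fv: assumes "all_reach vs" shows "extend_op (svec_op L) (fv vs) = fv (\<lambda>n. map (ap L) (vs n))"
proof -
  have "is_simple (to_svec x)" "svec_op L (to_svec x) = Some (to_svec (ap L x))" if "x \<in> set (vs n)" for n x
  proof -
    have "famv x" "simple x" using assms that by (auto simp: all_reach_def reach_def)
    then show "is_simple (to_svec x)" "svec_op L (to_svec x) = Some (to_svec (ap L x))"
      using simple_is_simple svec_op_good famv_good by blast+
  qed
  then show ?thesis unfolding extend_op_def fv_def by (auto simp: comp_def)
qed

lemma ops_fv:
  assumes "all_reach vs"
  shows "opA (fv vs) = fv (\<lambda>n. map (ap LA) (vs n))" "opB (fv vs) = fv (\<lambda>n. map (ap LB) (vs n))"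
    "opC (fv vs) = fv (\<lambda>n. map (ap LC) (vs n))" "opD (fv vs) = fv (\<lambda>n. map (ap LD) (vs n))"
    "opE (fv vs) = fv (\<lambda>n. map (ap LE) (vs n))"
  using extend_op_fv[OF assms, of LA] extend_op_fv[OF assms, of LB] extend_op_fv[OF assms, of LC]
    extend_op_fv[OF assms, of LD] extend_op_fv[OF assms, of LE]
  by (simp_all add: opA_def opB_def opC_def opD_def opE_def)

lemma op_plus_fv: "F V = fv vs \<Longrightarrow> G V = fv ws \<Longrightarrow> (F \<oplus>\<^sub>o G) V = fv (\<lambda>n. vs n @ ws n)"
  by (simp add: op_plus_def fv_def)

lemma op_power_fv:
  assumes "\<And>vs. all_reach vs \<Longrightarrow> F (fv vs) = fv (\<lambda>n. map (ap L) (vs n))"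
    and "\<And>m. all_reach (\<lambda>n. map (apw (replicate m L)) (vs n))"
  shows "(F ^^ m) (fv vs) = fv (\<lambda>n. map (apw (replicate m L)) (vs n))"
proof (induction m)
  case (Suc m)
  then show ?case using assms(1)[OF assms(2)[of m]] by (simp add: comp_def)
qed simp

lemma all_reachI: "(\<And>n x. x \<in> set (vs n) \<Longrightarrow> reach (N n) x) \<Longrightarrow> all_reach vs"
  unfolding all_reach_def using reach_mono by blast

lemma all_reach_Ds: "all_reach vs \<Longrightarrow> all_reach (\<lambda>n. map (apw (Ds m)) (vs n))"
  unfolding all_reach_def using reach_Ds[of 0 _ m] reach_mono by fastforce

lemma opD_power: "all_reach vs \<Longrightarrow> (opD ^^ m) (fv vs) = fv (\<lambda>n. map (apw (Ds m)) (vs n))"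
  by (intro op_power_fv all_reach_Ds ops_fv)

lemma all_reach_As:
  assumes "\<And>n x. x \<in> set (vs n) \<Longrightarrow> reach 0 x \<and> x_ok (xr x)"
  shows "all_reach (\<lambda>n. map (apw (As m)) (vs n))" "all_reach (\<lambda>n. map (ap LC) (map (apw (As m)) (vs n)))"
    "(opA ^^ m) (fv vs) = fv (\<lambda>n. map (apw (As m)) (vs n))"
proof -
  have r: "reach (m + 0) (apw (As m) x) \<and> x_ok (xr (apw (As m) x))" if "x \<in> set (vs n)" for m n x
    using assms[OF that] by (intro reach_As) auto
  have A: "all_reach (\<lambda>n. map (apw (As m)) (vs n))" for m
    using r by (intro all_reachI[where N = "\<lambda>_. m"]) auto
  then show "all_reach (\<lambda>n. map (apw (As m)) (vs n))" .
  show "all_reach (\<lambda>n. map (ap LC) (map (apw (As m)) (vs n)))"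
  proof (rule all_reachI[where N = "\<lambda>_. Suc (m + 0)"])
    fix n y assume "y \<in> set (map (ap LC) (map (apw (As m)) (vs n)))"
    then obtain x where x: "x \<in> set (vs n)" "y = ap LC (apw (As m) x)" by auto
    show "reach (Suc (m + 0)) y" unfolding x(2) using r[OF x(1), of m] by (intro reach_C) auto
  qed
  show "(opA ^^ m) (fv vs) = fv (\<lambda>n. map (apw (As m)) (vs n))" by (intro op_power_fv A ops_fv)
qed

lemma all_reach_U: "all_reach (U_list s)"
  using U_list_reach by (intro all_reachI) blast

lemma all_reach_BDE: "all_reach (\<lambda>n. map (ap LB) (U_list s n) @ map (ap LD) (U_list s n) @ map (ap LE) (U_list s n))"
proof (rule all_reachI)
  fix n y assume "y \<in> set (map (ap LB) (U_list s n) @ map (ap LD) (U_list s n) @ map (ap LE) (U_list s n))"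
  then obtain x L where "x \<in> set (U_list s n)" "L \<in> {LB, LD, LE}" "y = ap L x" by auto
  then show "reach (n + 2 * s) y" using reach_BDE U_list_reach U_list_Uent by blast
qed

lemma BDE_fv: "(opB \<oplus>\<^sub>o opD \<oplus>\<^sub>o opE) (fv (U_list s)) = fv (\<lambda>n. map (ap LB) (U_list s n) @ map (ap LD) (U_list s n) @ map (ap LE) (U_list s n))"
  unfolding append_assoc[symmetric] by (intro op_plus_fv ops_fv all_reach_U)

lemma DBDE_fv: "opD ((opB \<oplus>\<^sub>o opD \<oplus>\<^sub>o opE) (fv (U_list s))) = fv (\<lambda>n. DBDE (U_list s n))"
  unfolding BDE_fv ops_fv(4)[OF all_reach_BDE] DBDE_def ..

section \<open>The summands of the theorem as formal sums\<close>

context indices begin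

lemma list_T_0: "z \<in> set (DBDE (U_list s n)) \<Longrightarrow> reach 0 z \<and> x_ok (xr z)"
  using list_T[of z s n] reach_mono[of "n + 2 * s" z 0] by auto

lemma list_B_0: "z \<in> set (map (ap LB) (U_list s n)) \<Longrightarrow> reach 0 z \<and> x_ok (xr z)"
  using list_B[of z s n] reach_mono[of "n + 2 * s" z 0] by auto

lemma all_reach_T: "all_reach (\<lambda>n. DBDE (U_list s n))"
  using list_T_0 by (auto simp: all_reach_def)

lemma opL_power: "(opL ^^ s) v_inf = fv (U_list s)"
proof (induction s)
  case 0
  have "mon 0 = 1" "mon (int n + 1, 0, 1) = qq ^ Suc n * zz2" "mon (0, 0, 1) = zz2" for n
    unfolding zz2_mon qq_power_mon mon_add[symmetric] by (simp_all add: add.commute)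
  then show ?case by (simp add: v_inf_def fv_def v_vec_def del: power_Suc)
next
  case (Suc s)
  have "opL (fv (U_list s)) = (opC \<oplus>\<^sub>o opD) (fv (\<lambda>n. DBDE (U_list s n)))"
    unfolding opL_def comp_def DBDE_fv ..
  also have "\<dots> = fv (U_list (Suc s))"
  proof -
    have "U_list (Suc s) = (\<lambda>n. map (ap LC) (DBDE (U_list s n)) @ map (ap LD) (DBDE (U_list s n)))" by (intro ext) simp
    then show ?thesis by (simp only:) (intro op_plus_fv ops_fv all_reach_T)
  qed
  finally show ?case by (simp add: Suc del: U_list.simps)
qed

text \<open>The entries of the (n, m, s) summand before merging, in the order of the five products.
  The third block shows m letters \<open>E\<close>, as \<open>E\<close> has already been applied
  once to the list.\<close>

definition T_list :: "nat \<Rightarrow> nat \<Rightarrow> nat \<Rightarrow> nat \<Rightarrow> mvec list" where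
  "T_list n m s j =
     map (apw (Ds n @ As m)) (map (ap LB) (U_list s j)) @ map (apw (Ds n @ LC # As m)) (map (ap LB) (U_list s j)) @
     map (apw (Ds n @ Es m)) (map (ap LE) (U_list s j)) @ map (apw (Ds n @ LC # As m)) (DBDE (U_list s j)) @
     map (apw (Ds n @ As (Suc m))) (DBDE (U_list s j))"

lemma fs_T_list: "lf (\<lambda>j. \<Sum>x\<leftarrow>T_list n m s j. cmp k i l x)" "fs (\<lambda>j. \<Sum>x\<leftarrow>T_list n m s j. cmp k i l x) = trm n m s"
proof -
  note ms = merged_fA[of "[]" LA, unfolded append_Nil, OF disjI1[OF refl]] merged_fC[of "[]" LA, unfolded append_Nil, OF disjI1[OF refl]]
    merged_fE[of "[]" LA, unfolded append_Nil, OF disjI1[OF refl]] merged_gC[of "[]" LA, unfolded append_Nil, OF disjI1[OF refl]]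
    merged_gA[of "[]" LA, unfolded append_Nil, OF disjI1[OF refl]]
  note lfs = merged_lf[OF ms(1)] merged_lf[OF ms(2)] merged_lf[OF ms(3)] merged_lf[OF ms(4)] merged_lf[OF ms(5)]
  note fss = ms[unfolded merged_def, THEN conjunct2]
  have e: "(\<Sum>x\<leftarrow>T_list n m s j. cmp k i l x) =
     (\<Sum>z\<leftarrow>map (ap LB) (U_list s j). cmp k i l (apw (Ds n @ As m) z)) + ((\<Sum>z\<leftarrow>map (ap LB) (U_list s j). cmp k i l (apw (Ds n @ LC # As m) z)) +
     ((\<Sum>z\<leftarrow>map (ap LE) (U_list s j). cmp k i l (apw (Ds n @ Es m) z)) + ((\<Sum>z\<leftarrow>DBDE (U_list s j). cmp k i l (apw (Ds n @ LC # As m) z)) +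
     (\<Sum>z\<leftarrow>DBDE (U_list s j). cmp k i l (apw (Ds n @ As (Suc m)) z)))))" for j
    unfolding T_list_def map_append sum_list_append list.map_comp comp_def ..
  show "lf (\<lambda>j. \<Sum>x\<leftarrow>T_list n m s j. cmp k i l x)" unfolding e by (intro lf_add(1) lfs)
  show "fs (\<lambda>j. \<Sum>x\<leftarrow>T_list n m s j. cmp k i l x) = trm n m s"
    unfolding e lf_add(2)[OF lfs(1) lf_add(1)[OF lfs(2) lf_add(1)[OF lfs(3) lf_add(1)[OF lfs(4,5)]]]]
      lf_add(2)[OF lfs(2) lf_add(1)[OF lfs(3) lf_add(1)[OF lfs(4,5)]]] lf_add(2)[OF lfs(3) lf_add(1)[OF lfs(4,5)]] lf_add(2)[OF lfs(4,5)]
      fss word_vectors trm_def by (simp only: add.assoc)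
qed

lemma T_list_Wt: "x \<in> set (T_list n m s j) \<Longrightarrow> cmp k i l x \<in> Wt (j - 1)"
proof -
  assume x: "x \<in> set (T_list n m s j)"
  have m: "cmp k i l x \<in> Wt (j - 1)" if M: "merged k i l ys W y N" and X: "x \<in> set (map (apw W) (ys j))" for ys W y N
  proof -
    obtain z where z: "z \<in> set (ys j)" "x = apw W z" using X by auto
    then have "cmp k i l x \<in> Wt (j + N - 1)" using M by (simp add: merged_def)
    then show ?thesis by (rule Wt_mono) simp
  qed
  show ?thesis
    using x m[OF merged_fA[of "[]" LA, unfolded append_Nil, OF disjI1[OF refl]]] m[OF merged_fC[of "[]" LA, unfolded append_Nil, OF disjI1[OF refl]]]
      m[OF merged_fE[of "[]" LA, unfolded append_Nil, OF disjI1[OF refl]]] m[OF merged_gC[of "[]" LA, unfolded append_Nil, OF disjI1[OF refl]]]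
      m[OF merged_gA[of "[]" LA, unfolded append_Nil, OF disjI1[OF refl]]]
    unfolding T_list_def set_append by blast
qed

lemma component_sum_T_list: "component_sum k (\<lambda>j. map to_svec (T_list n m s j)) i l (trm n m s)"
  unfolding component_sum_def formal_sum_def
proof (intro conjI allI ballI)
  let ?I = "SIGMA j:UNIV. {..<length (map to_svec (T_list n m s j))}"
  let ?f = "\<lambda>(j, x). svec_component k (map to_svec (T_list n m s j) ! x) i l"
  have f: "?f (j, x) = cmp k i l (T_list n m s j ! x)" if "x < length (T_list n m s j)" for j x
    using that by (simp add: cmp_svec_component)
  have W: "?f (j, x) \<in> Wt (j - 1)" if "x < length (T_list n m s j)" for j x
    unfolding f[OF that] by (rule T_list_Wt[OF nth_mem[OF that]])
  show "?f p \<in> ring_R" if "p \<in> ?I" for p using that W Wt_ring_R by (cases p) fastforce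
  show "trm n m s \<in> ring_R" by (rule Wt_ring_R[OF trm_Wt])
  fix a c
  \<comment> \<open>Entries that stem from v_(j+1) have degree at least j - 1, which bounds j for a
    given coefficient.\<close>
  define J where "J = nat (a + c) + 2"
  have sub: "{p\<in>?I. qz_coeff (?f p) a c \<noteq> 0} \<subseteq> (SIGMA j:{..<J}. {..<length (T_list n m s j)})"
  proof
    fix p assume p: "p \<in> {p\<in>?I. qz_coeff (?f p) a c \<noteq> 0}"
    obtain j x where jx: "p = (j, x)" by (cases p)
    have x: "x < length (T_list n m s j)" using p by (auto simp: jx)
    have "\<not> a + c < int (j - 1)" using Wt_coeff_0[OF W[OF x]] p by (auto simp: jx)
    then show "p \<in> (SIGMA j:{..<J}. {..<length (T_list n m s j)})" using x by (auto simp: jx J_def)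
  qed
  then show "finite {p\<in>?I. qz_coeff (?f p) a c \<noteq> 0}" by (rule finite_subset) auto
  have "(\<Sum>p | p \<in> ?I \<and> qz_coeff (?f p) a c \<noteq> 0. qz_coeff (?f p) a c) = (\<Sum>p\<in>(SIGMA j:{..<J}. {..<length (T_list n m s j)}). qz_coeff (?f p) a c)"
    using sub by (intro sum.mono_neutral_left) auto
  also have "\<dots> = (\<Sum>j<J. \<Sum>x<length (T_list n m s j). qz_coeff (?f (j, x)) a c)"
    by (subst sum.Sigma) (auto simp: case_prod_unfold)
  also have "\<dots> = (\<Sum>j<J. qz_coeff (\<Sum>x\<leftarrow>T_list n m s j. cmp k i l x) a c)"
    unfolding sum_list_sum_nth qz_coeff_sum by (intro sum.cong) (auto simp: cmp_svec_component atLeast0LessThan)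
  also have "\<dots> = qz_coeff (fs (\<lambda>j. \<Sum>x\<leftarrow>T_list n m s j. cmp k i l x)) a c"
  proof (rule qz_coeff_fs[OF fs_T_list(1), symmetric])
    show "{j. qz_coeff (\<Sum>x\<leftarrow>T_list n m s j. cmp k i l x) a c \<noteq> 0} \<subseteq> {..<J}"
    proof
      fix j assume j: "j \<in> {j. qz_coeff (\<Sum>x\<leftarrow>T_list n m s j. cmp k i l x) a c \<noteq> 0}"
      have "(\<Sum>x\<leftarrow>T_list n m s j. cmp k i l x) \<in> Wt (j - 1)" by (intro Wt_sum_list T_list_Wt)
      then have "\<not> a + c < int (j - 1)" using j Wt_coeff_0 by blast
      then show "j \<in> {..<J}" by (auto simp: J_def)
    qed
  qed simp
  finally show "(\<Sum>p | p \<in> ?I \<and> qz_coeff (?f p) a c \<noteq> 0. qz_coeff (?f p) a c) = qz_coeff (trm n m s) a c"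
    unfolding fs_T_list(2) .
qed

lemma component_T_list: "component k (fv (T_list n m s)) i l = trm n m s"
  unfolding component_def fv_def option.sel using component_sum_T_list formal_sum_unique
  unfolding component_sum_def by (intro the_equality) blast+

lemma T_list_simple: assumes "x \<in> set (T_list n m s j)" shows "simple x"
proof -
  have E: "reach 0 z \<and> e_ok (yr z)" if "z \<in> set (map (ap LE) (U_list s j))" for z
    using list_E[OF that] reach_mono[of "j + 2 * s" z 0] by auto
  have D: "simple (apw (Ds n) z)" if "reach N z" for z N using reach_Ds[OF that, of n] by (simp add: reach_def)
  have A: "simple (apw (Ds n @ As m) z)" "simple (apw (Ds n @ LC # As m) z)" if "reach 0 z \<and> x_ok (xr z)" for z m
  proof -
    have r: "reach (m + 0) (apw (As m) z) \<and> x_ok (xr (apw (As m) z))" using that by (intro reach_As) auto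
    from D[OF r[THEN conjunct1]] show "simple (apw (Ds n @ As m) z)" by simp
    have "reach (Suc (m + 0)) (ap LC (apw (As m) z))" using r by (intro reach_C) auto
    from D[OF this] show "simple (apw (Ds n @ LC # As m) z)" by (simp del: ap.simps)
  qed
  have Em: "simple (apw (Ds n @ Es m) z)" if "reach 0 z \<and> e_ok (yr z)" for z
    using reach_Es[of 0 z m] D[of "m + 0" "apw (Es m) z"] that by simp
  have S: "x \<in> set (map (apw W) ys) \<Longrightarrow> (\<And>z. z \<in> set ys \<Longrightarrow> simple (apw W z)) \<Longrightarrow> simple x" for W ys by auto
  show ?thesis
    using assms unfolding T_list_def set_append Un_iff
  proof (elim disjE)
    assume "x \<in> set (map (apw (Ds n @ As m)) (map (ap LB) (U_list s j)))"
    then show ?thesis by (rule S) (rule A(1)[OF list_B_0])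
  next
    assume "x \<in> set (map (apw (Ds n @ LC # As m)) (map (ap LB) (U_list s j)))"
    then show ?thesis by (rule S) (rule A(2)[OF list_B_0])
  next
    assume "x \<in> set (map (apw (Ds n @ Es m)) (map (ap LE) (U_list s j)))"
    then show ?thesis by (rule S) (rule Em[OF E])
  next
    assume "x \<in> set (map (apw (Ds n @ LC # As m)) (DBDE (U_list s j)))"
    then show ?thesis by (rule S) (rule A(2)[OF list_T_0])
  next
    assume "x \<in> set (map (apw (Ds n @ As (Suc m))) (DBDE (U_list s j)))"
    then show ?thesis by (rule S) (rule A(1)[OF list_T_0])
  qed
qed

lemma map_apw_append: "map (apw V) (map (apw W) xs) = map (apw (V @ W)) xs"
  by (simp add: comp_def)

lemma T_fv:
  "((opD ^^ n) \<circ> (opA ^^ m) \<circ> opB \<circ> (opL ^^ s)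
     \<oplus>\<^sub>o (opD ^^ n) \<circ> opC \<circ> (opA ^^ m) \<circ> opB \<circ> (opL ^^ s)
     \<oplus>\<^sub>o (opD ^^ n) \<circ> (opE ^^ (m + 1)) \<circ> (opL ^^ s)
     \<oplus>\<^sub>o (opD ^^ n) \<circ> opC \<circ> (opA ^^ m) \<circ> opD \<circ> (opB \<oplus>\<^sub>o opD \<oplus>\<^sub>o opE) \<circ> (opL ^^ s)
     \<oplus>\<^sub>o (opD ^^ n) \<circ> (opA ^^ (m + 1)) \<circ> opD \<circ> (opB \<oplus>\<^sub>o opD \<oplus>\<^sub>o opE) \<circ> (opL ^^ s)) v_inf = fv (T_list n m s)"
proof -
  have A_B: "all_reach (\<lambda>j. map (apw (As m)) (map (ap LB) (U_list s j)))" "all_reach (\<lambda>j. map (ap LC) (map (apw (As m)) (map (ap LB) (U_list s j))))"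
    "(opA ^^ m) (fv (\<lambda>j. map (ap LB) (U_list s j))) = fv (\<lambda>j. map (apw (As m)) (map (ap LB) (U_list s j)))"
    by (rule all_reach_As, erule list_B_0)+
  have A_T: "all_reach (\<lambda>j. map (apw (As m)) (DBDE (U_list s j)))" "all_reach (\<lambda>j. map (ap LC) (map (apw (As m)) (DBDE (U_list s j))))"
    "(opA ^^ m) (fv (\<lambda>j. DBDE (U_list s j))) = fv (\<lambda>j. map (apw (As m)) (DBDE (U_list s j)))" for m
    by (rule all_reach_As, erule list_T_0)+
  have C_Cons: "map (apw (Ds n)) (map (ap LC) (map (apw (As m)) xs)) = map (apw (Ds n @ LC # As m)) xs" for xs
    by (simp add: comp_def del: ap.simps)
  have 1: "((opD ^^ n) \<circ> (opA ^^ m) \<circ> opB \<circ> (opL ^^ s)) v_inf = fv (\<lambda>j. map (apw (Ds n @ As m)) (map (ap LB) (U_list s j)))"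
    unfolding comp_apply opL_power ops_fv(2)[OF all_reach_U] A_B(3) opD_power[OF A_B(1)] map_apw_append ..
  have 2: "((opD ^^ n) \<circ> opC \<circ> (opA ^^ m) \<circ> opB \<circ> (opL ^^ s)) v_inf = fv (\<lambda>j. map (apw (Ds n @ LC # As m)) (map (ap LB) (U_list s j)))"
    unfolding comp_apply opL_power ops_fv(2)[OF all_reach_U] A_B(3) ops_fv(3)[OF A_B(1)] opD_power[OF A_B(2)] C_Cons ..
  have 4: "((opD ^^ n) \<circ> opC \<circ> (opA ^^ m) \<circ> opD \<circ> (opB \<oplus>\<^sub>o opD \<oplus>\<^sub>o opE) \<circ> (opL ^^ s)) v_inf =
      fv (\<lambda>j. map (apw (Ds n @ LC # As m)) (DBDE (U_list s j)))"
    unfolding comp_apply opL_power DBDE_fv A_T(3) ops_fv(3)[OF A_T(1)] opD_power[OF A_T(2)] C_Cons ..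
  have 5: "((opD ^^ n) \<circ> (opA ^^ (m + 1)) \<circ> opD \<circ> (opB \<oplus>\<^sub>o opD \<oplus>\<^sub>o opE) \<circ> (opL ^^ s)) v_inf =
      fv (\<lambda>j. map (apw (Ds n @ As (Suc m))) (DBDE (U_list s j)))"
    unfolding comp_apply opL_power DBDE_fv A_T(3) opD_power[OF A_T(1)] map_apw_append by simp
  have 3: "((opD ^^ n) \<circ> (opE ^^ (m + 1)) \<circ> (opL ^^ s)) v_inf = fv (\<lambda>j. map (apw (Ds n @ Es m)) (map (ap LE) (U_list s j)))"
  proof -
    have r: "all_reach (\<lambda>j. map (apw (Es m)) (U_list s j))" for m
    proof (rule all_reachI)
      fix j y assume "y \<in> set (map (apw (Es m)) (U_list s j))"
      then obtain x where x: "x \<in> set (U_list s j)" "y = apw (Es m) x" by auto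
      show "reach (m + (j + 2 * s)) y"
        unfolding x(2) using reach_Es[OF U_list_reach[OF x(1)] Uent_ok(2)[OF U_list_Uent[OF x(1)]], of m] by blast
    qed
    have "(opE ^^ (m + 1)) (fv (U_list s)) = fv (\<lambda>j. map (apw (Es (m + 1))) (U_list s j))"
      by (intro op_power_fv r ops_fv)
    moreover have "apw (Es (m + 1)) x = apw (Es m) (ap LE x)" for x by (induction m) simp_all
    ultimately show ?thesis
      unfolding comp_apply opL_power using opD_power[OF r[of "m + 1"], of n] by (simp add: comp_def del: ap.simps)
  qed
  have "T_list n m s = (\<lambda>j. (((map (apw (Ds n @ As m)) (map (ap LB) (U_list s j)) @ map (apw (Ds n @ LC # As m)) (map (ap LB) (U_list s j))) @
     map (apw (Ds n @ Es m)) (map (ap LE) (U_list s j))) @ map (apw (Ds n @ LC # As m)) (DBDE (U_list s j))) @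
     map (apw (Ds n @ As (Suc m))) (DBDE (U_list s j)))"
    by (intro ext) (simp only: T_list_def append_assoc)
  then show ?thesis by (simp only:) (intro op_plus_fv 1 2 3 4 5)
qed

end

theorem theorem6p1:
  fixes k :: nat
  assumes "k > 0"
  shows "let T = (\<lambda>n m s.
              ((opD ^^ n) \<circ> (opA ^^ m) \<circ> opB \<circ> (opL ^^ s)
               \<oplus>\<^sub>o (opD ^^ n) \<circ> opC \<circ> (opA ^^ m) \<circ> opB \<circ> (opL ^^ s)
               \<oplus>\<^sub>o (opD ^^ n) \<circ> (opE ^^ (m + 1)) \<circ> (opL ^^ s)
               \<oplus>\<^sub>o (opD ^^ n) \<circ> opC \<circ> (opA ^^ m) \<circ> opD \<circ> (opB \<oplus>\<^sub>o opD \<oplus>\<^sub>o opE) \<circ> (opL ^^ s)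
               \<oplus>\<^sub>o (opD ^^ n) \<circ> (opA ^^ (m + 1)) \<circ> opD \<circ> (opB \<oplus>\<^sub>o opD \<oplus>\<^sub>o opE) \<circ> (opL ^^ s))
              v_inf)
         in (\<forall>n m s. is_defined k (T n m s)) \<and>
            (\<forall>(i, l)\<in>index_set k.
               formal_sum (\<lambda>(n, m, s). component k (T n m s) i l) UNIV (chi k i l))"
proof -
  \<comment> \<open>The lists of entries do not depend on (i, l). The instance (0, 0) provides one
    name for them that serves all components.\<close>
  interpret zero: indices k 0 0 using assms by unfold_locales auto
  have T: "indices.T_list = zero.T_list"
    by (intro ext) (simp add: indices.T_list_def[OF zero.indices_axioms])
  have "is_defined k (fv (zero.T_list n m s))" for n m s
    unfolding is_defined_def
  proof (intro exI[of _ "\<lambda>j. map to_svec (zero.T_list n m s j)"] conjI allI ballI)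
    show "fv (zero.T_list n m s) = Some (\<lambda>j. map to_svec (zero.T_list n m s j))" by (simp add: fv_def)
    show "is_simple x" if "x \<in> set (map to_svec (zero.T_list n m s j))" for j x
      using that zero.T_list_simple simple_is_simple by auto
    show "case il of (i, l) \<Rightarrow> \<exists>t. component_sum k (\<lambda>j. map to_svec (zero.T_list n m s j)) i l t" if "il \<in> index_set k" for il
    proof (cases il)
      case (Pair i l)
      interpret I: indices k i l using index_indices assms that Pair by blast
      show ?thesis using I.component_sum_T_list[of n m s] by (auto simp: Pair)
    qed
  qed
  moreover have "formal_sum (\<lambda>(n, m, s). component k (fv (zero.T_list n m s)) i l) UNIV (chi k i l)" if il: "(i, l) \<in> index_set k" for i l
  proof -
    interpret I: indices k i l by (rule index_indices[OF assms il])
    have "lf (\<lambda>(n, m, s). I.trm n m s)" using I.lf_box[of "\<lambda>(n, m, s). I.trm n m s"] I.trm_Wt by simp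
    from formal_sum_fs[OF this] show ?thesis
      using I.component_T_list by (simp add: chi_total[OF assms il] I.total_def)
  qed
  ultimately show ?thesis unfolding Let_def zero.T_fv by auto
qed

end
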